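(* Let $\mathcal{T}$ be a subsequential, complete, deterministic transducer with input alphabet $\{0,\dots,q-1\}^d$, output alphabet $\mathbb R$ and final period $p$, and let $\Psi_1$ be the $p$-periodic continuous function with $\mathbb{E}(\mathcal{T}(\boldsymbol{n}))=e_{\mathcal{T}}\log_{q}N+\Psi_{1}(\log_{q}N)+\mathcal{O}(N^{-\xi}\log N)$. Then the Fourier coefficients $c_k=\frac1p\int_0^p\Psi_1(x)e^{-2\pi i kx/p}\,dx$ of $\Psi_1$ are \[c_{0}=-\frac{e_{\mathcal{T}}}{d\log q}-i\boldsymbol{w}_{0}'^{\top}\boldsymbol{1}+\frac1d\operatorname{Res}_{z=d}\boldsymbol{w}_{0}^{\top}\boldsymbol{H}(z),\qquad c_{k}=\frac{1}{d+\chi_{k}}\operatorname{Res}_{z=d+\chi_{k}}\boldsymbol{w}_{k}^{\top}\boldsymbol{H}(z)\quad(k\neq 0).\] The Fourier series $\sum_{k\in\mathbb Z}c_{k}\exp(\frac{2\pi ik}{p}x)$ converges absolutely and uniformly. For every $k\in\mathbb Z$, the function $\boldsymbol{w}_{k}^{\top}\boldsymbol{H}(z)$ is meromorphic in $\Re z>d-1$; it has a possible double pole at $z=d$ for $k=0$ and possible simple poles at $z=d+\chi_{k}$ for $k\neq0$.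
   Context: Let $q\ge 2$, $d\ge 1$. A complete, deterministic, subsequential transducer $\mathcal T$ with input alphabet $\{0,\dots,q-1\}^d$ and output alphabet $\mathbb R$ has finitely many states $1,\dots,S$ with initial state $1$, for each state and input letter exactly one outgoing transition with that input label and a real output label, and a real final output for each state; all states are accessible from the initial state. For $\boldsymbol n\in\mathbb N_0^d$ its standard $q$-ary joint expansion $\boldsymbol\varepsilon_L\dots\boldsymbol\varepsilon_0$ ($\boldsymbol n=\sum q^k\boldsymbol\varepsilon_k$, $\boldsymbol\varepsilon_L\ne0$, empty for $\boldsymbol n=0$) is read least significant digit first; $\mathcal T(\boldsymbol n)$ is the sum of the transition outputs along the path from the initial state plus the final output of the last state. $\boldsymbol b(\boldsymbol n)\in\mathbb R^S$ has as $s$-th coordinate the same sum but starting in state $s$ (so $\boldsymbol b(0)$ is the vector of final outputs). $\boldsymbol n$ is uniform on $\{0,\dots,N-1\}^d$. Final components $C_1,\dots,C_c$ are the strongly connected components with no leaving arc, $p$ the lcm of their periods. $M(t)=\sum_{\boldsymbol\varepsilon}M_{\boldsymbol\varepsilon}(t)$, where $M_{\boldsymbol\varepsilon}(t)$ has $(s_1,s_2)$ entry $e^{it\delta}$ if the transition from $s_1$ with input $\boldsymbol\varepsilon$ goes to $s_2$ with output $\delta$ and $0$ otherwise. Near $t=0$, $\mu_j(t)$ is the eigenvalue of the principal submatrix of $M(t)$ on $C_j$ with $\mu_j(0)=q^d$ (differentiable). For $l\in\mathbb Z$, $\boldsymbol w_l^\top(t)$ is the image of $\boldsymbol e_1^\top$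 (indicator of the initial state) under the projection onto the sum of the left eigenspaces of $M(t)$ for $\mu_j(t)e^{2\pi il/p}$, $j=1,\dots,c$, with kernel the sum of the remaining generalized left eigenspaces; $\boldsymbol w_l=\boldsymbol w_l(0)$ and $\boldsymbol w_l'$ is the derivative at $t=0$. $\lambda_j=\boldsymbol w_0^\top\boldsymbol c_j$ ($\boldsymbol c_j$ the indicator of $C_j$), $e_{\mathcal T}=\sum_j\lambda_j(-iq^{-d}\mu_j'(0))$, and $\xi>0$ is such that all eigenvalues of $M(0)$ of modulus $<q^d$ have modulus $<q^{d-\xi}$. $\boldsymbol 1$ is the all-ones vector, $\chi_k=\frac{2\pi i k}{p\log q}$, and \[\boldsymbol H(z)=\sum_{\boldsymbol n\ge 0,\ \boldsymbol n\ne0}\boldsymbol b(\boldsymbol n)\|\boldsymbol n\|_\infty^{-z}\] (inequality coordinatewise, $\|\cdot\|_\infty$ the maximum norm). *)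

theory Defs
  imports
    "HOL-Complex_Analysis.Complex_Analysis"
    "HOL-Probability.Probability"
    "HOL-Library.Landau_Symbols"
begin

section \<open>Transducers over joint q-ary digits\<close>

definition letters :: "nat \<Rightarrow> (nat ^ 'd) set" where
  "letters q = {\<epsilon>. \<forall>i. \<epsilon> $ i < q}"

text \<open>
  The state set is the finite type \<open>'s\<close> and the dimension is \<open>CARD('d)\<close>. The transition target
  and the transition output are total functions, so completeness and determinism are built in;
  their values outside \<open>letters q\<close> are never used.
\<close>

record ('s, 'd :: finite) transducer =
  init :: 's
  target :: "'s \<Rightarrow> nat ^ 'd \<Rightarrow> 's"
  trans_out :: "'s \<Rightarrow> nat ^ 'd \<Rightarrow> real"
  final_out :: "'s \<Rightarrow> real"

definition arcs :: "nat \<Rightarrow> ('s, 'd :: finite) transducer \<Rightarrow> ('s \<times> 's) set" where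
  "arcs q T = {(s, target T s \<epsilon>) |s \<epsilon>. \<epsilon> \<in> letters q}"

definition accessible :: "nat \<Rightarrow> ('s, 'd :: finite) transducer \<Rightarrow> bool" where
  "accessible q T \<longleftrightarrow> (\<forall>s. (init T, s) \<in> (arcs q T)\<^sup>*)"

fun output_sum :: "('s, 'd :: finite) transducer \<Rightarrow> 's \<Rightarrow> (nat ^ 'd) list \<Rightarrow> real" where
  "output_sum T s [] = final_out T s"
| "output_sum T s (\<epsilon> # \<epsilon>s) = trans_out T s \<epsilon> + output_sum T (target T s \<epsilon>) \<epsilon>s"

definition digit :: "nat \<Rightarrow> nat ^ 'd \<Rightarrow> nat \<Rightarrow> nat ^ 'd" where
  "digit q n k = (\<chi> i. n $ i div q ^ k mod q)"

text \<open>
  The expansion is listed least significant digit first. Its length is minimal, so the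
  last listed digit vector is nonzero, and the expansion of 0 is empty.
\<close>

definition joint_expansion :: "nat \<Rightarrow> nat ^ 'd \<Rightarrow> (nat ^ 'd) list" where
  "joint_expansion q n = map (digit q n) [0..<(LEAST L. \<forall>i. n $ i < q ^ L)]"

definition b_vec :: "nat \<Rightarrow> ('s :: finite, 'd :: finite) transducer \<Rightarrow> nat ^ 'd \<Rightarrow> real ^ 's" where
  "b_vec q T n = (\<chi> s. output_sum T s (joint_expansion q n))"

definition transducer_value :: "nat \<Rightarrow> ('s, 'd :: finite) transducer \<Rightarrow> nat ^ 'd \<Rightarrow> real" where
  "transducer_value q T n = output_sum T (init T) (joint_expansion q n)"

definition expected_value :: "nat \<Rightarrow> ('s, 'd :: finite) transducer \<Rightarrow> nat \<Rightarrow> real" where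
  "expected_value q T N =
     measure_pmf.expectation (pmf_of_set {n. \<forall>i. n $ i < N}) (transducer_value q T)"


section \<open>Final components and periods\<close>

definition strong_components :: "nat \<Rightarrow> ('s, 'd :: finite) transducer \<Rightarrow> 's set set" where
  "strong_components q T =
     {{s'. (s, s') \<in> (arcs q T)\<^sup>* \<and> (s', s) \<in> (arcs q T)\<^sup>*} |s. True}"

definition final_components :: "nat \<Rightarrow> ('s, 'd :: finite) transducer \<Rightarrow> 's set set" where
  "final_components q T =
     {C \<in> strong_components q T. \<forall>s s'. s \<in> C \<and> (s, s') \<in> arcs q T \<longrightarrow> s' \<in> C}"

definition component_period :: "nat \<Rightarrow> ('s, 'd :: finite) transducer \<Rightarrow> 's set \<Rightarrow> nat" where
  "component_period q T C = Gcd {m. m > 0 \<and> (\<exists>s\<in>C. (s, s) \<in> (arcs q T \<inter> C \<times> C) ^^ m)}"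

definition final_period :: "nat \<Rightarrow> ('s, 'd :: finite) transducer \<Rightarrow> nat" where
  "final_period q T = Lcm (component_period q T ` final_components q T)"


section \<open>The transition matrix and its dominant spectrum\<close>

definition letter_matrix ::
    "('s :: finite, 'd :: finite) transducer \<Rightarrow> nat ^ 'd \<Rightarrow> real \<Rightarrow> complex ^ 's ^ 's" where
  "letter_matrix T \<epsilon> t =
     (\<chi> s1 s2. if target T s1 \<epsilon> = s2 then exp (\<i> * of_real (t * trans_out T s1 \<epsilon>)) else 0)"

definition trans_matrix ::
    "nat \<Rightarrow> ('s :: finite, 'd :: finite) transducer \<Rightarrow> real \<Rightarrow> complex ^ 's ^ 's" where
  "trans_matrix q T t = (\<Sum>\<epsilon>\<in>letters q. letter_matrix T \<epsilon> t)"

definition is_eigenvalue :: "complex ^ 's ^ 's \<Rightarrow> complex \<Rightarrow> bool" where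
  "is_eigenvalue A \<mu> \<longleftrightarrow> (\<exists>v. v \<noteq> 0 \<and> A *v v = \<mu> *s v)"

definition is_principal_eigenvalue :: "complex ^ 's ^ 's \<Rightarrow> 's set \<Rightarrow> complex \<Rightarrow> bool" where
  "is_principal_eigenvalue A C \<mu> \<longleftrightarrow>
     (\<exists>v. (\<exists>s\<in>C. v s \<noteq> 0) \<and> (\<forall>s\<in>C. (\<Sum>s'\<in>C. A $ s $ s' * v s') = \<mu> * v s))"

text \<open>
  The principal submatrix on a final component \<open>C\<close> is irreducible at \<open>t = 0\<close> with simple
  Perron eigenvalue \<open>q ^ CARD('d)\<close>, so the function below is determined near \<open>t = 0\<close>; only its
  germ at 0 is used.
\<close>

definition dominant_eigenvalue ::
    "nat \<Rightarrow> ('s :: finite, 'd :: finite) transducer \<Rightarrow> 's set \<Rightarrow> real \<Rightarrow> complex" where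
  "dominant_eigenvalue q T C =
     (SOME \<mu>. \<mu> 0 = of_nat (q ^ CARD('d)) \<and> \<mu> differentiable (at 0) \<and>
        (\<forall>\<^sub>F t in nhds 0. is_principal_eigenvalue (trans_matrix q T t) C (\<mu> t)))"

definition left_eigenspace :: "complex ^ 's ^ 's \<Rightarrow> complex \<Rightarrow> (complex ^ 's) set" where
  "left_eigenspace A \<mu> = {x. x v* A = \<mu> *s x}"

definition left_gen_eigenspace :: "complex ^ 's ^ 's \<Rightarrow> complex \<Rightarrow> (complex ^ 's) set" where
  "left_gen_eigenspace A \<mu> = {x. \<exists>m. ((\<lambda>y. y v* A - \<mu> *s y) ^^ m) x = 0}"

text \<open>The image of \<open>x\<close> under the projection onto \<open>U\<close> with kernel \<open>V\<close>.\<close>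

definition proj_along :: "(complex ^ 's) set \<Rightarrow> (complex ^ 's) set \<Rightarrow> complex ^ 's \<Rightarrow> complex ^ 's" where
  "proj_along U V x = (THE u. u \<in> U \<and> x - u \<in> V)"

definition dominant_values ::
    "nat \<Rightarrow> ('s :: finite, 'd :: finite) transducer \<Rightarrow> int \<Rightarrow> real \<Rightarrow> complex set" where
  "dominant_values q T l t =
     (\<lambda>C. dominant_eigenvalue q T C t *
            exp (2 * of_real pi * \<i> * of_int l / of_nat (final_period q T))) ` final_components q T"

text \<open>
  Generalized eigenspaces of numbers that are not eigenvalues are zero, so they may be
  included in the kernel.
\<close>

definition w_vec ::
    "nat \<Rightarrow> ('s :: finite, 'd :: finite) transducer \<Rightarrow> int \<Rightarrow> real \<Rightarrow> complex ^ 's" where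
  "w_vec q T l t =
     proj_along
       (vec.span (\<Union>\<mu>\<in>dominant_values q T l t. left_eigenspace (trans_matrix q T t) \<mu>))
       (vec.span (\<Union>\<mu>\<in>- dominant_values q T l t. left_gen_eigenspace (trans_matrix q T t) \<mu>))
       (axis (init T) 1)"

text \<open>The bilinear (not sesquilinear) pairing \<open>x\<^sup>T y\<close>.\<close>

definition tdot :: "complex ^ 's \<Rightarrow> complex ^ 's \<Rightarrow> complex" where
  "tdot x y = (\<Sum>s\<in>UNIV. x $ s * y $ s)"

definition component_weight ::
    "nat \<Rightarrow> ('s :: finite, 'd :: finite) transducer \<Rightarrow> 's set \<Rightarrow> complex" where
  "component_weight q T C = tdot (w_vec q T 0 0) (\<chi> s. indicator C s)"

definition e_const :: "nat \<Rightarrow> ('s :: finite, 'd :: finite) transducer \<Rightarrow> complex" where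
  "e_const q T =
     (\<Sum>C\<in>final_components q T. component_weight q T C *
        (- \<i> * vector_derivative (dominant_eigenvalue q T C) (at 0) / of_nat (q ^ CARD('d))))"

definition spectral_gap :: "nat \<Rightarrow> ('s :: finite, 'd :: finite) transducer \<Rightarrow> real \<Rightarrow> bool" where
  "spectral_gap q T \<xi> \<longleftrightarrow> \<xi> > 0 \<and>
     (\<forall>\<mu>. is_eigenvalue (trans_matrix q T 0) \<mu> \<and> cmod \<mu> < real q ^ CARD('d) \<longrightarrow>
        cmod \<mu> < real q powr (real CARD('d) - \<xi>))"


section \<open>The Dirichlet series and Fourier coefficients\<close>

definition max_norm :: "nat ^ 'd \<Rightarrow> nat" where
  "max_norm n = Max (range (\<lambda>i. n $ i))"

definition H_term ::
    "nat \<Rightarrow> ('s :: finite, 'd :: finite) transducer \<Rightarrow> complex \<Rightarrow> nat ^ 'd \<Rightarrow> complex ^ 's" where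
  "H_term q T z n = (\<chi> s. of_real (b_vec q T n $ s) * of_nat (max_norm n) powr (- z))"

text \<open>This is the series itself, meaningful in the half-plane of convergence only.\<close>

definition H_series ::
    "nat \<Rightarrow> ('s :: finite, 'd :: finite) transducer \<Rightarrow> complex \<Rightarrow> complex ^ 's" where
  "H_series q T z = (\<Sum>\<^sub>\<infinity>n\<in>{n. n \<noteq> 0}. H_term q T z n)"

definition chi_freq :: "nat \<Rightarrow> nat \<Rightarrow> int \<Rightarrow> complex" where
  "chi_freq q p k = 2 * of_real pi * \<i> * of_int k / of_real (real p * ln (real q))"

definition fourier_coeff :: "nat \<Rightarrow> (real \<Rightarrow> real) \<Rightarrow> int \<Rightarrow> complex" where
  "fourier_coeff p f k = 1 / of_nat p *
     integral {0..real p}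
       (\<lambda>x. of_real (f x) * exp (- 2 * of_real pi * \<i> * of_int k * of_real x / of_nat p))"

end

theory Submission
  imports Defs "HOL-Computational_Algebra.Fundamental_Theorem_Algebra" "HOL-Real_Asymp.Real_Asymp"
begin

text \<open>
  Let \<open>\<alpha>\<^sub>u(N)\<close> be the pairing of a vector \<open>u\<close> with the sum of \<open>\<^bold>b(\<^bold>n)\<close> over the shell \<open>\<parallel>\<^bold>n\<parallel> = N\<close>.
  Splitting off the least significant digit gives
  \<open>\<Sum>j<q. \<alpha>\<^sub>u(qN + j) = \<alpha>\<^sub>u\<^sub>M(N) + (u\<^sup>T o) \<cdot> card(shell N)\<close>, where \<open>M = M(0)\<close> and \<open>o\<close> collects the
  transition outputs. Hence the Dirichlet series \<open>h\<^sub>u\<close> of \<open>\<alpha>\<^sub>u\<close> satisfies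
  \<open>h\<^sub>u(z) = J\<^sub>u(z) + q\<^sup>-\<^sup>z (h\<^sub>u\<^sub>M(z) + (u\<^sup>T o) Z(z))\<close> with \<open>J\<^sub>u\<close> holomorphic for \<open>Re z > d - 1\<close> and
  \<open>Z\<close> zeta-like with a simple pole at \<open>d\<close>. For the eigenvector \<open>u = w\<^sub>k\<close> this is solved by division
  by \<open>1 - q\<^sup>-\<^sup>z q\<^sup>d exp(2\<pi>ik/p)\<close>, which gives the continuation and the orders of the poles.

  For the coefficient formulas, put \<open>u = e\<^sub>1\<close>, so that the partial sums of \<open>\<alpha>\<^sub>u\<close> are
  \<open>N\<^sup>d E(T(\<^bold>n))\<close>. Abel summation turns the assumed asymptotic expansion into the behaviour of
  \<open>h\<^sub>u(d + \<chi>\<^sub>k + \<sigma>)\<close> as \<open>\<sigma> \<rightarrow> 0+\<close>, with \<open>(d + \<chi>\<^sub>k) c\<^sub>k\<close> as the coefficient of \<open>1/\<sigma>\<close>. The difference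
  \<open>e\<^sub>1 - w\<^sub>k\<close> lies in the image of \<open>(M - \<lambda>\<^sub>k)\<^sup>2\<close>, where \<open>\<lambda>\<^sub>k = q\<^sup>d exp(2\<pi>ik/p)\<close>, and for such vectors the
  functional equation forces the \<open>1/\<sigma>\<close> term to vanish, except for \<open>k = 0\<close>, where the pole of \<open>Z\<close>
  contributes \<open>d u\<^sup>T o\<close> up to sign with \<open>u (M - q\<^sup>d) = e\<^sub>1 - w\<^sub>0\<close>. First order perturbation theory
  identifies \<open>u\<^sup>T o\<close> with \<open>i w\<^sub>0'\<^sup>T 1\<close>.

  Shifting the argument by many periods, the error term and the slow growth of the partial sums show
  that \<open>\<Psi>\<^sub>1\<close> is Hoelder continuous with exponent \<open>3/4 > 1/2\<close>, so that Bernstein's theorem applies.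
\<close>

section \<open>Generalized left eigenspaces\<close>

text \<open>The expansion speaks about the initial vector \<open>e_1\<close>, while only
  eigenvectors allow the division that continues the Dirichlet series. The two are therefore
  compared only on the rays d + \<chi>_k + \<sigma> with \<sigma> > 0, inside the half-plane of
  absolute convergence, and the remainder \<open>e_1 - w_k\<close> is never continued. Every vector
  obeys a crude bound of order 1 / \<sigma>^2 there, and applying M - \<lambda>_k once gains a
  factor of order \<sigma>; hence the second power of M - \<lambda>_k. Since M(0) is nonnegative
  with constant row sums, it has no Jordan blocks on the circle of radius q^d, so eigenspaces there
  have a generalized complement. For t \<noteq> 0 the values \<mu>_j(t) of different final
  components may separate or coincide, and \<open>w_0(t)\<close> must be differentiated across this.
  The bordered matrix gives one pair of eigenvectors per component by Cramer's rule, irrespective of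
  coincidences, and \<mu>_j(t) as a fixed point of a contraction. The exponent 3/4 is a convenient
  choice: the logarithms cost an arbitrarily small power of h, and anything above 1/2 serves
  Bernstein's theorem.\<close>

definition lshift :: "complex ^ 's ^ 's \<Rightarrow> complex \<Rightarrow> complex ^ 's \<Rightarrow> complex ^ 's" where
  "lshift A \<mu> y = y v* A - \<mu> *s y"

text \<open>\<open>D\<close> may contain arbitrary numbers, since those that are not eigenvalues
  contribute only 0. With \<open>- D\<close> this is literally the kernel used in
  \<open>w_vec\<close>.\<close>

definition gen_span :: "complex ^ 's ^ 's \<Rightarrow> complex set \<Rightarrow> (complex ^ 's) set" where
  "gen_span A D = vec.span (\<Union>\<mu>\<in>D. left_gen_eigenspace A \<mu>)"

lemma left_gen_eigenspace_iff:
  "x \<in> left_gen_eigenspace A \<mu> \<longleftrightarrow> (\<exists>m. (lshift A \<mu> ^^ m) x = 0)"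
  by (simp add: left_gen_eigenspace_def lshift_def[abs_def])

lemma lshift_add: "lshift A \<mu> (x + y) = lshift A \<mu> x + lshift A \<mu> y"
  by (simp add: lshift_def vec_eq_iff vector_matrix_mult_def algebra_simps sum.distrib)

lemma lshift_scale: "lshift A \<mu> (c *s x) = c *s lshift A \<mu> x"
  by (simp add: lshift_def vec_eq_iff vector_matrix_mult_def algebra_simps sum_distrib_left)

lemma lshift_0 [simp]: "lshift A \<mu> 0 = 0"
  using lshift_scale[of A \<mu> 0 0] by simp

lemma lshift_diff: "lshift A \<mu> (x - y) = lshift A \<mu> x - lshift A \<mu> y"
  using lshift_add[of A \<mu> "x - y" y] by (simp add: algebra_simps)

lemma lshift_commute: "lshift A \<mu> (lshift A \<nu> x) = lshift A \<nu> (lshift A \<mu> x)"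
proof -
  have "(x v* A - \<nu> *s x) v* A = (x v* A) v* A - \<nu> *s (x v* A)" for \<nu> :: complex and x
    using lshift_diff[of A 0 "x v* A" "\<nu> *s x"] lshift_scale[of A 0 \<nu> x] by (simp add: lshift_def)
  then show ?thesis
    by (simp add: lshift_def vec_eq_iff algebra_simps)
qed

lemma lshift_change: "lshift A \<mu> x = lshift A \<nu> x + (\<nu> - \<mu>) *s x"
  by (simp add: lshift_def vec_eq_iff algebra_simps)

lemma linear_lshift: "Vector_Spaces.linear (*s) (*s) (lshift A \<mu>)"
  by unfold_locales (auto simp: lshift_add lshift_scale)

lemma funpow_lshift_add: "(lshift A \<mu> ^^ m) (x + y) = (lshift A \<mu> ^^ m) x + (lshift A \<mu> ^^ m) y"
  by (induction m) (auto simp: lshift_add)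

lemma funpow_lshift_scale: "(lshift A \<mu> ^^ m) (c *s x) = c *s (lshift A \<mu> ^^ m) x"
  by (induction m) (auto simp: lshift_scale)

lemma funpow_lshift_0 [simp]: "(lshift A \<mu> ^^ m) 0 = 0"
  by (induction m) auto

lemma funpow_lshift_mono: "(lshift A \<mu> ^^ m) x = 0 \<Longrightarrow> m \<le> n \<Longrightarrow> (lshift A \<mu> ^^ n) x = 0"
  using funpow_add[of "n - m" m "lshift A \<mu>"] by simp

lemma subspace_left_gen_eigenspace: "vec.subspace (left_gen_eigenspace A \<mu>)"
proof (rule vec.subspaceI)
  show "0 \<in> left_gen_eigenspace A \<mu>"
    by (auto simp: left_gen_eigenspace_iff)
next
  fix x y assume "x \<in> left_gen_eigenspace A \<mu>" "y \<in> left_gen_eigenspace A \<mu>"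
  then obtain m n where "(lshift A \<mu> ^^ m) x = 0" "(lshift A \<mu> ^^ n) y = 0"
    by (auto simp: left_gen_eigenspace_iff)
  then have "(lshift A \<mu> ^^ (max m n)) (x + y) = 0"
    by (simp add: funpow_lshift_add funpow_lshift_mono)
  then show "x + y \<in> left_gen_eigenspace A \<mu>"
    by (auto simp: left_gen_eigenspace_iff)
next
  fix c x assume "x \<in> left_gen_eigenspace A \<mu>"
  then show "c *s x \<in> left_gen_eigenspace A \<mu>"
    by (auto simp: left_gen_eigenspace_iff funpow_lshift_scale)
qed

lemma subspace_gen_span: "vec.subspace (gen_span A D)"
  by (simp add: gen_span_def)

lemma gen_span_empty: "gen_span A {} = {0}"
  by (simp add: gen_span_def)

lemma gen_span_Un: "x \<in> gen_span A (D \<union> E) \<longleftrightarrow> (\<exists>y\<in>gen_span A D. \<exists>z\<in>gen_span A E. x = y + z)"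
  unfolding gen_span_def by (auto simp: UN_Un vec.span_Un)

lemma gen_span_single: "gen_span A {\<mu>} = left_gen_eigenspace A \<mu>"
  using subspace_left_gen_eigenspace[of A \<mu>] by (simp add: gen_span_def vec.span_eq_iff)

lemma lshift_gen_eigenspace:
  assumes "x \<in> left_gen_eigenspace A \<mu>"
  shows "lshift A \<nu> x \<in> left_gen_eigenspace A \<mu>"
proof -
  obtain m where m: "(lshift A \<mu> ^^ m) x = 0"
    using assms by (auto simp: left_gen_eigenspace_iff)
  have "(lshift A \<mu> ^^ m) (lshift A \<nu> y) = lshift A \<nu> ((lshift A \<mu> ^^ m) y)" for y
    by (induction m) (auto simp: lshift_commute)
  then show ?thesis
    using m unfolding left_gen_eigenspace_iff by (metis lshift_0)
qed

lemma lshift_gen_span: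
  assumes "x \<in> gen_span A D"
  shows "lshift A \<nu> x \<in> gen_span A D"
proof -
  have "vec.subspace {x. lshift A \<nu> x \<in> gen_span A D}"
    using subspace_gen_span[of A D]
    by (auto simp: vec.subspace_def lshift_add lshift_scale)
  moreover have "(\<Union>\<mu>\<in>D. left_gen_eigenspace A \<mu>) \<subseteq> {x. lshift A \<nu> x \<in> gen_span A D}"
    using lshift_gen_eigenspace by (fastforce simp: gen_span_def intro!: vec.span_base)
  ultimately have "gen_span A D \<subseteq> {x. lshift A \<nu> x \<in> gen_span A D}"
    unfolding gen_span_def by (intro vec.span_minimal)
  then show ?thesis
    using assms by auto
qed

text \<open>\<open>A - \<nu>\<close> is the nilpotent \<open>A - \<mu>\<close> plus a nonzero
  multiple of the identity. The preimage is built by induction on the nilpotency index: once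
  \<open>x (A - \<mu>) = y (A - \<nu>)\<close> is known, \<open>(x - y) / (\<mu> - \<nu>)\<close> is
  a preimage of \<open>x\<close>.\<close>

lemma lshift_surj_gen_eigenspace:
  assumes "\<nu> \<noteq> \<mu>" "x \<in> left_gen_eigenspace A \<mu>"
  shows "\<exists>y\<in>left_gen_eigenspace A \<mu>. x = lshift A \<nu> y"
proof -
  obtain m where "(lshift A \<mu> ^^ m) x = 0"
    using assms by (auto simp: left_gen_eigenspace_iff)
  then show ?thesis
    using assms(2)
  proof (induction m arbitrary: x)
    case 0
    then show ?case by (auto simp: left_gen_eigenspace_iff intro!: bexI[of _ 0])
  next
    case (Suc m)
    have "(lshift A \<mu> ^^ m) (lshift A \<mu> x) = 0"
      using Suc.prems(1) by (simp add: funpow_swap1)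
    moreover have "lshift A \<mu> x \<in> left_gen_eigenspace A \<mu>"
      using Suc.prems(2) by (rule lshift_gen_eigenspace)
    ultimately obtain y where y: "y \<in> left_gen_eigenspace A \<mu>" "lshift A \<mu> x = lshift A \<nu> y"
      using Suc.IH by blast
    define z where "z = (1 / (\<mu> - \<nu>)) *s (x - y)"
    have "lshift A \<nu> z = (1 / (\<mu> - \<nu>)) *s (lshift A \<nu> x - lshift A \<nu> y)"
      by (simp add: z_def lshift_scale lshift_diff)
    also have "\<dots> = x"
    proof -
      have "lshift A \<nu> x - lshift A \<nu> y = (\<mu> - \<nu>) *s x"
        using y(2) lshift_change[of A \<nu> x \<mu>] by simp
      then have "(1 / (\<mu> - \<nu>)) *s (lshift A \<nu> x - lshift A \<nu> y) = (1 / (\<mu> - \<nu>) * (\<mu> - \<nu>)) *s x"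
        by (simp only: vec.scale_scale)
      then show ?thesis using assms(1) by simp
    qed
    finally have "x = lshift A \<nu> z" by simp
    moreover have "z \<in> left_gen_eigenspace A \<mu>"
      unfolding z_def using y(1) Suc.prems(2) subspace_left_gen_eigenspace[of A \<mu>]
      by (meson vec.subspace_diff vec.subspace_scale)
    ultimately show ?case by blast
  qed
qed

lemma lshift_surj_gen_span:
  assumes "\<nu> \<notin> D" "x \<in> gen_span A D"
  shows "\<exists>y\<in>gen_span A D. x = lshift A \<nu> y"
proof -
  have "vec.subspace (lshift A \<nu> ` gen_span A D)"
    using vec.linear_subspace_image[OF linear_lshift subspace_gen_span] by blast
  moreover have "(\<Union>\<mu>\<in>D. left_gen_eigenspace A \<mu>) \<subseteq> lshift A \<nu> ` gen_span A D"
  proof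
    fix x assume "x \<in> (\<Union>\<mu>\<in>D. left_gen_eigenspace A \<mu>)"
    then obtain \<mu> where "\<mu> \<in> D" "x \<in> left_gen_eigenspace A \<mu>" by blast
    moreover have "\<nu> \<noteq> \<mu>" using \<open>\<mu> \<in> D\<close> assms(1) by auto
    ultimately obtain y where "y \<in> left_gen_eigenspace A \<mu>" "x = lshift A \<nu> y"
      using lshift_surj_gen_eigenspace by blast
    moreover have "y \<in> gen_span A D"
      using \<open>\<mu> \<in> D\<close> \<open>y \<in> _\<close> by (auto simp: gen_span_def intro!: vec.span_base)
    ultimately show "x \<in> lshift A \<nu> ` gen_span A D" by blast
  qed
  ultimately have "gen_span A D \<subseteq> lshift A \<nu> ` gen_span A D"
    unfolding gen_span_def by (intro vec.span_minimal)
  then show ?thesis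
    using assms by blast
qed

text \<open>Dimensions cannot grow under a linear map, so the image of a basis of \<open>W\<close>,
  whose span contains \<open>W\<close>, has as many elements as the basis and is
  independent.\<close>

lemma inj_on_if_surj_on_subspace:
  fixes f :: "complex ^ 's \<Rightarrow> complex ^ 's"
  assumes lin: "Vector_Spaces.linear (*s) (*s) f" and W: "vec.subspace W" and sub: "W \<subseteq> f ` W"
  shows "inj_on f W"
proof -
  obtain B where B: "B \<subseteq> W" "vec.independent B" "W \<subseteq> vec.span B" "card B = vec.dim W"
    using vec.basis_exists[of W] by blast
  have finB: "finite B"
    using B(2) vec.finiteI_independent by blast
  have span: "vec.span B = W"
    using B W by (metis subset_antisym vec.span_minimal)
  have fW: "f ` W = vec.span (f ` B)"
    using vec.linear_span_image[OF lin, of B] span by simp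
  have ge: "vec.dim W \<le> vec.dim (vec.span (f ` B))"
    using vec.dim_subset[OF sub] unfolding fW .
  have dc: "vec.dim (vec.span (f ` B)) \<le> card (f ` B)"
    by (rule vec.dim_le_card) (use finB in auto)
  have "card B \<le> card (f ` B)"
    using ge B(4) dc by (metis order_trans)
  then have card: "card (f ` B) = card B"
    using card_image_le[OF finB, of f] by (metis order_antisym)
  then have inj: "inj_on f B"
    using finB by (metis eq_card_imp_inj_on)
  have cd: "card (f ` B) \<le> vec.dim (vec.span (f ` B))"
    using card ge B(4) by metis
  have ind: "vec.independent (f ` B)"
    by (rule vec.card_le_dim_spanning[OF vec.span_superset order_refl _ cd]) (use finB in blast)
  show ?thesis
    using vec.linear_inj_on_span_iff_independent_image[OF lin ind] inj span by metis
qed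

lemma lshift_inj_gen_span:
  assumes "\<nu> \<notin> D" "x \<in> gen_span A D" "lshift A \<nu> x = 0"
  shows "x = 0"
proof -
  have "inj_on (lshift A \<nu>) (gen_span A D)"
    using lshift_surj_gen_span[OF assms(1)]
    by (intro inj_on_if_surj_on_subspace linear_lshift subspace_gen_span) blast
  then show ?thesis
    using assms(2,3) vec.subspace_0[OF subspace_gen_span, of A D]
    by (metis inj_onD lshift_0)
qed

text \<open>Induction on \<open>D\<close>: a power of \<open>A - \<kappa>\<close> kills the
  \<kappa>-component of \<open>x\<close> and leaves an element of the smaller span, which vanishes
  by induction; injectivity on \<open>W\<close> then removes the factors \<open>A - \<kappa>\<close>
  one at a time. \<open>W\<close> is kept abstract because it serves both as a span over other
  numbers and as the annihilator of right eigenvectors.\<close>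

lemma gen_span_Int_invariant:
  assumes "finite D" and W: "vec.subspace W" "\<And>x \<mu>. x \<in> W \<Longrightarrow> lshift A \<mu> x \<in> W"
    and inj: "\<And>x \<mu>. x \<in> W \<Longrightarrow> \<mu> \<in> D \<Longrightarrow> lshift A \<mu> x = 0 \<Longrightarrow> x = 0"
    and "x \<in> W" "x \<in> gen_span A D"
  shows "x = 0"
  using assms(1,4,5,6)
proof (induction D arbitrary: x rule: finite_induct)
  case empty
  then show ?case by (simp add: gen_span_empty)
next
  case (insert \<kappa> D)
  have "x \<in> gen_span A ({\<kappa>} \<union> D)"
    using insert.prems by simp
  then obtain g y where gy: "g \<in> gen_span A {\<kappa>}" "y \<in> gen_span A D" "x = g + y"
    by (auto simp only: gen_span_Un)
  then obtain m where m: "(lshift A \<kappa> ^^ m) g = 0"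
    by (auto simp: gen_span_single left_gen_eigenspace_iff)
  have inW: "(lshift A \<kappa> ^^ n) x \<in> W" for n
    by (induction n) (use insert.prems W(2) in auto)
  have "(lshift A \<kappa> ^^ n) y \<in> gen_span A D" for n
    by (induction n) (use gy(2) lshift_gen_span in auto)
  moreover have "(lshift A \<kappa> ^^ m) x = (lshift A \<kappa> ^^ m) y"
    using gy m by (simp add: funpow_lshift_add)
  ultimately have "(lshift A \<kappa> ^^ m) x \<in> gen_span A D"
    by simp
  then have *: "(lshift A \<kappa> ^^ m) x = 0"
    using inW insert by blast
  have "(lshift A \<kappa> ^^ (m - n)) x = 0" if "n \<le> m" for n
    using that
  proof (induction n)
    case (Suc n)
    have "lshift A \<kappa> ((lshift A \<kappa> ^^ (m - Suc n)) x) = (lshift A \<kappa> ^^ (m - n)) x"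
    proof -
      have "m - n = Suc (m - Suc n)" using Suc.prems by simp
      then show ?thesis by simp
    qed
    then show ?case
      using Suc inW insert.prems(1) by auto
  qed (use * in simp)
  from this[of m] show ?case by simp
qed

lemma gen_span_disjoint:
  assumes "finite D" "D \<inter> E = {}" "x \<in> gen_span A D" "x \<in> gen_span A E"
  shows "x = 0"
  using assms lshift_inj_gen_span[of _ E _ A] lshift_gen_span[of _ A E]
  by (intro gen_span_Int_invariant[of D "gen_span A E" A x]) (auto simp: subspace_gen_span)

text \<open>On the part of \<open>x (A - \<mu>)\<close> belonging to the other numbers,
  \<open>A - \<mu>\<close> can be inverted. Subtracting that preimage from \<open>x\<close> leaves a
  vector that \<open>A - \<mu>\<close> maps into the generalized eigenspace of \<mu>, so it lies in
  this eigenspace itself.\<close>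

lemma gen_span_if_lshift_in:
  assumes "lshift A \<mu> x \<in> gen_span A UNIV"
  shows "x \<in> gen_span A UNIV"
proof -
  have "lshift A \<mu> x \<in> gen_span A ({\<mu>} \<union> -{\<mu>})"
    using assms by (simp add: Un_commute)
  then obtain g v where gv: "g \<in> left_gen_eigenspace A \<mu>" "v \<in> gen_span A (-{\<mu>})" "lshift A \<mu> x = g + v"
    by (auto simp only: gen_span_Un gen_span_single)
  obtain v' where v': "v' \<in> gen_span A (-{\<mu>})" "v = lshift A \<mu> v'"
    using lshift_surj_gen_span[OF _ gv(2), of \<mu>] by auto
  have eq: "lshift A \<mu> (x - v') = g"
    using gv v' by (simp add: lshift_diff)
  obtain m where "(lshift A \<mu> ^^ m) g = 0"
    using gv(1) by (auto simp: left_gen_eigenspace_iff)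
  then have "(lshift A \<mu> ^^ (Suc m)) (x - v') = 0"
    using eq by (simp add: funpow_swap1)
  then have "x - v' \<in> gen_span A {\<mu>}"
    unfolding gen_span_single left_gen_eigenspace_iff by blast
  then have "(x - v') + v' \<in> gen_span A ({\<mu>} \<union> -{\<mu>})"
    using v'(1) gen_span_Un by blast
  then show ?thesis by (simp add: Un_commute)
qed

section \<open>Generalized eigenvectors span the whole space\<close>

definition poly_act :: "complex ^ 's ^ 's \<Rightarrow> complex poly \<Rightarrow> complex ^ 's \<Rightarrow> complex ^ 's" where
  "poly_act A P x = (\<Sum>i\<le>degree P. coeff P i *s (lshift A 0 ^^ i) x)"

lemma poly_act_altdef:
  assumes "degree P \<le> n"
  shows "poly_act A P x = (\<Sum>i\<le>n. coeff P i *s (lshift A 0 ^^ i) x)"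
  unfolding poly_act_def
  by (rule sum.mono_neutral_left) (use assms in \<open>auto simp: coeff_eq_0\<close>)

text \<open>\<open>poly_act A P x\<close> is \<open>x P(A)\<close>, since \<open>lshift A 0\<close>
  is multiplication by \<open>A\<close>. Splitting off one linear factor as an application of
  \<open>A - c\<close> is what the induction over the degree consumes.\<close>

lemma poly_act_linear_factor: "poly_act A ([:-c, 1:] * P) x = poly_act A P (lshift A c x)"
proof (cases "P = 0")
  case True
  then show ?thesis by (simp add: poly_act_def)
next
  case False
  define n where "n = degree P"
  let ?f = "\<lambda>i. (lshift A 0 ^^ i) x"
  have deg: "degree ([:-c, 1:] * P) \<le> Suc n"
    using degree_mult_le[of "[:-c, 1:]" P] by (simp add: n_def)
  have co: "coeff ([:-c, 1:] * P) i = (if i = 0 then 0 else coeff P (i - 1)) - c * coeff P i" for i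
    by (cases i) (auto simp: coeff_pCons)
  have "poly_act A ([:-c, 1:] * P) x = (\<Sum>i\<le>Suc n. coeff ([:-c, 1:] * P) i *s ?f i)"
    by (rule poly_act_altdef[OF deg])
  also have "\<dots> = (\<Sum>i\<le>Suc n. (if i = 0 then 0 else coeff P (i - 1)) *s ?f i)
      - (\<Sum>i\<le>Suc n. (c * coeff P i) *s ?f i)"
    unfolding co by (simp only: vec.scale_left_diff_distrib sum_subtractf)
  also have "(\<Sum>i\<le>Suc n. (if i = 0 then 0 else coeff P (i - 1)) *s ?f i)
      = (\<Sum>i\<le>n. coeff P i *s ?f (Suc i))"
    by (subst sum.atMost_Suc_shift) simp
  also have "(\<Sum>i\<le>Suc n. (c * coeff P i) *s ?f i) = (\<Sum>i\<le>n. coeff P i *s (c *s ?f i))"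
    by (simp add: n_def coeff_eq_0 mult.commute)
  also have "(\<Sum>i\<le>n. coeff P i *s ?f (Suc i)) - \<dots> = (\<Sum>i\<le>n. coeff P i *s (lshift A c (?f i)))"
    by (simp add: sum_subtractf[symmetric] vec.scale_right_diff_distrib[symmetric] lshift_def[of A 0] lshift_def[of A c])
  also have "\<dots> = poly_act A P (lshift A c x)"
  proof -
    have "lshift A c (?f i) = (lshift A 0 ^^ i) (lshift A c x)" for i
      by (induction i) (auto simp: lshift_commute)
    then show ?thesis by (simp add: poly_act_def n_def)
  qed
  finally show ?thesis .
qed

text \<open>A root \<open>c\<close> of \<open>P\<close> moves one factor onto the vector:
  \<open>x (A - c)\<close> is annihilated by a polynomial of smaller degree, and membership passes
  from \<open>x (A - c)\<close> back to \<open>x\<close>.\<close>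

lemma gen_span_if_poly_act_0:
  assumes "P \<noteq> 0" "poly_act A P x = 0"
  shows "x \<in> gen_span A UNIV"
  using assms
proof (induction "degree P" arbitrary: P x rule: less_induct)
  case less
  show ?case
  proof (cases "degree P = 0")
    case True
    then have "x = 0"
      using less.prems by (auto simp: poly_act_def elim!: degree_eq_zeroE)
    then show ?thesis by (simp add: vec.subspace_0 subspace_gen_span)
  next
    case False
    then obtain c where "poly P c = 0"
      using alg_closed_imp_poly_has_root[of P] by auto
    then obtain R where R: "P = [:-c, 1:] * R"
      by (auto simp: poly_eq_0_iff_dvd)
    have "R \<noteq> 0" using R less.prems by auto
    moreover have "degree R < degree P"
      using degree_mult_eq[of "[:-c, 1:]" R] \<open>R \<noteq> 0\<close> unfolding R by simp
    moreover have "poly_act A R (lshift A c x) = 0"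
      using less.prems by (simp add: R poly_act_linear_factor del: mult_pCons_left)
    ultimately show ?thesis
      using less.hyps gen_span_if_lshift_in by blast
  qed
qed

text \<open>The vectors \<open>x, x A, x A^2, ...\<close> up to the power \<open>CARD('s)\<close>
  are linearly dependent, which yields a nonzero polynomial annihilating the single vector
  \<open>x\<close>; this takes the place of the characteristic polynomial.\<close>

lemma gen_span_UNIV: "gen_span (A :: complex ^ 's ^ 's) UNIV = UNIV"
proof -
  have "x \<in> gen_span A UNIV" for x :: "complex ^ 's"
  proof -
    let ?n = "CARD('s)"
    let ?f = "\<lambda>i. (lshift A 0 ^^ i) x"
    have "\<exists>P. P \<noteq> 0 \<and> poly_act A P x = 0"
    proof (cases "inj_on ?f {..?n}")
      \<comment> \<open>Linear dependence is a property of sets, so a repetition among the powers is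
        treated separately, with the difference of two monomials.\<close>
      case False
      then obtain i j where ij: "i \<noteq> j" "?f i = ?f j" "i \<le> ?n" "j \<le> ?n"
        by (auto simp: inj_on_def)
      define P :: "complex poly" where "P = monom 1 i - monom 1 j"
      have "coeff P i = 1" using ij by (simp add: P_def)
      then have nz: "P \<noteq> 0" by auto
      have "degree P \<le> ?n"
        unfolding P_def using ij by (intro degree_diff_le) (auto simp: degree_monom_eq)
      then have "poly_act A P x = (\<Sum>k\<le>?n. coeff P k *s ?f k)"
        by (rule poly_act_altdef)
      also have "\<dots> = (\<Sum>k\<le>?n. (if k = i then ?f k else 0)) - (\<Sum>k\<le>?n. (if k = j then ?f k else 0))"
        unfolding sum_subtractf[symmetric] by (rule sum.cong) (auto simp: P_def)
      also have "\<dots> = 0" using ij by simp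
      finally have "poly_act A P x = 0" .
      with nz show ?thesis by blast
    next
      case True
      then have "card (?f ` {..?n}) = Suc ?n"
        by (simp add: card_image)
      then have "vec.dependent (?f ` {..?n})"
        using dim_subset_UNIV_cart_gen[of "?f ` {..?n}"]
        by (intro vec.dependent_biggerset_general) linarith
      then obtain u where u: "\<exists>v\<in>?f ` {..?n}. u v \<noteq> 0" "(\<Sum>v\<in>?f ` {..?n}. u v *s v) = 0"
        by (subst (asm) vec.dependent_finite) auto
      define P :: "complex poly" where "P = (\<Sum>i\<le>?n. monom (u (?f i)) i)"
      have co: "coeff P k = u (?f k)" if "k \<le> ?n" for k
        using that by (simp add: P_def coeff_sum)
      have nz: "P \<noteq> 0" using u(1) co by fastforce
      have "degree P \<le> ?n"
        unfolding P_def by (intro degree_sum_le) (auto intro: order_trans[OF degree_monom_le])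
      then have "poly_act A P x = (\<Sum>k\<le>?n. coeff P k *s ?f k)"
        by (rule poly_act_altdef)
      also have "\<dots> = (\<Sum>k\<le>?n. u (?f k) *s ?f k)"
        using co by simp
      also have "\<dots> = 0"
        using u(2) by (simp add: sum.reindex[OF True])
      finally have "poly_act A P x = 0" .
      with nz show ?thesis by blast
    qed
    then show ?thesis using gen_span_if_poly_act_0 by blast
  qed
  then show ?thesis by auto
qed

lemma gen_span_decompose:
  obtains g v where "g \<in> gen_span A D" "v \<in> gen_span A (- D)" "x = g + v"
proof -
  have "x \<in> gen_span A (D \<union> - D)" by (simp add: gen_span_UNIV)
  then show ?thesis using that by (auto simp only: gen_span_Un)
qed

lemma eigenspace_span_subset_gen_span:
  "vec.span (\<Union>\<mu>\<in>D. left_eigenspace A \<mu>) \<subseteq> gen_span A D"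
  unfolding gen_span_def
proof (rule vec.span_mono, rule UN_mono)
  fix \<mu> show "left_eigenspace A \<mu> \<subseteq> left_gen_eigenspace A \<mu>"
    unfolding left_gen_eigenspace_iff subset_iff left_eigenspace_def
    by (auto simp: lshift_def intro: exI[of _ 1])
qed simp

text \<open>Uniqueness is automatic: two candidates differ by an element of both
  \<open>gen_span A D\<close> and \<open>gen_span A (- D)\<close>, hence by 0. Only the two
  memberships remain to be shown in applications.\<close>

lemma proj_along_gen_spanI:
  assumes "finite D" "u \<in> vec.span (\<Union>\<mu>\<in>D. left_eigenspace A \<mu>)" "x - u \<in> gen_span A (- D)"
  shows "proj_along (vec.span (\<Union>\<mu>\<in>D. left_eigenspace A \<mu>))
    (vec.span (\<Union>\<mu>\<in>- D. left_gen_eigenspace A \<mu>)) x = u"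
  unfolding proj_along_def gen_span_def[symmetric]
proof (rule the_equality)
  fix u' assume u': "u' \<in> vec.span (\<Union>\<mu>\<in>D. left_eigenspace A \<mu>) \<and> x - u' \<in> gen_span A (- D)"
  have "u' - u \<in> gen_span A D"
    using u' assms(2) eigenspace_span_subset_gen_span[of A D] vec.span_diff by blast
  moreover have "(x - u) - (x - u') \<in> gen_span A (- D)"
    using u' assms(3) subspace_gen_span vec.subspace_diff by blast
  then have "u' - u \<in> gen_span A (- D)" by simp
  ultimately have "u' - u = 0"
    using gen_span_disjoint[OF assms(1), of "- D" "u' - u" A] by simp
  then show "u' = u" by simp
qed (use assms in auto)

text \<open>A Jordan chain of length 2 for \<kappa> would make the norm of \<open>x A^n\<close> grow
  like \<open>n * |\<kappa>|^n\<close>, whereas contractivity in the \<open>l1\<close> norm allows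
  only \<open>|\<kappa>|^n\<close>. Longer chains contain one of length 2.\<close>

lemma gen_eigenspace_eq_eigenspace_if_contractive:
  fixes A :: "complex ^ 's ^ 's"
  assumes contr: "\<And>x. (\<Sum>s\<in>UNIV. cmod ((x v* A) $ s)) \<le> cmod \<kappa> * (\<Sum>s\<in>UNIV. cmod (x $ s))"
    and "\<kappa> \<noteq> 0" and "x \<in> left_gen_eigenspace A \<kappa>"
  shows "lshift A \<kappa> x = 0"
proof -
  define N where "N x = (\<Sum>s\<in>UNIV. cmod (x $ s))" for x :: "complex ^ 's"
  have two: "lshift A \<kappa> x = 0" if "lshift A \<kappa> (lshift A \<kappa> x) = 0" for x
  proof -
    define y where "y = lshift A \<kappa> x"
    have yA: "y v* A = \<kappa> *s y" using that by (simp add: y_def lshift_def)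
    have xA: "x v* A = \<kappa> *s x + y" by (simp add: y_def lshift_def)
    define X where "X n = ((\<lambda>x. x v* A) ^^ n) x" for n
    have add: "(a + b) v* A = a v* A + b v* A" for a b
      using lshift_add[of A 0 a b] by (simp add: lshift_def)
    have scale: "(c *s a) v* A = c *s (a v* A)" for c a
      using lshift_scale[of A 0 c a] by (simp add: lshift_def)
    \<comment> \<open>Closed form of the powers on a chain of length 2; the truncated exponent
      \<open>n - 1\<close> at \<open>n = 0\<close> is harmless because of the factor
      \<open>of_nat n\<close>.\<close>
    have X: "X n = \<kappa> ^ n *s x + (of_nat n * \<kappa> ^ (n - 1)) *s y" for n
    proof (induction n)
      case 0 then show ?case by (simp add: X_def)
    next
      case (Suc n)
      have "X (Suc n) = X n v* A" by (simp add: X_def)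
      also have "\<dots> = \<kappa> ^ n *s (\<kappa> *s x + y) + (of_nat n * \<kappa> ^ (n - 1)) *s (\<kappa> *s y)"
        by (simp only: Suc add scale xA yA)
      also have "\<dots> = \<kappa> ^ Suc n *s x + (of_nat (Suc n) * \<kappa> ^ n) *s y"
        by (cases n) (auto simp: vec_eq_iff algebra_simps)
      finally show ?case by simp
    qed
    have bound: "N (X n) \<le> cmod \<kappa> ^ n * N x" for n
    proof (induction n)
      case 0 then show ?case by (simp add: X_def)
    next
      case (Suc n)
      have "N (X (Suc n)) \<le> cmod \<kappa> * N (X n)"
        using contr[of "X n"] by (simp add: X_def N_def)
      also have "\<dots> \<le> cmod \<kappa> * (cmod \<kappa> ^ n * N x)"
        by (intro mult_left_mono Suc) auto
      finally show ?case by (simp add: mult_ac)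
    qed
    have "y $ s = 0" for s
    proof (rule ccontr)
      assume ns: "y $ s \<noteq> 0"
      have main: "real n * cmod (y $ s) \<le> 2 * cmod \<kappa> * N x" for n
      proof (cases n)
        case 0 then show ?thesis by (simp add: N_def sum_nonneg)
      next
        case (Suc m)
        have le: "cmod (z $ s) \<le> N z" for z :: "complex ^ 's"
          unfolding N_def by (rule member_le_sum) auto
        have "(of_nat n * \<kappa> ^ m) * y $ s = X n $ s - \<kappa> ^ n * x $ s"
          unfolding X by (simp add: Suc)
        then have "cmod ((of_nat n * \<kappa> ^ m) * y $ s) = cmod (X n $ s - \<kappa> ^ n * x $ s)"
          by (rule arg_cong)
        then have "real n * cmod \<kappa> ^ m * cmod (y $ s) = cmod (X n $ s - \<kappa> ^ n * x $ s)"
          by (simp only: norm_mult norm_power norm_of_nat)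
        also have "\<dots> \<le> cmod (X n $ s) + cmod \<kappa> ^ n * cmod (x $ s)"
          using norm_triangle_ineq4[of "X n $ s" "\<kappa> ^ n * x $ s"] by (simp add: norm_mult norm_power)
        also have "\<dots> \<le> cmod \<kappa> ^ n * N x + cmod \<kappa> ^ n * N x"
          by (intro add_mono mult_left_mono le order_trans[OF le bound]) auto
        also have "\<dots> = cmod \<kappa> ^ m * (2 * cmod \<kappa> * N x)"
          by (simp add: Suc)
        finally have "cmod \<kappa> ^ m * (real n * cmod (y $ s)) \<le> cmod \<kappa> ^ m * (2 * cmod \<kappa> * N x)"
          by (simp add: mult_ac)
        then show ?thesis using \<open>\<kappa> \<noteq> 0\<close> by (simp add: mult_le_cancel_left)
      qed
      obtain n where "2 * cmod \<kappa> * N x < real n * cmod (y $ s)"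
        using ns reals_Archimedean3[of "cmod (y $ s)"] by auto
      with main[of n] show False by simp
    qed
    then show ?thesis by (simp add: y_def vec_eq_iff)
  qed
  obtain m where "(lshift A \<kappa> ^^ m) x = 0"
    using assms by (auto simp: left_gen_eigenspace_iff)
  then show ?thesis
  proof (induction m arbitrary: x)
    case (Suc m)
    then have "(lshift A \<kappa> ^^ m) (lshift A \<kappa> x) = 0"
      by (simp add: funpow_swap1)
    then show ?case using Suc.IH two by blast
  qed simp
qed

section \<open>Absolutely convergent Fourier series\<close>

definition fexp :: "nat \<Rightarrow> int \<Rightarrow> real \<Rightarrow> complex" where
  "fexp p k x = exp (2 * of_real pi * \<i> * of_int k / of_nat p * of_real x)"

definition fcoef :: "nat \<Rightarrow> (real \<Rightarrow> complex) \<Rightarrow> int \<Rightarrow> complex" where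
  "fcoef p f k = 1 / of_nat p * integral {0..real p} (\<lambda>x. f x * fexp p (- k) x)"

lemma fourier_coeff_eq_fcoef: "fourier_coeff p f k = fcoef p (\<lambda>x. of_real (f x)) k"
  by (simp add: fourier_coeff_def fcoef_def fexp_def)

lemma fexp_cis: "fexp p k x = cis (2 * pi * of_int k * x / real p)"
  by (simp add: fexp_def cis_conv_exp mult_ac)

lemma fexp_0 [simp]: "fexp p 0 x = 1" "fexp p k 0 = 1"
  by (simp_all add: fexp_def)

lemma norm_fexp [simp]: "cmod (fexp p k x) = 1"
  by (simp add: fexp_cis)

lemma fexp_add: "fexp p (k + l) x = fexp p k x * fexp p l x"
  by (simp add: fexp_cis cis_mult ring_distribs add_divide_distrib)

lemma fexp_shift: "fexp p k (x + y) = fexp p k x * fexp p k y"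
  by (simp add: fexp_cis cis_mult ring_distribs add_divide_distrib)

lemma cnj_fexp: "cnj (fexp p k x) = fexp p (- k) x"
  by (simp add: fexp_cis cis_cnj)

lemma fexp_period: "p > 0 \<Longrightarrow> fexp p k (x + real p) = fexp p k x"
  by (simp add: fexp_shift) (simp add: fexp_cis cis_multiple_2pi)

lemma continuous_on_fexp [continuous_intros]:
  "continuous_on S f \<Longrightarrow> continuous_on S (\<lambda>x. fexp p k (f x))"
  unfolding fexp_def by (intro continuous_intros)

lemma integral_fexp:
  assumes "p > 0"
  shows "integral {0..real p} (fexp p k) = (if k = 0 then of_nat p else 0)"
proof (cases "k = 0")
  case True
  then show ?thesis by (simp add: fexp_0(1)[abs_def] scaleR_conv_of_real)
next
  case False
  define a where "a = 2 * of_real pi * \<i> * of_int k / (of_nat p :: complex)"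
  have a: "a \<noteq> 0" using False assms by (simp add: a_def)
  have "(fexp p k has_integral (exp (a * of_real (real p)) / a - exp (a * of_real 0) / a)) {0..real p}"
  proof (rule fundamental_theorem_of_calculus)
    fix x
    have "((\<lambda>z. exp (a * z) / a) has_field_derivative exp (a * of_real x)) (at (of_real x))"
      using a by (auto intro!: derivative_eq_intros)
    then have "((\<lambda>x. exp (a * of_real x) / a) has_vector_derivative exp (a * of_real x)) (at x within {0..real p})"
      by (rule has_vector_derivative_real_field)
    then show "((\<lambda>x. exp (a * of_real x) / a) has_vector_derivative fexp p k x) (at x within {0..real p})"
      by (simp add: fexp_def a_def)
  qed simp
  moreover have "exp (a * of_real (real p)) = 1"
    using fexp_period[OF assms, of k 0] by (simp add: fexp_def a_def)
  ultimately show ?thesis using False by (simp add: integral_unique)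
qed

lemma integral_fexp_mult:
  assumes "p > 0"
  shows "integral {0..real p} (\<lambda>x. fexp p k x * fexp p (- l) x) = (if k = l then of_nat p else 0)"
proof -
  have "(\<lambda>x. fexp p k x * fexp p (- l) x) = fexp p (k - l)"
    using fexp_add[of p k "- l"] by auto
  then show ?thesis by (simp only: integral_fexp[OF assms]) simp
qed

text \<open>Expanding \<open>|f - S|^2\<close> for the partial Fourier sum \<open>S\<close> gives a
  nonnegative integral, in which the integrals of \<open>f * cnj S\<close> and of
  \<open>S * cnj S\<close> are both \<open>p\<close> times the sum of the squared moduli of the
  coefficients.\<close>

lemma bessel_inequality:
  fixes f :: "real \<Rightarrow> complex"
  assumes "p > 0" "continuous_on {0..real p} f" "finite K"
  shows "(\<Sum>k\<in>K. (cmod (fcoef p f k))\<^sup>2) \<le> integral {0..real p} (\<lambda>x. (cmod (f x))\<^sup>2) / real p"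
proof -
  define c where "c = fcoef p f"
  define S where "S x = (\<Sum>k\<in>K. c k * fexp p k x)" for x
  define E where "E = (\<Sum>k\<in>K. (cmod (c k))\<^sup>2)"
  define I where "I g = integral {0..real p} g" for g :: "real \<Rightarrow> complex"
  have contS: "continuous_on {0..real p} S"
    unfolding S_def by (intro continuous_intros)
  have contS': "continuous_on {0..real p} (\<lambda>x. cnj (S x))"
    by (intro continuous_intros contS)
  note cont = assms(2) contS contS'
  have ce: "integral {0..real p} (\<lambda>x. f x * fexp p (- k) x) = of_nat p * c k" for k
    using assms(1) by (simp add: c_def fcoef_def)
  have fS: "I (\<lambda>x. f x * cnj (S x)) = of_nat p * of_real E"
  proof -
    have "I (\<lambda>x. f x * cnj (S x)) = integral {0..real p} (\<lambda>x. \<Sum>k\<in>K. cnj (c k) * (f x * fexp p (- k) x))"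
      unfolding I_def S_def by (rule integral_cong) (simp add: sum_distrib_left cnj_fexp mult_ac)
    also have "\<dots> = (\<Sum>k\<in>K. cnj (c k) * (of_nat p * c k))"
      using assms
      by (subst integral_sum) (auto simp: ce intro!: integrable_continuous_interval continuous_intros)
    also have "\<dots> = of_nat p * of_real E"
      unfolding E_def of_real_sum sum_distrib_left
      by (rule sum.cong) (auto simp: complex_norm_square simp del: of_real_power)
    finally show ?thesis .
  qed
  have SS: "I (\<lambda>x. S x * cnj (S x)) = of_nat p * of_real E"
  proof -
    have "I (\<lambda>x. S x * cnj (S x)) = integral {0..real p} (\<lambda>x. \<Sum>k\<in>K. cnj (c k) * (S x * fexp p (- k) x))"
      unfolding I_def S_def by (rule integral_cong) (simp add: sum_distrib_left cnj_fexp mult_ac)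
    also have "\<dots> = (\<Sum>k\<in>K. cnj (c k) * integral {0..real p} (\<lambda>x. S x * fexp p (- k) x))"
      using assms contS
      by (subst integral_sum) (auto intro!: integrable_continuous_interval continuous_intros)
    also have "\<dots> = (\<Sum>k\<in>K. cnj (c k) * (of_nat p * c k))"
    proof (rule sum.cong[OF refl])
      fix k assume k: "k \<in> K"
      have "integral {0..real p} (\<lambda>x. S x * fexp p (- k) x)
          = integral {0..real p} (\<lambda>x. \<Sum>l\<in>K. c l * (fexp p l x * fexp p (- k) x))"
        unfolding S_def by (rule integral_cong) (simp add: sum_distrib_left sum_distrib_right mult_ac)
      also have "\<dots> = (\<Sum>l\<in>K. c l * (if l = k then of_nat p else 0))"
        using assms
        by (subst integral_sum)
           (auto simp: integral_fexp_mult intro!: integrable_continuous_interval continuous_intros)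
      also have "\<dots> = of_nat p * c k"
        using k assms by (simp add: if_distrib cong: if_cong)
      finally show "cnj (c k) * integral {0..real p} (\<lambda>x. S x * fexp p (- k) x) = cnj (c k) * (of_nat p * c k)"
        by simp
    qed
    also have "\<dots> = of_nat p * of_real E"
      unfolding E_def of_real_sum sum_distrib_left
      by (rule sum.cong) (auto simp: complex_norm_square simp del: of_real_power)
    finally show ?thesis .
  qed
  have "(cmod (f x))\<^sup>2 = (cmod (f x - S x))\<^sup>2 + 2 * Re (f x * cnj (S x)) - Re (S x * cnj (S x))" for x
    by (simp only: cmod_power2) (simp add: power2_eq_square algebra_simps)
  then have "integral {0..real p} (\<lambda>x. (cmod (f x))\<^sup>2)
     = integral {0..real p} (\<lambda>x. (cmod (f x - S x))\<^sup>2 + 2 * Re (f x * cnj (S x)) - Re (S x * cnj (S x)))"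
    by simp
  also have "\<dots> = integral {0..real p} (\<lambda>x. (cmod (f x - S x))\<^sup>2)
     + 2 * integral {0..real p} (\<lambda>x. Re (f x * cnj (S x))) - integral {0..real p} (\<lambda>x. Re (S x * cnj (S x)))"
  proof -
    have i: "(\<lambda>x. (cmod (f x - S x))\<^sup>2) integrable_on {0..real p}"
      "(\<lambda>x. 2 * Re (f x * cnj (S x))) integrable_on {0..real p}"
      "(\<lambda>x. Re (S x * cnj (S x))) integrable_on {0..real p}"
      using cont by (auto intro!: integrable_continuous_interval continuous_intros)
    show ?thesis
      using integral_diff[OF integrable_add[OF i(1,2)] i(3)] integral_add[OF i(1,2)]
        integral_mult_right[of "{0..real p}" 2 "\<lambda>x. Re (f x * cnj (S x))"] by linarith
  qed
  also have "integral {0..real p} (\<lambda>x. Re (f x * cnj (S x))) = Re (I (\<lambda>x. f x * cnj (S x)))"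
    unfolding I_def using cont
    by (intro integral_linear[OF _ bounded_linear_Re, unfolded o_def] integrable_continuous_interval continuous_intros)
  also have "integral {0..real p} (\<lambda>x. Re (S x * cnj (S x))) = Re (I (\<lambda>x. S x * cnj (S x)))"
    unfolding I_def using cont
    by (intro integral_linear[OF _ bounded_linear_Re, unfolded o_def] integrable_continuous_interval continuous_intros)
  finally have "integral {0..real p} (\<lambda>x. (cmod (f x))\<^sup>2)
      = integral {0..real p} (\<lambda>x. (cmod (f x - S x))\<^sup>2) + real p * E"
    by (simp add: fS SS)
  moreover have "integral {0..real p} (\<lambda>x. (cmod (f x - S x))\<^sup>2) \<ge> 0"
    by (rule integral_nonneg) (use cont in \<open>auto intro!: integrable_continuous_interval continuous_intros\<close>)
  ultimately show ?thesis
    using assms(1) unfolding E_def c_def by (simp add: field_simps)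
qed

lemma integral_periodic_shift:
  fixes f :: "real \<Rightarrow> complex"
  assumes "continuous_on UNIV f" "\<And>x. f (x + P) = f x" "0 \<le> h" "h \<le> P"
  shows "integral {0..P} (\<lambda>x. f (x + h)) = integral {0..P} f"
proof -
  have int: "f integrable_on {a..b}" for a b
    using assms(1) by (intro integrable_continuous_interval continuous_on_subset[OF assms(1)]) auto
  have shift: "integral {a..b} (\<lambda>x. f (x + c)) = integral {a + c..b + c} f" for a b c
    using integral_shift[OF continuous_on_subset[OF assms(1)], of a c b] by (simp add: o_def)
  have "integral {0..P} (\<lambda>x. f (x + h)) = integral {h..P + h} f"
    using shift[of 0 P h] by simp
  also have "\<dots> = integral {h..P} f + integral {P..P + h} f"
    by (rule Henstock_Kurzweil_Integration.integral_combine[symmetric]) (use assms int in auto)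
  also have "integral {P..P + h} f = integral {0..h} (\<lambda>x. f (x + P))"
    using shift[of 0 h P] by (simp add: add.commute)
  also have "\<dots> = integral {0..h} f"
    by (simp add: assms(2))
  also have "integral {h..P} f + integral {0..h} f = integral {0..P} f"
    using Henstock_Kurzweil_Integration.integral_combine[of 0 h P f] assms int by (simp add: add.commute)
  finally show ?thesis .
qed

text \<open>Translation by \<open>h\<close> multiplies the k-th coefficient by
  \<open>fexp p k h\<close>. Bessel's inequality for a difference of translates thus controls the
  coefficients for which this factor stays away from 1.\<close>

lemma fcoef_shift_diff:
  fixes f :: "real \<Rightarrow> complex"
  assumes "p > 0" "continuous_on UNIV f" "\<And>x. f (x + real p) = f x" "0 \<le> h" "h \<le> real p"
  shows "fcoef p (\<lambda>x. f (x + h) - f x) k = (fexp p k h - 1) * fcoef p f k"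
proof -
  have cf: "continuous_on S f" for S
    using assms(2) by (rule continuous_on_subset) simp
  have cfh: "continuous_on S (\<lambda>x. f (x + h))" for S
    by (rule continuous_on_compose2[OF assms(2)]) (auto intro!: continuous_intros)
  have "integral {0..real p} (\<lambda>x. f (x + h) * fexp p (- k) (x + h))
      = integral {0..real p} (\<lambda>x. f x * fexp p (- k) x)"
    using assms
    by (intro integral_periodic_shift[of "\<lambda>x. f x * fexp p (- k) x"])
       (auto intro!: continuous_intros simp: fexp_period)
  moreover have "integral {0..real p} (\<lambda>x. f (x + h) * fexp p (- k) x)
      = integral {0..real p} (\<lambda>x. fexp p k h * (f (x + h) * fexp p (- k) (x + h)))"
  proof (rule integral_cong)
    fix x
    have "fexp p k h * fexp p (- k) h = 1"
      using fexp_add[of p k "- k" h] by simp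
    then show "f (x + h) * fexp p (- k) x = fexp p k h * (f (x + h) * fexp p (- k) (x + h))"
      by (simp add: fexp_shift)
  qed
  ultimately have 1: "integral {0..real p} (\<lambda>x. f (x + h) * fexp p (- k) x)
      = fexp p k h * integral {0..real p} (\<lambda>x. f x * fexp p (- k) x)"
    by simp
  have "integral {0..real p} (\<lambda>x. (f (x + h) - f x) * fexp p (- k) x)
      = integral {0..real p} (\<lambda>x. f (x + h) * fexp p (- k) x) - integral {0..real p} (\<lambda>x. f x * fexp p (- k) x)"
    unfolding left_diff_distrib
    by (rule integral_diff) (auto intro!: integrable_continuous_interval continuous_intros cf cfh)
  then show ?thesis
    by (simp add: fcoef_def 1 left_diff_distrib diff_divide_distrib)
qed

text \<open>The hypotheses put the modulus of the angle \<open>a = 2 * pi * k * h / p\<close>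
  between \<open>pi / 2\<close> and \<open>pi\<close>, where the cosine is nonpositive, and
  \<open>|exp (\<i> * a) - 1|^2 = 2 - 2 * cos a\<close>.\<close>

lemma cmod_fexp_minus_1_ge:
  assumes "1 \<le> \<bar>real_of_int k\<bar> * h * 4 / real p" "\<bar>real_of_int k\<bar> * h * 4 / real p \<le> 2"
  shows "1 \<le> cmod (fexp p k h - 1)"
proof -
  define a where "a = 2 * pi * of_int k * h / real p"
  have h: "h / real p \<ge> 0"
  proof (rule ccontr)
    assume "\<not> h / real p \<ge> 0"
    then have "(\<bar>real_of_int k\<bar> * 4) * (h / real p) \<le> 0"
      by (intro mult_nonneg_nonpos) auto
    then show False using assms(1) by (simp add: mult_ac)
  qed
  have "\<bar>a\<bar> = pi / 2 * (\<bar>real_of_int k\<bar> * h * 4 / real p)"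
  proof -
    have "a = (2 * pi * of_int k) * (h / real p)" by (simp add: a_def)
    then have "\<bar>a\<bar> = \<bar>2 * pi * of_int k\<bar> * (h / real p)" using h by (simp only: abs_mult abs_of_nonneg)
    then show ?thesis by (simp add: abs_mult)
  qed
  moreover have "pi / 2 * 1 \<le> pi / 2 * (\<bar>real_of_int k\<bar> * h * 4 / real p)"
    by (rule mult_left_mono[OF assms(1)]) simp
  moreover have "pi / 2 * (\<bar>real_of_int k\<bar> * h * 4 / real p) \<le> pi / 2 * 2"
    by (rule mult_left_mono[OF assms(2)]) simp
  ultimately have "pi / 2 \<le> \<bar>a\<bar>" "\<bar>a\<bar> \<le> pi" by linarith+
  then have "cos \<bar>a\<bar> \<le> cos (pi / 2)"
    by (intro cos_monotone_0_pi_le) auto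
  then have cosa: "cos a \<le> 0" by simp
  have "(cmod (fexp p k h - 1))\<^sup>2 = (cos a - 1)\<^sup>2 + (sin a)\<^sup>2"
    by (simp add: fexp_cis cmod_power2 a_def)
  also have "\<dots> = 2 - 2 * cos a"
    using sin_cos_squared_add[of a] by (simp add: power2_eq_square algebra_simps)
  finally have "1\<^sup>2 \<le> (cmod (fexp p k h - 1))\<^sup>2" using cosa by simp
  then show ?thesis by (rule power2_le_imp_le) simp
qed

text \<open>Bernstein's argument: Bessel's inequality for \<open>f (x + h) - f x\<close> with \<open>h = p / (4 \<cdot> 2 ^ j)\<close>
  controls the block \<open>2 ^ j \<le> \<bar>k\<bar> < 2 ^ Suc j\<close>.\<close>

lemma summable_fcoef_if_holder:
  fixes f :: "real \<Rightarrow> complex"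
  assumes p: "p > 0" and cont: "continuous_on UNIV f" and per: "\<And>x. f (x + real p) = f x"
    and holder: "\<And>x h. 0 < h \<Longrightarrow> h \<le> real p \<Longrightarrow> cmod (f (x + h) - f x) \<le> C * h powr (3/4)"
  shows "(\<lambda>k. cmod (fcoef p f k)) summable_on UNIV"
proof -
  define c where "c = fcoef p f"
  define B where "B j = {k :: int. 2 ^ j \<le> \<bar>k\<bar> \<and> \<bar>k\<bar> < 2 ^ Suc j}" for j :: nat
  \<comment> \<open>Cauchy-Schwarz over the \<open>2 * 2 ^ j\<close> indices of a block costs a
    factor of order 2^(j/2), Hoelder continuity gains 2^(-3j/4); the remaining 2^(-j/4) is summable
    because 3/4 > 1/2.\<close>
  define r where "r = (2 :: real) powr (- 1/4)"
  have C0: "C \<ge> 0"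
    using holder[of 1 0] p by (auto intro: order_trans[OF norm_ge_zero])
  have r: "0 \<le> r" "r < 1" unfolding r_def using powr_less_mono[of "-1/4" 0 "2::real"] by auto
  have finB: "finite (B j)" for j
    by (rule finite_subset[of _ "{- (2 ^ Suc j)..2 ^ Suc j}"]) (auto simp: B_def)
  have cardB: "card (B j) = 2 * 2 ^ j" for j
  proof -
    have "B j = {2 ^ j..<2 ^ Suc j} \<union> {- (2 ^ Suc j)<..- (2 ^ j)}"
      by (auto simp: B_def)
    moreover have "{2 ^ j..<2 ^ Suc j} \<inter> {- (2 ^ Suc j)<..- (2 ^ j) :: int} = {}"
    proof -
      have "(0::int) < 2 ^ j" by simp
      then show ?thesis by auto
    qed
    ultimately have "card (B j) = card {2 ^ j..<2 ^ Suc j :: int} + card {- (2 ^ Suc j)<..- (2 ^ j) :: int}"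
      by (simp add: card_Un_disjoint)
    also have "\<dots> = nat (2 ^ j) + nat (2 ^ j)" by simp
    finally show ?thesis by (simp add: nat_power_eq)
  qed
  define K where "K = C * real p powr (3/4) * 2"
  have block: "(\<Sum>k\<in>B j. cmod (c k)) \<le> K * r ^ j" for j
  proof -
    define h where "h = real p / (4 * 2 ^ j)"
    have "real p * 1 \<le> real p * (4 * 2 ^ j)"
      by (intro mult_left_mono) (auto intro: order_trans[of 1 "2 ^ j :: real"])
    then have h: "0 < h" "h \<le> real p" using p by (auto simp: h_def field_simps)
    define g where "g x = f (x + h) - f x" for x
    have contg: "continuous_on {0..real p} g"
      unfolding g_def
      by (intro continuous_intros continuous_on_subset[OF cont] continuous_on_compose2[OF cont]) auto
    have ge: "1 \<le> cmod (fexp p k h - 1)" if "k \<in> B j" for k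
    proof (rule cmod_fexp_minus_1_ge)
      have "real_of_int (2 ^ j) \<le> real_of_int \<bar>k\<bar>" "real_of_int \<bar>k\<bar> \<le> real_of_int (2 * 2 ^ j)"
        using that unfolding of_int_le_iff by (auto simp: B_def)
      then have k: "2 ^ j \<le> \<bar>real_of_int k\<bar>" "\<bar>real_of_int k\<bar> \<le> 2 * 2 ^ j" by simp_all
      have *: "\<bar>real_of_int k\<bar> * h * 4 / real p = \<bar>real_of_int k\<bar> / 2 ^ j"
        using p by (simp add: h_def)
      show "1 \<le> \<bar>real_of_int k\<bar> * h * 4 / real p" "\<bar>real_of_int k\<bar> * h * 4 / real p \<le> 2"
        unfolding * using k by (simp_all add: field_simps)
    qed
    have "(\<Sum>k\<in>B j. (cmod (c k))\<^sup>2) \<le> (\<Sum>k\<in>B j. (cmod (fcoef p g k))\<^sup>2)"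
    proof (rule sum_mono, rule power_mono)
      fix k assume "k \<in> B j"
      have "fcoef p g k = (fexp p k h - 1) * c k"
        using fcoef_shift_diff[OF p cont per, of h k] h by (simp add: g_def[abs_def] c_def)
      then have "cmod (fcoef p g k) = cmod (fexp p k h - 1) * cmod (c k)" by (simp add: norm_mult)
      then show "cmod (c k) \<le> cmod (fcoef p g k)"
        using mult_right_mono[OF ge[OF \<open>k \<in> B j\<close>], of "cmod (c k)"] by simp
    qed simp
    also have "\<dots> \<le> integral {0..real p} (\<lambda>x. (cmod (g x))\<^sup>2) / real p"
      by (rule bessel_inequality[OF p contg finB])
    also have "\<dots> \<le> integral {0..real p} (\<lambda>x. (C * h powr (3/4))\<^sup>2) / real p"
      using contg holder[of h] h
      by (intro divide_right_mono integral_le power_mono)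
         (auto simp: g_def[symmetric] intro!: integrable_continuous_interval continuous_intros)
    also have "\<dots> = (C * h powr (3/4))\<^sup>2" using p by simp
    finally have sq: "(\<Sum>k\<in>B j. (cmod (c k))\<^sup>2) \<le> (C * h powr (3/4))\<^sup>2" .
    have "(\<Sum>k\<in>B j. cmod (c k))\<^sup>2 \<le> (\<Sum>k\<in>B j. (cmod (c k))\<^sup>2) * card (B j)"
      using Cauchy_Schwarz_ineq_sum[of "\<lambda>k. cmod (c k)" "\<lambda>_. 1" "B j"] by simp
    also have "\<dots> \<le> (C * h powr (3/4))\<^sup>2 * (2 * 2 ^ j)"
      using mult_right_mono[OF sq, of "card (B j)"] by (simp add: cardB)
    also have "\<dots> \<le> (K * r ^ j)\<^sup>2"
    proof -
      have "h powr (3/4) \<le> real p powr (3/4) * (2 powr real j) powr (- 3/4)"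
      proof -
        have "h \<le> real p * 2 powr (- real j)"
          using p by (simp add: h_def powr_minus powr_realpow field_simps)
        then have "h powr (3/4) \<le> (real p * 2 powr (- real j)) powr (3/4)"
          using h by (intro powr_mono2) auto
        also have "\<dots> = real p powr (3/4) * (2 powr real j) powr (- 3/4)"
          by (simp add: powr_mult powr_powr)
        finally show ?thesis .
      qed
      then have "C * h powr (3/4) \<le> K / 2 * (2 powr real j) powr (- 3/4)"
        using mult_left_mono[OF _ C0] by (fastforce simp: K_def mult_ac)
      then have "(C * h powr (3/4))\<^sup>2 * (2 * 2 ^ j) \<le> (K / 2 * (2 powr real j) powr (- 3/4))\<^sup>2 * (2 * 2 ^ j)"
        using C0 by (intro mult_right_mono power_mono) auto
      also have "\<dots> = K\<^sup>2 / 2 * (((2 powr real j) powr (- 3/4))\<^sup>2 * 2 powr real j)"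
        by (simp add: power_mult_distrib powr_realpow power2_eq_square)
      also have "((2 powr real j) powr (- 3/4))\<^sup>2 * 2 powr real j = (r ^ j)\<^sup>2"
        unfolding power2_eq_square r_def
        by (simp flip: powr_realpow add: powr_powr powr_add[symmetric])
      also have "K\<^sup>2 / 2 * (r ^ j)\<^sup>2 \<le> (K * r ^ j)\<^sup>2"
        by (simp add: power_mult_distrib)
      finally show ?thesis .
    qed
    finally show ?thesis
      by (rule power2_le_imp_le) (use C0 r in \<open>auto simp: K_def\<close>)
  qed
  have upto: "(\<Sum>k\<in>{- (2 ^ n)<..<2 ^ n}. cmod (c k)) \<le> cmod (c 0) + (\<Sum>j<n. K * r ^ j)" for n :: nat
  proof (induction n)
    case 0
    have "{- 1<..<1 :: int} = {0}" by auto
    then show ?case by simp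
  next
    case (Suc n)
    have "{- (2 ^ Suc n)<..<2 ^ Suc n :: int} = {- (2 ^ n)<..<2 ^ n} \<union> B n"
      by (auto simp: B_def)
    moreover have "{- (2 ^ n)<..<2 ^ n} \<inter> B n = {}" by (auto simp: B_def)
    ultimately have "(\<Sum>k\<in>{- (2 ^ Suc n)<..<2 ^ Suc n}. cmod (c k))
       = (\<Sum>k\<in>{- (2 ^ n)<..<2 ^ n}. cmod (c k)) + (\<Sum>k\<in>B n. cmod (c k))"
      using finB by (simp add: sum.union_disjoint)
    then show ?case using Suc block[of n] by simp
  qed
  have geo: "(\<Sum>j<n. K * r ^ j) \<le> K * (1 / (1 - r))" for n
  proof -
    have "(\<Sum>j<n. r ^ j) \<le> (\<Sum>j. r ^ j)"
      using r by (intro sum_le_suminf summable_geometric) auto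
    also have "\<dots> = 1 / (1 - r)" using r by (simp add: suminf_geometric)
    finally have "K * (\<Sum>j<n. r ^ j) \<le> K * (1 / (1 - r))"
      using C0 by (intro mult_left_mono) (auto simp: K_def)
    then show ?thesis by (simp add: sum_distrib_left)
  qed
  have "sum (\<lambda>k. cmod (c k)) F \<le> cmod (c 0) + K * (1 / (1 - r))" if "finite F" for F
  proof -
    define m where "m = Max (insert 0 ((\<lambda>k. nat \<bar>k\<bar>) ` F))"
    have "\<bar>k\<bar> < 2 ^ m" if "k \<in> F" for k
    proof -
      have "nat \<bar>k\<bar> \<le> m" unfolding m_def using that \<open>finite F\<close> by (intro Max_ge) auto
      also have "m < 2 ^ m" by (rule less_exp)
      finally show ?thesis by (simp add: nat_less_iff)
    qed
    then have "F \<subseteq> {- (2 ^ m)<..<2 ^ m}" by force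
    then have "sum (\<lambda>k. cmod (c k)) F \<le> (\<Sum>k\<in>{- (2 ^ m)<..<2 ^ m}. cmod (c k))"
      by (intro sum_mono2) auto
    also have "\<dots> \<le> cmod (c 0) + K * (1 / (1 - r))"
      using upto[of m] geo[of m] by linarith
    finally show ?thesis .
  qed
  then have "bdd_above (sum (\<lambda>k. cmod (c k)) ` {F. F \<subseteq> UNIV \<and> finite F})"
    by (intro bdd_aboveI) auto
  then show ?thesis
    unfolding c_def[symmetric] by (intro nonneg_bdd_above_summable_on) auto
qed

section \<open>Uniqueness of Fourier coefficients and the sum of the series\<close>

lemma periodic_int_shift:
  fixes f :: "real \<Rightarrow> 'a" and P :: real
  assumes "\<And>x. f (x + P) = f x"
  shows "f (x + of_int m * P) = f x"
proof (induction m rule: int_induct[of _ 0])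
  case (step1 i)
  then show ?case using assms[of "x + of_int i * P"] by (simp add: algebra_simps)
next
  case (step2 i)
  then show ?case using assms[of "x + of_int (i - 1) * P"] by (simp add: algebra_simps)
qed simp

lemma periodic_reduce:
  fixes x P :: real
  assumes "P > 0"
  obtains m :: int where "x - of_int m * P \<in> {0..P}"
proof
  show "x - of_int \<lfloor>x / P\<rfloor> * P \<in> {0..P}"
    using floor_divide_lower[OF assms, of x] floor_divide_upper[OF assms, of x]
    by (auto simp: algebra_simps)
qed

text \<open>Moves \<open>D\<close> to the unit circle, where Stone-Weierstrass is available.
  Continuity at the cut of \<open>Arg2pi\<close> is obtained by reading \<open>D\<close> as a loop:
  the passage from homotopic loops to homotopic circle maps, applied to the constant homotopy,
  provides a continuous map.\<close>

lemma periodic_circle_map: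
  fixes D :: "real \<Rightarrow> complex"
  assumes p: "p > 0" and cont: "continuous_on UNIV D" and per: "\<And>x. D (x + real p) = D x"
  obtains F where "continuous_on (sphere 0 1) F" "\<And>x. x \<in> {0..real p} \<Longrightarrow> F (fexp p 1 x) = D x"
proof -
  define l where "l t = D (real p * t)" for t
  have "path l"
    unfolding path_def l_def by (rule continuous_on_compose2[OF cont]) (auto intro!: continuous_intros)
  moreover have "pathfinish l = pathstart l"
    using per[of 0] by (simp add: pathfinish_def pathstart_def l_def)
  ultimately have "homotopic_loops UNIV l l" by (simp add: homotopic_loops_refl)
  then have "homotopic_with_canon (\<lambda>h. True) (sphere 0 1) UNIV
      (l \<circ> (\<lambda>z. Arg2pi z / (2 * pi))) (l \<circ> (\<lambda>z. Arg2pi z / (2 * pi)))"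
    by (rule homotopic_loops_imp_homotopic_circlemaps)
  then have *: "continuous_on (sphere 0 1) (l \<circ> (\<lambda>z. Arg2pi z / (2 * pi)))"
    by (rule homotopic_with_imp_continuous[THEN conjunct1])
  have "(l \<circ> (\<lambda>z. Arg2pi z / (2 * pi))) (fexp p 1 x) = D x" if x: "x \<in> {0..real p}" for x
  proof (cases "x = real p")
    case True
    then have "fexp p 1 x = 1" using fexp_period[OF p, of 1 0] by simp
    moreover have "Arg2pi 1 = 0" by (simp add: Arg2pi_eq_0)
    ultimately show ?thesis using True per[of 0] by (simp add: l_def)
  next
    case False
    have "Arg2pi (fexp p 1 x) = 2 * pi * x / real p"
    proof (rule Arg2pi_unique[of 1])
      show "complex_of_real 1 * exp (\<i> * complex_of_real (2 * pi * x / real p)) = fexp p 1 x"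
        by (simp add: fexp_def mult_ac)
      show "2 * pi * x / real p < 2 * pi" using x False p by (simp add: field_simps)
    qed (use x in auto)
    then show ?thesis using p by (simp add: l_def)
  qed
  then show ?thesis using * that by blast
qed

text \<open>On the circle a real-linear functional is a combination of the characters of index 1 and
  -1, so real polynomials in \<open>fexp p 1 x\<close> are trigonometric polynomials, to which
  \<open>D\<close> is orthogonal.\<close>

lemma integral_mult_trig_polynomial_eq_0:
  fixes D :: "real \<Rightarrow> complex" and g :: "complex \<Rightarrow> real"
  assumes p: "p > 0" and cont: "continuous_on {0..real p} D" and zero: "\<And>k. fcoef p D k = 0"
    and g: "real_polynomial_function g"
  shows "integral {0..real p} (\<lambda>x. D x * of_real (g (fexp p 1 x))) = 0"
    and "continuous_on {0..real p} (\<lambda>x. complex_of_real (g (fexp p 1 x)))"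
proof -
  define N where "N = {u. continuous_on {0..real p} u \<and>
     (\<forall>k. integral {0..real p} (\<lambda>x. D x * u x * fexp p k x) = 0)}"
  \<comment> \<open>\<open>N\<close> consists of the factors that keep \<open>D\<close> orthogonal
    to all characters, \<open>R\<close> of the multipliers of \<open>N\<close>. Inducting on
    membership in \<open>R\<close> instead of \<open>N\<close> makes the product case
    immediate.\<close>
  define R where "R = {h. continuous_on {0..real p} h \<and> (\<forall>u\<in>N. (\<lambda>x. u x * h x) \<in> N)}"
  have add: "(\<lambda>x. h1 x + h2 x) \<in> N" if "h1 \<in> N" "h2 \<in> N" for h1 h2
  proof -
    have "integral {0..real p} (\<lambda>x. D x * (h1 x + h2 x) * fexp p k x)
      = integral {0..real p} (\<lambda>x. D x * h1 x * fexp p k x) + integral {0..real p} (\<lambda>x. D x * h2 x * fexp p k x)" for k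
      unfolding ring_distribs using that cont
      by (intro integral_add) (auto simp: N_def intro!: integrable_continuous_interval continuous_intros)
    then show ?thesis using that by (auto simp: N_def intro!: continuous_intros)
  qed
  have cmul: "(\<lambda>x. u x * c) \<in> N" if "u \<in> N" for u c
  proof -
    have "integral {0..real p} (\<lambda>x. D x * (u x * c) * fexp p k x)
       = c * integral {0..real p} (\<lambda>x. D x * u x * fexp p k x)" for k
      by (subst integral_mult_right[symmetric]) (simp add: mult_ac)
    then show ?thesis using that by (auto simp: N_def intro!: continuous_intros)
  qed
  have fe: "(\<lambda>x. u x * fexp p l x) \<in> N" if "u \<in> N" for u l
  proof -
    have "integral {0..real p} (\<lambda>x. D x * (u x * fexp p l x) * fexp p k x)
       = integral {0..real p} (\<lambda>x. D x * u x * fexp p (l + k) x)" for k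
      by (simp add: fexp_add mult_ac)
    then show ?thesis using that by (auto simp: N_def intro!: continuous_intros)
  qed
  have one: "(\<lambda>x. 1) \<in> N"
  proof -
    have "integral {0..real p} (\<lambda>x. D x * fexp p k x) = 0" for k
      using zero[of "- k"] p by (simp add: fcoef_def)
    then show ?thesis by (simp add: N_def)
  qed
  have "(\<lambda>x. of_real (g (fexp p 1 x))) \<in> R"
    using g
  proof (induction rule: real_polynomial_function.induct)
    case (linear f)
    \<comment> \<open>These coefficients come from \<open>Re z = (z + cnj z) / 2\<close> and
      \<open>Im z = (z - cnj z) / (2 * \<i>)\<close>.\<close>
    define a b where "a = complex_of_real (f 1) / 2 + of_real (f \<i>) / (2 * \<i>)"
      and "b = complex_of_real (f 1) / 2 - of_real (f \<i>) / (2 * \<i>)"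
    have eq: "complex_of_real (f (fexp p 1 x)) = fexp p 1 x * a + fexp p (- 1) x * b" for x
    proof -
      define z where "z = fexp p 1 x"
      interpret bl: bounded_linear f by (rule linear.hyps)
      have "z = Re z *\<^sub>R 1 + Im z *\<^sub>R \<i>" by (simp add: complex_eq_iff)
      then have "f z = f (Re z *\<^sub>R 1 + Im z *\<^sub>R \<i>)" by (rule arg_cong)
      also have "\<dots> = Re z * f 1 + Im z * f \<i>"
        by (simp only: bl.add bl.scaleR real_scaleR_def)
      finally have "f z = Re z * f 1 + Im z * f \<i>" .
      moreover have "of_real (Re z) = (z + cnj z) / 2" "of_real (Im z) = (z - cnj z) / (2 * \<i>)"
        by (simp_all add: complex_eq_iff)
      ultimately have "complex_of_real (f z) = (z + cnj z) / 2 * of_real (f 1) + (z - cnj z) / (2 * \<i>) * of_real (f \<i>)"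
        by simp
      also have "\<dots> = z * (of_real (f 1) / 2 + of_real (f \<i>) / (2 * \<i>)) + cnj z * (of_real (f 1) / 2 - of_real (f \<i>) / (2 * \<i>))"
        by (simp add: field_simps)
      finally show ?thesis by (simp add: z_def cnj_fexp a_def b_def)
    qed
    show ?case
      unfolding R_def mem_Collect_eq
    proof (intro conjI ballI)
      show "continuous_on {0..real p} (\<lambda>x. complex_of_real (f (fexp p 1 x)))"
        unfolding eq by (intro continuous_intros)
      fix u assume u: "u \<in> N"
      show "(\<lambda>x. u x * complex_of_real (f (fexp p 1 x))) \<in> N"
        using add[OF cmul[OF fe[OF u, of 1]] cmul[OF fe[OF u, of "-1"]]]
        by (simp only: eq distrib_left mult.assoc)
    qed
  next
    case (const c)
    then show ?case using cmul by (auto simp: R_def)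
  next
    case (add f g)
    then show ?case using \<open>\<And>h1 h2. h1 \<in> N \<Longrightarrow> h2 \<in> N \<Longrightarrow> (\<lambda>x. h1 x + h2 x) \<in> N\<close>
      by (auto simp: R_def distrib_left intro!: continuous_intros)
  next
    case (mult f g)
    then show ?case by (auto simp: R_def mult.assoc[symmetric] intro!: continuous_intros)
  qed
  then have R: "(\<lambda>x. of_real (g (fexp p 1 x))) \<in> R" .
  then have "(\<lambda>x. 1 * of_real (g (fexp p 1 x))) \<in> N"
    using one unfolding R_def by auto
  then have "\<forall>k. integral {0..real p} (\<lambda>x. D x * (1 * of_real (g (fexp p 1 x))) * fexp p k x) = 0"
    unfolding N_def by blast
  from this[rule_format, of 0] show "integral {0..real p} (\<lambda>x. D x * of_real (g (fexp p 1 x))) = 0"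
    by simp
  show "continuous_on {0..real p} (\<lambda>x. complex_of_real (g (fexp p 1 x)))"
    using R by (simp add: R_def)
qed

text \<open>For a trigonometric polynomial \<open>h\<close> uniformly e-close to \<open>D\<close>,
  the integral of \<open>|D|^2\<close> equals that of \<open>D * cnj (D - h)\<close> and is at most
  \<open>e\<close> times the integral of \<open>|D|\<close>. Letting \<open>e\<close> tend to 0
  gives a vanishing integral of a continuous nonnegative function.\<close>

lemma fcoef_eq_0_imp_eq_0:
  fixes D :: "real \<Rightarrow> complex"
  assumes p: "p > 0" and cont: "continuous_on UNIV D" and per: "\<And>x. D (x + real p) = D x"
    and zero: "\<And>k. fcoef p D k = 0"
  shows "D x = 0"
proof -
  obtain F where F: "continuous_on (sphere 0 1) F" "\<And>x. x \<in> {0..real p} \<Longrightarrow> F (fexp p 1 x) = D x"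
    using periodic_circle_map[OF p cont per] by blast
  have contD: "continuous_on {0..real p} D"
    using cont by (rule continuous_on_subset) simp
  define A where "A = integral {0..real p} (\<lambda>x. cmod (D x))"
  define J where "J = integral {0..real p} (\<lambda>x. (cmod (D x))\<^sup>2)"
  have A0: "A \<ge> 0" unfolding A_def
    by (rule integral_nonneg) (auto intro!: integrable_continuous_interval continuous_intros contD)
  have J0: "J \<ge> 0" unfolding J_def
    by (rule integral_nonneg) (auto intro!: integrable_continuous_interval continuous_intros contD)
  have le: "J \<le> e * A" if "e > 0" for e
  proof -
    obtain g where g: "polynomial_function g" "\<And>z. z \<in> sphere 0 1 \<Longrightarrow> cmod (F z - g z) < e"
      using Stone_Weierstrass_polynomial_function[OF compact_sphere F(1) \<open>e > 0\<close>] by blast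
    define h where "h x = g (fexp p 1 x)" for x
    have near: "cmod (D x - h x) \<le> e" if "x \<in> {0..real p}" for x
      using g(2)[of "fexp p 1 x"] F(2)[OF that] by (simp add: h_def)
    have poly: "real_polynomial_function (\<lambda>z. Re (g z))" "real_polynomial_function (\<lambda>z. Im (g z))"
      using g(1) bounded_linear_Re bounded_linear_Im unfolding polynomial_function_def o_def by blast+
    note pr = integral_mult_trig_polynomial_eq_0[OF p contD zero poly(1)]
    note pi = integral_mult_trig_polynomial_eq_0[OF p contD zero poly(2)]
    have hc: "cnj (h x) = of_real (Re (g (fexp p 1 x))) - \<i> * of_real (Im (g (fexp p 1 x)))" for x
      by (simp add: h_def complex_eq_iff)
    have conth: "continuous_on {0..real p} (\<lambda>x. cnj (h x))"
      unfolding hc by (intro continuous_intros pr(2) pi(2))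
    have "integral {0..real p} (\<lambda>x. D x * cnj (h x))
       = integral {0..real p} (\<lambda>x. D x * of_real (Re (g (fexp p 1 x))) - \<i> * (D x * of_real (Im (g (fexp p 1 x)))))"
      unfolding hc by (simp add: algebra_simps)
    also have "\<dots> = integral {0..real p} (\<lambda>x. D x * of_real (Re (g (fexp p 1 x))))
        - integral {0..real p} (\<lambda>x. \<i> * (D x * of_real (Im (g (fexp p 1 x)))))"
      by (rule integral_diff) (intro integrable_continuous_interval continuous_intros contD pr(2) pi(2))+
    also have "\<dots> = 0" using pr(1) pi(1) by simp
    finally have z: "integral {0..real p} (\<lambda>x. D x * cnj (h x)) = 0" .
    have "complex_of_real J = integral {0..real p} (\<lambda>x. of_real ((cmod (D x))\<^sup>2))"
      unfolding J_def
      by (intro integral_linear[OF _ bounded_linear_of_real, unfolded o_def, symmetric]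
          integrable_continuous_interval continuous_intros contD)
    also have "\<dots> = integral {0..real p} (\<lambda>x. D x * cnj (D x))"
      by (rule integral_cong) (simp only: complex_norm_square)
    also have "\<dots> = integral {0..real p} (\<lambda>x. D x * cnj (D x)) - integral {0..real p} (\<lambda>x. D x * cnj (h x))"
      by (simp add: z)
    also have "\<dots> = integral {0..real p} (\<lambda>x. D x * cnj (D x) - D x * cnj (h x))"
      by (rule integral_diff[symmetric]) (intro integrable_continuous_interval continuous_intros contD conth)+
    also have "cmod \<dots> \<le> integral {0..real p} (\<lambda>x. e * cmod (D x))"
    proof (rule integral_norm_bound_integral)
      fix x assume x: "x \<in> {0..real p}"
      have "cmod (D x * cnj (D x) - D x * cnj (h x)) = cmod (D x) * cmod (D x - h x)"
        by (metis complex_cnj_diff complex_mod_cnj norm_mult right_diff_distrib)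
      also have "\<dots> \<le> cmod (D x) * e" by (intro mult_left_mono near x) simp
      finally show "cmod (D x * cnj (D x) - D x * cnj (h x)) \<le> e * cmod (D x)" by (simp add: mult.commute)
    qed (intro integrable_continuous_interval continuous_intros contD conth)+
    also have "\<dots> = e * A" by (simp add: A_def)
    finally show ?thesis using J0 by simp
  qed
  have "J \<le> 0"
  proof (rule field_le_epsilon)
    fix e :: real assume "e > 0"
    have "J \<le> e / (A + 1) * A" using A0 \<open>e > 0\<close> by (intro le) auto
    also have "\<dots> \<le> e" using A0 \<open>e > 0\<close> by (simp add: field_simps)
    finally show "J \<le> 0 + e" by simp
  qed
  then have "J = 0" using J0 by simp
  have zero_on: "D x = 0" if "x \<in> {0..real p}" for x
  proof -
    have "continuous_on {0..real p} (\<lambda>x. (cmod (D x))\<^sup>2)"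
      by (intro continuous_intros contD)
    then have "\<forall>x\<in>{0..real p}. (cmod (D x))\<^sup>2 = 0"
      using integral_eq_0_iff[of 0 "real p" "\<lambda>x. (cmod (D x))\<^sup>2"] p \<open>J = 0\<close> by (simp add: J_def)
    then show ?thesis using that by simp
  qed
  obtain m :: int where "x - of_int m * real p \<in> {0..real p}"
    using periodic_reduce[of "real p" x] p by auto
  then have "D (x - of_int m * real p) = 0" by (rule zero_on)
  then show ?thesis using periodic_int_shift[of D "real p" x "- m"] per by simp
qed

text \<open>Summability makes the series converge uniformly to a continuous \<open>S\<close>.
  Integrating term by term shows that \<open>S\<close> has the coefficients of \<open>f\<close>, and
  uniqueness gives \<open>S = f\<close>.\<close>

lemma fourier_series_uniform_limit:
  fixes f :: "real \<Rightarrow> complex"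
  assumes p: "p > 0" and cont: "continuous_on UNIV f" and per: "\<And>x. f (x + real p) = f x"
    and summ: "(\<lambda>k. cmod (fcoef p f k)) summable_on UNIV"
  shows "uniform_limit UNIV (\<lambda>K x. \<Sum>k\<in>K. fcoef p f k * fexp p k x) f (finite_subsets_at_top UNIV)"
proof -
  define c where "c = fcoef p f"
  define S where "S x = (\<Sum>\<^sub>\<infinity>k. c k * fexp p k x)" for x
  have lim: "uniform_limit UNIV (\<lambda>K x. \<Sum>k\<in>K. c k * fexp p k x) S (finite_subsets_at_top UNIV)"
    unfolding S_def
    by (rule Weierstrass_m_test_general[where M = "\<lambda>k. cmod (c k)"])
       (use summ in \<open>auto simp: norm_mult c_def\<close>)
  have contS: "continuous_on UNIV S"
    by (rule uniform_limit_theorem[OF _ lim])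
       (auto intro!: always_eventually continuous_intros)
  have perS: "S (x + real p) = S x" for x
    by (simp add: S_def fexp_period[OF p])
  have coefS: "fcoef p S l = c l" for l
  proof -
    let ?F = "finite_subsets_at_top (UNIV :: int set)"
    have "uniform_limit {0..real p} (\<lambda>K x. (\<Sum>k\<in>K. c k * fexp p k x) * fexp p (- l) x)
       (\<lambda>x. S x * fexp p (- l) x) ?F"
    proof (rule uniform_lim_mult[OF uniform_limit_on_subset[OF lim] uniform_limit_const])
      show "bounded (S ` {0..real p})"
        by (intro compact_imp_bounded compact_continuous_image continuous_on_subset[OF contS]) auto
      show "bounded (fexp p (- l) ` {0..real p})"
        by (auto simp: bounded_iff intro!: exI[of _ 1])
    qed simp
    then obtain I J where IJ: "\<And>K. ((\<lambda>x. (\<Sum>k\<in>K. c k * fexp p k x) * fexp p (- l) x) has_integral I K) {0..real p}"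
      "((\<lambda>x. S x * fexp p (- l) x) has_integral J) {0..real p}" "(I \<longlongrightarrow> J) ?F"
      by (rule uniform_limit_integral)
         (auto intro!: always_eventually continuous_intros)
    have "I K = (if l \<in> K then of_nat p * c l else 0)" if "finite K" for K
    proof -
      have "I K = integral {0..real p} (\<lambda>x. \<Sum>k\<in>K. c k * (fexp p k x * fexp p (- l) x))"
        using integral_unique[OF IJ(1)[of K]] by (simp add: sum_distrib_right mult.assoc)
      also have "\<dots> = (\<Sum>k\<in>K. c k * (if k = l then of_nat p else 0))"
        using that p
        by (subst integral_sum)
           (auto simp: integral_fexp_mult intro!: integrable_continuous_interval continuous_intros)
      also have "\<dots> = (if l \<in> K then of_nat p * c l else 0)"
        using that by (simp add: if_distrib cong: if_cong)
      finally show ?thesis .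
    qed
    moreover have "\<forall>\<^sub>F K in ?F. finite K \<and> l \<in> K"
      by (auto simp: eventually_finite_subsets_at_top intro!: exI[of _ "{l}"])
    ultimately have "\<forall>\<^sub>F K in ?F. I K = of_nat p * c l"
      by (auto elim!: eventually_mono)
    then have "(I \<longlongrightarrow> of_nat p * c l) ?F" by (rule tendsto_eventually)
    then have "J = of_nat p * c l"
      using IJ(3) by (intro tendsto_unique[OF _ IJ(3)]) auto
    then show ?thesis using p integral_unique[OF IJ(2)] by (simp add: fcoef_def)
  qed
  have "f x - S x = 0" for x
  proof (rule fcoef_eq_0_imp_eq_0[OF p])
    show "continuous_on UNIV (\<lambda>x. f x - S x)" by (intro continuous_intros cont contS)
    show "f (x + real p) - S (x + real p) = f x - S x" for x by (simp add: per perS)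
    fix k
    have "integral {0..real p} (\<lambda>x. (f x - S x) * fexp p (- k) x)
      = integral {0..real p} (\<lambda>x. f x * fexp p (- k) x) - integral {0..real p} (\<lambda>x. S x * fexp p (- k) x)"
      unfolding left_diff_distrib
      by (rule integral_diff)
         (intro integrable_continuous_interval continuous_intros continuous_on_subset[OF cont] continuous_on_subset[OF contS]; simp)+
    then show "fcoef p (\<lambda>x. f x - S x) k = 0"
      using coefS[of k] by (auto simp: fcoef_def c_def right_diff_distrib)
  qed
  then have "S = f" by (auto simp: fun_eq_iff)
  then show ?thesis using lim by (simp add: c_def)
qed

section \<open>Digit recursion for the sums over shells\<close>

definition level :: "nat \<Rightarrow> (nat ^ 'd :: finite) set" where
  "level N = {n. max_norm n = N}"

definition vdiv :: "nat \<Rightarrow> nat ^ 'd \<Rightarrow> nat ^ 'd" where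
  "vdiv q n = (\<chi> i. n $ i div q)"

definition level_sum :: "nat \<Rightarrow> ('s :: finite, 'd :: finite) transducer \<Rightarrow> nat \<Rightarrow> complex ^ 's" where
  "level_sum q T N = (\<chi> s. \<Sum>n\<in>level N. of_real (b_vec q T n $ s))"

text \<open>Equals \<open>- \<i>\<close> times M'(0) applied to the all-ones vector; in this role it
  reappears in the derivative of the spectral projection.\<close>

definition out_vec :: "nat \<Rightarrow> ('s :: finite, 'd :: finite) transducer \<Rightarrow> complex ^ 's" where
  "out_vec q T = (\<chi> s. \<Sum>\<epsilon>\<in>letters q. of_real (trans_out T s \<epsilon>))"

lemma max_norm_less_iff: "max_norm n < N \<longleftrightarrow> (\<forall>i. n $ i < N)" for n :: "nat ^ 'd :: finite"
  unfolding max_norm_def by (subst Max_less_iff) auto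

lemma letters_altdef: "letters q = {n :: nat ^ 'd :: finite. max_norm n < q}"
  by (simp add: letters_def max_norm_less_iff)

lemma max_norm_eq_0_iff [simp]: "max_norm n = 0 \<longleftrightarrow> n = 0" for n :: "nat ^ 'd :: finite"
  using max_norm_less_iff[of n 1] by (simp add: vec_eq_iff)

lemma max_norm_0 [simp]: "max_norm (0 :: nat ^ 'd :: finite) = 0"
  by simp

lemma card_letters: "card (letters q :: (nat ^ 'd :: finite) set) = q ^ CARD('d)"
  and finite_letters: "finite (letters q :: (nat ^ 'd) set)"
proof -
  have bij: "bij_betw vec_lambda (UNIV \<rightarrow>\<^sub>E {..<q}) (letters q :: (nat ^ 'd) set)"
    by (rule bij_betw_byWitness[where f' = vec_nth]) (auto simp: letters_def)
  show "card (letters q :: (nat ^ 'd) set) = q ^ CARD('d)"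
    using bij_betw_same_card[OF bij] by (simp add: card_funcsetE)
  show "finite (letters q :: (nat ^ 'd) set)"
    using bij_betw_finite[OF bij] by (simp add: finite_PiE)
qed

lemma level_eq_Diff: "level N = letters (Suc N) - (letters N :: (nat ^ 'd :: finite) set)"
  by (auto simp: level_def letters_altdef)

lemma finite_level [simp]: "finite (level N :: (nat ^ 'd :: finite) set)"
  by (simp add: level_eq_Diff finite_letters)

lemma card_level: "card (level N :: (nat ^ 'd :: finite) set) = Suc N ^ CARD('d) - N ^ CARD('d)"
  unfolding level_eq_Diff
proof -
  have "letters N \<subseteq> (letters (Suc N) :: (nat ^ 'd) set)" by (auto simp: letters_altdef)
  then show "card (letters (Suc N) - letters N :: (nat ^ 'd) set) = Suc N ^ CARD('d) - N ^ CARD('d)"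
    by (simp add: card_Diff_subset finite_letters card_letters)
qed

lemma letters_eq_UN: "letters N = (\<Union>K<N. level K :: (nat ^ 'd :: finite) set)"
  by (auto simp: letters_altdef level_def)

lemma sum_letters_level:
  "(\<Sum>n\<in>letters N. f n) = (\<Sum>K<N. \<Sum>n\<in>level K. f n)" for f :: "nat ^ 'd :: finite \<Rightarrow> 'b :: comm_monoid_add"
  unfolding letters_eq_UN
proof (rule sum.UNION_disjoint)
  show "\<forall>K\<in>{..<N}. \<forall>K'\<in>{..<N}. K \<noteq> K' \<longrightarrow> level K \<inter> level K' = {}" by (auto simp: level_def)
qed auto

lemma max_norm_vdiv:
  fixes n :: "nat ^ 'd :: finite"
  assumes "q > 0"
  shows "max_norm (vdiv q n) = max_norm n div q"
proof -
  have iff: "max_norm (vdiv q n) < N \<longleftrightarrow> max_norm n div q < N" for N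
    using assms by (simp add: max_norm_less_iff vdiv_def div_less_iff_less_mult)
  from iff[of "max_norm (vdiv q n)"] iff[of "max_norm n div q"] show ?thesis by simp
qed

lemma joint_expansion_0: "joint_expansion q (0 :: nat ^ 'd :: finite) = []"
  by (simp add: joint_expansion_def)

text \<open>For \<open>n \<noteq> 0\<close> the minimal length is positive, and a coordinate is
  below \<open>q ^ Suc L\<close> iff its quotient by \<open>q\<close> is below \<open>q ^ L\<close>;
  so removing the lowest digit shortens the expansion by exactly one.\<close>

lemma joint_expansion_rec:
  fixes n :: "nat ^ 'd :: finite"
  assumes "q \<ge> 2" "n \<noteq> 0"
  shows "joint_expansion q n = digit q n 0 # joint_expansion q (vdiv q n)"
proof -
  \<comment> \<open>A crude length that is always sufficient, from \<open>m < 2 ^ m\<close>; it only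
    guarantees that the least length exists.\<close>
  have ex: "\<forall>i. n $ i < q ^ max_norm n"
  proof
    fix i
    have "n $ i < Suc (max_norm n)" using max_norm_less_iff[of n "Suc (max_norm n)"] by simp
    also have "Suc (max_norm n) \<le> 2 ^ max_norm n" by (simp add: Suc_leI)
    also have "\<dots> \<le> q ^ max_norm n" using assms by (intro power_mono) auto
    finally show "n $ i < q ^ max_norm n" .
  qed
  have "(LEAST L. \<forall>i. n $ i < q ^ L) = Suc (LEAST L. \<forall>i. n $ i < q ^ Suc L)"
    by (rule Least_Suc[of _ "max_norm n"]) (use ex assms in \<open>auto simp: vec_eq_iff\<close>)
  also have "(LEAST L. \<forall>i. n $ i < q ^ Suc L) = (LEAST L. \<forall>i. vdiv q n $ i < q ^ L)"
    using assms by (simp add: vdiv_def div_less_iff_less_mult mult.commute)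
  finally have L: "(LEAST L. \<forall>i. n $ i < q ^ L) = Suc (LEAST L. \<forall>i. vdiv q n $ i < q ^ L)" .
  have "digit q n (Suc k) = digit q (vdiv q n) k" for k
    by (simp add: digit_def vdiv_def div_mult2_eq)
  then show ?thesis
    unfolding joint_expansion_def L
    by (simp add: upt_conv_Cons map_Suc_upt[symmetric] del: upt_Suc)
qed

lemma b_vec_0: "b_vec q T 0 $ s = final_out T s"
  by (simp add: b_vec_def joint_expansion_0)

lemma b_vec_rec:
  assumes "q \<ge> 2" "n \<noteq> 0"
  shows "b_vec q T n $ s = trans_out T s (digit q n 0) + b_vec q T (vdiv q n) $ target T s (digit q n 0)"
  using assms by (simp add: b_vec_def joint_expansion_rec)

lemma digit_in_letters: "q > 0 \<Longrightarrow> digit q n k \<in> letters q"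
  by (simp add: digit_def letters_def)

text \<open>Each digit contributes a bounded output, and the number of digits is logarithmic in the
  norm. The estimate is proved by removing digits one at a time, uniformly in the starting
  state.\<close>

lemma b_vec_bound:
  fixes T :: "('s :: finite, 'd :: finite) transducer"
  assumes q: "q \<ge> 2"
  obtains C where "C \<ge> 0" "\<And>n s. n \<noteq> 0 \<Longrightarrow> \<bar>b_vec q T n $ s\<bar> \<le> C * (1 + ln (real (max_norm n)))"
proof -
  define B where "B = (\<Sum>s\<in>UNIV. \<bar>final_out T s\<bar>) + (\<Sum>s\<in>UNIV. \<Sum>\<epsilon>\<in>letters q. \<bar>trans_out T s \<epsilon>\<bar>)"
  have fin: "\<bar>final_out T s\<bar> \<le> B" for s
  proof -
    have "\<bar>final_out T s\<bar> \<le> (\<Sum>s\<in>UNIV. \<bar>final_out T s\<bar>)" by (rule member_le_sum) auto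
    then show ?thesis unfolding B_def by (intro add_increasing2 sum_nonneg) auto
  qed
  have tr: "\<bar>trans_out T s \<epsilon>\<bar> \<le> B" if "\<epsilon> \<in> letters q" for s \<epsilon>
  proof -
    have "\<bar>trans_out T s \<epsilon>\<bar> \<le> (\<Sum>\<epsilon>\<in>letters q. \<bar>trans_out T s \<epsilon>\<bar>)"
      using that by (intro member_le_sum) (auto simp: finite_letters)
    also have "\<dots> \<le> (\<Sum>s\<in>UNIV. \<Sum>\<epsilon>\<in>letters q. \<bar>trans_out T s \<epsilon>\<bar>)"
      by (rule member_le_sum[of s UNIV "\<lambda>s. \<Sum>\<epsilon>\<in>letters q. \<bar>trans_out T s \<epsilon>\<bar>"]) (auto intro: sum_nonneg)
    finally show ?thesis unfolding B_def by (intro add_increasing sum_nonneg) auto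
  qed
  have B0: "B \<ge> 0" using fin[of undefined] by linarith
  have lnq: "ln (real q) > 0" using q by simp
  \<comment> \<open>The 2 pays for the leading digit and for the final output; each further digit
    raises the logarithm to base \<open>q\<close> by at least 1.\<close>
  have bd: "\<bar>b_vec q T n $ s\<bar> \<le> B * (2 + ln (real (max_norm n)) / ln (real q))" if "n \<noteq> 0" for n s
    using that
  proof (induction "max_norm n" arbitrary: n s rule: less_induct)
    case less
    define t where "t = target T s (digit q n 0)"
    have "\<bar>b_vec q T n $ s\<bar> \<le> \<bar>trans_out T s (digit q n 0)\<bar> + \<bar>b_vec q T (vdiv q n) $ t\<bar>"
      using b_vec_rec[OF q less.prems, of T s] by (simp add: t_def)
    also have "\<dots> \<le> B + \<bar>b_vec q T (vdiv q n) $ t\<bar>"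
      using q by (intro add_right_mono tr digit_in_letters) auto
    finally have 1: "\<bar>b_vec q T n $ s\<bar> \<le> B + \<bar>b_vec q T (vdiv q n) $ t\<bar>" .
    have N: "max_norm n \<ge> 1" using less.prems by (metis less_one linorder_not_le max_norm_eq_0_iff)
    show ?case
    proof (cases "vdiv q n = 0")
      case True
      have "\<bar>b_vec q T n $ s\<bar> \<le> B + B" using 1 fin[of t] by (simp add: True b_vec_0)
      also have "\<dots> \<le> B * (2 + ln (real (max_norm n)) / ln (real q))"
        using B0 lnq N by (simp add: ring_distribs)
      finally show ?thesis .
    next
      case False
      define m where "m = max_norm n div q"
      have m: "max_norm (vdiv q n) = m" using q by (simp add: max_norm_vdiv m_def)
      have m1: "m \<ge> 1" using False m by (metis less_one linorder_not_le max_norm_eq_0_iff)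
      have "m < max_norm n" using N q by (simp add: m_def)
      then have "\<bar>b_vec q T (vdiv q n) $ t\<bar> \<le> B * (2 + ln (real m) / ln (real q))"
        using less.hyps[of "vdiv q n" t] False m by simp
      moreover have "ln (real m) / ln (real q) \<le> ln (real (max_norm n)) / ln (real q) - 1"
      proof -
        have "m * q \<le> max_norm n" by (simp add: m_def)
        then have "real m * real q \<le> real (max_norm n)" by (metis of_nat_le_iff of_nat_mult)
        then have "ln (real m * real q) \<le> ln (real (max_norm n))"
          using m1 q N by (subst ln_le_cancel_iff) auto
        then have "ln (real m) + ln (real q) \<le> ln (real (max_norm n))"
          using m1 q by (simp add: ln_mult)
        then show ?thesis using lnq by (simp add: field_simps)
      qed
      ultimately have "\<bar>b_vec q T n $ s\<bar> \<le> B + B * (2 + (ln (real (max_norm n)) / ln (real q) - 1))"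
        using 1 B0 by (smt (verit) mult_left_mono)
      then show ?thesis by (simp add: algebra_simps)
    qed
  qed
  define C where "C = B * (2 + 1 / ln (real q))"
  have "\<bar>b_vec q T n $ s\<bar> \<le> C * (1 + ln (real (max_norm n)))" if "n \<noteq> 0" for n s
  proof -
    have N: "max_norm n \<ge> 1" using that by (metis less_one linorder_not_le max_norm_eq_0_iff)
    then have "2 + ln (real (max_norm n)) / ln (real q) \<le> (2 + 1 / ln (real q)) * (1 + ln (real (max_norm n)))"
      using lnq by (simp add: algebra_simps)
    then have "B * (2 + ln (real (max_norm n)) / ln (real q)) \<le> C * (1 + ln (real (max_norm n)))"
      using mult_left_mono[OF _ B0] by (simp add: C_def mult.assoc)
    then show ?thesis using bd[OF that, of s] by linarith
  qed
  moreover have "C \<ge> 0" using B0 lnq by (simp add: C_def)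
  ultimately show ?thesis using that by blast
qed

lemma trans_matrix_mult_vec:
  "(trans_matrix q T t *v v) $ s
    = (\<Sum>\<epsilon>\<in>letters q. exp (\<i> * of_real (t * trans_out T s \<epsilon>)) * v $ target T s \<epsilon>)"
proof -
  have "(trans_matrix q T t *v v) $ s
      = (\<Sum>s'\<in>UNIV. (\<Sum>\<epsilon>\<in>letters q. letter_matrix T \<epsilon> t $ s $ s') * v $ s')"
    by (simp add: matrix_vector_mult_def trans_matrix_def)
  also have "\<dots> = (\<Sum>\<epsilon>\<in>letters q. \<Sum>s'\<in>UNIV. letter_matrix T \<epsilon> t $ s $ s' * v $ s')"
    by (subst sum.swap) (simp add: sum_distrib_right)
  also have "\<dots> = (\<Sum>\<epsilon>\<in>letters q. exp (\<i> * of_real (t * trans_out T s \<epsilon>)) * v $ target T s \<epsilon>)"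
    by (rule sum.cong) (auto simp: letter_matrix_def if_distrib[of "\<lambda>x. x * _"] cong: if_cong)
  finally show ?thesis .
qed

lemma vmult_q_plus_inverse:
  fixes m \<epsilon> :: "nat ^ 'd"
  assumes "q > 0" "\<epsilon> \<in> letters q"
  defines "n \<equiv> \<chi> i. q * m $ i + \<epsilon> $ i"
  shows "vdiv q n = m" "digit q n 0 = \<epsilon>"
  using assms by (auto simp: vdiv_def digit_def vec_eq_iff letters_def)

text \<open>The shells \<open>q * N + j\<close> with \<open>j < q\<close> together consist of the
  vectors whose quotient by \<open>q\<close> lies in the shell \<open>N\<close>, and these are
  parametrized by quotient and last digit. One step of the transducer produces M(0) and the outputs,
  and every output is counted once per element of the shell \<open>N\<close>.\<close>

lemma level_sum_block:
  fixes T :: "('s :: finite, 'd :: finite) transducer"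
  assumes q: "q \<ge> 2" and N: "N \<ge> 1"
  shows "(\<Sum>j<q. level_sum q T (q * N + j))
     = trans_matrix q T 0 *v level_sum q T N + of_nat (Suc N ^ CARD('d) - N ^ CARD('d)) *s out_vec q T"
proof -
  have UN: "(\<Union>j<q. level (q * N + j)) = {n :: nat ^ 'd. vdiv q n \<in> level N}"
  proof -
    have "max_norm n div q = N \<longleftrightarrow> (\<exists>j<q. max_norm n = q * N + j)" for n :: "nat ^ 'd"
      using q by (metis add.commute div_mult_self4 div_less add_0 mod_less_divisor mult_div_mod_eq
          mod_mult_div_eq not_numeral_le_zero zero_less_iff_neq_zero)
    then show ?thesis using q by (auto simp: level_def max_norm_vdiv)
  qed
  have "(\<Sum>j<q. \<Sum>n\<in>level (q * N + j). of_real (b_vec q T n $ s))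
     = (\<Sum>\<epsilon>\<in>letters q. level_sum q T N $ target T s \<epsilon>)
       + of_nat (Suc N ^ CARD('d) - N ^ CARD('d)) * (\<Sum>\<epsilon>\<in>letters q. complex_of_real (trans_out T s \<epsilon>))" for s
  proof -
    have "(\<Sum>j<q. \<Sum>n\<in>level (q * N + j). complex_of_real (b_vec q T n $ s))
       = (\<Sum>n\<in>{n :: nat ^ 'd. vdiv q n \<in> level N}. of_real (b_vec q T n $ s))"
      unfolding UN[symmetric]
    proof (rule sum.UNION_disjoint[symmetric])
      show "\<forall>K\<in>{..<q}. \<forall>K'\<in>{..<q}. K \<noteq> K' \<longrightarrow> level (q * N + K) \<inter> level (q * N + K') = {}"
        by (auto simp: level_def)
    qed auto
    also have "\<dots> = (\<Sum>n\<in>{n :: nat ^ 'd. vdiv q n \<in> level N}. of_real (trans_out T s (digit q n 0)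
          + b_vec q T (vdiv q n) $ target T s (digit q n 0)))"
    proof (rule sum.cong[OF refl])
      fix n :: "nat ^ 'd" assume "n \<in> {n. vdiv q n \<in> level N}"
      \<comment> \<open>This is where \<open>N \<ge> 1\<close> enters: the expansion of 0 is empty,
        so the digit recursion fails for the zero vector.\<close>
      then have "n \<noteq> 0" using N by (auto simp: level_def vdiv_def zero_vec_def[symmetric])
      then show "complex_of_real (b_vec q T n $ s) = of_real (trans_out T s (digit q n 0)
          + b_vec q T (vdiv q n) $ target T s (digit q n 0))"
        using b_vec_rec[OF q, of n T s] by simp
    qed
    also have "\<dots> = (\<Sum>(m, \<epsilon>)\<in>level N \<times> letters q. of_real (trans_out T s \<epsilon> + b_vec q T m $ target T s \<epsilon>))"
    proof (rule sum.reindex_bij_witness[where j = "\<lambda>n. (vdiv q n, digit q n 0)"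
          and i = "\<lambda>(m, \<epsilon>). \<chi> i. q * m $ i + \<epsilon> $ i"])
      show "(\<lambda>(m, \<epsilon>). \<chi> i. q * m $ i + \<epsilon> $ i) (vdiv q n, digit q n 0) = n" for n :: "nat ^ 'd"
        by (simp add: vdiv_def digit_def vec_eq_iff)
    qed (use q in \<open>auto simp: vmult_q_plus_inverse digit_in_letters\<close>)
    also have "\<dots> = (\<Sum>\<epsilon>\<in>letters q. \<Sum>m\<in>level N. of_real (trans_out T s \<epsilon> + b_vec q T m $ target T s \<epsilon>))"
      by (subst sum.cartesian_product[symmetric], subst sum.swap) simp
    also have "\<dots> = (\<Sum>\<epsilon>\<in>letters q. of_nat (card (level N :: (nat ^ 'd) set)) * of_real (trans_out T s \<epsilon>))
        + (\<Sum>\<epsilon>\<in>letters q. level_sum q T N $ target T s \<epsilon>)"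
      by (simp add: sum.distrib level_sum_def)
    finally show ?thesis
      by (simp only: card_level sum_distrib_left add.commute)
  qed
  then show ?thesis
    by (simp add: vec_eq_iff trans_matrix_mult_vec level_sum_def out_vec_def left_diff_distrib)
qed

lemma expected_value_eq:
  fixes T :: "('s :: finite, 'd :: finite) transducer"
  assumes "N \<ge> 1"
  shows "complex_of_real (expected_value q T N)
     = (\<Sum>K<N. level_sum q T K $ init T) / of_nat (N ^ CARD('d))"
proof -
  have ne: "(letters N :: (nat ^ 'd) set) \<noteq> {}"
    using assms by (auto simp: letters_def intro!: exI[of _ 0])
  have "expected_value q T N = (\<Sum>n\<in>letters N. transducer_value q T n) / real (card (letters N :: (nat ^ 'd) set))"
    unfolding expected_value_def letters_def[symmetric]
    by (rule integral_pmf_of_set[OF ne finite_letters])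
  then show ?thesis
    by (simp add: card_letters sum_letters_level level_sum_def transducer_value_def b_vec_def)
qed

lemma tdot_sum_right: "tdot u (\<Sum>x\<in>X. f x) = (\<Sum>x\<in>X. tdot u (f x))"
  unfolding tdot_def by (simp add: sum_distrib_left) (rule sum.swap)

lemma tdot_add_right: "tdot u (v + w) = tdot u v + tdot u w"
  by (simp add: tdot_def ring_distribs sum.distrib)

lemma tdot_add_left: "tdot (v + w) u = tdot v u + tdot w u"
  by (simp add: tdot_def ring_distribs sum.distrib)

lemma tdot_diff_left: "tdot (v - w) u = tdot v u - tdot w u"
  by (simp add: tdot_def ring_distribs sum_subtractf)

lemma tdot_scale_right: "tdot u (c *s v) = c * tdot u v"
  by (simp add: tdot_def sum_distrib_left mult_ac)

lemma tdot_scale_left: "tdot (c *s u) v = c * tdot u v"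
  by (simp add: tdot_def sum_distrib_left mult_ac)

lemma tdot_matrix: "tdot u (A *v v) = tdot (u v* A) v"
proof -
  have "(\<Sum>s\<in>UNIV. \<Sum>s'\<in>UNIV. u $ s * (A $ s $ s' * v $ s')) = (\<Sum>s'\<in>UNIV. \<Sum>s\<in>UNIV. u $ s * (A $ s $ s' * v $ s'))"
    by (rule sum.swap)
  then show ?thesis
    by (simp add: tdot_def matrix_vector_mult_def vector_matrix_mult_def sum_distrib_left sum_distrib_right mult_ac)
qed

lemma tdot_axis: "tdot (axis s 1) v = v $ s"
  by (simp add: tdot_def axis_def if_distrib[of "\<lambda>x. x * _"] cong: if_cong)

lemma tdot_level_sum_block:
  fixes T :: "('s :: finite, 'd :: finite) transducer"
  assumes "q \<ge> 2" "N \<ge> 1"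
  shows "(\<Sum>j<q. tdot u (level_sum q T (q * N + j)))
     = tdot (u v* trans_matrix q T 0) (level_sum q T N)
       + of_nat (Suc N ^ CARD('d) - N ^ CARD('d)) * tdot u (out_vec q T)"
  unfolding tdot_sum_right[symmetric] level_sum_block[OF assms]
  by (simp only: tdot_add_right tdot_matrix tdot_scale_right)

section \<open>Dirichlet series and their continuation\<close>

definition hser :: "(nat \<Rightarrow> complex) \<Rightarrow> complex \<Rightarrow> complex" where
  "hser \<alpha> z = (\<Sum>n. \<alpha> n * of_nat n powr (- z))"

text \<open>The difference between the Dirichlet series and the series in which every \<open>n\<close> is rounded down to
  a multiple of \<open>q\<close>; it converges one unit further to the left.\<close>

definition jser :: "nat \<Rightarrow> (nat \<Rightarrow> complex) \<Rightarrow> complex \<Rightarrow> complex" where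
  "jser q \<alpha> z = (\<Sum>n. \<alpha> n * (of_nat n powr (- z) - of_nat (q * (n div q)) powr (- z)))"

text \<open>The size of a shell sum: of the order of \<open>n powr (d - 1)\<close> vectors, each
  with a value of logarithmic order. The entry at index 0 is unrestricted.\<close>

definition log_growth :: "nat \<Rightarrow> (nat \<Rightarrow> complex) \<Rightarrow> bool" where
  "log_growth d \<alpha> \<longleftrightarrow> (\<exists>C\<ge>0. \<forall>n\<ge>1. cmod (\<alpha> n) \<le> C * real n powr (real d - 1) * (1 + ln (real n)))"

lemma cmod_of_nat_powr: "cmod (of_nat n powr z) = real n powr Re z"
  by (subst norm_powr_real_powr) auto

lemma cmod_of_real_powr: "x > 0 \<Longrightarrow> cmod (of_real x powr z) = x powr Re z"
  by (subst norm_powr_real_powr) auto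

lemma cmod_powr_diff_le:
  fixes a b :: real
  assumes "0 < a" "a \<le> b" "Re z \<ge> 0"
  shows "cmod (of_real a powr (- z) - of_real b powr (- z)) \<le> cmod z * a powr (- Re z - 1) * (b - a)"
proof -
  have S: "x \<in> closed_segment (complex_of_real a) (of_real b) \<Longrightarrow> \<exists>u. x = of_real u \<and> a \<le> u \<and> u \<le> b" for x
    using assms by (auto simp: closed_segment_of_real closed_segment_eq_real_ivl)
  have "cmod (of_real a powr (- z) - of_real b powr (- z)) \<le> (cmod z * a powr (- Re z - 1)) * cmod (of_real a - of_real b :: complex)"
  proof (rule field_differentiable_bound[of "closed_segment (complex_of_real a) (of_real b)"])
    fix x assume "x \<in> closed_segment (complex_of_real a) (of_real b)"
    then obtain u where u: "x = of_real u" "a \<le> u" "u \<le> b" using S by blast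
    have "x \<notin> \<real>\<^sub>\<le>\<^sub>0" using u assms by (simp add: complex_nonpos_Reals_iff)
    then show "((\<lambda>x. x powr (- z)) has_field_derivative (- z) * x powr (- z - 1)) (at x within closed_segment (complex_of_real a) (of_real b))"
      by (rule has_field_derivative_at_within[OF has_field_derivative_powr])
    have "cmod (- z * x powr (- z - 1)) = cmod z * u powr (- Re z - 1)"
      using u assms by (simp add: norm_mult cmod_of_real_powr)
    also have "\<dots> \<le> cmod z * a powr (- Re z - 1)"
      using u assms by (intro mult_left_mono powr_mono2') auto
    finally show "cmod (- z * x powr (- z - 1)) \<le> cmod z * a powr (- Re z - 1)" .
  qed auto
  also have "cmod (of_real a - of_real b :: complex) = b - a"
    using assms by (metis abs_minus_commute abs_of_nonneg diff_ge_0_iff_ge norm_of_real of_real_diff)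
  finally show ?thesis .
qed

lemma one_plus_ln_le_powr:
  assumes "\<tau> > 0" "n \<ge> 1"
  shows "1 + ln (real n) \<le> (1 + 1 / \<tau>) * real n powr \<tau>"
proof -
  have "ln (real n) \<le> real n powr \<tau> / \<tau>"
    using assms by (intro ln_powr_bound) auto
  moreover have "1 \<le> real n powr \<tau>" using assms by (intro ge_one_powr_ge_zero) auto
  ultimately show ?thesis by (simp add: algebra_simps)
qed

text \<open>Telescoping comparison with \<open>x powr (- \<tau>) / \<tau>\<close>. The dependence on
  \<tau> is made explicit because later \<tau> tends to 0 and the order of growth counts.\<close>

lemma sum_powr_le:
  assumes "\<tau> > 0"
  shows "(\<Sum>n=1..N. real n powr (- 1 - \<tau>)) \<le> 1 + 1 / \<tau>"
proof -
  have "(\<Sum>n=1..Suc N. real n powr (- 1 - \<tau>)) \<le> 1 + (1 - real (Suc N) powr (- \<tau>)) / \<tau>" for N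
  proof (induction N)
    case (Suc N)
    define a b where "a = real (Suc N)" and "b = real (Suc (Suc N))"
    have ab: "0 < a" "b = a + 1" by (auto simp: a_def b_def)
    have "\<exists>z. z > a \<and> z < b \<and> b powr (- \<tau>) - a powr (- \<tau>) = (b - a) * ((- \<tau>) * z powr (- \<tau> - 1))"
      using ab by (intro MVT2) (auto intro!: derivative_eq_intros simp: powr_diff)
    then obtain z where z: "z > a" "z < b" "b powr (- \<tau>) - a powr (- \<tau>) = (- \<tau>) * z powr (- \<tau> - 1)"
      using ab by auto
    have "b powr (- 1 - \<tau>) \<le> z powr (- \<tau> - 1)"
      using z ab assms powr_mono2'[of "- 1 - \<tau>" z b] by (simp add: minus_diff_commute)
    then have "\<tau> * b powr (- 1 - \<tau>) \<le> \<tau> * z powr (- \<tau> - 1)"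
      using assms by (intro mult_left_mono) auto
    then have "\<tau> * b powr (- 1 - \<tau>) \<le> a powr (- \<tau>) - b powr (- \<tau>)"
      using z(3) by simp
    then have "b powr (- 1 - \<tau>) \<le> (a powr (- \<tau>) - b powr (- \<tau>)) / \<tau>"
      using assms by (simp add: field_simps)
    moreover have "(\<Sum>n=1..Suc (Suc N). real n powr (- 1 - \<tau>)) = (\<Sum>n=1..Suc N. real n powr (- 1 - \<tau>)) + b powr (- 1 - \<tau>)"
      by (simp add: b_def)
    ultimately show ?case using Suc by (simp add: a_def b_def diff_divide_distrib)
  qed simp
  moreover have "(1 - real (Suc N) powr (- \<tau>)) / \<tau> \<le> 1 / \<tau>" for N
    using assms by (intro divide_right_mono) auto
  ultimately have "(\<Sum>n=1..Suc N. real n powr (- 1 - \<tau>)) \<le> 1 + 1 / \<tau>" for N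
    by (meson add_left_mono order_trans)
  then show ?thesis using assms by (cases N) auto
qed

lemma suminf_powr_le:
  assumes "\<tau> > 0"
  shows "summable (\<lambda>n. real n powr (- 1 - \<tau>))" "(\<Sum>n. real n powr (- 1 - \<tau>)) \<le> 1 + 1 / \<tau>"
proof -
  show *: "summable (\<lambda>n. real n powr (- 1 - \<tau>))"
    using assms by (simp add: summable_real_powr_iff)
  show "(\<Sum>n. real n powr (- 1 - \<tau>)) \<le> 1 + 1 / \<tau>"
  proof (rule suminf_le_const[OF *])
    fix N
    have "(\<Sum>n<N. real n powr (- 1 - \<tau>)) \<le> (\<Sum>n=0..N. real n powr (- 1 - \<tau>))"
      by (intro sum_mono2) auto
    also have "\<dots> = (\<Sum>n=1..N. real n powr (- 1 - \<tau>))"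
      by (simp add: sum.atLeast_Suc_atMost)
    also have "\<dots> \<le> 1 + 1 / \<tau>" by (rule sum_powr_le[OF assms])
    finally show "(\<Sum>n<N. real n powr (- 1 - \<tau>)) \<le> 1 + 1 / \<tau>" .
  qed
qed

text \<open>Half of \<sigma> absorbs the logarithm, the other half leaves a convergent
  series.\<close>

lemma log_growth_term_bound:
  assumes C: "\<And>n. n \<ge> 1 \<Longrightarrow> cmod (\<alpha> n) \<le> C * real n powr (real d - 1) * (1 + ln (real n))" "C \<ge> 0"
    and "\<sigma> > 0" "Re z \<ge> real d + \<sigma>"
  shows "cmod (\<alpha> n * of_nat n powr (- z)) \<le> C * (1 + 2 / \<sigma>) * real n powr (- 1 - \<sigma> / 2)"
proof (cases "n = 0")
  case True then show ?thesis by simp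
next
  case False
  then have n: "n \<ge> 1" by simp
  have "cmod (\<alpha> n * of_nat n powr (- z)) = cmod (\<alpha> n) * real n powr (- Re z)"
    by (simp add: norm_mult cmod_of_nat_powr)
  also have "\<dots> \<le> (C * real n powr (real d - 1) * (1 + ln (real n))) * real n powr (- real d - \<sigma>)"
    using assms n C by (intro mult_mono powr_mono) auto
  also have "\<dots> = C * (1 + ln (real n)) * (real n powr (real d - 1) * real n powr (- real d - \<sigma>))"
    by simp
  also have "real n powr (real d - 1) * real n powr (- real d - \<sigma>) = real n powr (- 1 - \<sigma>)"
    by (simp add: powr_add[symmetric])
  also have "C * (1 + ln (real n)) * real n powr (- 1 - \<sigma>) \<le> C * ((1 + 1 / (\<sigma>/2)) * real n powr (\<sigma>/2)) * real n powr (- 1 - \<sigma>)"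
    using assms n by (intro mult_right_mono mult_left_mono one_plus_ln_le_powr) auto
  also have "\<dots> = C * (1 + 2 / \<sigma>) * (real n powr (\<sigma>/2) * real n powr (- 1 - \<sigma>))"
    by simp
  also have "real n powr (\<sigma>/2) * real n powr (- 1 - \<sigma>) = real n powr (- 1 - \<sigma> / 2)"
    unfolding powr_add[symmetric] by (rule arg_cong[of _ _ "\<lambda>x. real n powr x"]) (simp add: field_simps)
  finally show ?thesis .
qed

lemma hser_summable:
  assumes "log_growth d \<alpha>" "Re z > real d"
  shows "summable (\<lambda>n. cmod (\<alpha> n * of_nat n powr (- z)))"
proof -
  obtain C where C: "C \<ge> 0" "\<And>n. n \<ge> 1 \<Longrightarrow> cmod (\<alpha> n) \<le> C * real n powr (real d - 1) * (1 + ln (real n))"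
    using assms by (auto simp: log_growth_def)
  define \<sigma> where "\<sigma> = Re z - real d"
  have b: "cmod (\<alpha> n * of_nat n powr (- z)) \<le> C * (1 + 2 / \<sigma>) * real n powr (- 1 - \<sigma> / 2)" for n
    by (rule log_growth_term_bound[OF C(2,1)]) (use assms in \<open>auto simp: \<sigma>_def\<close>)
  have "summable (\<lambda>n. C * (1 + 2 / \<sigma>) * real n powr (- 1 - \<sigma> / 2))"
    using assms by (intro summable_mult suminf_powr_le) (auto simp: \<sigma>_def)
  then show ?thesis by (rule summable_comparison_test'[of _ 0]) (use b in simp)
qed

text \<open>One factor \<open>3 / \<sigma>\<close> comes from absorbing the logarithm, another from
  the sum of \<open>n powr (- 1 - \<sigma> / 2)\<close>. The bound presupposes nothing about poles,
  and this is what starts the analysis of the remainder \<open>e_1 - w_k\<close>.\<close>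

lemma hser_bound:
  assumes "log_growth d \<alpha>"
  obtains K where "\<And>z \<sigma>. 0 < \<sigma> \<Longrightarrow> \<sigma> \<le> 1 \<Longrightarrow> Re z = real d + \<sigma> \<Longrightarrow> cmod (hser \<alpha> z) \<le> K / \<sigma>\<^sup>2"
proof -
  obtain C where C: "C \<ge> 0" "\<And>n. n \<ge> 1 \<Longrightarrow> cmod (\<alpha> n) \<le> C * real n powr (real d - 1) * (1 + ln (real n))"
    using assms by (auto simp: log_growth_def)
  have "cmod (hser \<alpha> z) \<le> (9 * C) / \<sigma>\<^sup>2" if \<sigma>: "0 < \<sigma>" "\<sigma> \<le> 1" "Re z = real d + \<sigma>" for z \<sigma>
  proof -
    have s: "summable (\<lambda>n. cmod (\<alpha> n * of_nat n powr (- z)))"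
      using that assms by (intro hser_summable) auto
    have "cmod (hser \<alpha> z) \<le> (\<Sum>n. cmod (\<alpha> n * of_nat n powr (- z)))"
      unfolding hser_def by (rule summable_norm[OF s])
    also have "\<dots> \<le> (\<Sum>n. C * (1 + 2 / \<sigma>) * real n powr (- 1 - \<sigma> / 2))"
      using \<sigma> by (intro suminf_le s summable_mult suminf_powr_le log_growth_term_bound[OF C(2,1)]) auto
    also have "\<dots> = C * (1 + 2 / \<sigma>) * (\<Sum>n. real n powr (- 1 - \<sigma> / 2))"
      using \<sigma> by (intro suminf_mult suminf_powr_le) auto
    also have "\<dots> \<le> C * (1 + 2 / \<sigma>) * (1 + 1 / (\<sigma> / 2))"
      using \<sigma> C by (intro mult_left_mono suminf_powr_le) auto
    also have "\<dots> \<le> C * (3 / \<sigma>) * (3 / \<sigma>)"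
    proof -
      have "1 + 2 / \<sigma> \<le> 3 / \<sigma>" using \<sigma> by (simp add: field_simps)
      then show ?thesis using \<sigma> C by (intro mult_mono) auto
    qed
    finally show ?thesis by (simp add: power2_eq_square)
  qed
  then show ?thesis using that by blast
qed

text \<open>Weierstrass test with locally uniform majorants. They are required only from
  \<open>n0\<close> on because the estimate for the terms of \<open>jser\<close> starts at
  \<open>n = q\<close>.\<close>

lemma holomorphic_suminf:
  assumes "open S" "\<And>n. f n holomorphic_on S"
    and "\<And>z. z \<in> S \<Longrightarrow> \<exists>r>0. cball z r \<subseteq> S \<and> (\<exists>M n0. summable M \<and> (\<forall>n\<ge>n0. \<forall>w\<in>cball z r. cmod (f n w) \<le> M n))"
  shows "(\<lambda>z. \<Sum>n. f n z) holomorphic_on S"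
proof (rule holomorphic_uniform_sequence[OF assms(1)])
  show "(\<lambda>z. \<Sum>i<n. f i z) holomorphic_on S" for n
    using assms(2) by (intro holomorphic_intros)
  fix z assume "z \<in> S"
  then obtain r M n0 where r: "r > 0" "cball z r \<subseteq> S" "summable M"
    "\<forall>n\<ge>n0. \<forall>w\<in>cball z r. cmod (f n w) \<le> M n"
    using assms(3) by meson
  have "uniform_limit (cball z r) (\<lambda>n x. \<Sum>i<n. f i x) (\<lambda>x. \<Sum>n. f n x) sequentially"
    by (rule Weierstrass_m_test_ev[OF _ r(3)]) (use r(4) in \<open>auto simp: eventually_sequentially\<close>)
  then show "\<exists>d>0. cball z d \<subseteq> S \<and> uniform_limit (cball z d) (\<lambda>n x. \<Sum>i<n. f i x) (\<lambda>x. \<Sum>n. f n x) sequentially"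
    using r by blast
qed

lemma holomorphic_of_nat_powr: "(\<lambda>z. of_nat n powr (- z)) holomorphic_on S"
  by (cases "n = 0") (auto intro!: holomorphic_intros)

lemma cball_halfplane:
  assumes "Re z > c"
  obtains r where "r > 0" "\<And>w. w \<in> cball z r \<Longrightarrow> Re w \<ge> c + r \<and> cmod w \<le> cmod z + r"
proof
  show "(Re z - c) / 2 > 0" using assms by simp
  fix w assume "w \<in> cball z ((Re z - c) / 2)"
  then have d: "cmod (z - w) \<le> (Re z - c) / 2" by (simp add: dist_norm)
  have "Re z - Re w \<le> cmod (z - w)" using complex_Re_le_cmod[of "z - w"] by simp
  moreover have "cmod w \<le> cmod z + cmod (z - w)" using norm_triangle_ineq[of z "w - z"] by (simp add: norm_minus_commute)
  ultimately show "Re w \<ge> c + (Re z - c) / 2 \<and> cmod w \<le> cmod z + (Re z - c) / 2"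
    using d by (auto simp: field_simps)
qed

text \<open>The mean value bound for \<open>x powr (- w)\<close> between
  \<open>m = q * (n div q)\<close> and \<open>n\<close> gains one power of \<open>n\<close>, as
  \<open>n - m < q\<close>. The constant \<open>2 powr (R + 1)\<close> comes from replacing
  \<open>m\<close> by \<open>n / 2\<close>, which uses \<open>n \<ge> q\<close>.\<close>

lemma jser_term_bound:
  assumes C: "\<And>n. n \<ge> 1 \<Longrightarrow> cmod (\<alpha> n) \<le> C * real n powr (real d - 1) * (1 + ln (real n))" "C \<ge> 0"
    and "r > 0" "d \<ge> 1" "Re w \<ge> real d - 1 + r" "cmod w \<le> R" "q \<ge> 2" "n \<ge> q"
  shows "cmod (\<alpha> n * (of_nat n powr (- w) - of_nat (q * (n div q)) powr (- w)))
     \<le> C * (1 + 2 / r) * R * 2 powr (R + 1) * real q * real n powr (- 1 - r / 2)"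
proof -
  define m where "m = q * (n div q)"
  have m: "m \<le> n" "n < m + q" "m \<ge> q"
  proof -
    have "n = m + n mod q" "n mod q < q" using assms by (auto simp: m_def)
    then show "m \<le> n" "n < m + q" by linarith+
    have "n div q \<ge> 1" using assms by (simp add: Suc_le_eq div_greater_zero_iff)
    then show "m \<ge> q" unfolding m_def by simp
  qed
  have n2: "n \<le> 2 * m" using m by linarith
  have pos: "m \<ge> 1" "n \<ge> 1" using m assms by linarith+
  have Rew: "Re w \<ge> 0" using assms by linarith
  have "cmod (of_nat n powr (- w) - of_nat m powr (- w)) = cmod (of_real (real m) powr (- w) - of_real (real n) powr (- w))"
    by (simp add: norm_minus_commute)
  also have "\<dots> \<le> cmod w * real m powr (- Re w - 1) * (real n - real m)"
    using m pos Rew by (intro cmod_powr_diff_le) auto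
  also have "\<dots> \<le> R * (2 powr (R + 1) * real n powr (- real d - r)) * real q"
  proof (intro mult_mono)
    have "real m powr (- Re w - 1) \<le> (real n / 2) powr (- Re w - 1)"
      using n2 pos Rew by (intro powr_mono2') auto
    also have "\<dots> = 2 powr (Re w + 1) * real n powr (- Re w - 1)"
      using pos by (simp add: powr_divide powr_minus field_simps powr_diff powr_add)
    also have "\<dots> \<le> 2 powr (R + 1) * real n powr (- real d - r)"
      using pos assms order_trans[OF complex_Re_le_cmod[of w]] by (intro mult_mono powr_mono) auto
    finally show "real m powr (- Re w - 1) \<le> 2 powr (R + 1) * real n powr (- real d - r)" .
    show "real n - real m \<le> real q" using m by linarith
    show "0 \<le> R" using assms norm_ge_zero[of w] by linarith
    then show "0 \<le> R * (2 powr (R + 1) * real n powr (- real d - r))" by simp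
  qed (use m assms in auto)
  finally have diff: "cmod (of_nat n powr (- w) - of_nat m powr (- w)) \<le> R * (2 powr (R + 1) * real n powr (- real d - r)) * real q" .
  have R0: "R \<ge> 0" using assms norm_ge_zero[of w] by linarith
  have "cmod (\<alpha> n * (of_nat n powr (- w) - of_nat m powr (- w)))
    \<le> (C * real n powr (real d - 1) * (1 + ln (real n))) * (R * (2 powr (R + 1) * real n powr (- real d - r)) * real q)"
    unfolding norm_mult using C pos diff by (intro mult_mono) auto
  also have "\<dots> \<le> (C * real n powr (real d - 1) * ((1 + 1 / (r/2)) * real n powr (r/2))) * (R * (2 powr (R + 1) * real n powr (- real d - r)) * real q)"
    using assms pos R0 by (intro mult_right_mono mult_left_mono one_plus_ln_le_powr) auto
  also have "\<dots> = C * (1 + 2 / r) * R * 2 powr (R + 1) * real q * (real n powr (real d - 1) * real n powr (r/2) * real n powr (- real d - r))"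
    by (simp add: mult_ac)
  also have "real n powr (real d - 1) * real n powr (r/2) * real n powr (- real d - r) = real n powr (- 1 - r / 2)"
    by (simp add: powr_add[symmetric])
  finally show ?thesis unfolding m_def .
qed

lemma jser_holomorphic:
  assumes "log_growth d \<alpha>" "d \<ge> 1" "q \<ge> 2"
  shows "jser q \<alpha> holomorphic_on {z. Re z > real d - 1}"
  unfolding jser_def[abs_def]
proof (rule holomorphic_suminf)
  show "open {z. Re z > real d - 1}" by (rule open_halfspace_Re_gt)
  show "(\<lambda>z. \<alpha> n * (of_nat n powr (- z) - of_nat (q * (n div q)) powr (- z))) holomorphic_on {z. Re z > real d - 1}" for n
    by (intro holomorphic_intros holomorphic_of_nat_powr)
  obtain C where C: "C \<ge> 0" "\<And>n. n \<ge> 1 \<Longrightarrow> cmod (\<alpha> n) \<le> C * real n powr (real d - 1) * (1 + ln (real n))"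
    using assms by (auto simp: log_growth_def)
  fix z assume "z \<in> {z. Re z > real d - 1}"
  then obtain r where r: "r > 0" "\<And>w. w \<in> cball z r \<Longrightarrow> Re w \<ge> real d - 1 + r \<and> cmod w \<le> cmod z + r"
    using cball_halfplane[of "real d - 1" z] by auto
  define K where "K = C * (1 + 2 / r) * (cmod z + r) * 2 powr ((cmod z + r) + 1) * real q"
  show "\<exists>r>0. cball z r \<subseteq> {z. Re z > real d - 1} \<and> (\<exists>M n0. summable M \<and> (\<forall>n\<ge>n0. \<forall>w\<in>cball z r.
     cmod (\<alpha> n * (of_nat n powr (- w) - of_nat (q * (n div q)) powr (- w))) \<le> M n))"
  proof (intro exI[of _ r] exI[of _ "\<lambda>n. K * real n powr (- 1 - r / 2)"] exI[of _ q] conjI allI impI ballI)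
    show "cball z r \<subseteq> {z. Re z > real d - 1}" using r by fastforce
    show "summable (\<lambda>n. K * real n powr (- 1 - r / 2))"
      using r by (intro summable_mult suminf_powr_le) auto
    show "cmod (\<alpha> n * (of_nat n powr (- w) - of_nat (q * (n div q)) powr (- w))) \<le> K * real n powr (- 1 - r / 2)"
      if "n \<ge> q" "w \<in> cball z r" for n w
      unfolding K_def by (rule jser_term_bound[OF C(2,1)]) (use r that assms in auto)
  qed (use r in auto)
qed

lemma jser_summable:
  assumes "log_growth d \<alpha>" "d \<ge> 1" "q \<ge> 2" "Re z > real d - 1"
  shows "summable (\<lambda>n. \<alpha> n * (of_nat n powr (- z) - of_nat (q * (n div q)) powr (- z)))"
proof -
  obtain C where C: "C \<ge> 0" "\<And>n. n \<ge> 1 \<Longrightarrow> cmod (\<alpha> n) \<le> C * real n powr (real d - 1) * (1 + ln (real n))"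
    using assms by (auto simp: log_growth_def)
  define r where "r = Re z - (real d - 1)"
  have r: "r > 0" using assms by (simp add: r_def)
  define K where "K = C * (1 + 2 / r) * (cmod z) * 2 powr (cmod z + 1) * real q"
  show ?thesis
  proof (rule summable_comparison_test')
    show "summable (\<lambda>n. K * real n powr (- 1 - r / 2))"
      using r by (intro summable_mult suminf_powr_le) auto
    show "cmod (\<alpha> n * (of_nat n powr (- z) - of_nat (q * (n div q)) powr (- z))) \<le> K * real n powr (- 1 - r / 2)"
      if "n \<ge> q" for n
      unfolding K_def by (rule jser_term_bound[OF C(2,1)]) (use r that assms in \<open>auto simp: r_def\<close>)
  qed
qed

text \<open>The junk value \<open>0 powr z = 0\<close> makes the terms with index \<open>0\<close> vanish, so no index set has to
  exclude it.\<close>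

lemma hser_functional_equation:
  assumes \<alpha>: "log_growth d \<alpha>" and \<beta>: "log_growth d \<beta>" and \<gamma>: "log_growth d \<gamma>"
    and d: "d \<ge> 1" and q: "q \<ge> 2" and z: "Re z > real d"
    and block: "\<And>N. N \<ge> 1 \<Longrightarrow> (\<Sum>j<q. \<alpha> (q * N + j)) = \<beta> N + \<gamma> N * \<omega>"
  shows "hser \<alpha> z = of_nat q powr (- z) * hser \<beta> z + jser q \<alpha> z + of_nat q powr (- z) * \<omega> * hser \<gamma> z"
proof -
  have s: "summable (\<lambda>n. \<delta> n * of_nat n powr (- z))" if "log_growth d \<delta>" for \<delta>
    using hser_summable[OF that z] by (rule summable_norm_cancel)
  have j: "summable (\<lambda>n. \<alpha> n * (of_nat n powr (- z) - of_nat (q * (n div q)) powr (- z)))"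
    using assms by (intro jser_summable) auto
  \<comment> \<open>Rounding makes the weight constant on each block of \<open>q\<close> consecutive
    indices, so grouping the series blockwise leaves only the block sums of \<alpha>.\<close>
  define f where "f n = \<alpha> n * of_nat (q * (n div q)) powr (- z)" for n
  have "f sums (hser \<alpha> z - jser q \<alpha> z)"
    using sums_diff[OF summable_sums[OF s[OF \<alpha>]] summable_sums[OF j]]
    by (simp add: f_def[abs_def] hser_def jser_def algebra_simps)
  then have "(\<lambda>N. sum f {N * q..<N * q + q}) sums (hser \<alpha> z - jser q \<alpha> z)"
    using q by (intro sums_group) auto
  moreover have "sum f {N * q..<N * q + q} = of_nat q powr (- z) * (\<beta> N * of_nat N powr (- z))
     + of_nat q powr (- z) * \<omega> * (\<gamma> N * of_nat N powr (- z))" for N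
  proof -
    have "sum f {N * q..<N * q + q} = (\<Sum>j<q. f (q * N + j))"
      by (rule sum.reindex_bij_witness[where j = "\<lambda>n. n - q * N" and i = "\<lambda>j. q * N + j"]) (auto simp: mult.commute)
    also have "\<dots> = (\<Sum>j<q. \<alpha> (q * N + j) * of_nat (q * N) powr (- z))"
      by (rule sum.cong) (auto simp: f_def)
    also have "\<dots> = (\<Sum>j<q. \<alpha> (q * N + j)) * of_nat (q * N) powr (- z)"
      by (simp add: sum_distrib_right)
    also have "\<dots> = (\<beta> N + \<gamma> N * \<omega>) * of_nat (q * N) powr (- z)"
      by (cases "N = 0") (simp_all add: block)
    also have "of_nat (q * N) powr (- z) = (of_nat q powr (- z) * of_nat N powr (- z) :: complex)"
      by (simp add: powr_times_real)
    finally show ?thesis by (simp add: algebra_simps)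
  qed
  ultimately have "(\<lambda>N. of_nat q powr (- z) * (\<beta> N * of_nat N powr (- z))
     + of_nat q powr (- z) * \<omega> * (\<gamma> N * of_nat N powr (- z))) sums (hser \<alpha> z - jser q \<alpha> z)"
    by simp
  moreover have "(\<lambda>N. of_nat q powr (- z) * (\<beta> N * of_nat N powr (- z))
     + of_nat q powr (- z) * \<omega> * (\<gamma> N * of_nat N powr (- z))) sums
     (of_nat q powr (- z) * hser \<beta> z + of_nat q powr (- z) * \<omega> * hser \<gamma> z)"
    unfolding hser_def by (intro sums_add sums_mult summable_sums s \<beta> \<gamma>)
  ultimately have "hser \<alpha> z - jser q \<alpha> z = of_nat q powr (- z) * hser \<beta> z + of_nat q powr (- z) * \<omega> * hser \<gamma> z"
    using sums_unique2 by blast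
  then show ?thesis by (simp add: algebra_simps)
qed

section \<open>The Dirichlet series of the shell sizes\<close>

definition shell_count :: "nat \<Rightarrow> nat \<Rightarrow> complex" where
  "shell_count d n = of_nat (Suc n ^ d - n ^ d)"

lemma Suc_power_diff_le: "n \<ge> 1 \<Longrightarrow> d \<ge> 1 \<Longrightarrow> real (Suc n ^ d - n ^ d) \<le> real d * 2 ^ d * real n powr (real d - 1)"
proof -
  assume n: "n \<ge> 1" and d: "d \<ge> 1"
  have "\<exists>z. z > real n \<and> z < real n + 1 \<and> (real n + 1) ^ d - real n ^ d = ((real n + 1) - real n) * (real d * z ^ (d - 1))"
    by (intro MVT2) (auto intro!: derivative_eq_intros)
  then obtain z where z: "z > real n" "z < real n + 1" "(real n + 1) ^ d - real n ^ d = real d * z ^ (d - 1)" by auto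
  have "z ^ (d - 1) \<le> (2 * real n) ^ (d - 1)" using z n by (intro power_mono) auto
  also have "\<dots> = 2 ^ (d - 1) * real n ^ (d - 1)" by (simp add: power_mult_distrib)
  also have "\<dots> \<le> 2 ^ d * real n ^ (d - 1)" by (intro mult_right_mono power_increasing) auto
  also have "real n ^ (d - 1) = real n powr (real d - 1)"
    using n d by (simp add: powr_realpow[symmetric] of_nat_diff)
  finally have "z ^ (d - 1) \<le> 2 ^ d * real n powr (real d - 1)" .
  then have "real d * z ^ (d - 1) \<le> real d * (2 ^ d * real n powr (real d - 1))" by (intro mult_left_mono) auto
  moreover have "real (Suc n ^ d - n ^ d) = (real n + 1) ^ d - real n ^ d"
    by (subst of_nat_diff) (auto intro: power_mono simp: add.commute)
  ultimately show ?thesis using z(3) by simp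
qed

lemma log_growth_shell_count: "d \<ge> 1 \<Longrightarrow> log_growth d (shell_count d)"
  unfolding log_growth_def
proof (intro exI[of _ "real d * 2 ^ d"] conjI allI impI)
  fix n :: nat assume "d \<ge> 1" "n \<ge> 1"
  have "cmod (shell_count d n) = real (Suc n ^ d - n ^ d)" by (simp only: shell_count_def norm_of_nat)
  also have "\<dots> \<le> real d * 2 ^ d * real n powr (real d - 1)" by (rule Suc_power_diff_le) fact+
  also have "\<dots> \<le> real d * 2 ^ d * real n powr (real d - 1) * (1 + ln (real n))"
    using mult_left_mono[of 1 "1 + ln (real n)" "real d * 2 ^ d * real n powr (real d - 1)"] \<open>n \<ge> 1\<close> by simp
  finally show "cmod (shell_count d n) \<le> real d * 2 ^ d * real n powr (real d - 1) * (1 + ln (real n))" .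
qed simp

text \<open>This is \<open>z - d\<close> times the difference between the n-th term of the series of
  shell sizes and the integral of \<open>d * x powr (d - 1 - z)\<close> over
  \<open>[n, n + 1]\<close>; multiplied out, so that no division by \<open>z - d\<close>
  occurs.\<close>

definition zeta_term :: "nat \<Rightarrow> nat \<Rightarrow> complex \<Rightarrow> complex" where
  "zeta_term d n z = (z - of_nat d) * shell_count d n * of_nat n powr (- z)
     + of_nat d * (of_nat (Suc n) powr (of_nat d - z) - of_nat n powr (of_nat d - z))"

text \<open>\<open>zeta_num d z / (z - d)\<close> continues the Dirichlet series of the shell sizes.\<close>

definition zeta_num :: "nat \<Rightarrow> complex \<Rightarrow> complex" where
  "zeta_num d z = of_nat d + (\<Sum>n. zeta_term d (Suc n) z)"

text \<open>\<open>zeta_term d n z\<close> is \<open>\<phi> (n + 1) - \<phi> n\<close> for a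
  function with derivative \<open>(z - d) * d * x ^ (d - 1) * (n powr (- z) - x powr (- z))\<close>.
  The last factor is small by the mean value bound, which gives the additional power of
  \<open>n\<close> needed for convergence in Re z > d - 1.\<close>

lemma zeta_term_bound:
  assumes "d \<ge> 1" "n \<ge> 1" "Re z \<ge> 0"
  shows "cmod (zeta_term d n z) \<le> cmod (z - of_nat d) * real d * 2 ^ d * cmod z * real n powr (real d - 2 - Re z)"
proof -
  define \<phi> where "\<phi> x = (z - of_nat d) * (x ^ d - of_nat n ^ d) * of_nat n powr (- z)
     + of_nat d * (x powr (of_nat d - z) - of_nat n powr (of_nat d - z))" for x :: complex
  define B where "B = cmod (z - of_nat d) * (real d * (2 ^ d * real n powr (real d - 1))) * (cmod z * real n powr (- Re z - 1))"
  define S where "S = closed_segment (complex_of_real (real n)) (of_real (real (Suc n)))"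
  have S: "x \<in> S \<Longrightarrow> \<exists>u. x = of_real u \<and> real n \<le> u \<and> u \<le> real n + 1" for x
    unfolding S_def closed_segment_of_real by (auto simp: closed_segment_eq_real_ivl)
  have "cmod (\<phi> (of_real (real (Suc n))) - \<phi> (of_real (real n))) \<le> B * cmod (of_real (real (Suc n)) - of_real (real n) :: complex)"
  proof (rule field_differentiable_bound[of S])
    fix x assume "x \<in> S"
    then obtain u where u: "x = of_real u" "real n \<le> u" "u \<le> real n + 1" using S by blast
    have up: "u > 0" using u assms by linarith
    then have nr: "x \<notin> \<real>\<^sub>\<le>\<^sub>0" using u by (simp add: complex_nonpos_Reals_iff)
    have x0: "x \<noteq> 0" using u up by auto
    define D where "D = (z - of_nat d) * (of_nat d * x ^ (d - 1)) * of_nat n powr (- z)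
        + of_nat d * ((of_nat d - z) * x powr (of_nat d - z - 1))"
    show "(\<phi> has_field_derivative D) (at x within S)"
      unfolding \<phi>_def[abs_def] D_def
      by (rule has_field_derivative_at_within)
         (auto intro!: derivative_eq_intros simp: nr)
    have "x powr (of_nat d - z - 1) = x ^ (d - 1) * x powr (- z)"
    proof -
      have "of_nat d - z - 1 = of_nat (d - 1) + (- z :: complex)" using assms by (simp add: of_nat_diff)
      then have "x powr (of_nat d - z - 1) = x powr of_nat (d - 1) * x powr (- z)" by (simp only: powr_add)
      then show ?thesis using x0 by (simp add: powr_nat)
    qed
    then have D: "D = (z - of_nat d) * (of_nat d * x ^ (d - 1)) * (of_nat n powr (- z) - x powr (- z))"
      unfolding D_def by (simp add: algebra_simps)
    have 1: "cmod (x ^ (d - 1)) \<le> 2 ^ d * real n powr (real d - 1)"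
    proof -
      have "cmod (x ^ (d - 1)) = u ^ (d - 1)" using u up by (simp add: norm_power)
      also have "\<dots> \<le> (2 * real n) ^ (d - 1)" using u assms up by (intro power_mono) auto
      also have "\<dots> = 2 ^ (d - 1) * real n ^ (d - 1)" by (simp add: power_mult_distrib)
      also have "\<dots> \<le> 2 ^ d * real n ^ (d - 1)" by (intro mult_right_mono power_increasing) auto
      also have "real n ^ (d - 1) = real n powr (real d - 1)"
        using assms by (simp add: powr_realpow[symmetric] of_nat_diff)
      finally show ?thesis .
    qed
    have 2: "cmod (of_nat n powr (- z) - x powr (- z)) \<le> cmod z * real n powr (- Re z - 1)"
    proof -
      have "cmod (of_real (real n) powr (- z) - of_real u powr (- z)) \<le> cmod z * real n powr (- Re z - 1) * (u - real n)"
        using assms u by (intro cmod_powr_diff_le) auto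
      also have "\<dots> \<le> cmod z * real n powr (- Re z - 1) * 1"
        using u by (intro mult_left_mono) auto
      finally show ?thesis by (simp add: u)
    qed
    have "cmod D = cmod (z - of_nat d) * (real d * cmod (x ^ (d - 1))) * cmod (of_nat n powr (- z) - x powr (- z))"
      unfolding D by (simp add: norm_mult)
    also have "\<dots> \<le> B"
      unfolding B_def by (intro mult_mono mult_left_mono 1 2) auto
    finally show "cmod D \<le> B" .
  qed (auto simp: S_def)
  moreover have "\<phi> (of_real (real n)) = 0" by (simp add: \<phi>_def)
  moreover have "\<phi> (of_real (real (Suc n))) = zeta_term d n z"
  proof -
    have "shell_count d n = of_nat (Suc n) ^ d - of_nat n ^ d"
      unfolding shell_count_def by (subst of_nat_diff) (auto intro: power_mono)
    then show ?thesis by (simp add: \<phi>_def zeta_term_def)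
  qed
  moreover have "cmod (of_real (real (Suc n)) - of_real (real n) :: complex) = 1" by simp
  ultimately have "cmod (zeta_term d n z) \<le> B" by simp
  also have "B = cmod (z - of_nat d) * real d * 2 ^ d * cmod z * (real n powr (real d - 1) * real n powr (- Re z - 1))"
    by (simp add: B_def mult_ac)
  also have "real n powr (real d - 1) * real n powr (- Re z - 1) = real n powr (real d - 2 - Re z)"
    unfolding powr_add[symmetric] by (rule arg_cong[of _ _ "\<lambda>x. real n powr x"]) simp
  finally show ?thesis .
qed

lemma zeta_num_holomorphic:
  assumes "d \<ge> 1"
  shows "zeta_num d holomorphic_on {z. Re z > real d - 1}"
  unfolding zeta_num_def[abs_def]
proof (intro holomorphic_intros holomorphic_suminf)
  show "open {z. Re z > real d - 1}" by (rule open_halfspace_Re_gt)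
  show "zeta_term d (Suc n) holomorphic_on {z. Re z > real d - 1}" for n
    unfolding zeta_term_def[abs_def] by (intro holomorphic_intros holomorphic_of_nat_powr)
  fix z assume "z \<in> {z. Re z > real d - 1}"
  then obtain r where r: "r > 0" "\<And>w. w \<in> cball z r \<Longrightarrow> Re w \<ge> real d - 1 + r \<and> cmod w \<le> cmod z + r"
    using cball_halfplane[of "real d - 1" z] by auto
  define R where "R = cmod z + r"
  show "\<exists>r>0. cball z r \<subseteq> {z. Re z > real d - 1} \<and> (\<exists>M n0. summable M \<and> (\<forall>n\<ge>n0. \<forall>w\<in>cball z r.
     cmod (zeta_term d (Suc n) w) \<le> M n))"
  proof (intro exI[of _ r] exI[of _ "\<lambda>n. (R + real d) * real d * 2 ^ d * R * real (Suc n) powr (- 1 - r)"] exI[of _ 0] conjI allI impI ballI)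
    show "cball z r \<subseteq> {z. Re z > real d - 1}" using r by fastforce
    have "summable (\<lambda>n. real (Suc n) powr (- 1 - r))"
      using suminf_powr_le(1)[OF r(1)] by (subst summable_Suc_iff)
    then show "summable (\<lambda>n. (R + real d) * real d * 2 ^ d * R * real (Suc n) powr (- 1 - r))"
      by (rule summable_mult)
    fix n :: nat and w assume w: "w \<in> cball z r"
    have Rw: "cmod w \<le> R" using r(2)[OF w] by (simp add: R_def)
    have "cmod (w - of_nat d) \<le> cmod w + real d" using norm_triangle_ineq4[of w "of_nat d"] by simp
    then have dw: "cmod (w - of_nat d) \<le> R + real d" using Rw by linarith
    have "cmod (zeta_term d (Suc n) w) \<le> cmod (w - of_nat d) * real d * 2 ^ d * cmod w * real (Suc n) powr (real d - 2 - Re w)"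
      using r(2)[OF w] assms r(1) by (intro zeta_term_bound) auto
    also have "\<dots> \<le> (R + real d) * real d * 2 ^ d * R * real (Suc n) powr (- 1 - r)"
    proof -
      have "R \<ge> 0" using Rw norm_ge_zero[of w] by linarith
      then show ?thesis using dw Rw r(2)[OF w] by (intro mult_mono powr_mono) auto
    qed
    finally show "cmod (zeta_term d (Suc n) w) \<le> (R + real d) * real d * 2 ^ d * R * real (Suc n) powr (- 1 - r)" .
  qed (use r in auto)
qed

lemma zeta_num_at: "zeta_num d (of_nat d) = of_nat d"
proof -
  have "zeta_term d (Suc n) (of_nat d) = 0" for n
    by (simp add: zeta_term_def del: of_nat_Suc)
  then show ?thesis by (simp add: zeta_num_def)
qed

text \<open>The differences in \<open>zeta_term\<close> telescope:
  \<open>(n + 1) powr (d - z)\<close> starts at 1 and tends to 0, so they contribute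
  \<open>- d\<close>, which the constant in \<open>zeta_num\<close> compensates.\<close>

lemma hser_shell_count:
  assumes d: "d \<ge> 1" and z: "Re z > real d"
  shows "hser (shell_count d) z = zeta_num d z / (z - of_nat d)"
proof -
  define f where "f n = (of_nat (Suc n) :: complex) powr (of_nat d - z)" for n
  have "(\<lambda>n. cmod (f n)) \<longlonglongrightarrow> 0"
  proof -
    have "(\<lambda>n. real (Suc n) powr (real d - Re z)) \<longlonglongrightarrow> 0"
      using z by (intro LIMSEQ_Suc tendsto_neg_powr filterlim_real_sequentially) auto
    then show ?thesis by (simp only: f_def cmod_of_nat_powr) simp
  qed
  then have "f \<longlonglongrightarrow> 0" by (rule tendsto_norm_zero_cancel)
  then have tele: "(\<lambda>n. f (Suc n) - f n) sums (0 - f 0)" by (rule telescope_sums)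
  have s: "(\<lambda>n. shell_count d n * of_nat n powr (- z)) sums hser (shell_count d) z"
    unfolding hser_def
    by (intro summable_sums summable_norm_cancel[OF hser_summable[OF log_growth_shell_count[OF d] z]])
  then have "(\<lambda>n. shell_count d (Suc n) * of_nat (Suc n) powr (- z)) sums hser (shell_count d) z"
    by (subst sums_Suc_iff) simp
  then have "(\<lambda>n. (z - of_nat d) * (shell_count d (Suc n) * of_nat (Suc n) powr (- z)) + of_nat d * (f (Suc n) - f n)) sums
      ((z - of_nat d) * hser (shell_count d) z + of_nat d * (0 - f 0))"
    by (intro sums_add sums_mult tele)
  then have "(\<lambda>n. zeta_term d (Suc n) z) sums ((z - of_nat d) * hser (shell_count d) z - of_nat d)"
    by (simp add: zeta_term_def f_def mult.assoc)
  then have "(\<Sum>n. zeta_term d (Suc n) z) = (z - of_nat d) * hser (shell_count d) z - of_nat d"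
    by (rule sums_unique[symmetric])
  moreover have "z \<noteq> of_nat d" using z by auto
  ultimately show ?thesis by (simp add: zeta_num_def)
qed

section \<open>Abelian asymptotics at the critical line\<close>

text \<open>A null sequence as weight improves O(1 / \<sigma>) to o(1 / \<sigma>): the head of the
  series is bounded uniformly in \<sigma>, and on the tail the weight is at most an arbitrarily
  small \<eta>.\<close>

lemma abel_little_o:
  fixes \<omega> :: "nat \<Rightarrow> real"
  assumes "\<omega> \<longlonglongrightarrow> 0" "\<And>n. \<omega> n \<ge> 0"
  shows "\<And>\<sigma>. \<sigma> > 0 \<Longrightarrow> summable (\<lambda>n. \<omega> n * real (Suc n) powr (- 1 - \<sigma>))"
    and "((\<lambda>\<sigma>. \<sigma> * (\<Sum>n. \<omega> n * real (Suc n) powr (- 1 - \<sigma>))) \<longlongrightarrow> 0) (at_right 0)"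
proof -
  obtain W where W: "\<And>n. \<omega> n \<le> W"
    using Bseq_bdd_above[OF convergent_imp_Bseq[OF convergentI[OF assms(1)]]] by (auto simp: bdd_above_def)
  have W0: "W \<ge> 0" using assms(2)[of 0] W[of 0] by linarith
  have sP: "summable (\<lambda>n. real (Suc n) powr (- 1 - \<sigma>))" if "\<sigma> > 0" for \<sigma>
    using suminf_powr_le(1)[OF that] by (subst summable_Suc_iff)
  have leP: "(\<Sum>n. real (Suc n) powr (- 1 - \<sigma>)) \<le> 1 + 1 / \<sigma>" if "\<sigma> > 0" for \<sigma>
    using suminf_powr_le(2)[OF that] suminf_split_head[OF suminf_powr_le(1)[OF that]] by simp
  show s: "summable (\<lambda>n. \<omega> n * real (Suc n) powr (- 1 - \<sigma>))" if "\<sigma> > 0" for \<sigma>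
  proof (rule summable_comparison_test'[of _ 0])
    show "summable (\<lambda>n. W * real (Suc n) powr (- 1 - \<sigma>))" by (intro summable_mult sP that)
    show "norm (\<omega> n * real (Suc n) powr (- 1 - \<sigma>)) \<le> W * real (Suc n) powr (- 1 - \<sigma>)" for n
      using assms(2)[of n] W[of n] by (simp add: mult_right_mono)
  qed
  show "((\<lambda>\<sigma>. \<sigma> * (\<Sum>n. \<omega> n * real (Suc n) powr (- 1 - \<sigma>))) \<longlongrightarrow> 0) (at_right 0)"
  proof (rule tendstoI)
    fix e :: real assume e: "e > 0"
    define \<eta> where "\<eta> = e / 2"
    have \<eta>: "\<eta> > 0" using e by (simp add: \<eta>_def)
    obtain N0 where N0: "\<And>n. n \<ge> N0 \<Longrightarrow> \<omega> n \<le> \<eta>"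
      using order_tendstoD(2)[OF assms(1) \<eta>] by (auto simp: eventually_sequentially intro: less_imp_le)
    define K where "K = real N0 * W + \<eta>"
    have K: "K > 0" using \<eta> W0 by (simp add: K_def add_nonneg_pos)
    have bound: "\<sigma> * (\<Sum>n. \<omega> n * real (Suc n) powr (- 1 - \<sigma>)) \<le> \<sigma> * K + \<eta>" if \<sigma>: "\<sigma> > 0" for \<sigma>
    proof -
      have "(\<Sum>n. \<omega> n * real (Suc n) powr (- 1 - \<sigma>))
          \<le> (\<Sum>n. (if n < N0 then W else 0) + \<eta> * real (Suc n) powr (- 1 - \<sigma>))"
      proof (rule suminf_le[OF _ s[OF \<sigma>]])
        fix n
        show "\<omega> n * real (Suc n) powr (- 1 - \<sigma>) \<le> (if n < N0 then W else 0) + \<eta> * real (Suc n) powr (- 1 - \<sigma>)"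
        proof (cases "n < N0")
          case True
          have "real (Suc n) powr (- 1 - \<sigma>) \<le> real (Suc n) powr 0"
            using \<sigma> by (intro powr_mono) auto
          then have "\<omega> n * real (Suc n) powr (- 1 - \<sigma>) \<le> W * 1"
            using assms(2) W W0 by (intro mult_mono) auto
          then show ?thesis using True \<eta> by (simp add: add_increasing2)
        next
          case False
          then show ?thesis using N0[of n] by (simp add: mult_right_mono)
        qed
      next
        show "summable (\<lambda>n. (if n < N0 then W else 0) + \<eta> * real (Suc n) powr (- 1 - \<sigma>))"
          using sP[OF \<sigma>] by (intro summable_add summable_mult) (auto intro!: summable_finite[of "{..<N0}"])
      qed
      also have "\<dots> = (\<Sum>n. if n < N0 then W else 0) + (\<Sum>n. \<eta> * real (Suc n) powr (- 1 - \<sigma>))"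
        using sP[OF \<sigma>] by (intro suminf_add[symmetric] summable_mult) (auto intro!: summable_finite[of "{..<N0}"])
      also have "(\<Sum>n. if n < N0 then W else 0) = real N0 * W"
        by (subst suminf_finite[of "{..<N0}"]) auto
      also have "(\<Sum>n. \<eta> * real (Suc n) powr (- 1 - \<sigma>)) = \<eta> * (\<Sum>n. real (Suc n) powr (- 1 - \<sigma>))"
        by (rule suminf_mult[OF sP[OF \<sigma>]])
      also have "\<dots> \<le> \<eta> * (1 + 1 / \<sigma>)" using \<eta> leP[OF \<sigma>] by (intro mult_left_mono) auto
      finally have "(\<Sum>n. \<omega> n * real (Suc n) powr (- 1 - \<sigma>)) \<le> K + \<eta> / \<sigma>"
        by (simp add: K_def algebra_simps)
      then have "\<sigma> * (\<Sum>n. \<omega> n * real (Suc n) powr (- 1 - \<sigma>)) \<le> \<sigma> * (K + \<eta> / \<sigma>)"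
        using \<sigma> by (intro mult_left_mono) auto
      then show ?thesis using \<sigma> by (simp add: algebra_simps)
    qed
    have "\<forall>\<^sub>F \<sigma> in at_right 0. \<sigma> < \<eta> / K"
      using \<eta> K by (intro eventually_at_right_less order_tendstoD(2)[OF tendsto_ident_at]) auto
    moreover have "\<forall>\<^sub>F \<sigma> in at_right (0::real). \<sigma> > 0" by (simp add: eventually_at_right_less)
    ultimately show "\<forall>\<^sub>F \<sigma> in at_right 0. dist (\<sigma> * (\<Sum>n. \<omega> n * real (Suc n) powr (- 1 - \<sigma>))) 0 < e"
    proof eventually_elim
      case (elim \<sigma>)
      have "(\<Sum>n. \<omega> n * real (Suc n) powr (- 1 - \<sigma>)) \<ge> 0"
        using assms(2) by (intro suminf_nonneg s elim) auto
      moreover have "\<sigma> * K < \<eta>" using elim K by (simp add: field_simps)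
      ultimately show ?case using bound[OF elim(2)] elim by (simp add: \<eta>_def)
    qed
  qed
qed

lemma integral_exp_linear:
  fixes a :: complex
  assumes "a \<noteq> 0" "X \<ge> 0"
  shows "integral {0..X} (\<lambda>u. exp (- (a * of_real u)) * of_real u)
     = 1 / a\<^sup>2 - exp (- (a * of_real X)) * (of_real X / a + 1 / a\<^sup>2)"
proof -
  define F where "F w = - exp (- (a * w)) * (w / a + 1 / a\<^sup>2)" for w
  have "((\<lambda>u. exp (- (a * of_real u)) * of_real u) has_integral (F (of_real X) - F (of_real 0))) {0..X}"
  proof (rule fundamental_theorem_of_calculus[OF assms(2)])
    fix x
    have "(F has_field_derivative exp (- (a * of_real x)) * of_real x) (at (of_real x))"
      unfolding F_def[abs_def] using assms
      by (auto intro!: derivative_eq_intros simp: field_simps power2_eq_square)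
    then show "((\<lambda>u. F (of_real u)) has_vector_derivative exp (- (a * of_real x)) * of_real x) (at x within {0..X})"
      by (rule has_vector_derivative_real_field)
  qed
  then show ?thesis by (simp add: integral_unique F_def)
qed

text \<open>Turns a difference of consecutive values of \<open>n powr (- z)\<close> into an integral
  on the logarithmic scale. Keeping the factor \<open>z * L\<close> outside avoids a division and a
  case distinction at 0.\<close>

lemma integral_exp_log_interval:
  fixes z :: complex and L a b :: real
  assumes "a \<le> b"
  shows "z * of_real L * integral {a..b} (\<lambda>u. exp (- (z * of_real L * of_real u)))
     = exp (- (z * of_real L * of_real a)) - exp (- (z * of_real L * of_real b))"
proof -
  define c where "c = z * of_real L"
  have "((\<lambda>u. c * exp (- (c * of_real u))) has_integral (- exp (- (c * of_real b)) - (- exp (- (c * of_real a))))) {a..b}"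
  proof (rule fundamental_theorem_of_calculus[OF assms])
    fix x
    have "((\<lambda>w. - exp (- (c * w))) has_field_derivative c * exp (- (c * of_real x))) (at (of_real x))"
      by (auto intro!: derivative_eq_intros)
    then show "((\<lambda>u. - exp (- (c * of_real u))) has_vector_derivative c * exp (- (c * of_real x))) (at x within {a..b})"
      by (rule has_vector_derivative_real_field)
  qed
  then have "integral {a..b} (\<lambda>u. c * exp (- (c * of_real u))) = exp (- (c * of_real a)) - exp (- (c * of_real b))"
    by (rule integral_unique[THEN trans]) simp
  then show ?thesis by (simp add: c_def mult.assoc)
qed

text \<open>As \<open>A N\<close> runs over \<open>K < N\<close>, the term with index
  \<open>Suc N\<close> is \<open>A (Suc (Suc N)) - A (Suc N)\<close>; this shift explains the
  argument \<open>Suc (Suc n)\<close> in \<open>defect\<close>.\<close>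

lemma abel_partial_summation:
  fixes \<alpha> f :: "nat \<Rightarrow> complex"
  defines "A \<equiv> \<lambda>N. \<Sum>K<N. \<alpha> K"
  shows "(\<Sum>N<M. \<alpha> (Suc N) * f (Suc N))
     = A (Suc M) * f (Suc M) - \<alpha> 0 * f 1 + (\<Sum>N<M. A (Suc (Suc N)) * (f (Suc N) - f (Suc (Suc N))))"
proof (induction M)
  case (Suc M)
  have "A (Suc (Suc M)) = A (Suc M) + \<alpha> (Suc M)" by (simp add: A_def)
  then show ?case using Suc by (simp add: algebra_simps)
qed (simp add: A_def)

lemma of_nat_powr_exp_log:
  fixes z :: complex
  assumes "n \<ge> 1" "q \<ge> 2"
  shows "of_nat n powr (- z) = exp (- (z * of_real (ln (real q)) * of_real (log (real q) (real n))))"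
proof -
  have "ln (real q) * log (real q) (real n) = ln (real n)" using assms by (simp add: log_def)
  then have "complex_of_real (ln (real q)) * of_real (log (real q) (real n)) = of_real (ln (real n))"
    by (metis of_real_mult)
  moreover have "Ln (of_nat n) = complex_of_real (ln (real n))"
    using assms Ln_of_real[of "real n"] by simp
  ultimately show ?thesis using assms by (simp add: powr_def mult.assoc)
qed

lemma integral_periodic_blocks:
  fixes a :: complex and \<Psi> :: "real \<Rightarrow> complex"
  assumes p: "p > 0" and cont: "continuous_on UNIV \<Psi>" and per: "\<And>x. \<Psi> (x + real p) = \<Psi> x"
  shows "integral {0..real (p * J)} (\<lambda>u. exp (- (a * of_real u)) * \<Psi> u)
     = (\<Sum>j<J. exp (- (a * of_nat p)) ^ j) * integral {0..real p} (\<lambda>u. exp (- (a * of_real u)) * \<Psi> u)"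
proof (induction J)
  case (Suc J)
  define f where "f u = exp (- (a * of_real u)) * \<Psi> u" for u
  have contf: "continuous_on S f" for S
    unfolding f_def by (intro continuous_intros continuous_on_subset[OF cont]) auto
  have "integral {0..real (p * Suc J)} f = integral {0..real (p * J)} f + integral {real (p * J)..real (p * Suc J)} f"
    by (rule Henstock_Kurzweil_Integration.integral_combine[symmetric])
       (auto intro!: integrable_continuous_interval contf)
  also have "integral {real (p * J)..real (p * Suc J)} f = integral {0..real p} (\<lambda>u. f (u + real (p * J)))"
    using integral_shift[OF contf, of 0 "real p" "real (p * J)"] by (simp add: o_def algebra_simps)
  also have "\<dots> = integral {0..real p} (\<lambda>u. exp (- (a * of_nat p)) ^ J * f u)"
  proof (rule integral_cong)
    fix u
    have "\<Psi> (u + real (p * J)) = \<Psi> u"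
      using periodic_int_shift[of \<Psi> "real p" u "int J"] per by (simp add: mult.commute)
    moreover have "exp (- (a * of_real (u + real (p * J)))) = exp (- (a * of_nat p)) ^ J * exp (- (a * of_real u))"
      by (simp add: exp_of_nat_mult[symmetric] exp_add[symmetric] algebra_simps)
    ultimately show "f (u + real (p * J)) = exp (- (a * of_nat p)) ^ J * f u"
      by (simp add: f_def)
  qed
  also have "\<dots> = exp (- (a * of_nat p)) ^ J * integral {0..real p} f" by simp
  finally have "integral {0..real (p * Suc J)} f = integral {0..real (p * J)} f + exp (- (a * of_nat p)) ^ J * integral {0..real p} f" .
  moreover have "f = (\<lambda>u. exp (- (a * of_real u)) * \<Psi> u)" by (simp add: f_def[abs_def])
  ultimately show ?case using Suc by (simp add: distrib_right)
qed simp

lemma continuous_periodic_bounded: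
  fixes f :: "real \<Rightarrow> complex"
  assumes "P > 0" "continuous_on UNIV f" "\<And>x. f (x + P) = f x"
  obtains B where "B \<ge> 0" "\<And>x. cmod (f x) \<le> B"
proof -
  have "compact (f ` {0..P})"
    by (intro compact_continuous_image continuous_on_subset[OF assms(2)]) auto
  then obtain B where B: "\<And>y. y \<in> f ` {0..P} \<Longrightarrow> cmod y \<le> B"
    using compact_imp_bounded bounded_iff by metis
  have "cmod (f x) \<le> B" for x
  proof -
    obtain m :: int where m: "x - of_int m * P \<in> {0..P}" using periodic_reduce[OF assms(1)] by blast
    have "f (x - of_int m * P) = f x" using periodic_int_shift[of f P x "- m"] assms(3) by simp
    then show ?thesis using B[OF imageI[OF m]] by simp
  qed
  then show ?thesis using that[of B] norm_ge_zero order_trans by blast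
qed

lemma continuous_periodic_uniformly_continuous:
  fixes f :: "real \<Rightarrow> complex"
  assumes "P > 0" "continuous_on UNIV f" "\<And>x. f (x + P) = f x"
  shows "uniformly_continuous_on UNIV f"
  unfolding uniformly_continuous_on_def
proof (intro allI impI)
  fix \<eta> :: real assume "\<eta> > 0"
  have "uniformly_continuous_on {- P..2 * P} f"
    by (intro compact_uniformly_continuous continuous_on_subset[OF assms(2)]) auto
  then obtain \<delta> where \<delta>: "\<delta> > 0" "\<And>x y. x \<in> {- P..2 * P} \<Longrightarrow> y \<in> {- P..2 * P} \<Longrightarrow> dist y x < \<delta> \<Longrightarrow> dist (f y) (f x) < \<eta>"
    unfolding uniformly_continuous_on_def using \<open>\<eta> > 0\<close> by meson
  have "dist (f y) (f x) < \<eta>" if "dist y x < min \<delta> P" for x y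
  proof -
    obtain m :: int where m: "x - of_int m * P \<in> {0..P}" using periodic_reduce[OF assms(1)] by blast
    have eq: "f (w - of_int m * P) = f w" for w using periodic_int_shift[of f P w "- m"] assms(3) by simp
    have "dist (f (y - of_int m * P)) (f (x - of_int m * P)) < \<eta>"
      using m that by (intro \<delta>(2)) (auto simp: dist_real_def abs_if split: if_splits)
    then show ?thesis by (simp add: eq)
  qed
  then show "\<exists>\<delta>>0. \<forall>x\<in>UNIV. \<forall>y\<in>UNIV. dist y x < \<delta> \<longrightarrow> dist (f y) (f x) < \<eta>"
    using \<delta>(1) assms(1) by (intro exI[of _ "min \<delta> P"]) auto
qed

text \<open>Everything here concerns one scalar sequence and an expansion whose error tends to 0; a
  rate for the error enters as an additional hypothesis of the lemmas on Hoelder continuity.\<close>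

locale abel_asymptotics =
  fixes \<alpha> :: "nat \<Rightarrow> complex" and \<Psi> :: "real \<Rightarrow> complex" and e :: complex and q d p :: nat
  assumes q: "q \<ge> 2" and d: "d \<ge> 1" and p: "p > 0" and growth: "log_growth d \<alpha>"
    and cont: "continuous_on UNIV \<Psi>" and per: "\<And>x. \<Psi> (x + real p) = \<Psi> x"
    and asym: "(\<lambda>N. (\<Sum>K<N. \<alpha> K) / of_nat (N ^ d) - e * of_real (log (real q) (real N))
       - \<Psi> (log (real q) (real N))) \<longlonglongrightarrow> 0"
begin

definition L :: real where "L = ln (real q)"

definition A :: "nat \<Rightarrow> complex" where "A N = (\<Sum>K<N. \<alpha> K)"

text \<open>Shifted by one so that \<open>ll 0 = 0\<close> and the intervals from
  \<open>ll n\<close> to \<open>ll (Suc n)\<close> tile the nonnegative half-line.\<close>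

definition ll :: "nat \<Rightarrow> real" where "ll n = log (real q) (real (Suc n))"

text \<open>Between \<open>ll n\<close> and \<open>ll (Suc n)\<close> the partial sum in Abel
  summation is constant; this is the error of replacing it, divided by
  \<open>q powr (d * u)\<close>, by the expected \<open>e * u + \<Psi> u\<close>.\<close>

definition defect :: "nat \<Rightarrow> real \<Rightarrow> complex" where
  "defect n u = A (Suc (Suc n)) * exp (- (of_nat d * of_real L * of_real u)) - (e * of_real u + \<Psi> u)"

definition gap :: "nat \<Rightarrow> real" where
  "gap n = (SUP u\<in>{ll n..ll (Suc n)}. cmod (defect n u))"

lemma L_pos: "L > 0" using q by (simp add: L_def)

lemma ll_0 [simp]: "ll 0 = 0" by (simp add: ll_def)

lemma ll_mono: "ll n \<le> ll (Suc n)"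
  using q by (simp add: ll_def)

lemma ll_nonneg: "ll n \<ge> 0"
  using q by (simp add: ll_def)

lemma L_ll: "L * ll n = ln (real (Suc n))"
  using q by (simp add: ll_def L_def log_def)

lemma ll_eq: "ll n = ln (real (Suc n)) / L"
  using L_ll[of n] L_pos by (simp add: field_simps)

lemma ll_diff: "L * (ll (Suc n) - ll n) \<le> 1 / real (Suc n)"
proof -
  have "L * (ll (Suc n) - ll n) = ln (real (Suc (Suc n))) - ln (real (Suc n))"
    by (simp only: right_diff_distrib L_ll)
  also have "\<dots> = ln (real (Suc (Suc n)) / real (Suc n))" by (simp add: ln_div)
  also have "real (Suc (Suc n)) / real (Suc n) = 1 + 1 / real (Suc n)" by (simp add: field_simps)
  also have "ln (1 + 1 / real (Suc n)) \<le> 1 / real (Suc n)" by (rule ln_add_one_self_le_self) simp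
  finally show ?thesis .
qed

lemma le_div_L: "x \<le> 1 / (L * real (Suc n))" if "L * x \<le> 1 / real (Suc n)"
proof -
  have "x \<le> (1 / real (Suc n)) / L"
    using that L_pos by (subst pos_le_divide_eq) (auto simp: mult.commute)
  then show ?thesis by (simp add: mult.commute)
qed

lemma continuous_on_Psi: "continuous_on S \<Psi>"
  using cont by (rule continuous_on_subset) simp

lemma continuous_on_defect: "continuous_on S (defect n)"
  unfolding defect_def[abs_def] by (intro continuous_intros continuous_on_Psi)

lemma defect_le_gap: "u \<in> {ll n..ll (Suc n)} \<Longrightarrow> cmod (defect n u) \<le> gap n"
proof -
  assume u: "u \<in> {ll n..ll (Suc n)}"
  have "compact ((\<lambda>u. cmod (defect n u)) ` {ll n..ll (Suc n)})"
    by (intro compact_continuous_image continuous_intros continuous_on_defect) auto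
  then have "bdd_above ((\<lambda>u. cmod (defect n u)) ` {ll n..ll (Suc n)})"
    by (intro bounded_imp_bdd_above compact_imp_bounded)
  then show ?thesis unfolding gap_def using u by (intro cSUP_upper)
qed

lemma gap_nonneg: "gap n \<ge> 0"
  using defect_le_gap[of "ll n" n] ll_mono[of n] order_trans[OF norm_ge_zero] by auto

text \<open>On the n-th interval \<open>u\<close> is within O(1 / n) of the right end point, where
  the expansion holds up to a null sequence. Moving from the end point to \<open>u\<close> changes
  the normalization by a factor 1 + O(1 / n), which outweighs the logarithmic growth of
  \<open>e * u\<close>, and changes \<Psi> little by uniform continuity.\<close>

lemma gap_tendsto_0: "gap \<longlonglongrightarrow> 0"
proof -
  obtain B where B: "B \<ge> 0" "\<And>x. cmod (\<Psi> x) \<le> B"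
    using continuous_periodic_bounded[of "real p" \<Psi>] p cont per by auto
  define \<epsilon> where "\<epsilon> N = A N / of_nat (N ^ d) - e * of_real (log (real q) (real N)) - \<Psi> (log (real q) (real N))" for N
  have \<epsilon>: "\<epsilon> \<longlonglongrightarrow> 0" using asym by (simp add: \<epsilon>_def[abs_def] A_def)
  define b where "b n = exp (real d) * cmod (\<epsilon> (Suc (Suc n)))
     + (real d * exp (real d)) * (1 / real (Suc n)) * (cmod e * ll (Suc n) + B) + cmod e * (1 / (L * real (Suc n)))" for n
  have b: "b \<longlonglongrightarrow> 0"
  proof -
    have "(\<lambda>n. cmod (\<epsilon> (Suc (Suc n)))) \<longlonglongrightarrow> 0"
      using LIMSEQ_Suc[OF LIMSEQ_Suc[OF tendsto_norm_zero[OF \<epsilon>]]] .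
    moreover have "(\<lambda>n. 1 / real (Suc n) * (cmod e * ll (Suc n) + B)) \<longlonglongrightarrow> 0"
    proof -
      have "(\<lambda>n. 1 / real (Suc n) * (cmod e * (ln (real (Suc (Suc n))) / L) + B)) \<longlonglongrightarrow> 0"
        using L_pos by real_asymp
      then show ?thesis by (simp only: ll_eq)
    qed
    moreover have "(\<lambda>n. 1 / (L * real (Suc n))) \<longlonglongrightarrow> 0"
      using L_pos by real_asymp
    ultimately have "(\<lambda>n. exp (real d) * cmod (\<epsilon> (Suc (Suc n)))
       + (real d * exp (real d)) * (1 / real (Suc n) * (cmod e * ll (Suc n) + B)) + cmod e * (1 / (L * real (Suc n))))
       \<longlonglongrightarrow> exp (real d) * 0 + (real d * exp (real d)) * 0 + cmod e * 0"
      by (intro tendsto_intros)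
    then show ?thesis by (simp add: b_def[abs_def] mult.assoc)
  qed
  have bound: "cmod (defect n u) \<le> b n + cmod (\<Psi> (ll (Suc n)) - \<Psi> u)" if u: "u \<in> {ll n..ll (Suc n)}" for n u
  proof -
    define l where "l = ll (Suc n)"
    define N where "N = Suc (Suc n)"
    define x where "x = real d * (L * (l - u))"
    \<comment> \<open>The ratio \<open>N ^ d / q powr (d * u)\<close> of the normalizations at the
      right end point and at \<open>u\<close>.\<close>
    define \<kappa> where "\<kappa> = exp x"
    have "L * (l - u) \<le> L * (ll (Suc n) - ll n)"
      using u L_pos by (intro mult_left_mono) (auto simp: l_def)
    then have Lu: "L * (l - u) \<le> 1 / real (Suc n)" using ll_diff[of n] by linarith
    have Lu0: "L * (l - u) \<ge> 0" using u L_pos by (simp add: l_def)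
    have x: "0 \<le> x" "x \<le> real d * (1 / real (Suc n))"
      unfolding x_def using Lu0 mult_left_mono[OF Lu, of "real d"] by auto
    have "real d * (1 / real (Suc n)) \<le> real d * 1" by (intro mult_left_mono) auto
    then have xd: "x \<le> real d" using x by simp
    have \<kappa>1: "\<kappa> \<le> exp (real d)" "1 \<le> \<kappa>" using x xd by (auto simp: \<kappa>_def)
    have "\<kappa> - 1 \<le> x * \<kappa>"
    proof -
      have "1 - x \<le> exp (- x)" using exp_ge_add_one_self[of "- x"] by simp
      then have "(1 - x) * exp x \<le> exp (- x) * exp x" by (intro mult_right_mono) auto
      then show ?thesis by (simp add: \<kappa>_def algebra_simps exp_add[symmetric])
    qed
    also have "\<dots> \<le> real d * (1 / real (Suc n)) * exp (real d)"
      using x \<kappa>1 by (intro mult_mono) auto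
    finally have \<kappa>2: "\<kappa> - 1 \<le> real d * exp (real d) * (1 / real (Suc n))" by (simp add: mult_ac)
    have Nd: "of_nat (N ^ d) * exp (- (of_nat d * of_real L * of_real u)) = complex_of_real \<kappa>"
    proof -
      have "real (N ^ d) = exp (real d * (L * l))"
        by (simp add: l_def L_ll N_def exp_of_nat_mult)
      then have "real (N ^ d) * exp (- (real d * L * u)) = \<kappa>"
        by (simp add: \<kappa>_def x_def exp_add[symmetric] algebra_simps)
      then have "complex_of_real (real (N ^ d) * exp (- (real d * L * u))) = complex_of_real \<kappa>" by simp
      then show ?thesis by (simp add: exp_of_real[symmetric])
    qed
    have "A N = of_nat (N ^ d) * (\<epsilon> N + e * of_real l + \<Psi> l)"
      by (simp add: \<epsilon>_def l_def ll_def N_def del: of_nat_Suc)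
    then have "A N * exp (- (of_nat d * of_real L * of_real u)) = of_real \<kappa> * (\<epsilon> N + e * of_real l + \<Psi> l)"
      using Nd by (simp add: mult_ac)
    then have "defect n u = of_real \<kappa> * \<epsilon> N + of_real (\<kappa> - 1) * (e * of_real l + \<Psi> l) + e * of_real (l - u) + (\<Psi> l - \<Psi> u)"
      by (simp add: defect_def N_def[symmetric] algebra_simps)
    then have "cmod (defect n u) \<le> cmod (of_real \<kappa> * \<epsilon> N) + cmod (of_real (\<kappa> - 1) * (e * of_real l + \<Psi> l))
        + cmod (e * of_real (l - u)) + cmod (\<Psi> l - \<Psi> u)"
      by (simp only:) (intro norm_triangle_mono order_refl)
    moreover have "cmod (of_real \<kappa> * \<epsilon> N) \<le> exp (real d) * cmod (\<epsilon> N)"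
      using \<kappa>1 by (simp add: norm_mult mult_right_mono)
    moreover have "cmod (of_real (\<kappa> - 1) * (e * of_real l + \<Psi> l))
        \<le> real d * exp (real d) * (1 / real (Suc n)) * (cmod e * l + B)"
    proof -
      have "cmod (e * of_real l + \<Psi> l) \<le> cmod e * l + B"
        using norm_triangle_ineq[of "e * of_real l" "\<Psi> l"] B(2)[of l] ll_nonneg[of "Suc n"]
        by (simp add: norm_mult l_def)
      then show ?thesis
        unfolding norm_mult norm_of_real using \<kappa>1 \<kappa>2 by (intro mult_mono) auto
    qed
    moreover have "cmod (e * of_real (l - u)) \<le> cmod e * (1 / (L * real (Suc n)))"
    proof -
      have "l - u \<le> 1 / (L * real (Suc n))" by (rule le_div_L[OF Lu])
      moreover have "l - u \<ge> 0" using u by (simp add: l_def)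
      ultimately show ?thesis by (simp only: norm_mult norm_of_real abs_of_nonneg) (intro mult_left_mono, auto)
    qed
    ultimately show ?thesis by (simp add: b_def l_def[symmetric] N_def[symmetric])
  qed
  have unif: "uniformly_continuous_on UNIV \<Psi>"
    using continuous_periodic_uniformly_continuous[of "real p" \<Psi>] p cont per by auto
  show ?thesis
  proof (rule tendstoI)
    fix r :: real assume r: "r > 0"
    then obtain \<delta> where \<delta>: "\<delta> > 0" "\<And>x y. dist y x < \<delta> \<Longrightarrow> dist (\<Psi> y) (\<Psi> x) < r / 2"
      using unif unfolding uniformly_continuous_on_def by (metis UNIV_I half_gt_zero)
    have "(\<lambda>n. 1 / (L * real (Suc n))) \<longlonglongrightarrow> 0" using L_pos by real_asymp
    then have "\<forall>\<^sub>F n in sequentially. 1 / (L * real (Suc n)) < \<delta>" using \<delta>(1) by (rule order_tendstoD)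
    moreover have "\<forall>\<^sub>F n in sequentially. b n < r / 4" using order_tendstoD(2)[OF b, of "r / 4"] r by simp
    ultimately show "\<forall>\<^sub>F n in sequentially. dist (gap n) 0 < r"
    proof eventually_elim
      case (elim n)
      have "gap n \<le> r / 4 + r / 2"
        unfolding gap_def
      proof (rule cSUP_least)
        show "{ll n..ll (Suc n)} \<noteq> {}" using ll_mono[of n] by auto
        fix u assume u: "u \<in> {ll n..ll (Suc n)}"
        have "ll (Suc n) - ll n \<le> 1 / (L * real (Suc n))" by (rule le_div_L[OF ll_diff])
        then have "dist (ll (Suc n)) u < \<delta>" using u elim(1) by (auto simp: dist_real_def)
        then have "cmod (\<Psi> (ll (Suc n)) - \<Psi> u) < r / 2" using \<delta>(2)[of "ll (Suc n)" u] by (simp add: dist_norm)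
        then show "cmod (defect n u) \<le> r / 4 + r / 2" using bound[OF u] elim(2) by linarith
      qed
      then show ?case using gap_nonneg[of n] r by (simp add: dist_real_def)
    qed
  qed
qed

text \<open>\<open>(z - d) * ln q\<close> at \<open>z = d + \<chi>_k + \<sigma>\<close>, the decay
  rate in the logarithmic variable. Consequently \<open>beta\<close> is a Laplace transform over one
  period, which tends to \<open>p\<close> times the k-th Fourier coefficient.\<close>

definition rate :: "int \<Rightarrow> real \<Rightarrow> complex" where
  "rate k \<sigma> = (chi_freq q p k + of_real \<sigma>) * of_real L"

definition beta :: "int \<Rightarrow> real \<Rightarrow> complex" where
  "beta k \<sigma> = integral {0..real p} (\<lambda>u. exp (- (rate k \<sigma> * of_real u)) * \<Psi> u)"

text \<open>The contribution of all defects, the only part of \<open>hser_formula\<close> that is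
  not explicit; it is o(1 / \<sigma>).\<close>

definition err :: "int \<Rightarrow> real \<Rightarrow> complex" where
  "err k \<sigma> = (\<Sum>n. (of_nat d + chi_freq q p k + of_real \<sigma>) * of_real L *
      integral {ll n..ll (Suc n)} (\<lambda>u. defect n u * exp (- (rate k \<sigma> * of_real u))))"

lemma Re_chi: "Re (chi_freq q p k) = 0"
proof -
  have "chi_freq q p k = \<i> * of_real (2 * pi * of_int k / (real p * ln (real q)))"
    by (simp add: chi_freq_def)
  then show ?thesis by (simp only:) simp
qed

lemma Re_rate: "Re (rate k \<sigma>) = \<sigma> * L"
  by (simp add: rate_def Re_chi)

lemma chi_L: "chi_freq q p k * of_real L = 2 * of_real pi * \<i> * of_int k / of_nat p"
  using L_pos p by (simp add: chi_freq_def L_def)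

lemma exp_rate: "exp (- (rate k \<sigma> * of_real u)) = of_real (exp (- (\<sigma> * L * u))) * fexp p (- k) u"
proof -
  have "rate k \<sigma> * of_real u = 2 * of_real pi * \<i> * of_int k / of_nat p * of_real u + of_real (\<sigma> * L * u)"
    unfolding rate_def distrib_right chi_L by simp
  then have "exp (- (rate k \<sigma> * of_real u)) = exp (- of_real (\<sigma> * L * u)) * exp (- (2 * of_real pi * \<i> * of_int k / of_nat p * of_real u))"
    by (simp only: minus_add_distrib exp_add mult.commute)
  then show ?thesis by (simp add: fexp_def exp_of_real[symmetric])
qed

lemma exp_rate_period: "exp (- (rate k \<sigma> * of_nat p)) = of_real (exp (- (\<sigma> * L * real p)))"
  using exp_rate[of k \<sigma> "real p"] fexp_period[OF p, of "- k" 0] by simp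

text \<open>The length of the interval, at most \<open>1 / (L * (n + 1))\<close>, supplies the -1 in
  the exponent, and the exponential at its left end the \<open>- \<sigma>\<close>.\<close>

lemma err_term_bound:
  assumes \<sigma>: "\<sigma> > 0"
  shows "cmod ((of_nat d + chi_freq q p k + of_real \<sigma>) * of_real L *
      integral {ll n..ll (Suc n)} (\<lambda>u. defect n u * exp (- (rate k \<sigma> * of_real u))))
    \<le> cmod (of_nat d + chi_freq q p k + of_real \<sigma>) * (gap n * real (Suc n) powr (- 1 - \<sigma>))"
proof -
  define z where "z = of_nat d + chi_freq q p k + of_real \<sigma>"
  have "cmod (integral {ll n..ll (Suc n)} (\<lambda>u. defect n u * exp (- (rate k \<sigma> * of_real u))))
     \<le> (gap n * real (Suc n) powr (- \<sigma>)) * (ll (Suc n) - ll n)"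
  proof (rule integral_bound[OF ll_mono])
    show "continuous_on {ll n..ll (Suc n)} (\<lambda>u. defect n u * exp (- (rate k \<sigma> * of_real u)))"
      by (intro continuous_intros continuous_on_defect)
    fix u assume u: "u \<in> {ll n..ll (Suc n)}"
    have "cmod (exp (- (rate k \<sigma> * of_real u))) = exp (- (\<sigma> * L * u))"
      by (simp add: exp_rate norm_mult)
    also have "\<dots> \<le> exp (- (\<sigma> * (L * ll n)))"
      using u \<sigma> L_pos by (simp add: mult_left_mono mult.assoc)
    also have "\<dots> = real (Suc n) powr (- \<sigma>)"
      unfolding L_ll by (simp add: powr_def)
    finally have "cmod (exp (- (rate k \<sigma> * of_real u))) \<le> real (Suc n) powr (- \<sigma>)" .
    then show "cmod (defect n u * exp (- (rate k \<sigma> * of_real u))) \<le> gap n * real (Suc n) powr (- \<sigma>)"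
      unfolding norm_mult using defect_le_gap[OF u] gap_nonneg[of n] by (intro mult_mono) auto
  qed
  then have "L * cmod (integral {ll n..ll (Suc n)} (\<lambda>u. defect n u * exp (- (rate k \<sigma> * of_real u))))
     \<le> L * ((gap n * real (Suc n) powr (- \<sigma>)) * (ll (Suc n) - ll n))"
    using L_pos by (intro mult_left_mono) auto
  also have "\<dots> = (gap n * real (Suc n) powr (- \<sigma>)) * (L * (ll (Suc n) - ll n))" by simp
  also have "\<dots> \<le> (gap n * real (Suc n) powr (- \<sigma>)) * (1 / real (Suc n))"
    using gap_nonneg[of n] ll_diff[of n] by (intro mult_left_mono) auto
  also have "\<dots> = gap n * (real (Suc n) powr (- \<sigma>) * real (Suc n) powr (- 1))"
    by (simp add: powr_minus_divide)
  also have "real (Suc n) powr (- \<sigma>) * real (Suc n) powr (- 1) = real (Suc n) powr (- 1 - \<sigma>)"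
    unfolding powr_add[symmetric] by (rule arg_cong[of _ _ "\<lambda>x. real (Suc n) powr x"]) simp
  finally have "cmod z * (L * cmod (integral {ll n..ll (Suc n)} (\<lambda>u. defect n u * exp (- (rate k \<sigma> * of_real u)))))
     \<le> cmod z * (gap n * real (Suc n) powr (- 1 - \<sigma>))"
    by (intro mult_left_mono) auto
  then show ?thesis
    using L_pos by (simp add: norm_mult z_def mult.assoc)
qed

lemma err_summable:
  assumes \<sigma>: "\<sigma> > 0"
  shows "summable (\<lambda>n. (of_nat d + chi_freq q p k + of_real \<sigma>) * of_real L *
      integral {ll n..ll (Suc n)} (\<lambda>u. defect n u * exp (- (rate k \<sigma> * of_real u))))"
  by (rule summable_comparison_test'[of "\<lambda>n. cmod (of_nat d + chi_freq q p k + of_real \<sigma>) * (gap n * real (Suc n) powr (- 1 - \<sigma>))" 0])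
     (use abel_little_o(1)[OF gap_tendsto_0 gap_nonneg \<sigma>] err_term_bound[OF \<sigma>] in \<open>auto intro: summable_mult\<close>)

lemma cmod_err_le:
  assumes \<sigma>: "\<sigma> > 0"
  shows "cmod (err k \<sigma>) \<le> cmod (of_nat d + chi_freq q p k + of_real \<sigma>) * (\<Sum>n. gap n * real (Suc n) powr (- 1 - \<sigma>))"
proof -
  have s: "summable (\<lambda>n. gap n * real (Suc n) powr (- 1 - \<sigma>))"
    by (rule abel_little_o(1)[OF gap_tendsto_0 gap_nonneg \<sigma>])
  have "cmod (err k \<sigma>) \<le> (\<Sum>n. cmod (of_nat d + chi_freq q p k + of_real \<sigma>) * (gap n * real (Suc n) powr (- 1 - \<sigma>)))"
    unfolding err_def by (rule norm_suminf_le[OF err_term_bound[OF \<sigma>] summable_mult[OF s]])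
  also have "\<dots> = cmod (of_nat d + chi_freq q p k + of_real \<sigma>) * (\<Sum>n. gap n * real (Suc n) powr (- 1 - \<sigma>))"
    by (rule suminf_mult[OF s])
  finally show ?thesis .
qed

lemma err_tendsto_0: "((\<lambda>\<sigma>. of_real \<sigma> * err k \<sigma>) \<longlongrightarrow> 0) (at_right 0)"
proof (rule Lim_null_comparison)
  have "((\<lambda>\<sigma>. cmod (of_nat d + chi_freq q p k + of_real \<sigma>) * (\<sigma> * (\<Sum>n. gap n * real (Suc n) powr (- 1 - \<sigma>))))
     \<longlongrightarrow> cmod (of_nat d + chi_freq q p k + of_real 0) * 0) (at_right 0)"
    by (intro tendsto_intros abel_little_o(2)[OF gap_tendsto_0 gap_nonneg])
  then show "((\<lambda>\<sigma>. cmod (of_nat d + chi_freq q p k + of_real \<sigma>) * (\<sigma> * (\<Sum>n. gap n * real (Suc n) powr (- 1 - \<sigma>)))) \<longlongrightarrow> 0) (at_right 0)"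
    by simp
  show "\<forall>\<^sub>F \<sigma> in at_right 0. cmod (of_real \<sigma> * err k \<sigma>)
     \<le> cmod (of_nat d + chi_freq q p k + of_real \<sigma>) * (\<sigma> * (\<Sum>n. gap n * real (Suc n) powr (- 1 - \<sigma>)))"
    using eventually_at_right_less[of 0]
  proof eventually_elim
    case (elim \<sigma>)
    then show ?case using mult_left_mono[OF cmod_err_le[OF elim, of k], of \<sigma>] by (simp add: norm_mult mult_ac)
  qed
qed

text \<open>By the expansion the partial sums are of order \<open>M powr d\<close> times a
  logarithm, and the weight has modulus \<open>M powr (- d - \<sigma>)\<close>.\<close>

lemma boundary_tendsto_0:
  assumes \<sigma>: "\<sigma> > 0"
  shows "(\<lambda>M. A (Suc M) * of_nat (Suc M) powr (- (of_nat d + chi_freq q p k + of_real \<sigma>))) \<longlonglongrightarrow> 0"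
proof -
  obtain B where B: "B \<ge> 0" "\<And>x. cmod (\<Psi> x) \<le> B"
    using continuous_periodic_bounded[of "real p" \<Psi>] p cont per by auto
  define \<epsilon> where "\<epsilon> N = A N / of_nat (N ^ d) - e * of_real (log (real q) (real N)) - \<Psi> (log (real q) (real N))" for N
  have "\<epsilon> \<longlonglongrightarrow> 0" using asym by (simp add: \<epsilon>_def[abs_def] A_def)
  then have ev: "\<forall>\<^sub>F M in sequentially. cmod (\<epsilon> (Suc M)) < 1"
    using order_tendstoD(2)[OF LIMSEQ_Suc[OF tendsto_norm_zero], of \<epsilon> 1] by simp
  show ?thesis
  proof (rule Lim_null_comparison)
    show "(\<lambda>M. (1 + cmod e * (ln (real (Suc M)) / L) + B) * real (Suc M) powr (- \<sigma>)) \<longlonglongrightarrow> 0"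
    proof -
      have "(\<lambda>M. real (Suc M) powr (- \<sigma>)) \<longlonglongrightarrow> 0" "(\<lambda>M. ln (real (Suc M)) * real (Suc M) powr (- \<sigma>)) \<longlonglongrightarrow> 0"
        using \<sigma> by real_asymp+
      then have "(\<lambda>M. (1 + B) * real (Suc M) powr (- \<sigma>) + cmod e / L * (ln (real (Suc M)) * real (Suc M) powr (- \<sigma>)))
          \<longlonglongrightarrow> (1 + B) * 0 + cmod e / L * 0"
        by (intro tendsto_intros)
      then show ?thesis by (simp add: algebra_simps)
    qed
    show "\<forall>\<^sub>F M in sequentially. cmod (A (Suc M) * of_nat (Suc M) powr (- (of_nat d + chi_freq q p k + of_real \<sigma>)))
       \<le> (1 + cmod e * (ln (real (Suc M)) / L) + B) * real (Suc M) powr (- \<sigma>)"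
      using ev
    proof eventually_elim
      case (elim M)
      have "A (Suc M) = of_nat (Suc M ^ d) * (\<epsilon> (Suc M) + e * of_real (ll M) + \<Psi> (ll M))"
        by (simp add: \<epsilon>_def ll_def del: of_nat_Suc)
      then have "cmod (A (Suc M)) = real (Suc M) ^ d * cmod (\<epsilon> (Suc M) + e * of_real (ll M) + \<Psi> (ll M))"
        by (simp add: norm_mult norm_power del: of_nat_Suc)
      also have "\<dots> \<le> real (Suc M) ^ d * (1 + cmod e * ll M + B)"
      proof (intro mult_left_mono)
        have "cmod (\<epsilon> (Suc M) + e * of_real (ll M) + \<Psi> (ll M)) \<le> cmod (\<epsilon> (Suc M)) + cmod (e * of_real (ll M)) + cmod (\<Psi> (ll M))"
          by (intro norm_triangle_mono order_refl)
        also have "\<dots> \<le> 1 + cmod e * ll M + B"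
          using elim B(2)[of "ll M"] ll_nonneg[of M] by (simp add: norm_mult)
        finally show "cmod (\<epsilon> (Suc M) + e * of_real (ll M) + \<Psi> (ll M)) \<le> 1 + cmod e * ll M + B" .
      qed simp
      finally have 1: "cmod (A (Suc M)) \<le> real (Suc M) ^ d * (1 + cmod e * ll M + B)" .
      have 2: "cmod (of_nat (Suc M) powr (- (of_nat d + chi_freq q p k + of_real \<sigma>))) = real (Suc M) powr (- real d - \<sigma>)"
        unfolding cmod_of_nat_powr by (simp add: Re_chi)
      have "cmod (A (Suc M) * of_nat (Suc M) powr (- (of_nat d + chi_freq q p k + of_real \<sigma>)))
         \<le> real (Suc M) ^ d * (1 + cmod e * ll M + B) * real (Suc M) powr (- real d - \<sigma>)"
        unfolding norm_mult 2 by (intro mult_right_mono 1) simp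
      also have "\<dots> = (1 + cmod e * ll M + B) * (real (Suc M) powr real d * real (Suc M) powr (- real d - \<sigma>))"
        by (simp add: powr_realpow del: of_nat_Suc)
      also have "real (Suc M) powr real d * real (Suc M) powr (- real d - \<sigma>) = real (Suc M) powr (- \<sigma>)"
        unfolding powr_add[symmetric] by simp
      finally show ?case by (simp only: ll_eq)
    qed
  qed
qed

lemma integral_blocks_tendsto:
  assumes \<sigma>: "\<sigma> > 0"
  shows "(\<lambda>J. integral {0..real (p * J)} (\<lambda>u. exp (- (rate k \<sigma> * of_real u)) * (e * of_real u + \<Psi> u)))
     \<longlonglongrightarrow> e / (rate k \<sigma>)\<^sup>2 + beta k \<sigma> / (1 - of_real (exp (- (\<sigma> * L * real p))))"
proof -
  define a where "a = rate k \<sigma>"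
  define \<rho> where "\<rho> = exp (- (a * of_nat p))"
  have a0: "a \<noteq> 0" using Re_rate[of k \<sigma>] \<sigma> L_pos by (auto simp: a_def)
  have \<rho>: "\<rho> = of_real (exp (- (\<sigma> * L * real p)))" by (simp add: \<rho>_def a_def exp_rate_period)
  have \<rho>1: "cmod \<rho> < 1" using \<sigma> L_pos p by (simp add: \<rho>)
  have eq: "integral {0..real (p * J)} (\<lambda>u. exp (- (a * of_real u)) * (e * of_real u + \<Psi> u))
     = e * (1 / a\<^sup>2 - (of_nat p / a * (of_nat J * \<rho> ^ J) + \<rho> ^ J * (1 / a\<^sup>2))) + (\<Sum>j<J. \<rho> ^ j) * beta k \<sigma>" for J
  proof -
    have "integral {0..real (p * J)} (\<lambda>u. exp (- (a * of_real u)) * (e * of_real u + \<Psi> u))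
       = integral {0..real (p * J)} (\<lambda>u. e * (exp (- (a * of_real u)) * of_real u) + exp (- (a * of_real u)) * \<Psi> u)"
      by (simp add: algebra_simps)
    also have "\<dots> = integral {0..real (p * J)} (\<lambda>u. e * (exp (- (a * of_real u)) * of_real u))
        + integral {0..real (p * J)} (\<lambda>u. exp (- (a * of_real u)) * \<Psi> u)"
      by (rule integral_add) (intro integrable_continuous_interval continuous_intros continuous_on_Psi)+
    also have "integral {0..real (p * J)} (\<lambda>u. e * (exp (- (a * of_real u)) * of_real u))
        = e * integral {0..real (p * J)} (\<lambda>u. exp (- (a * of_real u)) * of_real u)" by simp
    also have "integral {0..real (p * J)} (\<lambda>u. exp (- (a * of_real u)) * of_real u)
        = 1 / a\<^sup>2 - exp (- (a * of_real (real (p * J)))) * (of_real (real (p * J)) / a + 1 / a\<^sup>2)"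
      by (rule integral_exp_linear[OF a0]) simp
    also have "exp (- (a * of_real (real (p * J)))) = \<rho> ^ J"
      by (simp add: \<rho>_def exp_of_nat_mult[symmetric] mult_ac)
    also have "integral {0..real (p * J)} (\<lambda>u. exp (- (a * of_real u)) * \<Psi> u) = (\<Sum>j<J. \<rho> ^ j) * beta k \<sigma>"
      unfolding \<rho>_def beta_def a_def[symmetric] by (rule integral_periodic_blocks[OF p cont per])
    finally show ?thesis by (simp add: algebra_simps)
  qed
  have "(\<lambda>J. \<Sum>j<J. \<rho> ^ j) \<longlonglongrightarrow> 1 / (1 - \<rho>)"
    using geometric_sums[OF \<rho>1] by (simp add: sums_def)
  then have "(\<lambda>J. e * (1 / a\<^sup>2 - (of_nat p / a * (of_nat J * \<rho> ^ J) + \<rho> ^ J * (1 / a\<^sup>2))) + (\<Sum>j<J. \<rho> ^ j) * beta k \<sigma>)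
     \<longlonglongrightarrow> e * (1 / a\<^sup>2 - (of_nat p / a * 0 + 0 * (1 / a\<^sup>2))) + 1 / (1 - \<rho>) * beta k \<sigma>"
    using \<rho>1 by (intro tendsto_intros powser_times_n_limit_0 LIMSEQ_power_zero)
  then show ?thesis unfolding a_def[symmetric] eq \<rho>[symmetric] by simp
qed

text \<open>Exact Abel summation: the main term is \<open>z * L\<close> times the integral of
  \<open>exp (- rate * u) * (e * u + \<Psi> u)\<close> over the half-line. Its linear part is
  \<open>e / rate^2\<close>, its periodic part a geometric series over the periods.\<close>

lemma hser_formula:
  fixes k :: int and \<sigma> :: real
  assumes \<sigma>: "\<sigma> > 0"
  defines "z \<equiv> of_nat d + chi_freq q p k + of_real \<sigma>"
  shows "hser \<alpha> z = - \<alpha> 0 + z * of_real L *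
     (e / (rate k \<sigma>)\<^sup>2 + beta k \<sigma> / (1 - of_real (exp (- (\<sigma> * L * real p))))) + err k \<sigma>"
proof -
  define a where "a = rate k \<sigma>"
  define g where "g u = exp (- (a * of_real u)) * (e * of_real u + \<Psi> u)" for u
  define f where "f n = (of_nat n powr (- z) :: complex)" for n
  define D where "D n = z * of_real L * integral {ll n..ll (Suc n)} (\<lambda>u. defect n u * exp (- (a * of_real u)))" for n
  have contg: "continuous_on S g" for S unfolding g_def by (intro continuous_intros continuous_on_Psi)
  have zL: "z * of_real L = of_nat d * of_real L + a" by (simp add: z_def a_def rate_def algebra_simps)
  have T: "A (Suc (Suc n)) * (f (Suc n) - f (Suc (Suc n))) = D n + z * of_real L * integral {ll n..ll (Suc n)} g" for n
  proof -
    have "f (Suc m) = exp (- (z * of_real L * of_real (ll m)))" for m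
      unfolding f_def ll_def L_def using q by (intro of_nat_powr_exp_log) auto
    then have "f (Suc n) - f (Suc (Suc n)) = z * of_real L * integral {ll n..ll (Suc n)} (\<lambda>u. exp (- (z * of_real L * of_real u)))"
      using integral_exp_log_interval[OF ll_mono, of z L n] by simp
    then have "A (Suc (Suc n)) * (f (Suc n) - f (Suc (Suc n)))
        = z * of_real L * integral {ll n..ll (Suc n)} (\<lambda>u. A (Suc (Suc n)) * exp (- (z * of_real L * of_real u)))"
      by simp
    also have "integral {ll n..ll (Suc n)} (\<lambda>u. A (Suc (Suc n)) * exp (- (z * of_real L * of_real u)))
        = integral {ll n..ll (Suc n)} (\<lambda>u. defect n u * exp (- (a * of_real u)) + g u)"
    proof (rule integral_cong)
      fix u
      have "exp (- (z * of_real L * of_real u)) = exp (- (of_nat d * of_real L * of_real u)) * exp (- (a * of_real u))"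
        unfolding zL by (simp add: exp_add[symmetric] algebra_simps)
      then show "A (Suc (Suc n)) * exp (- (z * of_real L * of_real u)) = defect n u * exp (- (a * of_real u)) + g u"
        by (simp add: defect_def g_def algebra_simps)
    qed
    also have "\<dots> = integral {ll n..ll (Suc n)} (\<lambda>u. defect n u * exp (- (a * of_real u))) + integral {ll n..ll (Suc n)} g"
      by (rule integral_add) (intro integrable_continuous_interval continuous_intros continuous_on_defect contg)+
    finally show ?thesis by (simp add: D_def algebra_simps)
  qed
  have sumI: "(\<Sum>n<M. integral {ll n..ll (Suc n)} g) = integral {0..ll M} g" for M
  proof (induction M)
    case (Suc M)
    have "integral {0..ll M} g + integral {ll M..ll (Suc M)} g = integral {0..ll (Suc M)} g"
      by (rule Henstock_Kurzweil_Integration.integral_combine)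
         (auto intro!: integrable_continuous_interval contg ll_nonneg ll_mono)
    then show ?case using Suc by simp
  qed simp
  have part: "(\<Sum>n<M. \<alpha> (Suc n) * f (Suc n)) = A (Suc M) * f (Suc M) - \<alpha> 0 + (\<Sum>n<M. D n)
      + z * of_real L * integral {0..ll M} g" for M
  proof -
    have "(\<Sum>n<M. A (Suc (Suc n)) * (f (Suc n) - f (Suc (Suc n)))) = (\<Sum>n<M. D n) + z * of_real L * integral {0..ll M} g"
      unfolding T sum.distrib sum_distrib_left[symmetric] sumI ..
    moreover have "f 1 = 1" by (simp add: f_def)
    ultimately show ?thesis
      using abel_partial_summation[of \<alpha> f M, folded A_def] by simp
  qed
  have Rez: "Re z > real d" using \<sigma> by (simp add: z_def Re_chi)
  have "(\<lambda>n. \<alpha> n * f n) sums hser \<alpha> z"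
    unfolding hser_def f_def
    by (intro summable_sums summable_norm_cancel[OF hser_summable[OF growth Rez]])
  then have "(\<lambda>n. \<alpha> (Suc n) * f (Suc n)) sums hser \<alpha> z"
    by (subst sums_Suc_iff) (simp add: f_def)
  then have lim1: "(\<lambda>M. \<Sum>n<M. \<alpha> (Suc n) * f (Suc n)) \<longlonglongrightarrow> hser \<alpha> z" by (simp add: sums_def)
  have lim2: "(\<lambda>M. A (Suc M) * f (Suc M)) \<longlonglongrightarrow> 0"
    unfolding f_def z_def by (rule boundary_tendsto_0[OF \<sigma>])
  have lim3: "(\<lambda>M. \<Sum>n<M. D n) \<longlonglongrightarrow> err k \<sigma>"
    using summable_sums[OF err_summable[OF \<sigma>, of k]] by (simp add: sums_def D_def[abs_def] err_def z_def a_def)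
  have "(\<lambda>M. (\<Sum>n<M. \<alpha> (Suc n) * f (Suc n)) - A (Suc M) * f (Suc M) + \<alpha> 0 - (\<Sum>n<M. D n)) \<longlonglongrightarrow> hser \<alpha> z - 0 + \<alpha> 0 - err k \<sigma>"
    by (intro tendsto_intros lim1 lim2 lim3)
  then have lim4: "(\<lambda>M. z * of_real L * integral {0..ll M} g) \<longlonglongrightarrow> hser \<alpha> z + \<alpha> 0 - err k \<sigma>"
    unfolding part by simp
  \<comment> \<open>The full limit exists by \<open>lim4\<close>, so it may be computed along the
    subsequence \<open>M = q ^ (p * J) - 1\<close>, for which \<open>ll M\<close> is a whole number
    of periods.\<close>
  define m where "m J = q ^ (p * J) - 1" for J
  have m: "ll (m J) = real (p * J)" for J
  proof -
    have "Suc (m J) = q ^ (p * J)" using q by (simp add: m_def)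
    then show ?thesis using q by (simp add: ll_def log_nat_power)
  qed
  have "filterlim m at_top sequentially"
  proof (rule filterlim_at_top_mono[OF filterlim_ident])
    have "J \<le> m J" for J
    proof -
      have "J < 2 ^ J" by (rule less_exp)
      also have "(2::nat) ^ J \<le> q ^ J" using q by (intro power_mono) auto
      also have "q ^ J \<le> q ^ (p * J)" using q p by (intro power_increasing) auto
      finally show ?thesis by (simp add: m_def)
    qed
    then show "\<forall>\<^sub>F J in sequentially. J \<le> m J" by simp
  qed
  then have "(\<lambda>J. z * of_real L * integral {0..ll (m J)} g) \<longlonglongrightarrow> hser \<alpha> z + \<alpha> 0 - err k \<sigma>"
    by (rule filterlim_compose[OF lim4])
  moreover have "(\<lambda>J. z * of_real L * integral {0..ll (m J)} g) \<longlonglongrightarrow> z * of_real L *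
      (e / (rate k \<sigma>)\<^sup>2 + beta k \<sigma> / (1 - of_real (exp (- (\<sigma> * L * real p)))))"
    unfolding m g_def a_def by (intro tendsto_intros integral_blocks_tendsto[OF \<sigma>])
  ultimately have "hser \<alpha> z + \<alpha> 0 - err k \<sigma> = z * of_real L *
      (e / (rate k \<sigma>)\<^sup>2 + beta k \<sigma> / (1 - of_real (exp (- (\<sigma> * L * real p)))))"
    by (rule LIMSEQ_unique)
  then show ?thesis by (simp add: algebra_simps)
qed

lemma beta_tendsto: "((\<lambda>\<sigma>. beta k \<sigma>) \<longlongrightarrow> of_nat p * fcoef p \<Psi> k) (at_right 0)"
proof -
  obtain B where B: "B \<ge> 0" "\<And>x. cmod (\<Psi> x) \<le> B"
    using continuous_periodic_bounded[of "real p" \<Psi>] p cont per by auto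
  have I: "of_nat p * fcoef p \<Psi> k = integral {0..real p} (\<lambda>u. fexp p (- k) u * \<Psi> u)"
    using p by (simp add: fcoef_def mult.commute)
  have "((\<lambda>\<sigma>. beta k \<sigma> - of_nat p * fcoef p \<Psi> k) \<longlongrightarrow> 0) (at_right 0)"
  proof (rule Lim_null_comparison)
    show "((\<lambda>\<sigma>. (\<sigma> * L * real p) * B * real p) \<longlongrightarrow> 0) (at_right 0)"
      by (auto intro!: tendsto_eq_intros)
    show "\<forall>\<^sub>F \<sigma> in at_right 0. cmod (beta k \<sigma> - of_nat p * fcoef p \<Psi> k) \<le> (\<sigma> * L * real p) * B * real p"
      using eventually_at_right_less[of 0]
    proof eventually_elim
      case (elim \<sigma>)
      have "beta k \<sigma> - of_nat p * fcoef p \<Psi> k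
         = integral {0..real p} (\<lambda>u. exp (- (rate k \<sigma> * of_real u)) * \<Psi> u - fexp p (- k) u * \<Psi> u)"
        unfolding beta_def I
        by (rule integral_diff[symmetric]) (intro integrable_continuous_interval continuous_intros continuous_on_Psi)+
      also have "cmod \<dots> \<le> ((\<sigma> * L * real p) * B) * (real p - 0)"
      proof (rule integral_bound)
        show "continuous_on {0..real p} (\<lambda>u. exp (- (rate k \<sigma> * of_real u)) * \<Psi> u - fexp p (- k) u * \<Psi> u)"
          by (intro continuous_intros continuous_on_Psi)
        fix u assume u: "u \<in> {0..real p}"
        define x where "x = \<sigma> * L * u"
        have x: "0 \<le> x" "x \<le> \<sigma> * L * real p" using u elim L_pos by (auto simp: x_def intro: mult_left_mono)
        have "1 - x \<le> exp (- x)" using exp_ge_add_one_self[of "- x"] by simp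
        then have ex: "\<bar>exp (- x) - 1\<bar> \<le> x" using x by (simp add: abs_if)
        have "exp (- (rate k \<sigma> * of_real u)) * \<Psi> u - fexp p (- k) u * \<Psi> u = of_real (exp (- x) - 1) * (fexp p (- k) u * \<Psi> u)"
          by (simp add: exp_rate x_def left_diff_distrib)
        then have "cmod (exp (- (rate k \<sigma> * of_real u)) * \<Psi> u - fexp p (- k) u * \<Psi> u) = \<bar>exp (- x) - 1\<bar> * cmod (\<Psi> u)"
          by (simp only: norm_mult norm_of_real norm_fexp mult_1)
        also have "\<dots> \<le> (\<sigma> * L * real p) * B"
          using ex x B by (intro mult_mono) auto
        finally show "cmod (exp (- (rate k \<sigma> * of_real u)) * \<Psi> u - fexp p (- k) u * \<Psi> u) \<le> (\<sigma> * L * real p) * B" .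
      qed simp
      finally show ?case by simp
    qed
  qed
  then show ?thesis by (simp add: LIM_zero_iff)
qed

lemma geometric_factor_tendsto:
  "((\<lambda>\<sigma>. of_real \<sigma> / (1 - of_real (exp (- (\<sigma> * L * real p))))) \<longlongrightarrow> 1 / complex_of_real (L * real p)) (at_right 0)"
proof -
  have "((\<lambda>\<sigma>. \<sigma> / (1 - exp (- (\<sigma> * (L * real p))))) \<longlongrightarrow> 1 / (L * real p)) (at_right 0)"
  proof -
    define c where "c = L * real p"
    have "c > 0" using L_pos p by (simp add: c_def)
    then have "((\<lambda>\<sigma>. \<sigma> / (1 - exp (- (\<sigma> * c)))) \<longlongrightarrow> inverse c) (at_right 0)"
      by real_asymp
    then show ?thesis by (simp add: c_def divide_inverse)
  qed
  from tendsto_of_real[OF this, where 'a = complex] show ?thesis by (simp add: mult.assoc)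
qed

text \<open>For \<open>k \<noteq> 0\<close> the rate stays away from 0, so the linear part
  disappears after multiplication by \<sigma>. The periodic part contributes
  \<open>p * c_k / (L * p)\<close> times \<open>(d + \<chi>_k) * L\<close>.\<close>

lemma hser_tendsto_nonzero:
  assumes k: "k \<noteq> 0"
  shows "((\<lambda>\<sigma>. of_real \<sigma> * hser \<alpha> (of_nat d + chi_freq q p k + of_real \<sigma>))
     \<longlongrightarrow> (of_nat d + chi_freq q p k) * fcoef p \<Psi> k) (at_right 0)"
proof -
  define \<theta> where "\<theta> = chi_freq q p k"
  have L0: "complex_of_real L \<noteq> 0" using L_pos by simp
  have \<theta>0: "\<theta> \<noteq> 0" using k q p L_pos by (simp add: \<theta>_def chi_freq_def L_def)
  have "((\<lambda>\<sigma>. of_real \<sigma> * (- \<alpha> 0) + (of_nat d + \<theta> + of_real \<sigma>) * of_real L *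
      (of_real \<sigma> * (e / ((\<theta> + of_real \<sigma>) * of_real L)\<^sup>2)
        + beta k \<sigma> * (of_real \<sigma> / (1 - of_real (exp (- (\<sigma> * L * real p)))))) + of_real \<sigma> * err k \<sigma>)
     \<longlongrightarrow> of_real 0 * (- \<alpha> 0) + (of_nat d + \<theta> + of_real 0) * of_real L *
      (of_real 0 * (e / ((\<theta> + of_real 0) * of_real L)\<^sup>2)
        + (of_nat p * fcoef p \<Psi> k) * (1 / complex_of_real (L * real p))) + 0) (at_right 0)"
    using \<theta>0 L0 by (intro tendsto_intros beta_tendsto geometric_factor_tendsto err_tendsto_0) auto
  also have "of_real 0 * (- \<alpha> 0) + (of_nat d + \<theta> + of_real 0) * of_real L *
      (of_real 0 * (e / ((\<theta> + of_real 0) * of_real L)\<^sup>2)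
        + (of_nat p * fcoef p \<Psi> k) * (1 / complex_of_real (L * real p))) + 0 = (of_nat d + \<theta>) * fcoef p \<Psi> k"
    using L0 p by simp
  finally show ?thesis
    unfolding \<theta>_def[symmetric]
  proof (rule Lim_transform_eventually)
    show "\<forall>\<^sub>F \<sigma> in at_right 0. of_real \<sigma> * (- \<alpha> 0) + (of_nat d + \<theta> + of_real \<sigma>) * of_real L *
      (of_real \<sigma> * (e / ((\<theta> + of_real \<sigma>) * of_real L)\<^sup>2)
        + beta k \<sigma> * (of_real \<sigma> / (1 - of_real (exp (- (\<sigma> * L * real p)))))) + of_real \<sigma> * err k \<sigma>
      = of_real \<sigma> * hser \<alpha> (of_nat d + \<theta> + of_real \<sigma>)"
      using eventually_at_right_less[of 0]
    proof eventually_elim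
      case (elim \<sigma>)
      have "x * (- a + w * (E + b / D) + r) = x * (- a) + w * (x * E + b * (x / D)) + x * r"
        for x a w E b D r :: complex
        by (simp add: algebra_simps)
      then show ?case
        unfolding \<theta>_def hser_formula[OF elim] rate_def by (simp only:)
    qed
  qed
qed

text \<open>Here the rate is \<open>\<sigma> * L\<close>, and
  \<open>(d + \<sigma>) * L * e / (\<sigma> * L)^2\<close> splits into
  \<open>d * e / (L * \<sigma>^2)\<close> and \<open>e / (L * \<sigma>)\<close>. The second part is
  the source of the summand with \<open>e / (d * ln q)\<close> in the formula for
  \<open>c_0\<close>.\<close>

lemma hser_tendsto_zero:
  "((\<lambda>\<sigma>. of_real \<sigma> * hser \<alpha> (of_nat d + of_real \<sigma>) - of_nat d * e / of_real (L * \<sigma>))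
     \<longlongrightarrow> of_nat d * fcoef p \<Psi> 0 + e / of_real L) (at_right 0)"
proof -
  have L0: "complex_of_real L \<noteq> 0" using L_pos by simp
  have "((\<lambda>\<sigma>. of_real \<sigma> * (- \<alpha> 0) + e / of_real L + (of_nat d + of_real \<sigma>) * of_real L *
      (beta 0 \<sigma> * (of_real \<sigma> / (1 - of_real (exp (- (\<sigma> * L * real p)))))) + of_real \<sigma> * err 0 \<sigma>)
     \<longlongrightarrow> of_real 0 * (- \<alpha> 0) + e / of_real L + (of_nat d + of_real 0) * of_real L *
      ((of_nat p * fcoef p \<Psi> 0) * (1 / complex_of_real (L * real p))) + 0) (at_right 0)"
    using L0 by (intro tendsto_intros beta_tendsto geometric_factor_tendsto err_tendsto_0) auto
  also have "of_real 0 * (- \<alpha> 0) + e / of_real L + (of_nat d + of_real 0) * of_real L *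
      ((of_nat p * fcoef p \<Psi> 0) * (1 / complex_of_real (L * real p))) + 0 = of_nat d * fcoef p \<Psi> 0 + e / of_real L"
    using L0 p by simp
  finally show ?thesis
  proof (rule Lim_transform_eventually)
    show "\<forall>\<^sub>F \<sigma> in at_right 0. of_real \<sigma> * (- \<alpha> 0) + e / of_real L + (of_nat d + of_real \<sigma>) * of_real L *
      (beta 0 \<sigma> * (of_real \<sigma> / (1 - of_real (exp (- (\<sigma> * L * real p)))))) + of_real \<sigma> * err 0 \<sigma>
      = of_real \<sigma> * hser \<alpha> (of_nat d + of_real \<sigma>) - of_nat d * e / of_real (L * \<sigma>)"
      using eventually_at_right_less[of 0]
    proof eventually_elim
      case (elim \<sigma>)
      have chi0: "chi_freq q p 0 = 0" by (simp add: chi_freq_def)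
      define s where "s = complex_of_real \<sigma>"
      have s: "s \<noteq> 0" using elim by (simp add: s_def)
      define G where "G = beta 0 \<sigma> / (1 - complex_of_real (exp (- (\<sigma> * L * real p))))"
      define E where "E = e / (s * complex_of_real L)\<^sup>2"
      define w where "w = of_nat d * e / (complex_of_real L * s)"
      have h: "hser \<alpha> (of_nat d + s) = - \<alpha> 0 + (of_nat d + s) * of_real L * (E + G) + err 0 \<sigma>"
        using hser_formula[OF elim, of 0] by (simp add: chi0 rate_def s_def G_def E_def)
      have "s * hser \<alpha> (of_nat d + s) - w
         = s * (- \<alpha> 0) + (s * ((of_nat d + s) * of_real L * E) - w)
           + (of_nat d + s) * of_real L * (s * G) + s * err 0 \<sigma>"
        unfolding h by (simp add: algebra_simps)
      also have "s * ((of_nat d + s) * of_real L * E) - w = e / of_real L"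
        unfolding E_def w_def using s L0 by (simp add: field_simps power2_eq_square)
      finally show ?case by (simp add: s_def G_def w_def mult_ac)
    qed
  qed
qed

end

section \<open>Hoelder continuity of the fluctuation\<close>

lemma geometric_telescope_bound:
  fixes u :: "nat \<Rightarrow> complex"
  assumes "u \<longlonglongrightarrow> l" "\<And>j. cmod (u (Suc j) - u j) \<le> K * r ^ j" "0 \<le> r" "r < 1" "K \<ge> 0"
  shows "cmod (l - u 0) \<le> K / (1 - r)"
proof -
  have "cmod (u J - u 0) \<le> K / (1 - r)" for J
  proof -
    have "u J - u 0 = (\<Sum>j<J. u (Suc j) - u j)" by (simp add: sum_lessThan_telescope)
    then have "cmod (u J - u 0) \<le> (\<Sum>j<J. K * r ^ j)"
      using assms(2) by (auto intro: order_trans[OF norm_sum sum_mono])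
    also have "\<dots> = K * (\<Sum>j<J. r ^ j)" by (simp add: sum_distrib_left)
    also have "\<dots> \<le> K * (\<Sum>j. r ^ j)"
      using assms by (intro mult_left_mono sum_le_suminf summable_geometric) auto
    also have "\<dots> = K / (1 - r)" using assms by (simp add: suminf_geometric)
    finally show ?thesis .
  qed
  moreover have "(\<lambda>J. cmod (u J - u 0)) \<longlonglongrightarrow> cmod (l - u 0)" by (intro tendsto_intros assms)
  ultimately show ?thesis by (intro LIMSEQ_le_const2) auto
qed

lemma nat_floor_ge_half: "y \<ge> 1 \<Longrightarrow> y / 2 \<le> real (nat \<lfloor>y\<rfloor>)" "y \<ge> 0 \<Longrightarrow> real (nat \<lfloor>y\<rfloor>) \<le> y" for y :: real
proof -
  show "y / 2 \<le> real (nat \<lfloor>y\<rfloor>)" if "y \<ge> 1"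
  proof -
    have "real (nat \<lfloor>y\<rfloor>) = of_int \<lfloor>y\<rfloor>" using that by simp
    moreover have "of_int \<lfloor>y\<rfloor> \<ge> (1 :: real)" using that by simp
    moreover have "y < of_int \<lfloor>y\<rfloor> + 1" by linarith
    ultimately show ?thesis by linarith
  qed
  show "real (nat \<lfloor>y\<rfloor>) \<le> y" if "y \<ge> 0" using that by simp
qed

context abel_asymptotics
begin

text \<open>The restriction \<open>m \<le> N\<close> keeps all logarithms in the range below
  \<open>1 + ln N\<close>, as \<open>ln 2 < 1\<close>.\<close>

lemma A_increment_bound:
  obtains C where "C \<ge> 0"
    "\<And>N m. N \<ge> 1 \<Longrightarrow> m \<le> N \<Longrightarrow> cmod (A (N + m) - A N) \<le> C * real m * real (N + m) powr (real d - 1) * (1 + ln (real N))"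
proof -
  obtain C where C: "C \<ge> 0" "\<And>n. n \<ge> 1 \<Longrightarrow> cmod (\<alpha> n) \<le> C * real n powr (real d - 1) * (1 + ln (real n))"
    using growth by (auto simp: log_growth_def)
  have "cmod (A (N + m) - A N) \<le> (2 * C) * real m * real (N + m) powr (real d - 1) * (1 + ln (real N))"
    if N: "N \<ge> 1" "m \<le> N" for N m
  proof -
    have "A (N + m) - A N = (\<Sum>K\<in>{N..<N + m}. \<alpha> K)"
    proof -
      have "A (N + m) = A N + (\<Sum>K\<in>{N..<N + m}. \<alpha> K)"
        unfolding A_def lessThan_atLeast0
        by (rule sum.atLeastLessThan_concat[symmetric]) auto
      then show ?thesis by simp
    qed
    also have "cmod \<dots> \<le> (\<Sum>K\<in>{N..<N + m}. C * real (N + m) powr (real d - 1) * (2 * (1 + ln (real N))))"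
    proof (rule order_trans[OF norm_sum sum_mono])
      fix K assume K: "K \<in> {N..<N + m}"
      have "ln (real K) \<le> ln (2 * real N)" using K N by (subst ln_le_cancel_iff) auto
      also have "\<dots> = ln 2 + ln (real N)" using N by (simp add: ln_mult)
      also have "\<dots> \<le> 1 + ln (real N)" using ln_2_less_1 by simp
      finally have "ln (real K) \<le> 1 + ln (real N)" .
      moreover have "0 \<le> ln (real N)" using N by simp
      moreover have "1 + a \<le> 2 * (1 + b)" if "a \<le> 1 + b" "0 \<le> b" for a b :: real
        using that by simp
      ultimately have "1 + ln (real K) \<le> 2 * (1 + ln (real N))" by blast
      moreover have "1 + ln (real K) \<ge> 0" using K N by (simp add: add_nonneg_nonneg)
      moreover have "real K powr (real d - 1) \<le> real (N + m) powr (real d - 1)"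
        using K N d by (intro powr_mono2) auto
      ultimately have "C * real K powr (real d - 1) * (1 + ln (real K)) \<le> C * real (N + m) powr (real d - 1) * (2 * (1 + ln (real N)))"
        using C(1) by (intro mult_mono mult_left_mono) auto
      then show "cmod (\<alpha> K) \<le> C * real (N + m) powr (real d - 1) * (2 * (1 + ln (real N)))"
        using C(2)[of K] K N by simp
    qed
    also have "\<dots> = (2 * C) * real m * real (N + m) powr (real d - 1) * (1 + ln (real N))" by simp
    finally show ?thesis .
  qed
  then show ?thesis using that[of "2 * C"] C(1) by auto
qed

lemma A_bound:
  obtains C where "C \<ge> 0" "\<And>N. N \<ge> 1 \<Longrightarrow> cmod (A N) / real N ^ d \<le> C * (1 + ln (real N))"
proof -
  obtain C where C: "C \<ge> 0" "\<And>n. n \<ge> 1 \<Longrightarrow> cmod (\<alpha> n) \<le> C * real n powr (real d - 1) * (1 + ln (real n))"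
    using growth by (auto simp: log_growth_def)
  have "cmod (A N) / real N ^ d \<le> (cmod (\<alpha> 0) + C) * (1 + ln (real N))" if N: "N \<ge> 1" for N
  proof -
    have "cmod (A N) \<le> (\<Sum>K<N. (cmod (\<alpha> 0) + C) * (real N powr (real d - 1) * (1 + ln (real N))))"
      unfolding A_def
    proof (rule order_trans[OF norm_sum sum_mono])
      fix K assume K: "K \<in> {..<N}"
      have N1: "1 \<le> real N powr (real d - 1)" using N d by (intro ge_one_powr_ge_zero) auto
      have l0: "0 \<le> ln (real N)" using N by simp
      have "1 * 1 \<le> real N powr (real d - 1) * (1 + ln (real N))" using N1 l0 by (intro mult_mono) auto
      then have P: "1 \<le> real N powr (real d - 1) * (1 + ln (real N))" by simp
      show "cmod (\<alpha> K) \<le> (cmod (\<alpha> 0) + C) * (real N powr (real d - 1) * (1 + ln (real N)))"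
      proof (cases "K = 0")
        case True
        have "cmod (\<alpha> 0) * 1 \<le> (cmod (\<alpha> 0) + C) * (real N powr (real d - 1) * (1 + ln (real N)))"
          using P C(1) by (intro mult_mono) auto
        then show ?thesis using True by simp
      next
        case False
        then have "cmod (\<alpha> K) \<le> C * real K powr (real d - 1) * (1 + ln (real K))" using C(2) by simp
        also have "\<dots> \<le> C * real N powr (real d - 1) * (1 + ln (real N))"
          using K False C(1) d N by (intro mult_mono powr_mono2 add_mono) (auto simp: add_nonneg_nonneg)
        also have "\<dots> \<le> (cmod (\<alpha> 0) + C) * (real N powr (real d - 1) * (1 + ln (real N)))"
          using P by (simp add: distrib_right mult.assoc)
        finally show ?thesis .
      qed
    qed
    also have "\<dots> = (cmod (\<alpha> 0) + C) * (1 + ln (real N)) * (real N * real N powr (real d - 1))" by simp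
    also have "real N * real N powr (real d - 1) = real N ^ d"
      using N by (simp add: powr_realpow[symmetric] powr_diff)
    finally show ?thesis using N by (simp add: divide_le_eq)
  qed
  then show ?thesis using that[of "cmod (\<alpha> 0) + C"] C(1) by auto
qed

text \<open>The expansion is solved for \<Psi> at \<open>N + m\<close> and at \<open>N\<close>. The
  normalized sums and the linear terms differ by O(m / N) up to a logarithm, and the two error terms
  give \<open>N powr (- \<delta>)\<close>.\<close>

lemma Psi_step_bound:
  assumes \<xi>: "\<xi> > 0"
    and rate: "\<And>N. N \<ge> N0 \<Longrightarrow> cmod (A N / of_nat (N ^ d) - e * of_real (log (real q) (real N))
       - \<Psi> (log (real q) (real N))) \<le> C0 * (real N powr (- \<xi>) * ln (real N))"
  obtains C N1 \<delta> where "C \<ge> 0" "N1 \<ge> 1" "0 < \<delta>" "\<delta> \<le> 1/2"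
    "\<And>N m. N \<ge> N1 \<Longrightarrow> m \<le> N \<Longrightarrow> cmod (\<Psi> (log (real q) (real (N + m))) - \<Psi> (log (real q) (real N)))
        \<le> C * (real m / real N * (1 + ln (real N)) + real N powr (- \<delta>))"
proof -
  obtain C1 where C1: "C1 \<ge> 0" "\<And>N m. N \<ge> 1 \<Longrightarrow> m \<le> N \<Longrightarrow> cmod (A (N + m) - A N) \<le> C1 * real m * real (N + m) powr (real d - 1) * (1 + ln (real N))"
    using A_increment_bound by blast
  obtain C2 where C2: "C2 \<ge> 0" "\<And>N. N \<ge> 1 \<Longrightarrow> cmod (A N) / real N ^ d \<le> C2 * (1 + ln (real N))"
    using A_bound by blast
  \<comment> \<open>Half of \<xi> absorbs the logarithm in the error term; the cap 1/2 ensures later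
    that \<open>(1 + ln N) / N\<close> is dominated by a multiple of
    \<open>N powr (- \<delta>)\<close>.\<close>
  define \<delta> where "\<delta> = min (\<xi> / 2) (1 / 2)"
  have \<delta>: "0 < \<delta>" "\<delta> \<le> 1/2" "\<delta> \<le> \<xi> / 2" using \<xi> by (auto simp: \<delta>_def)
  define K where "K = C1 + C2 * real d + cmod e / L"
  define K' where "K' = 2 * \<bar>C0\<bar> * (1 + 2 / \<xi>)"
  have K: "K \<ge> 0" "K' \<ge> 0" using C1(1) C2(1) L_pos \<xi> by (auto simp: K_def K'_def)
  define N1 where "N1 = max N0 1"
  define \<epsilon> where "\<epsilon> N = A N / of_nat (N ^ d) - e * of_real (log (real q) (real N)) - \<Psi> (log (real q) (real N))" for N
  have eps: "cmod (\<epsilon> (N + m)) \<le> \<bar>C0\<bar> * (1 + 2 / \<xi>) * real N powr (- \<delta>)" if N: "N \<ge> N1" "m \<le> N" for N m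
  proof -
    have N': "N \<ge> 1" "N + m \<ge> N0" using N by (auto simp: N1_def)
    have "cmod (\<epsilon> (N + m)) \<le> C0 * (real (N + m) powr (- \<xi>) * ln (real (N + m)))"
      unfolding \<epsilon>_def using N' by (intro rate) auto
    also have "\<dots> \<le> \<bar>C0\<bar> * (real (N + m) powr (- \<xi>) * (1 + ln (real (N + m))))"
      using N' by (intro mult_mono) auto
    also have "\<dots> \<le> \<bar>C0\<bar> * (real (N + m) powr (- \<xi>) * ((1 + 1 / (\<xi>/2)) * real (N + m) powr (\<xi>/2)))"
      using N' \<xi> by (intro mult_left_mono one_plus_ln_le_powr) auto
    also have "\<dots> = \<bar>C0\<bar> * (1 + 2 / \<xi>) * (real (N + m) powr (- \<xi>) * real (N + m) powr (\<xi>/2))" by simp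
    also have "real (N + m) powr (- \<xi>) * real (N + m) powr (\<xi>/2) = real (N + m) powr (- (\<xi> / 2))"
      unfolding powr_add[symmetric] by simp
    also have "real (N + m) powr (- (\<xi> / 2)) \<le> real N powr (- (\<xi> / 2))"
      using N' \<xi> by (intro powr_mono2') auto
    also have "\<dots> \<le> real N powr (- \<delta>)" using N' \<delta> by (intro powr_mono) auto
    finally show ?thesis using \<xi> by (simp add: mult_left_mono)
  qed
  have "cmod (\<Psi> (log (real q) (real (N + m))) - \<Psi> (log (real q) (real N)))
        \<le> (K + K') * (real m / real N * (1 + ln (real N)) + real N powr (- \<delta>))" if N: "N \<ge> N1" "m \<le> N" for N m
  proof -
    have N': "N \<ge> 1" using N by (auto simp: N1_def)
    define E where "E n = A n / of_nat (n ^ d)" for n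
    define l0 where "l0 = 1 + ln (real N)"
    have l0: "l0 \<ge> 1" using N' by (simp add: l0_def)
    define t where "t = real N / real (N + m)"
    have t: "0 < t" "t \<le> 1" "1 - t = real m / real (N + m)" using N' by (auto simp: t_def field_simps)
    have mN: "real m / real (N + m) \<le> real m / real N" using N' by (intro divide_left_mono) auto
    have "E (N + m) - E N = (A (N + m) - A N) / of_nat ((N + m) ^ d) - E N * of_real (1 - t ^ d)"
    proof -
      define a b where "a = complex_of_nat ((N + m) ^ d)" and "b = complex_of_nat (N ^ d)"
      have "a \<noteq> 0" "b \<noteq> 0"
        unfolding a_def b_def of_nat_eq_0_iff using N' by auto
      moreover have "complex_of_real (t ^ d) = b / a" by (simp add: t_def a_def b_def power_divide)
      ultimately show ?thesis unfolding E_def a_def[symmetric] b_def[symmetric] of_real_diff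
        by (simp add: field_simps)
    qed
    then have "cmod (E (N + m) - E N) \<le> cmod ((A (N + m) - A N) / of_nat ((N + m) ^ d)) + cmod (E N * of_real (1 - t ^ d))"
      by (simp only: norm_triangle_ineq4)
    also have "cmod ((A (N + m) - A N) / of_nat ((N + m) ^ d)) \<le> C1 * l0 * (real m / real N)"
    proof -
      have "cmod ((A (N + m) - A N) / of_nat ((N + m) ^ d)) = cmod (A (N + m) - A N) / real (N + m) ^ d"
        by (simp add: norm_divide norm_power del: of_nat_add)
      also have "\<dots> \<le> (C1 * real m * real (N + m) powr (real d - 1) * l0) / real (N + m) ^ d"
        unfolding l0_def using C1(2)[OF N' N(2)] by (intro divide_right_mono) auto
      also have "\<dots> = C1 * l0 * (real m * (real (N + m) powr (real d - 1) / real (N + m) ^ d))" by simp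
      also have "real (N + m) powr (real d - 1) / real (N + m) ^ d = 1 / real (N + m)"
        using N' by (simp add: powr_realpow[symmetric] powr_diff del: of_nat_add)
      also have "C1 * l0 * (real m * (1 / real (N + m))) \<le> C1 * l0 * (real m / real N)"
        using C1(1) l0 mN by (intro mult_left_mono) auto
      finally show ?thesis .
    qed
    also have "cmod (E N * of_real (1 - t ^ d)) \<le> C2 * real d * l0 * (real m / real N)"
    proof -
      have "1 - t ^ d \<le> real d * (1 - t)"
        using Bernoulli_inequality[of "t - 1" d] t by (simp add: algebra_simps)
      also have "\<dots> \<le> real d * (real m / real N)" using mN by (simp only: t(3)) (intro mult_left_mono, auto)
      finally have 1: "1 - t ^ d \<le> real d * (real m / real N)" .
      have 2: "0 \<le> 1 - t ^ d" using t by (simp add: power_le_one)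
      have "cmod (E N) \<le> C2 * l0" using C2(2)[OF N'] by (simp add: E_def l0_def norm_divide norm_power)
      then have "cmod (E N) * (1 - t ^ d) \<le> (C2 * l0) * (real d * (real m / real N))"
        using 1 2 C2(1) l0 by (intro mult_mono) auto
      then show ?thesis using 2 unfolding norm_mult norm_of_real by (simp add: mult_ac)
    qed
    finally have 1: "cmod (E (N + m) - E N) \<le> (C1 + C2 * real d) * l0 * (real m / real N)"
      by (simp add: algebra_simps)
    have 2: "cmod (e * of_real (log (real q) (real (N + m)) - log (real q) (real N))) \<le> cmod e / L * l0 * (real m / real N)"
    proof -
      have "log (real q) (real (N + m)) - log (real q) (real N) = ln (real (N + m) / real N) / L"
        using N' by (simp add: log_def L_def ln_div diff_divide_distrib)
      also have "real (N + m) / real N = 1 + real m / real N" using N' by (simp add: field_simps)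
      finally have eq: "log (real q) (real (N + m)) - log (real q) (real N) = ln (1 + real m / real N) / L" .
      have "ln (1 + real m / real N) \<le> real m / real N" by (rule ln_add_one_self_le_self) simp
      then have "log (real q) (real (N + m)) - log (real q) (real N) \<le> (real m / real N) / L"
        unfolding eq using L_pos by (intro divide_right_mono) auto
      moreover have "0 \<le> log (real q) (real (N + m)) - log (real q) (real N)"
        unfolding eq using L_pos by (intro divide_nonneg_pos ln_ge_zero) auto
      ultimately have "cmod (e * of_real (log (real q) (real (N + m)) - log (real q) (real N))) \<le> cmod e * ((real m / real N) / L)"
        unfolding norm_mult norm_of_real by (intro mult_left_mono) auto
      also have "\<dots> = cmod e / L * 1 * (real m / real N)" by simp
      also have "\<dots> \<le> cmod e / L * l0 * (real m / real N)"
        using l0 L_pos by (intro mult_right_mono mult_left_mono) auto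
      finally show ?thesis .
    qed
    have "\<Psi> (log (real q) (real (N + m))) - \<Psi> (log (real q) (real N))
       = (E (N + m) - E N) - e * of_real (log (real q) (real (N + m)) - log (real q) (real N)) - \<epsilon> (N + m) + \<epsilon> N"
      by (simp add: \<epsilon>_def E_def algebra_simps)
    also have "cmod \<dots> \<le> cmod (E (N + m) - E N) + cmod (e * of_real (log (real q) (real (N + m)) - log (real q) (real N)))
        + cmod (\<epsilon> (N + m)) + cmod (\<epsilon> N)"
      by (intro norm_triangle_le norm_triangle_le_diff add_mono order_refl)
    also have "\<dots> \<le> (C1 + C2 * real d) * l0 * (real m / real N) + cmod e / L * l0 * (real m / real N)
        + \<bar>C0\<bar> * (1 + 2 / \<xi>) * real N powr (- \<delta>) + \<bar>C0\<bar> * (1 + 2 / \<xi>) * real N powr (- \<delta>)"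
      using 1 2 eps[OF N] eps[OF N(1), of 0] by (intro add_mono) auto
    also have "\<dots> = K * (real m / real N * l0) + K' * real N powr (- \<delta>)"
      by (simp add: K_def K'_def algebra_simps)
    also have "\<dots> \<le> (K + K') * (real m / real N * l0) + (K + K') * real N powr (- \<delta>)"
      using K l0 by (intro add_mono mult_right_mono) auto
    finally show ?thesis by (simp add: l0_def distrib_left)
  qed
  then show ?thesis using that[of "K + K'" N1 \<delta>] K \<delta> by (auto simp: N1_def)
qed

text \<open>The expansion informs about \<Psi> only at logarithms of integers. For real
  \<open>y\<close>, the floors of \<open>Q ^ j * y\<close> with \<open>Q = q ^ p\<close> have
  logarithms that approach the logarithm of \<open>y\<close> modulo the period. The floor for
  \<open>Suc j\<close> differs from \<open>Q\<close> times the floor for \<open>j\<close> by at most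
  \<open>Q\<close>, so the step bound gives a geometric series starting at the floor of
  \<open>y\<close>.\<close>

lemma Psi_floor_bound:
  fixes C \<delta> :: real and N1 :: nat
  assumes C: "C \<ge> 0" and N1: "N1 \<ge> 1" and \<delta>: "0 < \<delta>" "\<delta> \<le> 1/2"
    and step: "\<And>N m. N \<ge> N1 \<Longrightarrow> m \<le> N \<Longrightarrow> cmod (\<Psi> (log (real q) (real (N + m))) - \<Psi> (log (real q) (real N)))
        \<le> C * (real m / real N * (1 + ln (real N)) + real N powr (- \<delta>))"
  obtains K where "K \<ge> 0" "\<And>y. y \<ge> real N1 \<Longrightarrow> cmod (\<Psi> (log (real q) y) - \<Psi> (log (real q) (real (nat \<lfloor>y\<rfloor>)))) \<le> K * y powr (- \<delta>)"
proof -
  define Q where "Q = q ^ p"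
  have Q: "Q \<ge> 2"
  proof -
    have "q ^ 1 \<le> q ^ p" using q p by (intro power_increasing) auto
    then show ?thesis using q by (simp add: Q_def)
  qed
  have Qr: "real Q \<ge> 2" using Q by simp
  define r where "r = real Q powr (- \<delta>)"
  have r: "0 \<le> r" "r < 1"
    using powr_less_mono[of "- \<delta>" 0 "real Q"] \<delta> Qr by (auto simp: r_def)
  define K1 where "K1 = C * (3 * real Q + 1) * 2"
  have K1: "K1 \<ge> 0" using C by (simp add: K1_def)
  have logQ: "log (real q) (real Q ^ j * y) = real j * real p + log (real q) y" if "y > 0" for j y
    using that q by (simp add: log_mult Q_def power_mult[symmetric] log_nat_power mult.commute)
  have perj: "\<Psi> (x + real j * real p) = \<Psi> x" for x j
    using periodic_int_shift[of \<Psi> "real p" x "int j"] per by simp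
  have main: "cmod (\<Psi> (log (real q) y) - \<Psi> (log (real q) (real (nat \<lfloor>y\<rfloor>)))) \<le> K1 / (1 - r) * y powr (- \<delta>)"
    if y: "y \<ge> real N1" for y
  proof -
    have y1: "y \<ge> 1" using y N1 by linarith
    define N where "N j = nat \<lfloor>real Q ^ j * y\<rfloor>" for j
    have Qj: "real Q ^ j \<ge> 1" for j using Qr by (intro one_le_power) auto
    have Qy: "real Q ^ j * y \<ge> y" for j using mult_right_mono[OF Qj, of y] y1 by simp
    have Nge: "N j \<ge> N1" for j
      unfolding N_def using Qy[of j] y by (simp add: le_nat_floor)
    have half: "real Q ^ j * y / 2 \<le> real (N j)" "real (N j) \<le> real Q ^ j * y" for j
      using nat_floor_ge_half[of "real Q ^ j * y"] Qy[of j] y1 unfolding N_def by auto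
    define u where "u j = \<Psi> (log (real q) (real (N j)))" for j
    have lim: "u \<longlonglongrightarrow> \<Psi> (log (real q) y)"
    proof -
      have "(\<lambda>j. real (N j) / real Q ^ j) \<longlonglongrightarrow> y"
      proof (rule tendsto_sandwich)
        have "(\<lambda>j. (1 / real Q) ^ j) \<longlonglongrightarrow> 0" using Qr by (intro LIMSEQ_power_zero) auto
        then have "(\<lambda>j. y - (1 / real Q) ^ j) \<longlonglongrightarrow> y - 0" by (rule tendsto_diff[OF tendsto_const])
        then show "(\<lambda>j. y - 1 / real Q ^ j) \<longlonglongrightarrow> y" by (simp add: power_divide)
        show "\<forall>\<^sub>F j in sequentially. y - 1 / real Q ^ j \<le> real (N j) / real Q ^ j"
        proof (intro always_eventually allI)
          fix j
          have "real Q ^ j * y - 1 \<le> real (N j)"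
            unfolding N_def using Qy[of j] y1 by linarith
          then have "(real Q ^ j * y - 1) / real Q ^ j \<le> real (N j) / real Q ^ j"
            using Qr by (intro divide_right_mono) auto
          then show "y - 1 / real Q ^ j \<le> real (N j) / real Q ^ j" using Qr by (simp add: diff_divide_distrib)
        qed
        show "\<forall>\<^sub>F j in sequentially. real (N j) / real Q ^ j \<le> y"
          using half(2) Qr by (intro always_eventually allI) (simp add: field_simps)
      qed simp
      then have "(\<lambda>j. log (real q) (real (N j) / real Q ^ j)) \<longlonglongrightarrow> log (real q) y"
        using q y1 by (intro tendsto_log tendsto_const) auto
      then have "(\<lambda>j. \<Psi> (log (real q) (real (N j) / real Q ^ j))) \<longlonglongrightarrow> \<Psi> (log (real q) y)"
        using cont by (intro isCont_tendsto_compose[of "log (real q) y" \<Psi>]) (auto simp: continuous_on_eq_continuous_at)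
      moreover have "\<Psi> (log (real q) (real (N j) / real Q ^ j)) = u j" for j
      proof -
        have pos: "real (N j) / real Q ^ j > 0" using Nge[of j] N1 Qr by auto
        have "log (real q) (real (N j)) = log (real q) (real (N j) / real Q ^ j) + real j * real p"
          using logQ[OF pos, of j] Qr by simp
        then show ?thesis by (simp add: u_def perj)
      qed
      ultimately show ?thesis by simp
    qed
    have inc: "cmod (u (Suc j) - u j) \<le> (K1 * y powr (- \<delta>)) * r ^ j" for j
    proof -
      \<comment> \<open>Multiplication by \<open>Q\<close> shifts the logarithm by one period, so
        \<open>N'\<close> has the same value of \<Psi> as \<open>N j\<close> but lies within
        \<open>Q\<close> of \<open>N (Suc j)\<close>.\<close>
      define N' where "N' = Q * N j"
      have N'N1: "N' \<ge> N1" unfolding N'_def using Nge[of j] Q mult_le_mono[of 1 Q "N1" "N j"] by simp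
      have N'1: "N' \<ge> 1" using N'N1 N1 by linarith
      define m where "m = N (Suc j) - N'"
      have le: "N' \<le> N (Suc j)"
      proof -
        have "real N' \<le> real Q ^ Suc j * y"
          unfolding N'_def using mult_left_mono[OF half(2)[of j], of "real Q"] by simp
        then show ?thesis unfolding N_def by (simp add: le_nat_floor)
      qed
      have lt: "real (N (Suc j)) \<le> real N' + real Q"
      proof -
        have "real Q ^ j * y \<le> real (N j) + 1" unfolding N_def using Qy[of j] y1 by linarith
        then have "real Q * (real Q ^ j * y) \<le> real Q * (real (N j) + 1)" by (intro mult_left_mono) auto
        then show ?thesis using half(2)[of "Suc j"] by (simp add: N'_def algebra_simps)
      qed
      have Nm: "N (Suc j) = N' + m" using le by (simp add: m_def)
      have mQ: "m \<le> Q" using lt Nm by simp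
      have "1 \<le> N j" using Nge[of j] N1 by linarith
      then have "Q * 1 \<le> Q * N j" by (rule mult_le_mono2)
      then have mN: "m \<le> N'" using mQ unfolding N'_def by linarith
      have "u j = \<Psi> (log (real q) (real N'))"
      proof -
        have "real (N j) > 0" using Nge[of j] N1 by simp
        from logQ[OF this, of 1] have "log (real q) (real N') = log (real q) (real (N j)) + real 1 * real p"
          by (simp add: N'_def)
        then show ?thesis by (simp only: u_def perj)
      qed
      then have "cmod (u (Suc j) - u j) \<le> C * (real m / real N' * (1 + ln (real N')) + real N' powr (- \<delta>))"
        using step[OF N'N1 mN] by (simp add: u_def Nm)
      also have "\<dots> \<le> C * (3 * real Q * real N' powr (- \<delta>) + real N' powr (- \<delta>))"
      proof (intro mult_left_mono add_right_mono C)
        have "1 + ln (real N') \<le> (1 + 1 / (1/2)) * real N' powr (1/2)"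
          using N'1 by (intro one_plus_ln_le_powr) auto
        then have "real m / real N' * (1 + ln (real N')) \<le> real Q / real N' * (3 * real N' powr (1/2))"
          using mQ N'1 by (intro mult_mono divide_right_mono) auto
        also have "\<dots> = 3 * real Q * (real N' powr (1/2) / real N')" by simp
        also have "real N' powr (1/2) / real N' = real N' powr (1/2 - 1)"
          using N'1 by (simp only: powr_diff) simp
        also have "3 * real Q * real N' powr (1/2 - 1) \<le> 3 * real Q * real N' powr (- \<delta>)"
          using \<delta> N'1 by (intro mult_left_mono powr_mono) auto
        finally show "real m / real N' * (1 + ln (real N')) \<le> 3 * real Q * real N' powr (- \<delta>)" .
      qed
      also have "\<dots> = C * (3 * real Q + 1) * real N' powr (- \<delta>)" by (simp add: algebra_simps)
      also have "\<dots> \<le> C * (3 * real Q + 1) * (2 * y powr (- \<delta>) * r ^ j)"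
      proof (intro mult_left_mono)
        have "real N' powr (- \<delta>) \<le> (real Q ^ j * y / 2) powr (- \<delta>)"
        proof (rule powr_mono2')
          have "real (N j) \<le> real N'" unfolding N'_def using mult_right_mono[of 1 "real Q" "real (N j)"] Qr by simp
          then show "real Q ^ j * y / 2 \<le> real N'" using half(1)[of j] by linarith
          show "0 < real Q ^ j * y / 2" using y1 Qr by simp
        qed (use \<delta> in auto)
        also have "\<dots> = (real Q ^ j) powr (- \<delta>) * y powr (- \<delta>) * 2 powr \<delta>"
          using y1 Qr by (simp add: powr_mult powr_divide powr_minus field_simps)
        also have "(real Q ^ j) powr (- \<delta>) = r ^ j"
          using Qr by (simp add: r_def powr_realpow[symmetric] powr_powr mult.commute)
        also have "r ^ j * y powr (- \<delta>) * 2 powr \<delta> \<le> r ^ j * y powr (- \<delta>) * 2 powr 1"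
          using \<delta> r by (intro mult_left_mono powr_mono) auto
        finally show "real N' powr (- \<delta>) \<le> 2 * y powr (- \<delta>) * r ^ j" by (simp add: mult_ac)
      qed (use C in auto)
      finally show ?thesis unfolding K1_def by (simp only: mult_ac)
    qed
    have "cmod (\<Psi> (log (real q) y) - u 0) \<le> (K1 * y powr (- \<delta>)) / (1 - r)"
      by (rule geometric_telescope_bound[OF lim inc r]) (use K1 in simp)
    then show ?thesis by (simp add: u_def N_def)
  qed
  show ?thesis
    by (rule that[of "K1 / (1 - r)"]) (use main K1 r in auto)
qed

text \<open>By periodicity \<open>x\<close> may be replaced by the logarithm of a number \<open>y\<close> so large that the
  error \<open>y powr - \<delta>\<close> is at most \<open>h\<close>, while \<open>ln y\<close> remains of order \<open>ln (1 / h)\<close>.\<close>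

lemma Psi_holder:
  assumes \<xi>: "\<xi> > 0"
    and rate: "\<And>N. N \<ge> N0 \<Longrightarrow> cmod (A N / of_nat (N ^ d) - e * of_real (log (real q) (real N))
       - \<Psi> (log (real q) (real N))) \<le> C0 * (real N powr (- \<xi>) * ln (real N))"
  obtains C where "\<And>x h. 0 < h \<Longrightarrow> cmod (\<Psi> (x + h) - \<Psi> x) \<le> C * h powr (3/4)"
proof -
  obtain C N1 \<delta> where step: "C \<ge> 0" "N1 \<ge> 1" "0 < \<delta>" "\<delta> \<le> 1/2"
    "\<And>N m. N \<ge> N1 \<Longrightarrow> m \<le> N \<Longrightarrow> cmod (\<Psi> (log (real q) (real (N + m))) - \<Psi> (log (real q) (real N)))
        \<le> C * (real m / real N * (1 + ln (real N)) + real N powr (- \<delta>))"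
    using Psi_step_bound[OF \<xi> rate] by blast
  obtain K where K: "K \<ge> 0" "\<And>y. y \<ge> real N1 \<Longrightarrow> cmod (\<Psi> (log (real q) y) - \<Psi> (log (real q) (real (nat \<lfloor>y\<rfloor>)))) \<le> K * y powr (- \<delta>)"
    using Psi_floor_bound[OF step] by blast
  obtain B where B: "B \<ge> 0" "\<And>x. cmod (\<Psi> x) \<le> B"
    using continuous_periodic_bounded[of "real p" \<Psi>] p cont per by auto
  \<comment> \<open>\<open>D * h\<close> will bound \<open>m' / N\<close>: the increment
    \<open>Y - X\<close> gives \<open>h * L * q\<close>, rounding costs
    \<open>1 \<le> X * h\<close>, and \<open>N \<ge> X / 2\<close> doubles both.\<close>
  define D where "D = 2 * L * real q + 2"
  have D: "D \<ge> 2" using L_pos by (simp add: D_def)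
  \<comment> \<open>The first bound ensures \<open>m' \<le> N\<close>, the second that
    \<open>R\<close>, and with it \<open>X\<close>, is at least \<open>N1 + 1\<close>.\<close>
  define h0 where "h0 = min (1 / D) (real (N1 + 1) powr (- \<delta>))"
  have h0: "h0 > 0" using D by (auto simp: h0_def)
  define E where "E = 2 * K + C * (D * (1 + 4 / \<delta>) * real q ^ p + 2)"
  have E: "E \<ge> 0" using K(1) step(1) D step(3) by (simp add: E_def)
  have small: "cmod (\<Psi> (x + h) - \<Psi> x) \<le> E * h powr (3/4)" if h: "0 < h" "h \<le> h0" for x h
  proof -
    have h1: "h \<le> 1 / D" "h \<le> real (N1 + 1) powr (- \<delta>)" using h by (auto simp: h0_def)
    have "1 / D \<le> 1" using D by simp
    then have hle1: "h \<le> 1" using h1 by linarith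
    \<comment> \<open>Chosen so that \<open>R powr (- \<delta>) = h\<close>.\<close>
    define R where "R = h powr (- 1 / \<delta>)"
    have R0: "R > 0" using h by (simp add: R_def)
    obtain m :: int where m: "(x - log (real q) R) - of_int m * real p \<in> {0..real p}"
      using periodic_reduce[of "real p"] p by (metis of_nat_0_less_iff)
    define x' where "x' = x - of_int m * real p"
    have x': "log (real q) R \<le> x'" "x' \<le> log (real q) R + real p" using m by (auto simp: x'_def)
    define X where "X = real q powr x'"
    define Y where "Y = real q powr (x' + h)"
    have qr: "real q > 1" using q by simp
    have XR: "R \<le> X" "X \<le> R * real q ^ p"
    proof -
      have "real q powr (log (real q) R) \<le> X" unfolding X_def using x' qr by (intro powr_mono) auto
      then show "R \<le> X" using R0 qr by simp
      have "X \<le> real q powr (log (real q) R + real p)" unfolding X_def using x' qr by (intro powr_mono) auto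
      then show "X \<le> R * real q ^ p" using R0 qr by (simp add: powr_add powr_realpow)
    qed
    have Rd: "R powr (- \<delta>) = h" using step(3) h by (simp add: R_def powr_powr)
    have Xd: "X powr (- \<delta>) \<le> h"
      using powr_mono2'[of "- \<delta>" R X] XR(1) R0 step(3) Rd by simp
    have RN: "R \<ge> real (N1 + 1)"
    proof -
      have "R \<ge> (real (N1 + 1) powr (- \<delta>)) powr (- 1 / \<delta>)"
        unfolding R_def using h h1(2) step(3) by (intro powr_mono2') auto
      then show ?thesis using step(3) by (simp add: powr_powr)
    qed
    have XN: "X \<ge> real (N1 + 1)" using RN XR by linarith
    have X1: "X \<ge> 1" using XN by simp
    have XY: "X \<le> Y" unfolding X_def Y_def using qr h by (intro powr_mono) auto
    have YX: "Y - X \<le> X * (h * L * real q)"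
    proof -
      have "Y = X * exp (h * L)" unfolding X_def Y_def using qr by (simp add: powr_def L_def exp_add[symmetric] algebra_simps)
      moreover have "exp (h * L) - 1 \<le> h * L * real q"
      proof -
        have "1 - h * L \<le> exp (- (h * L))" using exp_ge_add_one_self[of "- (h * L)"] by simp
        then have "(1 - h * L) * exp (h * L) \<le> exp (- (h * L)) * exp (h * L)" by (intro mult_right_mono) auto
        then have "exp (h * L) - 1 \<le> h * L * exp (h * L)" by (simp add: algebra_simps exp_add[symmetric])
        also have "\<dots> \<le> h * L * exp L" using hle1 h L_pos by (intro mult_left_mono) (auto simp: mult_left_le_one_le)
        also have "exp L = real q" using q by (simp add: L_def)
        finally show ?thesis .
      qed
      ultimately have "Y - X \<le> X * (h * L * real q)"
        using mult_left_mono[of "exp (h * L) - 1" "h * L * real q" X] X1 by (simp add: algebra_simps)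
      then show ?thesis .
    qed
    define N where "N = nat \<lfloor>X\<rfloor>"
    define m' where "m' = nat \<lfloor>Y\<rfloor> - N"
    have NY: "nat \<lfloor>Y\<rfloor> = N + m'" unfolding m'_def N_def using XY by (simp add: nat_mono floor_mono)
    have Nhalf: "X / 2 \<le> real N" "real N \<le> X" using nat_floor_ge_half[of X] X1 by (auto simp: N_def)
    have NN1: "N \<ge> N1" unfolding N_def using XN by (simp add: le_nat_floor)
    have N1: "N \<ge> 1" using NN1 step(2) by linarith
    have Xinv: "1 \<le> X * h"
    proof -
      have "X powr (- 1) \<le> X powr (- \<delta>)" using X1 step(4) by (intro powr_mono) auto
      then have "1 / X \<le> h" using Xd X1 by (simp add: powr_minus_divide)
      then show ?thesis using X1 by (simp add: field_simps)
    qed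
    have m'X: "real m' \<le> X * (h * L * real q) + 1"
    proof -
      have "real (N + m') \<le> Y" using NY nat_floor_ge_half(2)[of Y] XY X1 by simp
      moreover have "real N \<ge> X - 1" unfolding N_def using X1 by linarith
      ultimately show ?thesis using YX by simp
    qed
    have m'N: "real m' / real N \<le> D * h"
    proof -
      have "real m' \<le> X * (h * L * real q) + X * h" using m'X Xinv by linarith
      also have "\<dots> = (X / 2) * (D * h)" by (simp add: D_def algebra_simps)
      also have "\<dots> \<le> real N * (D * h)" using Nhalf D h by (intro mult_right_mono) auto
      finally show ?thesis using N1 by (simp add: field_simps)
    qed
    have m'leN: "m' \<le> N"
    proof -
      have "D * h \<le> 1" using h1(1) D by (simp add: field_simps)
      then have "real m' / real N \<le> 1" using m'N by linarith
      then show ?thesis using N1 by (simp add: field_simps)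
    qed
    have logX: "log (real q) X = x'" "log (real q) Y = x' + h" using qr by (auto simp: X_def Y_def)
    have "\<Psi> (x + h) - \<Psi> x = \<Psi> (log (real q) Y) - \<Psi> (log (real q) X)"
      using periodic_int_shift[of \<Psi> "real p" x "- m"] periodic_int_shift[of \<Psi> "real p" "x + h" "- m"] per
      by (simp add: logX x'_def algebra_simps)
    also have "\<dots> = (\<Psi> (log (real q) Y) - \<Psi> (log (real q) (real (nat \<lfloor>Y\<rfloor>))))
        - (\<Psi> (log (real q) X) - \<Psi> (log (real q) (real (nat \<lfloor>X\<rfloor>))))
        + (\<Psi> (log (real q) (real (N + m'))) - \<Psi> (log (real q) (real N)))"
      by (simp add: NY[symmetric] N_def[symmetric])
    also have "cmod \<dots> \<le> cmod (\<Psi> (log (real q) Y) - \<Psi> (log (real q) (real (nat \<lfloor>Y\<rfloor>))))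
        + cmod (\<Psi> (log (real q) X) - \<Psi> (log (real q) (real (nat \<lfloor>X\<rfloor>))))
        + cmod (\<Psi> (log (real q) (real (N + m'))) - \<Psi> (log (real q) (real N)))"
      by (intro norm_triangle_le norm_triangle_le_diff add_mono order_refl)
    also have "\<dots> \<le> K * h + K * h + C * (D * h * ((1 + 4 / \<delta>) * (real q ^ p * h powr (- 1/4))) + 2 * h)"
    proof (intro add_mono)
      have "cmod (\<Psi> (log (real q) X) - \<Psi> (log (real q) (real (nat \<lfloor>X\<rfloor>)))) \<le> K * X powr (- \<delta>)"
        using XN by (intro K(2)) simp
      then show "cmod (\<Psi> (log (real q) X) - \<Psi> (log (real q) (real (nat \<lfloor>X\<rfloor>)))) \<le> K * h"
        using mult_left_mono[OF Xd K(1)] by linarith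
      have "Y powr (- \<delta>) \<le> X powr (- \<delta>)" using XY X1 step(3) by (intro powr_mono2') auto
      then have Yd: "Y powr (- \<delta>) \<le> h" using Xd by linarith
      have "cmod (\<Psi> (log (real q) Y) - \<Psi> (log (real q) (real (nat \<lfloor>Y\<rfloor>)))) \<le> K * Y powr (- \<delta>)"
        using XN XY by (intro K(2)) simp
      then show "cmod (\<Psi> (log (real q) Y) - \<Psi> (log (real q) (real (nat \<lfloor>Y\<rfloor>)))) \<le> K * h"
        using mult_left_mono[OF Yd K(1)] by linarith
      \<comment> \<open>The logarithm is traded for \<open>N powr (\<delta> / 4)\<close>, of order
        \<open>h powr (- 1/4)\<close> since \<open>N\<close> is at most a constant times
        \<open>R\<close>; this is the loss from exponent 1 to 3/4.\<close>
      have "1 + ln (real N) \<le> (1 + 4 / \<delta>) * (real q ^ p * h powr (- 1/4))"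
      proof -
        have "real N powr (\<delta>/4) \<le> (R * real q ^ p) powr (\<delta>/4)"
          using Nhalf XR step(3) by (intro powr_mono2) auto
        also have "\<dots> = R powr (\<delta>/4) * (real q ^ p) powr (\<delta>/4)"
          by (simp add: powr_mult)
        also have "R powr (\<delta>/4) = h powr (- 1/4)" using step(3) by (simp add: R_def powr_powr)
        also have "h powr (- 1/4) * (real q ^ p) powr (\<delta>/4) \<le> h powr (- 1/4) * (real q ^ p) powr 1"
          using step(3,4) qr by (intro mult_left_mono powr_mono) auto
        finally have nb: "real N powr (\<delta>/4) \<le> real q ^ p * h powr (- 1/4)"
          using qr by (simp add: mult.commute)
        have "1 + ln (real N) \<le> (1 + 1 / (\<delta>/4)) * real N powr (\<delta>/4)"
          using N1 step(3) by (intro one_plus_ln_le_powr) auto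
        also have "\<dots> \<le> (1 + 1 / (\<delta>/4)) * (real q ^ p * h powr (- 1/4))"
          using step(3) by (intro mult_left_mono nb) auto
        finally show ?thesis by simp
      qed
      moreover have "0 \<le> 1 + ln (real N)" using N1 by (simp add: add_nonneg_nonneg)
      ultimately have 1: "real m' / real N * (1 + ln (real N)) \<le> D * h * ((1 + 4 / \<delta>) * (real q ^ p * h powr (- 1/4)))"
        using m'N D h by (intro mult_mono) auto
      have 2: "real N powr (- \<delta>) \<le> 2 * h"
      proof -
        have "real N powr (- \<delta>) \<le> (X / 2) powr (- \<delta>)"
          using Nhalf X1 step(3) by (intro powr_mono2') auto
        also have "\<dots> = 2 powr \<delta> * X powr (- \<delta>)" using X1 by (simp add: powr_divide powr_minus field_simps)
        also have "\<dots> \<le> 2 powr 1 * h" using Xd step(3,4) by (intro mult_mono powr_mono) auto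
        finally show ?thesis by simp
      qed
      have "cmod (\<Psi> (log (real q) (real (N + m'))) - \<Psi> (log (real q) (real N)))
          \<le> C * (real m' / real N * (1 + ln (real N)) + real N powr (- \<delta>))"
        by (rule step(5)[OF NN1 m'leN])
      also have "\<dots> \<le> C * (D * h * ((1 + 4 / \<delta>) * (real q ^ p * h powr (- 1/4))) + 2 * h)"
        using 1 2 step(1) by (intro mult_left_mono add_mono) auto
      finally show "cmod (\<Psi> (log (real q) (real (N + m'))) - \<Psi> (log (real q) (real N)))
          \<le> C * (D * h * ((1 + 4 / \<delta>) * (real q ^ p * h powr (- 1/4))) + 2 * h)" .
    qed
    also have "\<dots> \<le> 2 * K * h powr (3/4) + C * (D * ((1 + 4 / \<delta>) * real q ^ p) * h powr (3/4) + 2 * h powr (3/4))"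
    proof -
      have hh: "h * h powr (- 1/4) = h powr (3/4)"
      proof -
        have "h powr 1 * h powr (- 1/4) = h powr (3/4)" unfolding powr_add[symmetric] by simp
        then show ?thesis using h by simp
      qed
      have "h powr 1 \<le> h powr (3/4)" using h hle1 by (intro powr_mono') auto
      then have hl: "h \<le> h powr (3/4)" using h by simp
      have "D * h * ((1 + 4 / \<delta>) * (real q ^ p * h powr (- 1/4))) = D * ((1 + 4 / \<delta>) * real q ^ p) * (h * h powr (- 1/4))"
        by (simp add: mult_ac)
      then have eqD: "D * h * ((1 + 4 / \<delta>) * (real q ^ p * h powr (- 1/4))) = D * ((1 + 4 / \<delta>) * real q ^ p) * h powr (3/4)"
        by (simp only: hh)
      have "K * h + K * h \<le> 2 * K * h powr (3/4)" using mult_left_mono[OF hl K(1)] by simp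
      then show ?thesis unfolding eqD using mult_left_mono[of "2 * h" "2 * h powr (3/4)" C] hl step(1)
        by (simp add: distrib_left)
    qed
    also have "\<dots> = E * h powr (3/4)" by (simp add: E_def algebra_simps)
    finally show ?thesis .
  qed
  \<comment> \<open>For \<open>h > h0\<close> the boundedness of \<Psi> suffices; the second summand
    of the constant covers this range.\<close>
  define F where "F = E + 2 * B * h0 powr (- 3/4)"
  have "cmod (\<Psi> (x + h) - \<Psi> x) \<le> F * h powr (3/4)" if "0 < h" for x h
  proof (cases "h \<le> h0")
    case True
    then have "cmod (\<Psi> (x + h) - \<Psi> x) \<le> E * h powr (3/4)" using small that by simp
    also have "\<dots> \<le> F * h powr (3/4)" using B(1) by (intro mult_right_mono) (auto simp: F_def)
    finally show ?thesis .
  next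
    case False
    have "cmod (\<Psi> (x + h) - \<Psi> x) \<le> 2 * B"
      using norm_triangle_ineq4[of "\<Psi> (x + h)" "\<Psi> x"] B(2)[of "x + h"] B(2)[of x] by linarith
    also have "\<dots> = 2 * B * (h0 powr (- 3/4) * h0 powr (3/4))" using h0 by (simp add: powr_add[symmetric])
    also have "\<dots> \<le> 2 * B * (h0 powr (- 3/4) * h powr (3/4))"
      using False h0 B(1) by (intro mult_left_mono powr_mono2) auto
    also have "\<dots> \<le> F * h powr (3/4)" using E by (simp add: F_def distrib_right)
    finally show ?thesis .
  qed
  then show ?thesis using that by blast
qed

end

section \<open>Eigenvectors of the final components\<close>

locale transducer_setup =
  fixes T :: "('s :: finite, 'd :: finite) transducer" and q :: nat
  assumes q: "q \<ge> 2"
begin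

definition Q :: nat where "Q = q ^ CARD('d)"

abbreviation M :: "real \<Rightarrow> complex ^ 's ^ 's" where "M \<equiv> trans_matrix q T"

abbreviation R :: "('s \<times> 's) set" where "R \<equiv> arcs q T"

abbreviation F :: "'s set set" where "F \<equiv> final_components q T"

lemma Q_pos: "Q > 0" using q by (simp add: Q_def)

lemma card_letters_Q: "card (letters q :: (nat ^ 'd) set) = Q"
  by (simp add: Q_def card_letters)

lemma finF [simp]: "finite F" by simp

lemma M0_mult: "(M 0 *v v) $ s = (\<Sum>\<epsilon>\<in>letters q. v $ target T s \<epsilon>)"
  by (simp add: trans_matrix_mult_vec)

lemma arcs_iff: "(s, s') \<in> R \<longleftrightarrow> (\<exists>\<epsilon>\<in>letters q. s' = target T s \<epsilon>)"
  by (auto simp: arcs_def)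

lemma zero_in_letters: "0 \<in> letters q"
  using q by (simp add: letters_def)

lemma final_componentE:
  assumes "C \<in> F"
  obtains s where "C = {s'. (s, s') \<in> R\<^sup>* \<and> (s', s) \<in> R\<^sup>*}" "s \<in> C"
  using assms by (auto simp: final_components_def strong_components_def)

lemma final_component_closed: "C \<in> F \<Longrightarrow> s \<in> C \<Longrightarrow> (s, s') \<in> R \<Longrightarrow> s' \<in> C"
  by (auto simp: final_components_def)

lemma final_component_target: "C \<in> F \<Longrightarrow> s \<in> C \<Longrightarrow> \<epsilon> \<in> letters q \<Longrightarrow> target T s \<epsilon> \<in> C"
  using final_component_closed arcs_iff by blast

lemma final_component_reach: "C \<in> F \<Longrightarrow> s \<in> C \<Longrightarrow> s' \<in> C \<Longrightarrow> (s, s') \<in> R\<^sup>*"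
  by (elim final_componentE) (auto intro: rtrancl_trans)

lemma final_component_disjoint:
  assumes "C \<in> F" "C' \<in> F" "s \<in> C" "s \<in> C'"
  shows "C = C'"
proof -
  have "{s'. (s, s') \<in> R\<^sup>* \<and> (s', s) \<in> R\<^sup>*} = C" if "C \<in> F" "s \<in> C" for C
    using that by (elim final_componentE) (auto intro: rtrancl_trans)
  then show ?thesis using assms by blast
qed

text \<open>A state reachable from \<open>s\<close> whose own reachable set has least cardinality
  can be reached back from everything it reaches, so its strong component is final.\<close>

lemma reach_final_component:
  obtains C s' where "C \<in> F" "s' \<in> C" "(s, s') \<in> R\<^sup>*"
proof -
  define rch where "rch t = {t'. (t, t') \<in> R\<^sup>*}" for t
  obtain t where t: "(s, t) \<in> R\<^sup>*" "\<And>t'. (s, t') \<in> R\<^sup>* \<Longrightarrow> card (rch t) \<le> card (rch t')"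
    using ex_has_least_nat[of "\<lambda>t. (s, t) \<in> R\<^sup>*" s "\<lambda>t. card (rch t)"] by auto
  have bk: "(t', t) \<in> R\<^sup>*" if "(t, t') \<in> R\<^sup>*" for t'
  proof -
    have "rch t' \<subseteq> rch t" using that by (auto simp: rch_def intro: rtrancl_trans)
    moreover have "card (rch t) \<le> card (rch t')" using t that by (meson rtrancl_trans)
    ultimately have "rch t' = rch t" by (metis card_seteq finite_code)
    then show ?thesis by (auto simp: rch_def)
  qed
  define C where "C = {s'. (t, s') \<in> R\<^sup>* \<and> (s', t) \<in> R\<^sup>*}"
  have "C \<in> F"
    unfolding final_components_def
  proof (safe)
    show "C \<in> strong_components q T" by (auto simp: strong_components_def C_def)
    fix a b assume "a \<in> C" "(a, b) \<in> R"
    then have "(t, b) \<in> R\<^sup>*" by (auto simp: C_def)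
    then show "b \<in> C" using bk by (simp add: C_def)
  qed
  moreover have "t \<in> C" by (simp add: C_def)
  ultimately show ?thesis using that t(1) by blast
qed

lemma F_nonempty: "F \<noteq> {}"
  using reach_final_component by blast

text \<open>Since \<open>Gcd {} = 0\<close>, a cycle has to be exhibited. Reading the letter 0 leads
  from a state to a state of the same component, from which there is a way back inside the
  component.\<close>

lemma component_period_pos:
  assumes "C \<in> F"
  shows "component_period q T C > 0"
proof -
  obtain s where s: "s \<in> C" using assms by (elim final_componentE)
  define s1 where "s1 = target T s 0"
  have a1: "(s, s1) \<in> R" using zero_in_letters by (auto simp: arcs_iff s1_def)
  have s1C: "s1 \<in> C" using final_component_closed[OF assms s a1] .
  have "(s1, s) \<in> R\<^sup>*" using final_component_reach[OF assms s1C s] .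
  then obtain n where n: "(s1, s) \<in> R ^^ n" by (auto simp: rtrancl_power)
  have "(a, b) \<in> (R \<inter> C \<times> C) ^^ n" if "(a, b) \<in> R ^^ n" "a \<in> C" for a b n
    using that
  proof (induction n arbitrary: a)
    case (Suc n)
    then obtain c where c: "(a, c) \<in> R" "(c, b) \<in> R ^^ n" by (meson relpow_Suc_E2)
    have "c \<in> C" using final_component_closed[OF assms Suc.prems(2) c(1)] .
    then show ?case using Suc c by (intro relpow_Suc_I2[of a c]) auto
  qed simp
  then have "(s1, s) \<in> (R \<inter> C \<times> C) ^^ n" using n s1C by blast
  then have "(s, s) \<in> (R \<inter> C \<times> C) ^^ Suc n"
    using a1 s s1C by (intro relpow_Suc_I2[of s s1]) auto
  then have "Suc n \<in> {m. m > 0 \<and> (\<exists>s\<in>C. (s, s) \<in> (R \<inter> C \<times> C) ^^ m)}" using s by blast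
  then have "Gcd {m. m > 0 \<and> (\<exists>s\<in>C. (s, s) \<in> (R \<inter> C \<times> C) ^^ m)} \<noteq> 0"
    by (metis (no_types, lifting) Gcd_0_iff Zero_not_Suc singletonD subsetD)
  then show ?thesis unfolding component_period_def neq0_conv .
qed

lemma final_period_pos: "final_period q T > 0"
proof -
  have "0 \<notin> component_period q T ` F" using component_period_pos by force
  then have "final_period q T \<noteq> 0" unfolding final_period_def by (simp add: Lcm_0_iff)
  then show ?thesis by simp
qed

text \<open>Maximum principle: \<open>Q\<close> times an entry of maximal modulus is a sum of
  \<open>Q\<close> entries, none of larger modulus, so all of them have the same modulus.\<close>

lemma max_modulus_propagates:
  fixes v :: "complex ^ 's"
  assumes v: "M 0 *v v = of_nat Q *s v" and max: "\<And>s'. cmod (v $ s') \<le> cmod (v $ s)"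
    and "(s, s') \<in> R\<^sup>*"
  shows "cmod (v $ s') = cmod (v $ s)"
  using assms(3)
proof (induction rule: rtrancl_induct)
  case (step a b)
  then obtain \<epsilon> where \<epsilon>: "\<epsilon> \<in> letters q" "b = target T a \<epsilon>" by (auto simp: arcs_iff)
  let ?m = "cmod (v $ s)"
  have "of_nat Q * v $ a = (\<Sum>\<epsilon>\<in>letters q. v $ target T a \<epsilon>)"
    using v M0_mult[of v a] by simp
  then have "real Q * ?m = cmod (\<Sum>\<epsilon>\<in>letters q. v $ target T a \<epsilon>)"
    using step.IH by (metis norm_mult norm_of_nat)
  also have "\<dots> \<le> (\<Sum>\<epsilon>\<in>letters q. cmod (v $ target T a \<epsilon>))" by (rule norm_sum)
  finally have "(\<Sum>\<epsilon>\<in>letters q. ?m - cmod (v $ target T a \<epsilon>)) \<le> 0"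
    by (simp add: sum_subtractf card_letters_Q)
  then have "(\<Sum>\<epsilon>\<in>letters q. ?m - cmod (v $ target T a \<epsilon>)) = 0"
    using max by (intro antisym sum_nonneg) auto
  then have "?m - cmod (v $ target T a \<epsilon>) = 0"
    using max \<epsilon> by (subst (asm) sum_nonneg_eq_0_iff) (auto simp: finite_letters)
  then show ?case using \<epsilon> by simp
qed simp

section \<open>The bordered matrix and explicit eigenvectors\<close>

definition rp :: "'s set \<Rightarrow> 's" where "rp C = (SOME s. s \<in> C)"

lemma rp_in: "C \<in> F \<Longrightarrow> rp C \<in> C"
  unfolding rp_def by (rule someI_ex) (elim final_componentE, blast)

definition ind :: "'s set \<Rightarrow> complex ^ 's" where "ind C = (\<chi> s. indicator C s)"

text \<open>A bordering of \<open>\<mu> - M(t)\<close> that is invertible near \<open>(q ^ d, 0)\<close>. If \<open>xv\<close> solves it for the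
  indicator of a final component \<open>C\<close>, then \<open>\<mu>\<close> is an eigenvalue on \<open>C\<close> with eigenvector \<open>xv\<close> precisely
  if the entry \<open>pev\<close> of \<open>xv\<close> at the representative of \<open>C\<close> is \<open>1\<close>; so the eigenvectors are
  explicit rational functions of \<open>\<mu>\<close> and the entries of \<open>M(t)\<close>.\<close>

definition K :: "complex \<Rightarrow> real \<Rightarrow> complex ^ 's ^ 's" where
  "K \<mu> t = (\<chi> i j. (if i = j then \<mu> else 0) - M t $ i $ j + (\<Sum>C\<in>F. if i \<in> C \<and> j = rp C then 1 else 0))"

lemma K_mult: "K \<mu> t *v v = \<mu> *s v - M t *v v + (\<Sum>C\<in>F. v $ rp C *s ind C)"
proof -
  have "(K \<mu> t *v v) $ i = (\<mu> *s v - M t *v v + (\<Sum>C\<in>F. v $ rp C *s ind C)) $ i" for i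
  proof -
    have "(K \<mu> t *v v) $ i = (\<Sum>j\<in>UNIV. (if i = j then \<mu> else 0) * v $ j) - (\<Sum>j\<in>UNIV. M t $ i $ j * v $ j)
       + (\<Sum>j\<in>UNIV. (\<Sum>C\<in>F. if i \<in> C \<and> j = rp C then 1 else 0) * v $ j)"
      by (simp add: K_def matrix_vector_mult_def ring_distribs sum.distrib sum_subtractf)
    also have "(\<Sum>j\<in>UNIV. (\<Sum>C\<in>F. if i \<in> C \<and> j = rp C then 1 else 0) * v $ j)
       = (\<Sum>C\<in>F. \<Sum>j\<in>UNIV. (if i \<in> C \<and> j = rp C then 1 else 0) * v $ j)"
      unfolding sum_distrib_right by (rule sum.swap)
    also have "\<dots> = (\<Sum>C\<in>F. v $ rp C * indicator C i)"
      by (rule sum.cong) (auto simp: indicator_def if_distrib[of "\<lambda>x. x * _"] cong: if_cong)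
    also have "(\<Sum>j\<in>UNIV. (if i = j then \<mu> else 0) * v $ j) = \<mu> * v $ i"
      by (simp add: if_distrib[of "\<lambda>x. x * _"] cong: if_cong)
    finally show ?thesis by (simp add: matrix_vector_mult_def ind_def)
  qed
  then show ?thesis by (simp only: vec_eq_iff) simp
qed

lemma sum_ind_at:
  assumes "C \<in> F" "s \<in> C"
  shows "(\<Sum>C'\<in>F. v $ rp C' *s ind C') $ s = v $ rp C"
proof -
  have "(\<Sum>C'\<in>F. v $ rp C' *s ind C') $ s = (\<Sum>C'\<in>F. if C' = C then v $ rp C' else 0)"
    unfolding sum_component
  proof (rule sum.cong)
    fix C' assume "C' \<in> F"
    then show "(v $ rp C' *s ind C') $ s = (if C' = C then v $ rp C' else 0)"
      using assms final_component_disjoint by (auto simp: ind_def indicator_def)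
  qed simp
  then show ?thesis using assms by simp
qed

text \<open>If the entry of \<open>v\<close> at a representative is nonzero, it is normalized to 1:
  where the real part is maximal on the component, \<open>Q\<close> times it, plus 1, would be a sum
  of \<open>Q\<close> values not exceeding it. So the border terms vanish, \<open>v\<close>
  satisfies the eigenvalue equation of M(0), and its maximal modulus propagates to a representative,
  where \<open>v\<close> is 0.\<close>

lemma K_injective: "K (of_nat Q) 0 *v v = 0 \<Longrightarrow> v = 0"
proof -
  assume Kv: "K (of_nat Q) 0 *v v = 0"
  have rp0: "v $ rp C = 0" if C: "C \<in> F" for C
  proof (rule ccontr)
    assume c: "v $ rp C \<noteq> 0"
    define u where "u s = Re (v $ s / v $ rp C)" for s
    have "finite C" "C \<noteq> {}" using rp_in[OF C] by auto
    then obtain s where s: "s \<in> C" "\<And>s'. s' \<in> C \<Longrightarrow> u s' \<le> u s"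
      using Max_in[of "u ` C"] Max_ge[of "u ` C"] by (metis (no_types, lifting) finite_imageI image_iff image_is_empty)
    have "(K (of_nat Q) 0 *v v) $ s = 0" using Kv by simp
    then have "of_nat Q * v $ s + v $ rp C = (\<Sum>\<epsilon>\<in>letters q. v $ target T s \<epsilon>)"
      unfolding K_mult using sum_ind_at[OF C s(1), of v] M0_mult[of v s] by (simp add: algebra_simps)
    then have "(of_nat Q * v $ s + v $ rp C) / v $ rp C = (\<Sum>\<epsilon>\<in>letters q. v $ target T s \<epsilon> / v $ rp C)"
      by (simp add: sum_divide_distrib)
    then have "of_nat Q * (v $ s / v $ rp C) + 1 = (\<Sum>\<epsilon>\<in>letters q. v $ target T s \<epsilon> / v $ rp C)"
      using c by (simp add: add_divide_distrib)
    then have "Re (of_nat Q * (v $ s / v $ rp C) + 1) = Re (\<Sum>\<epsilon>\<in>letters q. v $ target T s \<epsilon> / v $ rp C)"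
      by (rule arg_cong)
    then have "real Q * u s + 1 = (\<Sum>\<epsilon>\<in>letters q. u (target T s \<epsilon>))"
      by (simp add: u_def del: times_divide_eq_right)
    also have "\<dots> \<le> (\<Sum>\<epsilon>\<in>(letters q :: (nat ^ 'd) set). u s)"
      using s final_component_target[OF C s(1)] by (intro sum_mono) auto
    also have "\<dots> = real Q * u s" by (simp add: card_letters_Q)
    finally show False by simp
  qed
  have "M 0 *v v = of_nat Q *s v"
    using Kv rp0 unfolding K_mult by simp
  moreover obtain s where s: "\<And>s'. cmod (v $ s') \<le> cmod (v $ s)"
  proof -
    have "Max (range (\<lambda>s. cmod (v $ s))) \<in> range (\<lambda>s. cmod (v $ s))" by (intro Max_in) auto
    then obtain s where "Max (range (\<lambda>s. cmod (v $ s))) = cmod (v $ s)" by (rule rangeE)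
    then show ?thesis using that[of s] by (metis Max_ge finite_code finite_imageI rangeI)
  qed
  moreover obtain C s' where C: "C \<in> F" "s' \<in> C" "(s, s') \<in> R\<^sup>*" using reach_final_component by blast
  have "(s, rp C) \<in> R\<^sup>*"
    using C final_component_reach[OF C(1,2) rp_in[OF C(1)]] by (meson rtrancl_trans)
  ultimately have "cmod (v $ rp C) = cmod (v $ s)" using max_modulus_propagates by blast
  then have "cmod (v $ s') \<le> 0" for s' using s[of s'] rp0[OF C(1)] by simp
  then show "v = 0" by (simp add: vec_eq_iff)
qed

lemma det_K_nonzero: "det (K (of_nat Q) 0) \<noteq> 0"
proof -
  have "\<exists>B. B ** K (of_nat Q) 0 = mat 1"
    using K_injective by (subst matrix_left_invertible_ker) auto
  then show ?thesis using invertible_det_nz invertible_left_inverse by blast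
qed

text \<open>Cramer's rule rather than an inverse matrix, so that solutions are quotients of
  determinants and their differentiability in the entries is immediate.\<close>

definition sol :: "complex ^ 's ^ 's \<Rightarrow> complex ^ 's \<Rightarrow> complex ^ 's" where
  "sol A b = (\<chi> k. det (\<chi> i j. if j = k then b $ i else A $ i $ j) / det A)"

lemma sol_iff: "det A \<noteq> 0 \<Longrightarrow> A *v x = b \<longleftrightarrow> x = sol A b"
  unfolding sol_def by (rule cramer)

definition xv :: "'s set \<Rightarrow> complex \<Rightarrow> real \<Rightarrow> complex ^ 's" where
  "xv C \<mu> t = sol (K \<mu> t) (ind C)"

text \<open>The row of the inverse of \<open>K \<mu> t\<close> with index \<open>rp C\<close>; where
  \<open>pev C \<mu> t = 1\<close> it is the left eigenvector matching \<open>xv\<close>.\<close>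

definition yv :: "'s set \<Rightarrow> complex \<Rightarrow> real \<Rightarrow> complex ^ 's" where
  "yv C \<mu> t = sol (transpose (K \<mu> t)) (axis (rp C) 1)"

abbreviation pev :: "'s set \<Rightarrow> complex \<Rightarrow> real \<Rightarrow> complex" where
  "pev C \<mu> t \<equiv> xv C \<mu> t $ rp C"

context
  fixes \<mu> :: complex and t :: real
  assumes det: "det (K \<mu> t) \<noteq> 0"
begin

lemma K_xv: "K \<mu> t *v xv C \<mu> t = ind C"
  using det by (simp add: sol_iff xv_def)

lemma yv_K: "yv C \<mu> t v* K \<mu> t = axis (rp C) 1"
proof -
  have "det (transpose (K \<mu> t)) \<noteq> 0" using det by simp
  then have "transpose (K \<mu> t) *v yv C \<mu> t = axis (rp C) 1"
    by (rule iffD2[OF sol_iff]) (simp add: yv_def)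
  then show ?thesis by simp
qed

lemma K_cancel: "K \<mu> t *v v = K \<mu> t *v w \<Longrightarrow> v = w"
  using det by (metis sol_iff)

text \<open>The vectors vanishing on \<open>C\<close> form a subspace that \<open>K \<mu> t\<close>
  maps into itself, because \<open>C\<close> is closed under transitions and contains its
  representative. An injective map sends it onto itself, so \<open>K v\<close> lies in it only if
  \<open>v\<close> does.\<close>

lemma vanish_if_K_vanish:
  fixes v :: "complex ^ 's"
  assumes C: "C \<in> F" and Kv: "\<And>s. s \<in> C \<Longrightarrow> (K \<mu> t *v v) $ s = 0" and s: "s \<in> C"
  shows "v $ s = 0"
proof -
  define W where "W = {v :: complex ^ 's. \<forall>s\<in>C. v $ s = 0}"
  have W: "vec.subspace W" by (auto simp: W_def vec.subspace_def)
  let ?f = "\<lambda>v. K \<mu> t *v v"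
  have lin: "Vector_Spaces.linear (*s) (*s) ?f" by (rule matrix_vector_mul_linear_gen)
  have sub: "?f ` W \<subseteq> W"
  proof (clarsimp simp: W_def)
    fix v :: "complex ^ 's" and s assume v: "\<forall>s\<in>C. v $ s = 0" and s: "s \<in> C"
    have "(M t *v v) $ s = 0"
      unfolding trans_matrix_mult_vec using v final_component_target[OF C s] by (intro sum.neutral) auto
    then show "(K \<mu> t *v v) $ s = 0"
      unfolding K_mult using sum_ind_at[OF C s, of v] v s rp_in[OF C] by simp
  qed
  have "vec.dim (?f ` W) = vec.dim W"
    by (rule vec.dim_image_eq[OF lin]) (auto intro!: inj_onI K_cancel)
  then have "?f ` W = W"
    using sub by (intro vec.subspace_dim_equal W vec.linear_subspace_image[OF lin W]) auto
  moreover have "?f v \<in> W" using Kv by (simp add: W_def)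
  ultimately obtain w where "w \<in> W" "?f v = ?f w" by (metis imageE)
  then have "v \<in> W" using K_cancel by metis
  then show ?thesis using s by (simp add: W_def)
qed

lemma xv_vanish: "C \<in> F \<Longrightarrow> C' \<in> F \<Longrightarrow> C \<noteq> C' \<Longrightarrow> s \<in> C' \<Longrightarrow> xv C \<mu> t $ s = 0"
  by (rule vanish_if_K_vanish[of C'])
     (auto simp: K_xv ind_def indicator_def dest: final_component_disjoint)

text \<open>The entry at \<open>s\<close> is the entry at \<open>rp C\<close> of the solution of
  \<open>K u = e_s\<close>; for \<open>s\<close> outside \<open>C\<close> the right side vanishes on
  \<open>C\<close>, hence so does \<open>u\<close>.\<close>

lemma yv_vanish: "C \<in> F \<Longrightarrow> s \<notin> C \<Longrightarrow> yv C \<mu> t $ s = 0"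
proof -
  assume C: "C \<in> F" and s: "s \<notin> C"
  define u where "u = sol (K \<mu> t) (axis s 1)"
  have u: "K \<mu> t *v u = axis s 1" using det by (simp add: sol_iff u_def)
  have "u $ rp C = 0"
    by (rule vanish_if_K_vanish[OF C]) (use s rp_in[OF C] in \<open>auto simp: u axis_def\<close>)
  moreover have "yv C \<mu> t $ s = tdot (yv C \<mu> t) (axis s 1)"
    by (simp add: tdot_def axis_def if_distrib cong: if_cong)
  moreover have "\<dots> = u $ rp C"
    unfolding u[symmetric] tdot_matrix yv_K by (rule tdot_axis)
  ultimately show ?thesis by simp
qed

lemma tdot_yv_ind: "tdot (yv C \<mu> t) (ind C) = pev C \<mu> t"
  unfolding K_xv[of C, symmetric] tdot_matrix yv_K by (rule tdot_axis)

lemma tdot_yv_ind_other: "C \<in> F \<Longrightarrow> C' \<in> F \<Longrightarrow> C \<noteq> C' \<Longrightarrow> tdot (yv C \<mu> t) (ind C') = 0"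
  unfolding tdot_def
  by (rule sum.neutral) (use yv_vanish[of C] in \<open>auto simp: ind_def indicator_def dest: final_component_disjoint\<close>)

text \<open>With entry 1 at the representative of \<open>C\<close> and 0 at the others, the border
  terms add up to \<open>ind C\<close>, which cancels the right side.\<close>

lemma xv_eigen:
  assumes C: "C \<in> F" and one: "pev C \<mu> t = 1"
  shows "M t *v xv C \<mu> t = \<mu> *s xv C \<mu> t"
proof -
  have "(\<Sum>C'\<in>F. xv C \<mu> t $ rp C' *s ind C') = (\<Sum>C'\<in>F. if C' = C then ind C' else 0)"
    using one xv_vanish[OF C] rp_in by (intro sum.cong) auto
  also have "\<dots> = ind C" using C by simp
  finally show ?thesis using K_xv[of C] unfolding K_mult by simp
qed

lemma yv_eigen:
  assumes C: "C \<in> F" and one: "pev C \<mu> t = 1"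
  shows "yv C \<mu> t v* M t = \<mu> *s yv C \<mu> t"
proof -
  have "tdot (yv C \<mu> t v* M t) v = tdot (\<mu> *s yv C \<mu> t) v" for v
  proof -
    have "v $ rp C = tdot (yv C \<mu> t) (K \<mu> t *v v)"
      unfolding tdot_matrix yv_K by (simp add: tdot_axis)
    also have "\<dots> = \<mu> * tdot (yv C \<mu> t) v - tdot (yv C \<mu> t) (M t *v v)
        + (\<Sum>C'\<in>F. v $ rp C' * tdot (yv C \<mu> t) (ind C'))"
      unfolding K_mult tdot_add_right tdot_sum_right tdot_scale_right
      by (simp add: tdot_def ring_distribs sum_subtractf sum_distrib_left mult_ac)
    also have "(\<Sum>C'\<in>F. v $ rp C' * tdot (yv C \<mu> t) (ind C')) = (\<Sum>C'\<in>F. if C' = C then v $ rp C' else 0)"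
      using tdot_yv_ind_other[OF C] tdot_yv_ind[of C] one by (intro sum.cong) auto
    also have "\<dots> = v $ rp C" using C by simp
    finally show ?thesis by (simp add: tdot_matrix[symmetric] tdot_scale_left)
  qed
  from this[of "axis _ 1"] show ?thesis
    by (simp add: vec_eq_iff tdot_def axis_def if_distrib cong: if_cong)
qed

text \<open>An eigenvector on \<open>C\<close>, extended by 0, is mapped by \<open>K\<close> to a
  vector that is constant on \<open>C\<close>, so on \<open>C\<close> it is a multiple of
  \<open>xv\<close>; comparing the entries at the representative yields 1.\<close>

lemma principal_eigenvalue_iff:
  assumes C: "C \<in> F"
  shows "is_principal_eigenvalue (M t) C \<mu> \<longleftrightarrow> pev C \<mu> t = 1"
proof
  assume "is_principal_eigenvalue (M t) C \<mu>"
  then obtain v where v: "\<exists>s\<in>C. v s \<noteq> 0" "\<And>s. s \<in> C \<Longrightarrow> (\<Sum>s'\<in>C. M t $ s $ s' * v s') = \<mu> * v s"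
    by (auto simp: is_principal_eigenvalue_def)
  define V where "V = (\<chi> s. if s \<in> C then v s else 0)"
  have MV: "(M t *v V) $ s = \<mu> * v s" if "s \<in> C" for s
  proof -
    have "(M t *v V) $ s = (\<Sum>s'\<in>UNIV. if s' \<in> C then M t $ s $ s' * v s' else 0)"
      by (simp add: matrix_vector_mult_def V_def if_distrib cong: if_cong)
    also have "\<dots> = (\<Sum>s'\<in>C. M t $ s $ s' * v s')" by (simp add: sum.If_cases)
    finally show ?thesis using v(2)[OF that] by simp
  qed
  define U where "U = V - v (rp C) *s xv C \<mu> t"
  have "U $ s = 0" if "s \<in> C" for s
  proof (rule vanish_if_K_vanish[OF C _ that])
    fix s assume s: "s \<in> C"
    have "(K \<mu> t *v V) $ s = v (rp C)"
      unfolding K_mult using MV[OF s] sum_ind_at[OF C s, of V] s rp_in[OF C] by (simp add: V_def)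
    moreover have "K \<mu> t *v U = K \<mu> t *v V - v (rp C) *s ind C"
      by (simp add: U_def matrix_vector_mult_diff_distrib vector_scalar_commute K_xv[symmetric])
    ultimately show "(K \<mu> t *v U) $ s = 0" using s by (simp add: ind_def)
  qed
  then have eq: "v s = v (rp C) * xv C \<mu> t $ s" if "s \<in> C" for s
    using that by (force simp: U_def V_def)
  then have "v (rp C) \<noteq> 0" using v(1) by force
  then show "pev C \<mu> t = 1" using eq[OF rp_in[OF C]] by simp
next
  assume one: "pev C \<mu> t = 1"
  have "(\<Sum>s'\<in>C. M t $ s $ s' * xv C \<mu> t $ s') = \<mu> * xv C \<mu> t $ s" if s: "s \<in> C" for s
  proof -
    have "M t $ s $ s' = 0" if "s' \<notin> C" for s'
      using final_component_target[OF C s] that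
      by (auto simp: trans_matrix_def letter_matrix_def intro!: sum.neutral)
    then have "(\<Sum>s'\<in>C. M t $ s $ s' * xv C \<mu> t $ s') = (\<Sum>s'\<in>UNIV. M t $ s $ s' * xv C \<mu> t $ s')"
      by (intro sum.mono_neutral_left) auto
    also have "\<dots> = (M t *v xv C \<mu> t) $ s" by (simp add: matrix_vector_mult_def)
    finally show ?thesis by (simp add: xv_eigen[OF C one])
  qed
  then show "is_principal_eigenvalue (M t) C \<mu>"
    unfolding is_principal_eigenvalue_def using one rp_in[OF C]
    by (intro exI[of _ "\<lambda>s. xv C \<mu> t $ s"]) (auto intro!: bexI[of _ "rp C"])
qed

end

lemma tdot_yv_xv_other:
  assumes "det (K \<mu> t) \<noteq> 0" "det (K \<nu> t) \<noteq> 0" "C \<in> F" "C' \<in> F" "C \<noteq> C'"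
  shows "tdot (yv C \<mu> t) (xv C' \<nu> t) = 0"
  unfolding tdot_def
proof (rule sum.neutral, rule ballI)
  fix s
  show "yv C \<mu> t $ s * xv C' \<nu> t $ s = 0"
    using yv_vanish[OF assms(1,3), of s] xv_vanish[OF assms(2,4,3), of s] assms(5) by (cases "s \<in> C") auto
qed

text \<open>Resolvent identity: \<open>K \<nu> t - K \<mu> t\<close> is \<open>\<nu> - \<mu>\<close>
  times the identity. The pairing is 1 at the base point, so \<open>pev\<close> has slope close to
  -1 in \<mu>, and \<open>pev C \<mu> t = 1\<close> can be solved for \<mu>.\<close>

lemma pev_diff:
  assumes "det (K \<mu> t) \<noteq> 0" "det (K \<nu> t) \<noteq> 0"
  shows "pev C \<mu> t - pev C \<nu> t = (\<nu> - \<mu>) * tdot (yv C \<mu> t) (xv C \<nu> t)"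
proof -
  have "K \<nu> t *v v = K \<mu> t *v v + (\<nu> - \<mu>) *s v" for v
    unfolding K_mult by (simp add: vec_eq_iff algebra_simps)
  then have "tdot (yv C \<mu> t) (ind C) = tdot (yv C \<mu> t) (K \<mu> t *v xv C \<nu> t) + (\<nu> - \<mu>) * tdot (yv C \<mu> t) (xv C \<nu> t)"
    using K_xv[OF assms(2), of C] by (metis tdot_add_right tdot_scale_right)
  moreover have "tdot (yv C \<mu> t) (K \<mu> t *v xv C \<nu> t) = pev C \<nu> t"
    unfolding tdot_matrix yv_K[OF assms(1)] by (rule tdot_axis)
  ultimately show ?thesis using tdot_yv_ind[OF assms(1), of C] by simp
qed

text \<open>All rows of M(0) sum to \<open>Q\<close>, so \<open>K\<close> maps the all-ones vector
  to the sum of the indicators, as it does with the sum of the \<open>xv\<close>.\<close>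

lemma sum_xv_at_0: "(\<Sum>C\<in>F. xv C (of_nat Q) 0) = vec 1"
proof (rule K_cancel[OF det_K_nonzero])
  have "M 0 *v vec 1 = of_nat Q *s vec 1"
    by (simp add: vec_eq_iff M0_mult card_letters_Q)
  then have "K (of_nat Q) 0 *v vec 1 = (\<Sum>C\<in>F. ind C)"
    unfolding K_mult by simp
  moreover have "K (of_nat Q) 0 *v (\<Sum>C\<in>F. xv C (of_nat Q) 0) = (\<Sum>C\<in>F. ind C)"
    by (simp add: vec.sum K_xv[OF det_K_nonzero])
  ultimately show "K (of_nat Q) 0 *v (\<Sum>C\<in>F. xv C (of_nat Q) 0) = K (of_nat Q) 0 *v vec 1" by simp
qed

lemma xv_at_0: "C \<in> F \<Longrightarrow> s \<in> C \<Longrightarrow> xv C (of_nat Q) 0 $ s = 1"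
proof -
  assume C: "C \<in> F" and s: "s \<in> C"
  have "1 = (\<Sum>C'\<in>F. xv C' (of_nat Q) 0 $ s)"
    using sum_xv_at_0 by (metis sum_component vec_component)
  also have "\<dots> = (\<Sum>C'\<in>F. if C' = C then xv C' (of_nat Q) 0 $ s else 0)"
    using xv_vanish[OF det_K_nonzero _ C _ s] by (intro sum.cong) auto
  also have "\<dots> = xv C (of_nat Q) 0 $ s" using C by simp
  finally show ?thesis by simp
qed

lemma pev_at_0: "C \<in> F \<Longrightarrow> pev C (of_nat Q) 0 = 1"
  using xv_at_0 rp_in by blast

lemma tdot_yv_xv_at_0: "C \<in> F \<Longrightarrow> tdot (yv C (of_nat Q) 0) (xv C (of_nat Q) 0) = 1"
proof -
  assume C: "C \<in> F"
  have "tdot (yv C (of_nat Q) 0) (xv C (of_nat Q) 0) = tdot (yv C (of_nat Q) 0) (ind C)"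
    unfolding tdot_def
    using xv_at_0[OF C] yv_vanish[OF det_K_nonzero C] by (intro sum.cong) (auto simp: ind_def indicator_def)
  then show ?thesis using tdot_yv_ind[OF det_K_nonzero, of C] pev_at_0[OF C] by simp
qed

end

section \<open>Perturbation of the spectral projection\<close>

lemma differentiable_det:
  fixes A :: "'z :: real_normed_vector \<Rightarrow> complex ^ 'n ^ 'n"
  assumes "\<And>i j. (\<lambda>z. A z $ i $ j) differentiable (at a)"
  shows "(\<lambda>z. det (A z)) differentiable (at a)"
proof -
  have "(\<lambda>z. \<Prod>i\<in>I. A z $ i $ p i) differentiable (at a)" if "finite I" for I :: "'n set" and p
    using that by (induction I) (auto intro: assms differentiable_mult)
  then show ?thesis
    unfolding det_def by (auto intro!: differentiable_sum differentiable_mult)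
qed

lemma differentiable_vec_componentwise:
  fixes f :: "real \<Rightarrow> complex ^ 'n"
  assumes "\<And>s. (\<lambda>t. f t $ s) differentiable (at a)"
  shows "f differentiable (at a)"
proof -
  have bl: "bounded_linear (axis s :: complex \<Rightarrow> complex ^ 'n)" for s
    by (intro linear_conv_bounded_linear[THEN iffD1] linearI) (auto simp: axis_def vec_eq_iff)
  have "(\<lambda>t. \<Sum>s\<in>UNIV. axis s (f t $ s)) differentiable (at a)"
  proof (intro differentiable_sum ballI)
    fix s
    show "(\<lambda>t. axis s (f t $ s) :: complex ^ 'n) differentiable (at a)"
      by (rule differentiable_compose[OF bounded_linear_imp_differentiable[OF bl] assms])
  qed simp
  moreover have "(\<Sum>s\<in>UNIV. axis s (f t $ s)) = f t" for t
    by (simp add: vec_eq_iff axis_def if_distrib cong: if_cong)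
  ultimately show ?thesis by simp
qed

lemma has_vector_derivative_iff_quotient:
  fixes f :: "real \<Rightarrow> complex"
  shows "(f has_vector_derivative D) (at 0) \<longleftrightarrow> ((\<lambda>t. (f t - f 0) / of_real t) \<longlongrightarrow> D) (at 0)"
proof -
  have "(f has_vector_derivative D) (at 0) \<longleftrightarrow> ((\<lambda>h. norm (f (0 + h) - f 0 - h *\<^sub>R D) / norm h) \<longlongrightarrow> 0) (at 0)"
    unfolding has_vector_derivative_def has_derivative_at by (simp add: bounded_linear_scaleR_left)
  also have "\<dots> \<longleftrightarrow> ((\<lambda>h. norm ((f h - f 0) / of_real h - D)) \<longlongrightarrow> 0) (at 0)"
  proof (rule tendsto_cong)
    show "\<forall>\<^sub>F h in at 0. norm (f (0 + h) - f 0 - h *\<^sub>R D) / norm h = norm ((f h - f 0) / of_real h - D)"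
      unfolding eventually_at_filter
    proof (intro always_eventually allI impI)
      fix h :: real assume "h \<noteq> 0"
      then have "(f h - f 0) / of_real h - D = (f h - f 0 - h *\<^sub>R D) / of_real h"
        by (simp add: field_simps scaleR_conv_of_real)
      then show "norm (f (0 + h) - f 0 - h *\<^sub>R D) / norm h = norm ((f h - f 0) / of_real h - D)"
        by (simp add: norm_divide)
    qed
  qed
  also have "\<dots> \<longleftrightarrow> ((\<lambda>t. (f t - f 0) / of_real t) \<longlongrightarrow> D) (at 0)"
    by (simp add: tendsto_norm_zero_iff LIM_zero_iff)
  finally show ?thesis .
qed

context transducer_setup
begin

lemma differentiable_exp_entry: "(\<lambda>z :: complex \<times> real. exp (\<i> * of_real (snd z * r))) differentiable (at a)"
proof -
  have "bounded_linear (\<lambda>z :: complex \<times> real. snd z *\<^sub>R (\<i> * complex_of_real r))"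
    by (rule bounded_linear_compose[OF bounded_linear_scaleR_left bounded_linear_snd])
  then have bl: "bounded_linear (\<lambda>z :: complex \<times> real. \<i> * of_real (snd z * r))"
    by (simp add: scaleR_conv_of_real mult_ac)
  have "exp differentiable (at w)" for w :: complex
    using DERIV_exp[of w] by (auto simp: has_field_derivative_def differentiable_def)
  then show ?thesis
    by (rule differentiable_compose[OF _ bounded_linear_imp_differentiable[OF bl]])
qed

lemma M_entry: "M t $ i $ j = (\<Sum>\<epsilon>\<in>letters q. if target T i \<epsilon> = j then exp (\<i> * of_real (t * trans_out T i \<epsilon>)) else 0)"
  by (simp add: trans_matrix_def letter_matrix_def)

lemma differentiable_K: "(\<lambda>z. K (fst z) (snd z) $ i $ j) differentiable (at a)"
proof -
  have "(\<lambda>z :: complex \<times> real. if i = j then fst z else 0) differentiable (at a)"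
    by (cases "i = j") (auto intro: bounded_linear_imp_differentiable bounded_linear_fst)
  moreover have "(\<lambda>z :: complex \<times> real. if P then exp (\<i> * of_real (snd z * r)) else 0) differentiable (at a)" for P r
    using differentiable_exp_entry by (cases P) auto
  ultimately show ?thesis
    unfolding K_def M_entry by (auto intro!: differentiable_add differentiable_diff differentiable_sum simp: finite_letters)
qed

lemma differentiable_det_K: "(\<lambda>z. det (K (fst z) (snd z))) differentiable (at a)"
  by (rule differentiable_det[OF differentiable_K])

lemma differentiable_xv:
  assumes "det (K (fst a) (snd a)) \<noteq> 0"
  shows "(\<lambda>z. xv C (fst z) (snd z) $ s) differentiable (at a)"
proof -
  have "(\<lambda>z. det (\<chi> i j. if j = s then ind C $ i else K (fst z) (snd z) $ i $ j)) differentiable (at a)"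
  proof (rule differentiable_det)
    fix i j
    show "(\<lambda>z. (\<chi> i j. if j = s then ind C $ i else K (fst z) (snd z) $ i $ j) $ i $ j) differentiable (at a)"
      using differentiable_K by (cases "j = s") auto
  qed
  then show ?thesis
    unfolding xv_def sol_def using assms by (auto intro!: differentiable_divide differentiable_det_K)
qed

lemma differentiable_yv:
  assumes "det (K (fst a) (snd a)) \<noteq> 0"
  shows "(\<lambda>z. yv C (fst z) (snd z) $ s) differentiable (at a)"
proof -
  have "(\<lambda>z. det (\<chi> i j. if j = s then axis (rp C) 1 $ i else transpose (K (fst z) (snd z)) $ i $ j)) differentiable (at a)"
  proof (rule differentiable_det)
    fix i j
    show "(\<lambda>z. (\<chi> i j. if j = s then axis (rp C) 1 $ i else transpose (K (fst z) (snd z)) $ i $ j) $ i $ j) differentiable (at a)"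
      using differentiable_K by (cases "j = s") (auto simp: transpose_def)
  qed
  then show ?thesis
    unfolding yv_def sol_def using assms by (auto intro!: differentiable_divide differentiable_det_K)
qed

text \<open>Continuity at the base point, where the pairing equals 1. The margin 1/2 serves as the
  contraction constant in \<open>dominant_exists\<close> and keeps the pairing away from 0; the two
  arguments \<mu> and \<nu> are those of \<open>pev_diff\<close>.\<close>

lemma ex_good_radius:
  "\<exists>r>0. \<forall>\<mu> \<nu> t. dist \<mu> (of_nat Q) \<le> r \<longrightarrow> dist \<nu> (of_nat Q) \<le> r \<longrightarrow> \<bar>t\<bar> \<le> r \<longrightarrow>
     det (K \<mu> t) \<noteq> 0 \<and> (\<forall>C\<in>F. cmod (tdot (yv C \<mu> t) (xv C \<nu> t) - 1) < 1/2)"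
proof -
  define a where "a = (of_nat Q :: complex, of_nat Q :: complex, 0 :: real)"
  have c1: "isCont (\<lambda>w :: complex \<times> complex \<times> real. (fst w, snd (snd w))) a"
    and c2: "isCont (\<lambda>w :: complex \<times> complex \<times> real. (fst (snd w), snd (snd w))) a"
    by (intro continuous_intros)+
  have dK: "det (K (fst (of_nat Q, 0)) (snd (of_nat Q, 0))) \<noteq> 0" using det_K_nonzero by simp
  have cx: "isCont (\<lambda>w. xv C (fst (snd w)) (snd (snd w)) $ s) a" for C s
    using isCont_o2[OF c2, of "\<lambda>z. xv C (fst z) (snd z) $ s"]
      differentiable_imp_continuous_within[OF differentiable_xv[OF dK]] by (simp add: a_def)
  have cy: "isCont (\<lambda>w. yv C (fst w) (snd (snd w)) $ s) a" for C s
    using isCont_o2[OF c1, of "\<lambda>z. yv C (fst z) (snd z) $ s"]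
      differentiable_imp_continuous_within[OF differentiable_yv[OF dK]] by (simp add: a_def)
  have cd: "isCont (\<lambda>w. det (K (fst w) (snd (snd w)))) a"
    using isCont_o2[OF c1, of "\<lambda>z. det (K (fst z) (snd z))"]
      differentiable_imp_continuous_within[OF differentiable_det_K] by (simp add: a_def)
  have ct: "isCont (\<lambda>w. tdot (yv C (fst w) (snd (snd w))) (xv C (fst (snd w)) (snd (snd w)))) a" for C
    unfolding tdot_def by (intro continuous_intros cx cy)
  have "\<forall>\<^sub>F w in nhds a. det (K (fst w) (snd (snd w))) \<noteq> 0"
    using cd det_K_nonzero unfolding isCont_def continuous_at
    by (intro tendsto_imp_eventually_ne[where c = "det (K (of_nat Q) 0)"]) (auto simp: a_def tendsto_nhds_iff isCont_def)
  moreover have "\<forall>\<^sub>F w in nhds a. \<forall>C\<in>F. cmod (tdot (yv C (fst w) (snd (snd w))) (xv C (fst (snd w)) (snd (snd w))) - 1) < 1/2"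
  proof (rule eventually_ball_finite[OF finF], rule ballI)
    fix C assume C: "C \<in> F"
    have "((\<lambda>w. tdot (yv C (fst w) (snd (snd w))) (xv C (fst (snd w)) (snd (snd w)))) \<longlongrightarrow> 1) (nhds a)"
      using ct[of C] tdot_yv_xv_at_0[OF C] by (simp add: a_def tendsto_nhds_iff isCont_def)
    from tendstoD[OF this, of "1/2"] show "\<forall>\<^sub>F w in nhds a. cmod (tdot (yv C (fst w) (snd (snd w))) (xv C (fst (snd w)) (snd (snd w))) - 1) < 1/2"
      by (simp add: dist_norm)
  qed
  ultimately have "\<forall>\<^sub>F w in nhds a. det (K (fst w) (snd (snd w))) \<noteq> 0 \<and>
      (\<forall>C\<in>F. cmod (tdot (yv C (fst w) (snd (snd w))) (xv C (fst (snd w)) (snd (snd w))) - 1) < 1/2)"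
    by eventually_elim auto
  then obtain r where r: "r > 0" "\<And>w. dist w a < r \<Longrightarrow> det (K (fst w) (snd (snd w))) \<noteq> 0 \<and>
      (\<forall>C\<in>F. cmod (tdot (yv C (fst w) (snd (snd w))) (xv C (fst (snd w)) (snd (snd w))) - 1) < 1/2)"
    unfolding eventually_nhds_metric by blast
  show ?thesis
  proof (intro exI[of _ "r / 4"] conjI allI impI)
    fix \<mu> \<nu> :: complex and t :: real
    assume *: "dist \<mu> (of_nat Q) \<le> r / 4" "dist \<nu> (of_nat Q) \<le> r / 4" "\<bar>t\<bar> \<le> r / 4"
    have "dist (\<mu>, \<nu>, t) a \<le> dist \<mu> (of_nat Q) + dist (\<nu>, t) (of_nat Q, 0)"
      unfolding a_def by (subst dist_Pair_Pair) (rule sqrt_sum_squares_le_sum; simp)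
    also have "dist (\<nu>, t) (of_nat Q, 0) \<le> dist \<nu> (of_nat Q) + dist t 0"
      by (subst dist_Pair_Pair) (rule sqrt_sum_squares_le_sum; simp)
    finally have "dist (\<mu>, \<nu>, t) a < r" using * r(1) by (simp add: dist_real_def)
    from r(2)[OF this] show "det (K \<mu> t) \<noteq> 0" "\<forall>C\<in>F. cmod (tdot (yv C \<mu> t) (xv C \<nu> t) - 1) < 1/2" by auto
  qed (use r in auto)
qed

definition rad :: real where
  "rad = (SOME r. r > 0 \<and> (\<forall>\<mu> \<nu> t. dist \<mu> (of_nat Q) \<le> r \<longrightarrow> dist \<nu> (of_nat Q) \<le> r \<longrightarrow> \<bar>t\<bar> \<le> r \<longrightarrow>
     det (K \<mu> t) \<noteq> 0 \<and> (\<forall>C\<in>F. cmod (tdot (yv C \<mu> t) (xv C \<nu> t) - 1) < 1/2)))"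

lemma rad_pos: "rad > 0"
  and rad_det: "dist \<mu> (of_nat Q) \<le> rad \<Longrightarrow> \<bar>t\<bar> \<le> rad \<Longrightarrow> det (K \<mu> t) \<noteq> 0"
  and rad_near: "C \<in> F \<Longrightarrow> dist \<mu> (of_nat Q) \<le> rad \<Longrightarrow> dist \<nu> (of_nat Q) \<le> rad \<Longrightarrow> \<bar>t\<bar> \<le> rad \<Longrightarrow>
     cmod (tdot (yv C \<mu> t) (xv C \<nu> t) - 1) < 1/2"
proof -
  have *: "rad > 0 \<and> (\<forall>\<mu> \<nu> t. dist \<mu> (of_nat Q) \<le> rad \<longrightarrow> dist \<nu> (of_nat Q) \<le> rad \<longrightarrow> \<bar>t\<bar> \<le> rad \<longrightarrow>
     det (K \<mu> t) \<noteq> 0 \<and> (\<forall>C\<in>F. cmod (tdot (yv C \<mu> t) (xv C \<nu> t) - 1) < 1/2))"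
    unfolding rad_def by (rule someI_ex) (use ex_good_radius in blast)
  show "rad > 0" using * by blast
  show "dist \<mu> (of_nat Q) \<le> rad \<Longrightarrow> \<bar>t\<bar> \<le> rad \<Longrightarrow> det (K \<mu> t) \<noteq> 0" using * by blast
  show "C \<in> F \<Longrightarrow> dist \<mu> (of_nat Q) \<le> rad \<Longrightarrow> dist \<nu> (of_nat Q) \<le> rad \<Longrightarrow> \<bar>t\<bar> \<le> rad \<Longrightarrow>
     cmod (tdot (yv C \<mu> t) (xv C \<nu> t) - 1) < 1/2" using * by blast
qed

lemma rad_nonzero:
  assumes "C \<in> F" "dist \<mu> (of_nat Q) \<le> rad" "dist \<nu> (of_nat Q) \<le> rad" "\<bar>t\<bar> \<le> rad"
  shows "tdot (yv C \<mu> t) (xv C \<nu> t) \<noteq> 0" "cmod (tdot (yv C \<mu> t) (xv C \<nu> t)) \<ge> 1/2"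
proof -
  define w where "w = tdot (yv C \<mu> t) (xv C \<nu> t)"
  have "cmod (w - 1) < 1/2" unfolding w_def by (rule rad_near[OF assms])
  moreover have "cmod 1 \<le> cmod w + cmod (w - 1)" using norm_triangle_ineq4[of w "w - 1"] by simp
  ultimately have "cmod w \<ge> 1/2" by simp
  then show "tdot (yv C \<mu> t) (xv C \<nu> t) \<noteq> 0" "cmod (tdot (yv C \<mu> t) (xv C \<nu> t)) \<ge> 1/2"
    unfolding w_def by auto
qed

lemma differentiable_curve:
  fixes f :: "complex \<times> real \<Rightarrow> complex" and m :: "real \<Rightarrow> complex"
  assumes "f differentiable (at (m 0, 0))" "m differentiable (at 0)"
  shows "(\<lambda>t. f (m t, t :: real)) differentiable (at 0)"
proof -
  have "(\<lambda>t. (m t, t)) differentiable (at 0)"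
    using assms(2) has_derivative_Pair[OF _ has_derivative_ident] unfolding differentiable_def by blast
  then show ?thesis
    using differentiable_compose[of f "\<lambda>t. (m t, t)" 0 UNIV] assms(1) by simp
qed

text \<open>The equation \<open>pev C m t = 1\<close> says that \<open>m\<close> is fixed by
  \<open>m + pev C m t - 1\<close>, a contraction since the slope of \<open>pev\<close> in
  \<open>m\<close> is close to -1. Differentiability at 0 comes from \<open>pev_diff\<close>, which
  expresses \<open>\<mu> t - Q\<close> as \<open>pev C Q t - 1\<close> divided by a pairing tending
  to 1.\<close>

lemma dominant_exists:
  assumes C: "C \<in> F"
  shows "\<exists>\<mu>. \<mu> 0 = of_nat Q \<and> \<mu> differentiable (at 0) \<and>
     (\<forall>\<^sub>F t in nhds 0. is_principal_eigenvalue (M t) C (\<mu> t))"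
proof -
  have dK: "det (K (fst (of_nat Q, 0)) (snd (of_nat Q, 0))) \<noteq> 0" using det_K_nonzero by simp
  define \<phi> where "\<phi> t = pev C (of_nat Q) t" for t
  have d\<phi>: "\<phi> differentiable (at 0)"
    unfolding \<phi>_def
    using differentiable_curve[of "\<lambda>z. xv C (fst z) (snd z) $ rp C" "\<lambda>_. of_nat Q"] differentiable_xv[OF dK] by simp
  have \<phi>0: "\<phi> 0 = 1" by (simp add: \<phi>_def pev_at_0[OF C])
  have "isCont \<phi> 0" using d\<phi> by (rule differentiable_imp_continuous_within)
  then have "\<forall>\<^sub>F t in nhds 0. dist (\<phi> t) 1 < rad / 2"
    using rad_pos \<phi>0 by (intro tendstoD) (auto simp: isCont_def tendsto_nhds_iff)
  moreover have "\<forall>\<^sub>F t in nhds (0::real). \<bar>t\<bar> < rad"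
    using rad_pos by (auto simp: eventually_nhds_metric dist_real_def)
  ultimately have good: "\<forall>\<^sub>F t in nhds 0. \<bar>t\<bar> < rad \<and> dist (\<phi> t) 1 < rad / 2"
    by eventually_elim auto
  have ex: "\<exists>m. dist m (of_nat Q) \<le> rad \<and> pev C m t = 1" if t: "\<bar>t\<bar> < rad" "dist (\<phi> t) 1 < rad / 2" for t
  proof -
    define G where "G m = m + pev C m t - 1" for m
    define S where "S = cball (of_nat Q :: complex) rad"
    have lip: "dist (G a) (G b) \<le> 1/2 * dist a b" if "a \<in> S" "b \<in> S" for a b
    proof -
      have ab: "dist a (of_nat Q) \<le> rad" "dist b (of_nat Q) \<le> rad" using that by (auto simp: S_def dist_commute)
      have "G a - G b = (a - b) * (1 - tdot (yv C a t) (xv C b t))"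
        using pev_diff[OF rad_det[OF ab(1)] rad_det[OF ab(2)], of t C] t(1) by (simp add: G_def algebra_simps)
      then have "dist (G a) (G b) = dist a b * cmod (1 - tdot (yv C a t) (xv C b t))"
        by (simp add: dist_norm norm_mult)
      also have "\<dots> \<le> dist a b * (1/2)"
        using rad_near[OF C ab, of t] t(1) by (intro mult_left_mono) (auto simp: norm_minus_commute)
      finally show ?thesis by simp
    qed
    have "G ` S \<subseteq> S"
    proof
      fix y assume "y \<in> G ` S"
      then obtain a where a: "a \<in> S" "y = G a" by auto
      have "dist (G a) (of_nat Q) \<le> dist (G a) (G (of_nat Q)) + dist (G (of_nat Q)) (of_nat Q)" by (rule dist_triangle)
      also have "dist (G (of_nat Q)) (of_nat Q) = dist (\<phi> t) 1" by (simp add: G_def \<phi>_def dist_norm)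
      also have "dist (G a) (G (of_nat Q)) \<le> 1/2 * dist a (of_nat Q)"
        using lip[of a "of_nat Q"] a rad_pos by (simp add: S_def)
      also have "\<dots> \<le> 1/2 * rad" using a by (simp add: S_def dist_commute)
      finally have "dist (G a) (of_nat Q) \<le> rad" using t(2) by simp
      then show "y \<in> S" using a by (simp add: S_def dist_commute)
    qed
    moreover have "closed S" "S \<noteq> {}" using rad_pos by (auto simp: S_def)
    ultimately have "\<exists>!x\<in>S. G x = x"
      using Banach_fix[OF iffD2[OF complete_eq_closed], of S "1/2" G] lip by auto
    then obtain m where "m \<in> S" "G m = m" by blast
    then show ?thesis by (intro exI[of _ m]) (auto simp: S_def G_def dist_commute)
  qed
  define \<mu> where "\<mu> t = (if \<bar>t\<bar> < rad \<and> dist (\<phi> t) 1 < rad / 2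
     then SOME m. dist m (of_nat Q) \<le> rad \<and> pev C m t = 1 else of_nat Q)" for t
  have \<mu>: "dist (\<mu> t) (of_nat Q) \<le> rad" "pev C (\<mu> t) t = 1" if "\<bar>t\<bar> < rad" "dist (\<phi> t) 1 < rad / 2" for t
    using someI_ex[OF ex[OF that]] that by (auto simp: \<mu>_def)
  have QQ: "dist (of_nat Q) (of_nat Q :: complex) \<le> rad" using rad_pos by simp
  \<comment> \<open>\<open>pev_diff\<close> at \<open>\<nu> = Q\<close> with the value 1 inserted;
    it yields \<open>\<mu> 0 = Q\<close>, continuity and the derivative at 0.\<close>
  have key: "(\<mu> t - of_nat Q) * tdot (yv C (\<mu> t) t) (xv C (of_nat Q) t) = \<phi> t - 1"
    if t: "\<bar>t\<bar> < rad" "dist (\<phi> t) 1 < rad / 2" for t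
    using pev_diff[OF rad_det[OF \<mu>(1)[OF t]] rad_det[OF QQ], of t C] \<mu>(2)[OF t] t(1)
    by (simp add: \<phi>_def algebra_simps)
  have \<mu>0: "\<mu> 0 = of_nat Q"
  proof -
    have t: "\<bar>0::real\<bar> < rad" "dist (\<phi> 0) 1 < rad / 2" using rad_pos \<phi>0 by auto
    from key[OF t] rad_nonzero(1)[OF C \<mu>(1)[OF t] QQ, of 0] t show ?thesis by (simp add: \<phi>0)
  qed
  have \<mu>lim: "(\<mu> \<longlongrightarrow> of_nat Q) (nhds 0)"
  proof -
    have "((\<lambda>t. \<mu> t - of_nat Q) \<longlongrightarrow> 0) (nhds 0)"
    proof (rule Lim_null_comparison)
      have "(\<phi> \<longlongrightarrow> 1) (nhds 0)" using \<open>isCont \<phi> 0\<close> \<phi>0 by (simp add: isCont_def tendsto_nhds_iff)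
      then have "((\<lambda>t. 2 * cmod (\<phi> t - 1)) \<longlongrightarrow> 2 * cmod (1 - 1)) (nhds 0)" by (intro tendsto_intros)
      then show "((\<lambda>t. 2 * cmod (\<phi> t - 1)) \<longlongrightarrow> 0) (nhds 0)" by simp
      show "\<forall>\<^sub>F t in nhds 0. cmod (\<mu> t - of_nat Q) \<le> 2 * cmod (\<phi> t - 1)"
        using good
      proof eventually_elim
        case (elim t)
        have "cmod (\<mu> t - of_nat Q) * (1/2) \<le> cmod (\<mu> t - of_nat Q) * cmod (tdot (yv C (\<mu> t) t) (xv C (of_nat Q) t))"
          using elim by (intro mult_left_mono rad_nonzero(2)[OF C \<mu>(1) QQ]) auto
        also have "\<dots> = cmod (\<phi> t - 1)" using key[of t] elim by (metis norm_mult)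
        finally show ?case by simp
      qed
    qed
    then show ?thesis by (simp add: LIM_zero_iff)
  qed
  define g where "g t = tdot (yv C (\<mu> t) t) (xv C (of_nat Q) t)" for t
  have glim: "(g \<longlongrightarrow> 1) (at 0)"
  proof -
    have cy: "isCont (\<lambda>z. yv C (fst z) (snd z) $ s) (of_nat Q, 0)" for s
      by (rule differentiable_imp_continuous_within[OF differentiable_yv[OF dK]])
    have cx: "isCont (\<lambda>z. xv C (fst z) (snd z) $ s) (of_nat Q, 0)" for s
      by (rule differentiable_imp_continuous_within[OF differentiable_xv[OF dK]])
    have "((\<lambda>t. (\<mu> t, t)) \<longlongrightarrow> (of_nat Q, 0)) (at 0)"
      using \<mu>lim by (intro tendsto_Pair) (auto simp: tendsto_nhds_iff)
    from isCont_tendsto_compose[OF cy this]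
    have ly: "((\<lambda>t. yv C (\<mu> t) t $ s) \<longlongrightarrow> yv C (of_nat Q) 0 $ s) (at 0)" for s by simp
    have "((\<lambda>t. (of_nat Q :: complex, t)) \<longlongrightarrow> (of_nat Q, 0)) (at (0::real))"
      by (intro tendsto_intros)
    from isCont_tendsto_compose[OF cx this]
    have lx: "((\<lambda>t. xv C (of_nat Q) t $ s) \<longlongrightarrow> xv C (of_nat Q) 0 $ s) (at 0)" for s by simp
    have "(g \<longlongrightarrow> tdot (yv C (of_nat Q) 0) (xv C (of_nat Q) 0)) (at 0)"
      unfolding g_def tdot_def by (intro tendsto_intros lx ly)
    then show ?thesis by (simp add: tdot_yv_xv_at_0[OF C])
  qed
  obtain D where D: "(\<phi> has_vector_derivative D) (at 0)"
    using d\<phi> vector_derivative_works by blast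
  have "((\<lambda>t. ((\<phi> t - \<phi> 0) / of_real t) / g t) \<longlongrightarrow> D / 1) (at 0)"
    using D glim by (intro tendsto_divide) (auto simp: has_vector_derivative_iff_quotient)
  then have "((\<lambda>t. (\<mu> t - \<mu> 0) / of_real t) \<longlongrightarrow> D / 1) (at 0)"
  proof (rule Lim_transform_eventually)
    show "\<forall>\<^sub>F t in at 0. ((\<phi> t - \<phi> 0) / of_real t) / g t = (\<mu> t - \<mu> 0) / of_real t"
      using good[unfolded eventually_nhds_conv_at, THEN conjunct1]
    proof eventually_elim
      case (elim t)
      have "g t \<noteq> 0" unfolding g_def using elim by (intro rad_nonzero(1)[OF C \<mu>(1) QQ]) auto
      moreover have "\<phi> t - \<phi> 0 = (\<mu> t - \<mu> 0) * g t" using key[of t] elim by (simp add: g_def \<mu>0 \<phi>0)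
      ultimately show ?case by (simp only:) simp
    qed
  qed
  then have "(\<mu> has_vector_derivative D) (at 0)" by (simp add: has_vector_derivative_iff_quotient)
  then have "\<mu> differentiable (at 0)" by (auto simp: has_vector_derivative_def differentiable_def)
  moreover have "\<forall>\<^sub>F t in nhds 0. is_principal_eigenvalue (M t) C (\<mu> t)"
    using good
  proof eventually_elim
    case (elim t)
    then show ?case using \<mu>[of t] principal_eigenvalue_iff[OF rad_det[OF \<mu>(1)] C, of t t] by auto
  qed
  ultimately show ?thesis using \<mu>0 by blast
qed

abbreviation mu :: "'s set \<Rightarrow> real \<Rightarrow> complex" where "mu \<equiv> dominant_eigenvalue q T"

lemma mu_props:
  assumes "C \<in> F"
  shows "mu C 0 = of_nat Q" "mu C differentiable (at 0)"
    "\<forall>\<^sub>F t in nhds 0. is_principal_eigenvalue (M t) C (mu C t)"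
proof -
  have "mu C 0 = of_nat Q \<and> mu C differentiable (at 0) \<and>
     (\<forall>\<^sub>F t in nhds 0. is_principal_eigenvalue (M t) C (mu C t))"
    using someI_ex[OF dominant_exists[OF assms]] by (simp only: dominant_eigenvalue_def Q_def)
  then show "mu C 0 = of_nat Q" "mu C differentiable (at 0)"
    "\<forall>\<^sub>F t in nhds 0. is_principal_eigenvalue (M t) C (mu C t)" by blast+
qed

text \<open>\<open>mu\<close> is a chosen germ, so nothing is known of it far from 0. This predicate
  holds near 0 and collects what the perturbation identities use: \<open>mu C t\<close> is an
  eigenvalue on \<open>C\<close>, and all parameters stay within \<open>rad\<close>.\<close>

definition good :: "real \<Rightarrow> bool" where
  "good t \<longleftrightarrow> \<bar>t\<bar> \<le> rad \<and> (\<forall>C\<in>F. dist (mu C t) (of_nat Q) \<le> rad \<and> pev C (mu C t) t = 1)"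

lemma eventually_good: "\<forall>\<^sub>F t in nhds 0. good t"
proof -
  have rt: "\<forall>\<^sub>F t in nhds (0::real). \<bar>t\<bar> \<le> rad"
    using rad_pos by (auto simp: eventually_nhds_metric dist_real_def intro!: exI[of _ rad])
  have "\<forall>\<^sub>F t in nhds 0. \<forall>C\<in>F. dist (mu C t) (of_nat Q) \<le> rad \<and> pev C (mu C t) t = 1"
  proof (rule eventually_ball_finite[OF finF], rule ballI)
    fix C assume C: "C \<in> F"
    have "isCont (mu C) 0" by (rule differentiable_imp_continuous_within[OF mu_props(2)[OF C]])
    then have "(mu C \<longlongrightarrow> of_nat Q) (nhds 0)" using mu_props(1)[OF C] by (simp add: isCont_def tendsto_nhds_iff)
    from tendstoD[OF this rad_pos] mu_props(3)[OF C] rt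
    show "\<forall>\<^sub>F t in nhds 0. dist (mu C t) (of_nat Q) \<le> rad \<and> pev C (mu C t) t = 1"
    proof eventually_elim
      case (elim t)
      then show ?case using principal_eigenvalue_iff[OF rad_det C, of "mu C t" t] by auto
    qed
  qed
  with rt show ?thesis unfolding good_def by eventually_elim auto
qed

lemma good_0: "good 0"
  using eventually_nhds_x_imp_x[OF eventually_good] .

text \<open>For good \<open>t\<close> these are right and left eigenvectors for
  \<open>mu C t\<close>. \<open>Y\<close> pairs to 1 with the all-ones vector, and \<open>XH\<close>
  is \<open>X\<close> rescaled to be dual to \<open>Y\<close>.\<close>

definition X :: "'s set \<Rightarrow> real \<Rightarrow> complex ^ 's" where "X C t = xv C (mu C t) t"
definition Y :: "'s set \<Rightarrow> real \<Rightarrow> complex ^ 's" where "Y C t = yv C (mu C t) t"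
definition XH :: "'s set \<Rightarrow> real \<Rightarrow> complex ^ 's" where "XH C t = (1 / tdot (Y C t) (X C t)) *s X C t"

context
  fixes t :: real and C :: "'s set"
  assumes t: "good t" and C: "C \<in> F"
begin

lemma good_det: "det (K (mu C t) t) \<noteq> 0"
  using t C by (intro rad_det) (auto simp: good_def)

lemma X_eigen: "M t *v X C t = mu C t *s X C t"
  unfolding X_def using t C by (intro xv_eigen good_det) (auto simp: good_def)

lemma Y_eigen: "Y C t v* M t = mu C t *s Y C t"
  unfolding Y_def using t C by (intro yv_eigen good_det) (auto simp: good_def)

lemma YX_nonzero: "tdot (Y C t) (X C t) \<noteq> 0"
  unfolding X_def Y_def using t C by (intro rad_nonzero(1)) (auto simp: good_def)

lemma XH_eigen: "M t *v XH C t = mu C t *s XH C t"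
  by (simp add: XH_def vector_scalar_commute X_eigen mult.commute)

lemma YXH: "tdot (Y C t) (XH C t) = 1"
  using YX_nonzero by (simp add: XH_def tdot_scale_right)

text \<open>\<open>Y C t\<close> is supported on \<open>C\<close>, so the all-ones vector may be
  replaced by \<open>ind C\<close>, and that pairing is \<open>pev\<close>, which is 1 on the
  eigenvalue.\<close>

lemma Y_one: "tdot (Y C t) (vec 1) = 1"
proof -
  have "tdot (Y C t) (vec 1) = tdot (Y C t) (ind C)"
    unfolding tdot_def Y_def using yv_vanish[OF good_det C]
    by (intro sum.cong) (auto simp: ind_def indicator_def)
  also have "\<dots> = 1"
    unfolding Y_def using tdot_yv_ind[OF good_det, of C] t C by (simp add: good_def)
  finally show ?thesis .
qed

end

lemma YXH_other:
  assumes "good t" "C \<in> F" "C' \<in> F" "C \<noteq> C'"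
  shows "tdot (Y C t) (XH C' t) = 0"
  using tdot_yv_xv_other[OF good_det[OF assms(1,2)] good_det[OF assms(1,3)] assms(2-4)]
  by (simp add: XH_def tdot_scale_right X_def Y_def)

lemma tdot_lshift: "tdot (lshift A \<mu> g) v = tdot g (A *v v - \<mu> *s v)"
proof -
  have "tdot g (A *v v - \<mu> *s v) = tdot g (A *v v) - \<mu> * tdot g v"
    by (simp add: tdot_def ring_distribs sum_subtractf sum_distrib_left mult_ac)
  then show ?thesis
    by (simp add: lshift_def tdot_diff_left tdot_scale_left tdot_matrix)
qed

lemma dominant_values_0: "dominant_values q T 0 t = (\<lambda>C. mu C t) ` F"
  by (simp add: dominant_values_def)

text \<open>\<open>v\<close> is the image under \<open>A - \<mu>\<close> of another vector, and
  \<open>A - \<mu>\<close> annihilates \<open>x\<close> from the other side.\<close>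

lemma tdot_gen_span_eq_0:
  assumes "v \<in> gen_span A D" "\<mu> \<notin> D" "A *v x = \<mu> *s x"
  shows "tdot v x = 0"
proof -
  obtain v' where "v = lshift A \<mu> v'" using lshift_surj_gen_span[OF assms(2,1)] by blast
  then show ?thesis by (simp add: tdot_lshift assms(3)) (simp add: tdot_def)
qed

lemma tdot_eqI: "(\<And>b. tdot g b = tdot h b) \<Longrightarrow> g = h"
proof -
  assume *: "\<And>b. tdot g b = tdot h b"
  have "g $ s = h $ s" for s
    using *[of "axis s 1"] by (simp add: tdot_def axis_def if_distrib cong: if_cong)
  then show "g = h" by (simp add: vec_eq_iff)
qed

text \<open>A left eigenvector \<open>g\<close> turns \<open>K\<close> into a combination of the
  unit vectors at the representatives, with coefficients \<open>\<beta> C\<close>, so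
  \<open>g\<close> is the same combination of the \<open>yv\<close>. Pairing with \<open>X C\<close>
  isolates \<open>\<beta> C\<close> times a number that is nonzero within \<open>rad\<close>.
  Several components may share the eigenvalue; the argument treats them at once.\<close>

lemma left_eigenvector_eq_0:
  assumes t: "good t" and C0: "C0 \<in> F" and g: "lshift (M t) (mu C0 t) g = 0"
    and orth: "\<And>C. C \<in> F \<Longrightarrow> tdot g (X C t) = 0"
  shows "g = 0"
proof -
  define \<mu> where "\<mu> = mu C0 t"
  have \<mu>: "dist \<mu> (of_nat Q) \<le> rad" "\<bar>t\<bar> \<le> rad" using t C0 by (auto simp: good_def \<mu>_def)
  note dK = rad_det[OF \<mu>]
  define \<beta> where "\<beta> C = tdot g (ind C)" for C
  have gM: "tdot g (M t *v v) = \<mu> * tdot g v" for v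
  proof -
    have "tdot (lshift (M t) \<mu> g) v = 0" using g by (simp add: \<mu>_def tdot_def)
    then show ?thesis by (simp add: lshift_def tdot_diff_left tdot_scale_left tdot_matrix)
  qed
  have gK: "tdot g (K \<mu> t *v v) = (\<Sum>C\<in>F. v $ rp C * \<beta> C)" for v
  proof -
    have "tdot g (K \<mu> t *v v) = \<mu> * tdot g v - tdot g (M t *v v) + (\<Sum>C\<in>F. v $ rp C * \<beta> C)"
      unfolding K_mult tdot_add_right tdot_sum_right tdot_scale_right \<beta>_def
      by (simp add: tdot_def ring_distribs sum_subtractf sum_distrib_left mult_ac)
    then show ?thesis by (simp add: gM)
  qed
  have rep: "tdot g b = (\<Sum>C\<in>F. \<beta> C * tdot (yv C \<mu> t) b)" for b
  proof -
    define v where "v = sol (K \<mu> t) b"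
    have v: "K \<mu> t *v v = b" using dK by (simp add: sol_iff v_def)
    have "v $ rp C = tdot (yv C \<mu> t) b" for C
      unfolding v[symmetric] tdot_matrix yv_K[OF dK] by (simp add: tdot_axis)
    then show ?thesis using gK[of v] by (simp add: v mult.commute)
  qed
  have "\<beta> C = 0" if C: "C \<in> F" for C
  proof -
    have "0 = (\<Sum>C'\<in>F. \<beta> C' * tdot (yv C' \<mu> t) (X C t))"
      using orth[OF C] rep by simp
    also have "\<dots> = (\<Sum>C'\<in>F. if C' = C then \<beta> C' * tdot (yv C' \<mu> t) (X C t) else 0)"
      unfolding X_def using tdot_yv_xv_other[OF dK good_det[OF t C] _ C]
      by (intro sum.cong) auto
    also have "\<dots> = \<beta> C * tdot (yv C \<mu> t) (X C t)" using C by simp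
    finally have "\<beta> C * tdot (yv C \<mu> t) (X C t) = 0" by simp
    moreover have "tdot (yv C \<mu> t) (X C t) \<noteq> 0"
      unfolding X_def using t C \<mu> by (intro rad_nonzero(1)) (auto simp: good_def)
    ultimately show ?thesis by simp
  qed
  then have "tdot g b = tdot 0 b" for b using rep[of b] by (simp add: tdot_def)
  then show ?thesis by (rule tdot_eqI)
qed

text \<open>The candidate lies in the span of the left eigenvectors and agrees with
  \<open>e_1\<close> on all right eigenvectors \<open>X C\<close>. Hence the component of their
  difference in \<open>gen_span (M t) ?D\<close> annihilates all \<open>X C\<close>. On that
  invariant annihilator no dominant value is an eigenvalue, so the component is 0. Coincidences
  among the \<open>mu C t\<close> and Jordan blocks are covered without separate discussion.\<close>

lemma w_vec_near_0:
  assumes t: "good t"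
  shows "w_vec q T 0 t = (\<Sum>C\<in>F. XH C t $ init T *s Y C t)"
  unfolding w_vec_def dominant_values_0
proof (rule proj_along_gen_spanI)
  let ?D = "(\<lambda>C. mu C t) ` F"
  let ?u = "\<Sum>C\<in>F. XH C t $ init T *s Y C t"
  let ?e = "axis (init T) 1 :: complex ^ 's"
  show fin: "finite ?D" by simp
  have "Y C t \<in> (\<Union>\<mu>\<in>?D. left_eigenspace (M t) \<mu>)" if "C \<in> F" for C
    using Y_eigen[OF t that] that by (auto simp: left_eigenspace_def)
  then show "?u \<in> vec.span (\<Union>\<mu>\<in>?D. left_eigenspace (M t) \<mu>)"
    by (intro vec.span_sum vec.span_scale vec.span_base) auto
  obtain g v where gv: "g \<in> gen_span (M t) ?D" "v \<in> gen_span (M t) (- ?D)" "?e - ?u = g + v"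
    using gen_span_decompose by blast
  have vX: "tdot v (X C t) = 0" if "C \<in> F" for C
    by (rule tdot_gen_span_eq_0[OF gv(2) _ X_eigen[OF t that]]) (use that in auto)
  have eX: "tdot (?e - ?u) (X C t) = 0" if C: "C \<in> F" for C
  proof -
    have XX: "X C t = tdot (Y C t) (X C t) *s XH C t"
      using YX_nonzero[OF t C] by (simp add: XH_def)
    have "tdot ?u (XH C t) = (\<Sum>C'\<in>F. XH C' t $ init T * tdot (Y C' t) (XH C t))"
      by (simp add: tdot_def sum_distrib_right sum_distrib_left sum.swap[of _ F] mult.assoc)
    also have "\<dots> = (\<Sum>C'\<in>F. if C' = C then XH C' t $ init T else 0)"
      using YXH[OF t C] YXH_other[OF t _ C] by (intro sum.cong) auto
    also have "\<dots> = tdot ?e (XH C t)" using C by (simp add: tdot_axis)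
    finally have "tdot (?e - ?u) (XH C t) = 0" by (simp add: tdot_diff_left)
    then show ?thesis by (subst XX) (simp add: tdot_scale_right)
  qed
  have "g = 0"
  proof (rule gen_span_Int_invariant[OF fin, of "{g. \<forall>C\<in>F. tdot g (X C t) = 0}"])
    show "vec.subspace {g. \<forall>C\<in>F. tdot g (X C t) = 0}"
      by (auto simp: vec.subspace_def tdot_add_left tdot_scale_left) (simp add: tdot_def)
    show "lshift (M t) \<mu> x \<in> {g. \<forall>C\<in>F. tdot g (X C t) = 0}" if x: "x \<in> {g. \<forall>C\<in>F. tdot g (X C t) = 0}" for x \<mu>
    proof (clarify)
      fix C assume C: "C \<in> F"
      have "tdot (lshift (M t) \<mu> x) (X C t) = tdot x ((mu C t - \<mu>) *s X C t)"
        unfolding tdot_lshift X_eigen[OF t C] by (simp add: vec.scale_left_diff_distrib)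
      also have "\<dots> = (mu C t - \<mu>) * tdot x (X C t)" by (rule tdot_scale_right)
      finally show "tdot (lshift (M t) \<mu> x) (X C t) = 0" using x C by simp
    qed
    show "x = 0" if "x \<in> {g. \<forall>C\<in>F. tdot g (X C t) = 0}" "\<mu> \<in> ?D" "lshift (M t) \<mu> x = 0" for x \<mu>
      using that left_eigenvector_eq_0[OF t] by auto
    show "g \<in> {g. \<forall>C\<in>F. tdot g (X C t) = 0}"
    proof (clarify)
      fix C assume C: "C \<in> F"
      have "tdot g (X C t) = tdot (?e - ?u) (X C t) - tdot v (X C t)" unfolding gv(3) by (simp add: tdot_add_left)
      then show "tdot g (X C t) = 0" using vX[OF C] eX[OF C] by simp
    qed
    show "g \<in> gen_span (M t) ?D" by (rule gv(1))
  qed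
  then show "?e - ?u \<in> gen_span (M t) (- ?D)" using gv by simp
qed

lemma differentiable_X: "C \<in> F \<Longrightarrow> (\<lambda>t. X C t $ s) differentiable (at 0)"
  and differentiable_Y: "C \<in> F \<Longrightarrow> (\<lambda>t. Y C t $ s) differentiable (at 0)"
proof -
  assume C: "C \<in> F"
  have dK: "det (K (fst (mu C 0, 0)) (snd (mu C 0, 0))) \<noteq> 0"
    using det_K_nonzero by (simp add: mu_props[OF C])
  show "(\<lambda>t. X C t $ s) differentiable (at 0)"
    using differentiable_curve[OF differentiable_xv[OF dK] mu_props(2)[OF C], of C s] by (simp add: X_def)
  show "(\<lambda>t. Y C t $ s) differentiable (at 0)"
    using differentiable_curve[OF differentiable_yv[OF dK] mu_props(2)[OF C], of C s] by (simp add: Y_def)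
qed

lemma differentiable_XH: "C \<in> F \<Longrightarrow> (\<lambda>t. XH C t $ s) differentiable (at 0)"
  using YX_nonzero[OF good_0, of C] unfolding XH_def tdot_def
  by (auto intro!: differentiable_mult differentiable_divide differentiable_sum differentiable_X differentiable_Y
      simp del: times_divide_eq_left)

lemma XH_0: "C \<in> F \<Longrightarrow> XH C 0 = xv C (of_nat Q) 0"
  using tdot_yv_xv_at_0[of C] by (simp add: XH_def X_def Y_def mu_props)

lemma sum_XH_0: "(\<Sum>C\<in>F. XH C 0) = vec 1"
  using sum_xv_at_0 by (simp add: XH_0)

lemma M_entry_derivative:
  "((\<lambda>t. M t $ i $ j) has_vector_derivative
     (\<Sum>\<epsilon>\<in>letters q. if target T i \<epsilon> = j then \<i> * of_real (trans_out T i \<epsilon>) else 0)) (at 0)"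
proof -
  have e: "((\<lambda>t. exp (\<i> * of_real (t * r))) has_vector_derivative \<i> * of_real r) (at 0)" for r :: real
  proof -
    have "((\<lambda>z. exp (\<i> * (z * of_real r))) has_field_derivative \<i> * of_real r) (at (of_real 0))"
      by (auto intro!: derivative_eq_intros)
    from has_vector_derivative_real_field[OF this, of UNIV] show ?thesis by simp
  qed
  show ?thesis
    unfolding M_entry
    by (intro has_vector_derivative_sum) (auto intro: e[simplified] has_vector_derivative_const)
qed

text \<open>Let \<open>P\<close> be the sum of the \<open>XH C t\<close>; it is the all-ones vector
  at 0, and its entry at the initial state is the pairing of w_0(t) with the all-ones vector.
  Differentiate \<open>u M P\<close>, which is the sum of the \<open>mu C\<close> times
  \<open>u XH C\<close>, at 0: as \<open>u\<close> annihilates the \<open>XH C 0\<close>, the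
  derivatives of \<open>mu\<close> drop out, and \<open>u (M - Q) P'\<close> equals
  \<open>- \<i>\<close> times \<open>u o\<close>. Because \<open>u (M - Q) = e_1 - w_0\<close> and
  \<open>w_0 P' = 0\<close>, the former is the entry of \<open>P'\<close> at the initial
  state.\<close>

lemma w_vec_derivative:
  assumes u: "u \<in> gen_span (M 0) (- {of_nat Q})"
    and r: "lshift (M 0) (of_nat Q) u = axis (init T) 1 - w_vec q T 0 0"
  shows "tdot (vector_derivative (w_vec q T 0) (at 0)) (vec 1) = - \<i> * tdot u (out_vec q T)"
proof -
  define P where "P t = (\<Sum>C\<in>F. XH C t)" for t
  define W where "W t = (\<Sum>C\<in>F. XH C t $ init T *s Y C t)" for t
  define w where "w = w_vec q T 0 0"
  have w: "w = W 0" unfolding w_def W_def by (rule w_vec_near_0[OF good_0])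
  define vd where "vd f = vector_derivative f (at (0::real))" for f :: "real \<Rightarrow> complex"
  have vd: "(f has_vector_derivative vd f) (at 0)" if "f differentiable (at 0)" for f
    using that vector_derivative_works unfolding vd_def by blast
  have dXH: "((\<lambda>t. XH C t $ s) has_vector_derivative vd (\<lambda>t. XH C t $ s)) (at 0)" if "C \<in> F" for C s
    by (rule vd[OF differentiable_XH[OF that]])
  define P' where "P' s = (\<Sum>C\<in>F. vd (\<lambda>t. XH C t $ s))" for s
  have dP: "((\<lambda>t. P t $ s) has_vector_derivative P' s) (at 0)" for s
    unfolding P_def P'_def sum_component by (intro has_vector_derivative_sum dXH)
  have P0: "P 0 $ s = 1" for s using sum_XH_0 by (simp add: P_def)
  \<comment> \<open>Identities proved for good \<open>t\<close> may be differentiated at 0, since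
    such \<open>t\<close> fill a neighbourhood.\<close>
  have same: "vd f = vd g" if "\<And>t. good t \<Longrightarrow> f t = g t" for f g
  proof -
    have "\<forall>\<^sub>F t in nhds 0. f t = g t" using eventually_good by eventually_elim (rule that)
    then show ?thesis unfolding vd_def
      by (intro vector_derivative_cong_eq) (auto simp: eventually_nhds_conv_at)
  qed
  have vdI: "(f has_vector_derivative D) (at 0) \<Longrightarrow> vd f = D" for f D
    unfolding vd_def by (rule vector_derivative_at)

  \<comment> \<open>Both \<open>Y P\<close> and \<open>Y 1\<close> are identically 1 near 0, and
    \<open>P\<close> is the all-ones vector at 0, so the derivatives of \<open>Y\<close>
    cancel.\<close>
  have yP: "(\<Sum>s\<in>UNIV. Y C 0 $ s * P' s) = 0" if C: "C \<in> F" for C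
  proof -
    have dY: "((\<lambda>t. Y C t $ s) has_vector_derivative vd (\<lambda>t. Y C t $ s)) (at 0)" for s
      by (rule vd[OF differentiable_Y[OF C]])
    have "((\<lambda>t. tdot (Y C t) (P t)) has_vector_derivative
        (\<Sum>s\<in>UNIV. Y C 0 $ s * P' s + vd (\<lambda>t. Y C t $ s) * P 0 $ s)) (at 0)"
      unfolding tdot_def by (intro has_vector_derivative_sum has_vector_derivative_mult dY dP)
    then have 1: "vd (\<lambda>t. tdot (Y C t) (P t)) = (\<Sum>s\<in>UNIV. Y C 0 $ s * P' s) + (\<Sum>s\<in>UNIV. vd (\<lambda>t. Y C t $ s))"
      by (simp add: vdI P0 sum.distrib)
    have "((\<lambda>t. tdot (Y C t) (vec 1)) has_vector_derivative (\<Sum>s\<in>UNIV. vd (\<lambda>t. Y C t $ s))) (at 0)"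
      unfolding tdot_def by (simp, intro has_vector_derivative_sum dY)
    then have 2: "vd (\<lambda>t. tdot (Y C t) (vec 1)) = (\<Sum>s\<in>UNIV. vd (\<lambda>t. Y C t $ s))" by (rule vdI)
    have "vd (\<lambda>t. tdot (Y C t) (P t)) = vd (\<lambda>t. tdot (Y C t) (vec 1))"
    proof (rule same)
      fix t assume t: "good t"
      have "tdot (Y C t) (P t) = (\<Sum>C'\<in>F. if C' = C then 1 else 0)"
        unfolding P_def tdot_sum_right using YXH[OF t C] YXH_other[OF t C] by (intro sum.cong) auto
      then show "tdot (Y C t) (P t) = tdot (Y C t) (vec 1)" using Y_one[OF t C] C by simp
    qed
    then show ?thesis using 1 2 by simp
  qed
  have wP: "(\<Sum>s\<in>UNIV. w $ s * P' s) = 0"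
  proof -
    have "(\<Sum>s\<in>UNIV. w $ s * P' s) = (\<Sum>C\<in>F. XH C 0 $ init T * (\<Sum>s\<in>UNIV. Y C 0 $ s * P' s))"
      unfolding w W_def by (simp add: sum_distrib_right sum_distrib_left mult.assoc sum.swap[of _ F])
    then show ?thesis using yP by simp
  qed

  have uX: "tdot u (XH C 0) = 0" if C: "C \<in> F" for C
    by (rule tdot_gen_span_eq_0[OF u _ XH_eigen[OF good_0 C]]) (simp add: mu_props[OF C])
  \<comment> \<open>The eigenvalue equations of the \<open>XH C t\<close>, summed over the
    components, paired with \<open>u\<close> and differentiated at 0; M'(0) acts on the all-ones
    vector and yields \<open>out_vec\<close>.\<close>
  have main: "(\<Sum>s\<in>UNIV. (u v* M 0) $ s * P' s) + \<i> * tdot u (out_vec q T) = of_nat Q * (\<Sum>s\<in>UNIV. u $ s * P' s)"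
  proof -
    define M' where "M' i j = (\<Sum>\<epsilon>\<in>letters q. if target T i \<epsilon> = j then \<i> * of_real (trans_out T i \<epsilon>) else 0)" for i j
    have rowM': "(\<Sum>j\<in>UNIV. M' i j) = \<i> * out_vec q T $ i" for i
      unfolding M'_def by (subst sum.swap) (simp add: out_vec_def sum_distrib_left)
    have "((\<lambda>t. \<Sum>i\<in>UNIV. u $ i * (\<Sum>j\<in>UNIV. M t $ i $ j * P t $ j)) has_vector_derivative
       (\<Sum>i\<in>UNIV. u $ i * (\<Sum>j\<in>UNIV. M 0 $ i $ j * P' j + M' i j * P 0 $ j))) (at 0)"
      unfolding M'_def
      by (intro has_vector_derivative_sum has_vector_derivative_mult_right has_vector_derivative_mult M_entry_derivative dP)
    then have "vd (\<lambda>t. tdot u (M t *v P t)) = (\<Sum>i\<in>UNIV. u $ i * (\<Sum>j\<in>UNIV. M 0 $ i $ j * P' j + M' i j * P 0 $ j))"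
      by (intro vdI) (simp add: tdot_def matrix_vector_mult_def)
    also have "\<dots> = (\<Sum>i\<in>UNIV. \<Sum>j\<in>UNIV. u $ i * (M 0 $ i $ j * P' j)) + (\<Sum>i\<in>UNIV. u $ i * (\<Sum>j\<in>UNIV. M' i j))"
      by (simp add: P0 sum.distrib distrib_left sum_distrib_left)
    also have "(\<Sum>i\<in>UNIV. \<Sum>j\<in>UNIV. u $ i * (M 0 $ i $ j * P' j)) = (\<Sum>j\<in>UNIV. (u v* M 0) $ j * P' j)"
      by (subst sum.swap) (simp add: vector_matrix_mult_def sum_distrib_right sum_distrib_left mult_ac)
    also have "(\<Sum>i\<in>UNIV. u $ i * (\<Sum>j\<in>UNIV. M' i j)) = \<i> * tdot u (out_vec q T)"
      unfolding rowM' by (simp add: tdot_def sum_distrib_left mult_ac)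
    finally have L: "vd (\<lambda>t. tdot u (M t *v P t)) = (\<Sum>j\<in>UNIV. (u v* M 0) $ j * P' j) + \<i> * tdot u (out_vec q T)" .
    have "((\<lambda>t. \<Sum>C\<in>F. mu C t * (\<Sum>s\<in>UNIV. u $ s * XH C t $ s)) has_vector_derivative
       (\<Sum>C\<in>F. mu C 0 * (\<Sum>s\<in>UNIV. u $ s * vd (\<lambda>t. XH C t $ s)) + vd (mu C) * (\<Sum>s\<in>UNIV. u $ s * XH C 0 $ s))) (at 0)"
      by (intro has_vector_derivative_sum has_vector_derivative_mult has_vector_derivative_mult_right dXH vd mu_props)
    then have "vd (\<lambda>t. \<Sum>C\<in>F. mu C t * tdot u (XH C t))
       = (\<Sum>C\<in>F. mu C 0 * (\<Sum>s\<in>UNIV. u $ s * vd (\<lambda>t. XH C t $ s)) + vd (mu C) * tdot u (XH C 0))"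
      unfolding tdot_def by (rule vdI)
    also have "\<dots> = (\<Sum>C\<in>F. of_nat Q * (\<Sum>s\<in>UNIV. u $ s * vd (\<lambda>t. XH C t $ s)))"
      using uX by (intro sum.cong) (auto simp: mu_props)
    also have "\<dots> = of_nat Q * (\<Sum>s\<in>UNIV. u $ s * P' s)"
      unfolding P'_def by (simp add: sum_distrib_left sum.swap[of _ F])
    finally have Rr: "vd (\<lambda>t. \<Sum>C\<in>F. mu C t * tdot u (XH C t)) = of_nat Q * (\<Sum>s\<in>UNIV. u $ s * P' s)" .
    have "vd (\<lambda>t. tdot u (M t *v P t)) = vd (\<lambda>t. \<Sum>C\<in>F. mu C t * tdot u (XH C t))"
    proof (rule same)
      fix t assume t: "good t"
      have "M t *v P t = (\<Sum>C\<in>F. mu C t *s XH C t)"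
        unfolding P_def vec.sum by (intro sum.cong refl XH_eigen[OF t])
      then show "tdot u (M t *v P t) = (\<Sum>C\<in>F. mu C t * tdot u (XH C t))"
        by (simp add: tdot_sum_right tdot_scale_right)
    qed
    then show ?thesis using L Rr by simp
  qed
  have "P' (init T) = - \<i> * tdot u (out_vec q T)"
  proof -
    have "tdot (lshift (M 0) (of_nat Q) u) v = (\<Sum>s\<in>UNIV. (u v* M 0) $ s * v $ s) - of_nat Q * (\<Sum>s\<in>UNIV. u $ s * v $ s)" for v
      by (simp add: lshift_def tdot_def ring_distribs sum_subtractf sum_distrib_left mult_ac)
    from this[of "\<chi> s. P' s"] have "tdot (lshift (M 0) (of_nat Q) u) (\<chi> s. P' s)
        = (\<Sum>s\<in>UNIV. (u v* M 0) $ s * P' s) - of_nat Q * (\<Sum>s\<in>UNIV. u $ s * P' s)" by simp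
    also have "\<dots> = - \<i> * tdot u (out_vec q T)" unfolding main[symmetric] by simp
    finally have "tdot (lshift (M 0) (of_nat Q) u) (\<chi> s. P' s) = - \<i> * tdot u (out_vec q T)" .
    moreover have "tdot (lshift (M 0) (of_nat Q) u) (\<chi> s. P' s) = P' (init T)"
      unfolding r w_def[symmetric] tdot_diff_left tdot_axis using wP by (simp add: tdot_def)
    ultimately show ?thesis by simp
  qed
  moreover have "tdot (vector_derivative (w_vec q T 0) (at 0)) (vec 1) = P' (init T)"
  proof -
    have "(\<lambda>t. W t $ s) differentiable (at 0)" for s
      unfolding W_def by (auto intro!: differentiable_sum differentiable_mult differentiable_XH differentiable_Y)
    then have "W differentiable (at 0)" by (rule differentiable_vec_componentwise)
    then obtain D where D: "(W has_vector_derivative D) (at 0)" using vector_derivative_works by blast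
    have "\<forall>\<^sub>F t in nhds 0. W t = w_vec q T 0 t"
      using eventually_good by eventually_elim (simp add: W_def w_vec_near_0)
    then have "vector_derivative (w_vec q T 0) (at 0) = vector_derivative W (at 0)"
      by (intro vector_derivative_cong_eq) (auto simp: eventually_nhds_conv_at elim: eventually_mono)
    also have "\<dots> = D" by (rule vector_derivative_at[OF D])
    finally have wD: "vector_derivative (w_vec q T 0) (at 0) = D" .
    have "bounded_linear (\<lambda>x :: complex ^ 's. tdot x (vec 1))"
      by (intro linear_conv_bounded_linear[THEN iffD1] linearI)
         (auto simp: tdot_def sum.distrib scaleR_sum_right)
    from bounded_linear.has_vector_derivative[OF this D]
    have "vd (\<lambda>t. tdot (W t) (vec 1)) = tdot D (vec 1)" by (rule vdI)
    moreover have "vd (\<lambda>t. tdot (W t) (vec 1)) = vd (\<lambda>t. P t $ init T)"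
    proof (rule same)
      fix t assume t: "good t"
      have "tdot (W t) (vec 1) = (\<Sum>C\<in>F. XH C t $ init T * tdot (Y C t) (vec 1))"
        unfolding W_def tdot_def by (simp add: sum_distrib_left sum.swap[of _ F])
      also have "\<dots> = P t $ init T" using Y_one[OF t] by (simp add: P_def)
      finally show "tdot (W t) (vec 1) = P t $ init T" .
    qed
    ultimately show ?thesis using vdI[OF dP, of "init T"] wD by simp
  qed
  ultimately show ?thesis by simp
qed

section \<open>The spectrum of M(0) on the circle of radius Q\<close>

definition lam :: "int \<Rightarrow> complex" where
  "lam l = of_nat Q * exp (2 * of_real pi * \<i> * of_int l / of_nat (final_period q T))"

lemma cmod_lam: "cmod (lam l) = real Q"
proof -
  have "2 * of_real pi * \<i> * of_int l / of_nat (final_period q T) = \<i> * of_real (2 * pi * of_int l / real (final_period q T))"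
    by simp
  then show ?thesis unfolding lam_def norm_mult by (simp only: norm_exp_i_times) simp
qed

lemma lam_0: "lam 0 = of_nat Q" by (simp add: lam_def)

lemma M_l1_contraction: "(\<Sum>s\<in>UNIV. cmod ((x v* M 0) $ s)) \<le> real Q * (\<Sum>s\<in>UNIV. cmod (x $ s))"
proof -
  have row: "(\<Sum>j\<in>UNIV. cmod (M 0 $ i $ j)) \<le> real Q" for i
  proof -
    have "(\<Sum>j\<in>UNIV. cmod (M 0 $ i $ j)) \<le> (\<Sum>j\<in>UNIV. \<Sum>\<epsilon>\<in>(letters q :: (nat ^ 'd) set). if target T i \<epsilon> = j then 1 else 0)"
      unfolding M_entry by (intro sum_mono order_trans[OF norm_sum]) (auto intro!: sum_mono)
    also have "\<dots> = real Q" by (subst sum.swap) (simp add: card_letters_Q)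
    finally show ?thesis .
  qed
  have "(\<Sum>j\<in>UNIV. cmod ((x v* M 0) $ j)) \<le> (\<Sum>j\<in>UNIV. \<Sum>i\<in>UNIV. cmod (x $ i) * cmod (M 0 $ i $ j))"
    unfolding vector_matrix_mult_def
    by (intro sum_mono) (simp add: order_trans[OF norm_sum] norm_mult[symmetric] mult.commute sum_mono)
  also have "\<dots> = (\<Sum>i\<in>UNIV. cmod (x $ i) * (\<Sum>j\<in>UNIV. cmod (M 0 $ i $ j)))"
    by (subst sum.swap) (simp add: sum_distrib_left)
  also have "\<dots> \<le> (\<Sum>i\<in>UNIV. cmod (x $ i) * real Q)" by (intro sum_mono mult_left_mono row) auto
  finally show ?thesis by (simp add: sum_distrib_left mult.commute)
qed

text \<open>At 0 all dominant values coincide with \<open>lam l\<close>. M(0) enlarges the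
  \<open>l1\<close> norm by at most the factor \<open>Q\<close>, the modulus of
  \<open>lam l\<close>, so the component of \<open>e_1\<close> in the generalized eigenspace already
  lies in the eigenspace and hence is the projection.\<close>

lemma w_vec_at_0:
  shows "lshift (M 0) (lam l) (w_vec q T l 0) = 0"
    and "axis (init T) 1 - w_vec q T l 0 \<in> gen_span (M 0) (- {lam l})"
proof -
  let ?e = "axis (init T) 1 :: complex ^ 's"
  have dv: "dominant_values q T l 0 = {lam l}"
    using F_nonempty by (auto simp: dominant_values_def lam_def mu_props)
  obtain g v where gv: "g \<in> gen_span (M 0) {lam l}" "v \<in> gen_span (M 0) (- {lam l})" "?e = g + v"
    using gen_span_decompose by blast
  have g0: "lshift (M 0) (lam l) g = 0"
  proof (rule gen_eigenspace_eq_eigenspace_if_contractive)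
    show "(\<Sum>s\<in>UNIV. cmod ((x v* M 0) $ s)) \<le> cmod (lam l) * (\<Sum>s\<in>UNIV. cmod (x $ s))" for x
      unfolding cmod_lam by (rule M_l1_contraction)
    show "lam l \<noteq> 0" using cmod_lam[of l] Q_pos by auto
    show "g \<in> left_gen_eigenspace (M 0) (lam l)" using gv(1) by (simp add: gen_span_single)
  qed
  have "w_vec q T l 0 = g"
    unfolding w_vec_def dv
  proof (rule proj_along_gen_spanI)
    have "g \<in> left_eigenspace (M 0) (lam l)" using g0 by (simp add: left_eigenspace_def lshift_def)
    then show "g \<in> vec.span (\<Union>\<mu>\<in>{lam l}. left_eigenspace (M 0) \<mu>)" by (intro vec.span_base) auto
    show "?e - g \<in> gen_span (M 0) (- {lam l})" using gv by simp
  qed simp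
  then show "lshift (M 0) (lam l) (w_vec q T l 0) = 0" "?e - w_vec q T l 0 \<in> gen_span (M 0) (- {lam l})"
    using g0 gv by auto
qed

end

section \<open>Meromorphic continuation and residues\<close>

text \<open>If the pole had order \<open>m > n\<close>, then \<open>h z * (z - z0) ^ (m - n)\<close>
  would agree with \<open>zor_poly\<close> near \<open>z0\<close> and force its value at
  \<open>z0\<close> to be 0.\<close>

lemma zorder_ge_if_eq_divide_power:
  assumes "open A" "z0 \<in> A" "h holomorphic_on A" "\<And>z. z \<in> A - {z0} \<Longrightarrow> f z = h z / (z - z0) ^ n"
    and "is_pole f z0"
  shows "zorder f z0 \<ge> - int n"
proof (rule ccontr)
  assume neg: "\<not> zorder f z0 \<ge> - int n"
  have "f holomorphic_on A - {z0}"
  proof (rule holomorphic_transform)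
    show "(\<lambda>z. h z / (z - z0) ^ n) holomorphic_on A - {z0}"
      by (intro holomorphic_intros holomorphic_on_subset[OF assms(3)]) auto
  qed (use assms(4) in auto)
  from zorder_exist_pole[OF this assms(1,2,5)] obtain r where r:
    "zor_poly f z0 z0 \<noteq> 0" "r > 0" "cball z0 r \<subseteq> A" "zor_poly f z0 holomorphic_on cball z0 r"
    "\<And>w. w \<in> cball z0 r - {z0} \<Longrightarrow> f w = zor_poly f z0 w / (w - z0) ^ nat (- zorder f z0)"
    by auto
  define m where "m = nat (- zorder f z0)"
  have m: "m > n" using neg by (simp add: m_def)
  define g where "g = zor_poly f z0"
  have ev: "\<forall>\<^sub>F w in at z0. h w * (w - z0) ^ (m - n) = g w"
    unfolding eventually_at
  proof (intro exI[of _ r] conjI ballI impI)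
    fix w assume w: "w \<noteq> z0 \<and> dist w z0 < r"
    then have wc: "w \<in> cball z0 r - {z0}" by (auto simp: dist_commute)
    have "h w / (w - z0) ^ n = g w / (w - z0) ^ m"
      using r(5)[OF wc] assms(4)[of w] wc r(3) by (auto simp: g_def m_def)
    moreover have "(w - z0) ^ m = (w - z0) ^ n * (w - z0) ^ (m - n)" using m by (simp add: power_add[symmetric])
    ultimately show "h w * (w - z0) ^ (m - n) = g w" using w by (simp add: field_simps)
  qed (use r in auto)
  have "isCont h z0"
    using assms(1-3) by (meson analytic_at analytic_at_imp_isCont)
  then have "((\<lambda>w. h w * (w - z0) ^ (m - n)) \<longlongrightarrow> h z0 * (z0 - z0) ^ (m - n)) (at z0)"
    by (intro tendsto_intros) (simp add: isCont_def)
  then have "((\<lambda>w. h w * (w - z0) ^ (m - n)) \<longlongrightarrow> 0) (at z0)" using m by (simp add: power_0_left)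
  then have "(g \<longlongrightarrow> 0) (at z0)" using ev by (rule Lim_transform_eventually)
  moreover have "isCont g z0"
    using r(2,4) holomorphic_on_subset[OF r(4) ball_subset_cball] unfolding g_def
    by (metis analytic_at analytic_at_imp_isCont centre_in_ball open_ball)
  ultimately have "g z0 = 0" using tendsto_unique[of "at z0" g "g z0" 0] by (simp add: isCont_def)
  then show False using r(1) by (simp add: g_def)
qed

text \<open>Isolates the simple zero of the denominator: the cofactor is entire and, for
  \<open>L \<noteq> 0\<close>, does not vanish at that zero.\<close>

lemma one_minus_exp_factor:
  fixes L :: real
  obtains E :: "complex \<Rightarrow> complex" where "E holomorphic_on UNIV" "E 0 = of_real L"
    "\<And>w. 1 - exp (- of_real L * w) = w * E w"
proof -
  define E where "E w = (if w = 0 then complex_of_real L else (1 - exp (- of_real L * w)) / w)" for w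
  have "((\<lambda>w. 1 - exp (- complex_of_real L * w)) has_field_derivative of_real L) (at 0)"
    by (auto intro!: derivative_eq_intros)
  then have d: "deriv (\<lambda>w. 1 - exp (- complex_of_real L * w)) 0 = of_real L" by (rule DERIV_imp_deriv)
  have "E holomorphic_on UNIV"
    by (rule pole_theorem_0[of "\<lambda>w. 1 - exp (- complex_of_real L * w)" UNIV 0])
       (auto simp: E_def d[simplified] intro!: holomorphic_intros)
  moreover have "1 - exp (- of_real L * w) = w * E w" for w by (simp add: E_def)
  ultimately show ?thesis using that by (simp add: E_def)
qed

lemma hser_cmult:
  assumes "log_growth d \<alpha>" "Re z > real d"
  shows "hser (\<lambda>n. c * \<alpha> n) z = c * hser \<alpha> z"
  unfolding hser_def mult.assoc
  by (rule suminf_mult[OF summable_norm_cancel[OF hser_summable[OF assms]]])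

lemma hser_diff:
  assumes "log_growth d \<alpha>" "log_growth d \<beta>" "Re z > real d"
  shows "hser (\<lambda>n. \<alpha> n - \<beta> n) z = hser \<alpha> z - hser \<beta> z"
  unfolding hser_def left_diff_distrib
  by (rule suminf_diff[OF summable_norm_cancel[OF hser_summable[OF assms(1,3)]]
        summable_norm_cancel[OF hser_summable[OF assms(2,3)]], symmetric])

lemma chi_freq_add: "chi_freq q p (k + l) = chi_freq q p k + chi_freq q p l"
  by (simp add: chi_freq_def add_divide_distrib distrib_left)

text \<open>For \<open>h z / (z - z0)^2\<close> the residue is \<open>deriv h z0\<close>. The
  existence of the limit forces \<open>h z0 = a\<close>, after which the expression is a difference
  quotient; approach along one ray suffices because \<open>h\<close> is known to be
  holomorphic.\<close>

lemma tendsto_coefficient_of_double_pole: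
  fixes h :: "complex \<Rightarrow> complex"
  assumes "open A" "z0 \<in> A" "h holomorphic_on A"
    and lim: "((\<lambda>\<sigma>. h (z0 + of_real \<sigma>) / of_real \<sigma> - a / of_real \<sigma>) \<longlongrightarrow> b) (at_right 0)"
    and curve: "filterlim (\<lambda>\<sigma>. z0 + complex_of_real \<sigma>) (at z0) (at_right 0)"
  shows "deriv h z0 = b"
proof -
  have d: "(h has_field_derivative deriv h z0) (at z0)"
    using assms(1-3) by (intro holomorphic_derivI)
  then have "isCont h z0" by (rule DERIV_isCont)
  then have hl: "((\<lambda>\<sigma>. h (z0 + of_real \<sigma>)) \<longlongrightarrow> h z0) (at_right 0)"
    using curve unfolding isCont_def by (rule filterlim_compose)
  have "((\<lambda>\<sigma>. of_real \<sigma> * (h (z0 + of_real \<sigma>) / of_real \<sigma> - a / of_real \<sigma>) + a) \<longlongrightarrow> of_real 0 * b + a) (at_right 0)"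
    by (intro tendsto_add tendsto_mult tendsto_of_real tendsto_ident_at lim tendsto_const)
  then have "((\<lambda>\<sigma>. h (z0 + of_real \<sigma>)) \<longlongrightarrow> of_real 0 * b + a) (at_right 0)"
  proof (rule Lim_transform_eventually)
    show "\<forall>\<^sub>F \<sigma> in at_right 0. of_real \<sigma> * (h (z0 + of_real \<sigma>) / of_real \<sigma> - a / of_real \<sigma>) + a = h (z0 + of_real \<sigma>)"
      using eventually_at_right_less[of 0] by eventually_elim (simp add: right_diff_distrib)
  qed
  then have a: "h z0 = a" using tendsto_unique[OF _ hl] by simp
  have "((\<lambda>z. (h z - h z0) / (z - z0)) \<longlongrightarrow> deriv h z0) (at z0)"
    using d by (simp add: has_field_derivative_iff)
  from filterlim_compose[OF this curve]
  have "((\<lambda>\<sigma>. h (z0 + of_real \<sigma>) / of_real \<sigma> - a / of_real \<sigma>) \<longlongrightarrow> deriv h z0) (at_right 0)"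
    by (simp add: a diff_divide_distrib)
  then show ?thesis using tendsto_unique[OF _ lim] by simp
qed

context transducer_setup
begin

definition al :: "complex ^ 's \<Rightarrow> nat \<Rightarrow> complex" where
  "al u N = tdot u (level_sum q T N)"

definition per :: nat where "per = final_period q T"

lemma d_pos: "CARD('d) \<ge> 1" by (simp add: Suc_leI)

lemma shell_bound:
  assumes "n \<ge> 1"
  shows "real (card (level n :: (nat ^ 'd) set)) \<le> real CARD('d) * 2 ^ CARD('d) * real n powr (real CARD('d) - 1)"
  unfolding card_level by (rule Suc_power_diff_le[OF assms d_pos])

lemma log_growth_al: "log_growth CARD('d) (al u)"
proof -
  obtain C where C: "C \<ge> 0" "\<And>n s. n \<noteq> 0 \<Longrightarrow> \<bar>b_vec q T n $ s\<bar> \<le> C * (1 + ln (real (max_norm n)))"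
    using b_vec_bound[OF q] by blast
  define D where "D = (\<Sum>s\<in>UNIV. cmod (u $ s)) * (C * (real CARD('d) * 2 ^ CARD('d)))"
  have D: "D \<ge> 0" using C by (auto simp: D_def intro!: mult_nonneg_nonneg sum_nonneg)
  have "cmod (al u n) \<le> D * real n powr (real CARD('d) - 1) * (1 + ln (real n))" if n: "n \<ge> 1" for n
  proof -
    have l: "1 + ln (real n) \<ge> 0" using n by (simp add: add_nonneg_nonneg)
    have lev: "cmod (level_sum q T n $ s) \<le> C * (real CARD('d) * 2 ^ CARD('d)) * real n powr (real CARD('d) - 1) * (1 + ln (real n))" for s
    proof -
      have "cmod (level_sum q T n $ s) \<le> (\<Sum>m\<in>(level n :: (nat ^ 'd) set). C * (1 + ln (real n)))"
        unfolding level_sum_def vec_lambda_beta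
      proof (rule order_trans[OF norm_sum sum_mono])
        fix m :: "nat ^ 'd" assume "m \<in> level n"
        then have "max_norm m = n" "m \<noteq> 0" using n by (auto simp: level_def)
        then show "cmod (complex_of_real (b_vec q T m $ s)) \<le> C * (1 + ln (real n))" using C(2)[of m s] by simp
      qed
      also have "\<dots> = real (card (level n :: (nat ^ 'd) set)) * (C * (1 + ln (real n)))" by simp
      also have "\<dots> \<le> (real CARD('d) * 2 ^ CARD('d) * real n powr (real CARD('d) - 1)) * (C * (1 + ln (real n)))"
        using shell_bound[OF n] C(1) l by (intro mult_right_mono) auto
      finally show ?thesis by (simp add: mult_ac)
    qed
    have "cmod (al u n) \<le> (\<Sum>s\<in>UNIV. cmod (u $ s) * cmod (level_sum q T n $ s))"
      unfolding al_def tdot_def by (rule order_trans[OF norm_sum]) (simp add: norm_mult)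
    also have "\<dots> \<le> (\<Sum>s\<in>UNIV. cmod (u $ s) * (C * (real CARD('d) * 2 ^ CARD('d)) * real n powr (real CARD('d) - 1) * (1 + ln (real n))))"
      by (intro sum_mono mult_left_mono lev) auto
    also have "\<dots> = (\<Sum>s\<in>UNIV. cmod (u $ s)) * (C * (real CARD('d) * 2 ^ CARD('d)) * real n powr (real CARD('d) - 1) * (1 + ln (real n)))"
      by (rule sum_distrib_right[symmetric])
    also have "\<dots> = D * real n powr (real CARD('d) - 1) * (1 + ln (real n))"
      by (simp add: D_def mult_ac)
    finally show ?thesis .
  qed
  then show ?thesis unfolding log_growth_def using D by blast
qed

lemma al_lshift: "al (lshift (M 0) \<kappa> u) N = al (u v* M 0) N - \<kappa> * al u N"
  by (simp add: al_def lshift_def tdot_diff_left tdot_scale_left)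

text \<open>The norms on one shell add up to at most a term of a convergent scalar Dirichlet series,
  so finite partial sums are bounded by enclosing their index sets in cubes.\<close>

lemma H_term_summable:
  assumes z: "Re z > real CARD('d)"
  shows "H_term q T z summable_on {n. n \<noteq> 0}"
proof -
  obtain C where C: "C \<ge> 0" "\<And>n s. n \<noteq> 0 \<Longrightarrow> \<bar>b_vec q T n $ s\<bar> \<le> C * (1 + ln (real (max_norm n)))"
    using b_vec_bound[OF q] by blast
  define \<phi> where "\<phi> K = real CARD('s) * C * (1 + ln (real K)) * real K powr (- Re z)" for K :: nat
  \<comment> \<open>A real majorant of the shell sums, written as a complex sequence so that
    \<open>hser_summable\<close> applies.\<close>
  define \<beta> where "\<beta> K = complex_of_real (real (card (level K :: (nat ^ 'd) set)) * (real CARD('s) * C * (1 + ln (real K))))" for K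
  have lg: "log_growth CARD('d) \<beta>"
    unfolding log_growth_def
  proof (intro exI[of _ "real CARD('d) * 2 ^ CARD('d) * (real CARD('s) * C)"] conjI allI impI)
    show "0 \<le> real CARD('d) * 2 ^ CARD('d) * (real CARD('s) * C)" using C by simp
    fix n :: nat assume n: "n \<ge> 1"
    have l: "1 + ln (real n) \<ge> 0" using n by (simp add: add_nonneg_nonneg)
    have "cmod (\<beta> n) = real (card (level n :: (nat ^ 'd) set)) * (real CARD('s) * C * (1 + ln (real n)))"
      unfolding \<beta>_def norm_of_real using C(1) l by (intro abs_of_nonneg mult_nonneg_nonneg) auto
    also have "\<dots> \<le> (real CARD('d) * 2 ^ CARD('d) * real n powr (real CARD('d) - 1)) * (real CARD('s) * C * (1 + ln (real n)))"
      using shell_bound[OF n] C(1) l by (intro mult_right_mono) auto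
    finally show "cmod (\<beta> n) \<le> real CARD('d) * 2 ^ CARD('d) * (real CARD('s) * C) * real n powr (real CARD('d) - 1) * (1 + ln (real n))"
      by (simp add: mult_ac)
  qed
  note sb = hser_summable[OF lg z]
  have \<beta>\<phi>: "cmod (\<beta> K * of_nat K powr (- z)) = (\<Sum>n\<in>(level K :: (nat ^ 'd) set). \<phi> (max_norm n))" for K
  proof (cases "K = 0")
    case True
    then show ?thesis by (simp add: \<phi>_def level_def)
  next
    case False
    then have l: "1 + ln (real K) \<ge> 0" by (simp add: add_nonneg_nonneg)
    have "(\<Sum>n\<in>(level K :: (nat ^ 'd) set). \<phi> (max_norm n)) = (\<Sum>n\<in>(level K :: (nat ^ 'd) set). \<phi> K)"
      by (rule sum.cong) (auto simp: level_def)
    moreover have "cmod (\<beta> K) = real (card (level K :: (nat ^ 'd) set)) * (real CARD('s) * C * (1 + ln (real K)))"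
      unfolding \<beta>_def norm_of_real using C(1) l by (intro abs_of_nonneg mult_nonneg_nonneg) auto
    ultimately show ?thesis
      by (simp add: \<phi>_def norm_mult cmod_of_nat_powr)
  qed
  have \<phi>0: "\<phi> (max_norm n) \<ge> 0" for n :: "nat ^ 'd"
  proof (cases "n = 0")
    case False
    then have "max_norm n \<ge> 1" by (metis less_one linorder_not_le max_norm_eq_0_iff)
    then have "1 + ln (real (max_norm n)) \<ge> 0" by (simp add: add_nonneg_nonneg)
    then show ?thesis using C(1) by (simp add: \<phi>_def)
  qed (simp add: \<phi>_def)
  have le: "norm (H_term q T z n) \<le> \<phi> (max_norm n)" if n: "n \<noteq> 0" for n
  proof -
    have "norm (H_term q T z n) \<le> (\<Sum>s\<in>UNIV. norm (H_term q T z n $ s))"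
      unfolding norm_vec_def by (rule L2_set_le_sum) auto
    also have "\<dots> \<le> (\<Sum>s\<in>(UNIV :: 's set). C * (1 + ln (real (max_norm n))) * real (max_norm n) powr (- Re z))"
      using C(2)[OF n] by (intro sum_mono) (auto simp: H_term_def norm_mult cmod_of_nat_powr intro: mult_right_mono)
    finally show ?thesis by (simp add: \<phi>_def mult_ac)
  qed
  have "(\<lambda>n :: nat ^ 'd. \<phi> (max_norm n)) summable_on {n. n \<noteq> 0}"
  proof (rule nonneg_bdd_above_summable_on)
    show "bdd_above (sum (\<lambda>n :: nat ^ 'd. \<phi> (max_norm n)) ` {F. F \<subseteq> {n. n \<noteq> 0} \<and> finite F})"
    proof (rule bdd_aboveI2)
      fix F :: "(nat ^ 'd) set" assume "F \<in> {F. F \<subseteq> {n. n \<noteq> 0} \<and> finite F}"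
      then have fin: "finite F" by simp
      define m where "m = Suc (Max (insert 0 (max_norm ` F)))"
      have "F \<subseteq> letters m"
      proof
        fix n assume "n \<in> F"
        then have "max_norm n \<le> Max (insert 0 (max_norm ` F))" using fin by (intro Max_ge) auto
        then show "n \<in> letters m" by (simp add: letters_altdef m_def)
      qed
      then have "sum (\<lambda>n. \<phi> (max_norm n)) F \<le> sum (\<lambda>n. \<phi> (max_norm n)) (letters m :: (nat ^ 'd) set)"
        using \<phi>0 by (intro sum_mono2 finite_letters) auto
      also have "\<dots> = (\<Sum>K<m. cmod (\<beta> K * of_nat K powr (- z)))"
        unfolding sum_letters_level \<beta>\<phi> ..
      also have "\<dots> \<le> (\<Sum>K. cmod (\<beta> K * of_nat K powr (- z)))"
        by (rule sum_le_suminf[OF sb]) auto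
      finally show "sum (\<lambda>n. \<phi> (max_norm n)) F \<le> (\<Sum>K. cmod (\<beta> K * of_nat K powr (- z)))" .
    qed
  qed (use \<phi>0 in auto)
  then have "(\<lambda>n. norm (H_term q T z n)) summable_on {n. n \<noteq> 0}"
    by (rule summable_on_comparison_test) (use le in auto)
  then show ?thesis by (rule abs_summable_summable)
qed

text \<open>The sum over all nonzero vectors may be taken along the increasing cubes
  \<open>letters m\<close>, which are unions of shells; the vector 0 has a vanishing term and is
  added freely.\<close>

lemma tdot_H_series:
  assumes z: "Re z > real CARD('d)"
  shows "tdot w (H_series q T z) = hser (al w) z"
proof -
  define f where "f n = tdot w (H_term q T z n)" for n
  have "bounded_linear (\<lambda>x :: complex ^ 's. tdot w x)"
    by (intro linear_conv_bounded_linear[THEN iffD1] linearI)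
       (auto simp: tdot_def sum.distrib scaleR_sum_right distrib_left)
  from has_sum_bounded_linear[OF this has_sum_infsum[OF H_term_summable[OF z]]]
  have hs: "(f has_sum tdot w (H_series q T z)) {n. n \<noteq> 0}"
    by (simp add: f_def[abs_def] H_series_def)
  define E where "E m = letters m - {0 :: nat ^ 'd}" for m
  have "filterlim E (finite_subsets_at_top {n. n \<noteq> 0}) sequentially"
    unfolding filterlim_finite_subsets_at_top
  proof (intro allI impI)
    fix X :: "(nat ^ 'd) set" assume X: "finite X \<and> X \<subseteq> {n. n \<noteq> 0}"
    define m0 where "m0 = Suc (Max (insert 0 (max_norm ` X)))"
    have "X \<subseteq> E m" if "m \<ge> m0" for m
    proof
      fix n assume "n \<in> X"
      then have "max_norm n \<le> Max (insert 0 (max_norm ` X))" using X by (intro Max_ge) auto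
      then have "max_norm n < m" using that unfolding m0_def by linarith
      then show "n \<in> E m" using X \<open>n \<in> X\<close> by (auto simp: E_def letters_altdef)
    qed
    then show "\<forall>\<^sub>F m in sequentially. finite (E m) \<and> X \<subseteq> E m \<and> E m \<subseteq> {n. n \<noteq> 0}"
      unfolding eventually_sequentially by (intro exI[of _ m0]) (auto simp: E_def finite_letters)
  qed
  then have lim: "(\<lambda>m. sum f (E m)) \<longlonglongrightarrow> tdot w (H_series q T z)"
    using hs unfolding has_sum_def by (rule filterlim_compose[rotated])
  have "sum f (E m) = (\<Sum>K<m. al w K * of_nat K powr (- z))" for m
  proof -
    have f0: "f 0 = 0" by (simp add: f_def H_term_def tdot_def)
    have "sum f (E m) = sum f (letters m)"
      unfolding E_def by (rule sum.mono_neutral_left) (auto simp: finite_letters f0)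
    also have "\<dots> = (\<Sum>K<m. \<Sum>n\<in>level K. f n)" by (rule sum_letters_level)
    also have "\<dots> = (\<Sum>K<m. al w K * of_nat K powr (- z))"
    proof (rule sum.cong[OF refl])
      fix K
      have "(\<Sum>n\<in>(level K :: (nat ^ 'd) set). f n) = tdot w (\<Sum>n\<in>(level K :: (nat ^ 'd) set). H_term q T z n)"
        by (simp add: f_def tdot_sum_right)
      also have "(\<Sum>n\<in>(level K :: (nat ^ 'd) set). H_term q T z n) = of_nat K powr (- z) *s level_sum q T K"
        by (simp add: vec_eq_iff H_term_def level_sum_def sum_distrib_left level_def mult.commute)
      finally show "(\<Sum>n\<in>level K. f n) = al w K * of_nat K powr (- z)"
        by (simp add: tdot_scale_right al_def mult.commute)
    qed
    finally show ?thesis .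
  qed
  then have "(\<lambda>m. \<Sum>K<m. al w K * of_nat K powr (- z)) \<longlonglongrightarrow> tdot w (H_series q T z)" using lim by simp
  then have "(\<lambda>K. al w K * of_nat K powr (- z)) sums tdot w (H_series q T z)" by (simp add: sums_def)
  then show ?thesis unfolding hser_def by (rule sums_unique)
qed

text \<open>The part of the functional equation that does not involve the vector \<open>u M\<close>.
  Whatever \<open>u\<close> is, it is holomorphic for Re z > d - 1 except for a possible pole at
  \<open>d\<close>.\<close>

definition numer :: "complex ^ 's \<Rightarrow> complex \<Rightarrow> complex" where
  "numer u z = jser q (al u) z + of_nat q powr (- z) * tdot u (out_vec q T) * (zeta_num CARD('d) z / (z - of_nat CARD('d)))"

lemma hser_al_functional_equation:
  assumes z: "Re z > real CARD('d)"
  shows "hser (al u) z = of_nat q powr (- z) * hser (al (u v* M 0)) z + numer u z"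
proof -
  have "hser (al u) z = of_nat q powr (- z) * hser (al (u v* M 0)) z + jser q (al u) z
      + of_nat q powr (- z) * tdot u (out_vec q T) * hser (shell_count CARD('d)) z"
  proof (rule hser_functional_equation[OF log_growth_al log_growth_al log_growth_shell_count[OF d_pos] d_pos q z])
    fix N :: nat assume "N \<ge> 1"
    then show "(\<Sum>j<q. al u (q * N + j)) = al (u v* M 0) N + shell_count CARD('d) N * tdot u (out_vec q T)"
      unfolding al_def shell_count_def by (rule tdot_level_sum_block[OF q])
  qed
  then show ?thesis by (simp add: numer_def hser_shell_count[OF d_pos z])
qed

text \<open>Applying \<open>M - \<kappa>\<close> to the vector multiplies the series by
  \<open>q powr z - \<kappa>\<close>, up to a multiple of \<open>numer\<close>. For
  \<open>\<kappa> = lam k\<close> this factor has a simple zero at d + \<chi>_k, the source of every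
  gain of a power of \<sigma>.\<close>

lemma hser_al_lshift:
  assumes z: "Re z > real CARD('d)"
  shows "hser (al (lshift (M 0) \<kappa> u)) z
     = (of_nat q powr z - \<kappa>) * hser (al u) z - of_nat q powr z * numer u z"
proof -
  have "hser (al (lshift (M 0) \<kappa> u)) z = hser (al (u v* M 0)) z - \<kappa> * hser (al u) z"
  proof -
    have "al (\<kappa> *s u) = (\<lambda>N. \<kappa> * al u N)" by (simp add: al_def[abs_def] tdot_scale_left)
    then have "log_growth CARD('d) (\<lambda>N. \<kappa> * al u N)" using log_growth_al[of "\<kappa> *s u"] by simp
    then show ?thesis
      unfolding al_lshift[abs_def] by (simp add: hser_diff[OF log_growth_al _ z] hser_cmult[OF log_growth_al z])
  qed
  moreover have "of_nat q powr z * of_nat q powr (- z) = (1 :: complex)"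
    using q by (simp add: powr_minus)
  then have "of_nat q powr z * hser (al u) z = hser (al (u v* M 0)) z + of_nat q powr z * numer u z"
    using hser_al_functional_equation[OF z, of u] by (simp add: distrib_left mult.assoc[symmetric])
  ultimately show ?thesis by (simp add: left_diff_distrib)
qed

lemma per_pos: "per > 0"
  using final_period_pos by (simp add: per_def)

lemma chi_nonzero: "k \<noteq> 0 \<Longrightarrow> chi_freq q per k \<noteq> 0"
  using q per_pos by (simp add: chi_freq_def)

lemma Re_chi_freq: "Re (chi_freq q per k) = 0"
proof -
  have "chi_freq q per k = \<i> * of_real (2 * pi * of_int k / (real per * ln (real q)))"
    by (simp add: chi_freq_def)
  then show ?thesis by (simp only:) simp
qed

lemma lam_eq_powr: "lam k = of_nat q powr (of_nat CARD('d) + chi_freq q per k)"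
proof -
  have "chi_freq q per k * of_real (ln (real q)) = 2 * of_real pi * \<i> * of_int k / of_nat per"
    using q per_pos by (simp add: chi_freq_def)
  moreover have "Ln (of_nat q) = complex_of_real (ln (real q))"
    using q Ln_of_real[of "real q"] by simp
  moreover have "complex_of_nat Q = exp (of_nat CARD('d) * of_real (ln (real q)))"
  proof -
    have "exp (real CARD('d) * ln (real q)) = real q ^ CARD('d)" using q by (simp add: exp_of_nat_mult)
    then have "complex_of_real (exp (real CARD('d) * ln (real q))) = of_nat Q" by (simp add: Q_def)
    then show ?thesis by (simp add: exp_of_real[symmetric])
  qed
  ultimately show ?thesis
    using q by (simp add: powr_def lam_def exp_add distrib_right per_def)
qed

lemma powr_lam: "of_nat q powr (- z) * lam k
    = exp (- of_real (ln (real q)) * (z - (of_nat CARD('d) + chi_freq q per k)))"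
proof -
  have "Ln (of_nat q) = complex_of_real (ln (real q))"
    using q Ln_of_real[of "real q"] by simp
  then show ?thesis
    using q unfolding lam_eq_powr by (simp add: powr_def exp_add[symmetric] algebra_simps)
qed

text \<open>The zeros of the denominator differ by multiples of \<open>2 * pi * \<i> / ln q\<close>,
  which are the frequencies whose index is a multiple of the period; hence every zero is again of
  the form d + \<chi>_m.\<close>

lemma powr_lam_eq_1E:
  assumes "of_nat q powr (- z) * lam k = 1"
  obtains m where "z = of_nat CARD('d) + chi_freq q per m"
proof -
  define L where "L = complex_of_real (ln (real q))"
  have L: "L \<noteq> 0" using q by (simp add: L_def)
  define w where "w = z - (of_nat CARD('d) + chi_freq q per k)"
  have "exp (- L * w) = 1" using assms by (simp add: powr_lam L_def w_def)
  then obtain n :: int where n: "Re (- L * w) = 0" "Im (- L * w) = of_int (2 * n) * pi"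
    unfolding exp_eq_1 by auto
  then have "- L * w = \<i> * of_real (of_int (2 * n) * pi)" by (simp add: complex_eq_iff)
  then have "L * w = - (\<i> * of_real (of_int (2 * n) * pi))"
    by (metis add.inverse_inverse mult_minus_left)
  then have "w = - (\<i> * of_real (of_int (2 * n) * pi)) / L"
    using nonzero_mult_div_cancel_left[OF L, of w] by metis
  then have "w = - (2 * of_real pi * \<i> * of_int n) / L" by (simp add: mult_ac)
  also have "\<dots> = chi_freq q per (- (int per * n))"
    using per_pos by (simp add: chi_freq_def L_def)
  finally have "z = of_nat CARD('d) + (chi_freq q per k + chi_freq q per (- (int per * n)))"
    by (simp add: w_def algebra_simps)
  also have "chi_freq q per k + chi_freq q per (- (int per * n)) = chi_freq q per (k - int per * n)"
    using chi_freq_add[of q per k "- (int per * n)"] by simp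
  finally show ?thesis by (rule that)
qed

lemma numer_holomorphic: "numer u holomorphic_on {z. Re z > real CARD('d) - 1} - {of_nat CARD('d)}"
  unfolding numer_def[abs_def]
  by (intro holomorphic_intros holomorphic_of_nat_powr
      holomorphic_on_subset[OF jser_holomorphic[OF log_growth_al d_pos q]]
      holomorphic_on_subset[OF zeta_num_holomorphic[OF d_pos]]) auto

definition G :: "int \<Rightarrow> complex \<Rightarrow> complex" where
  "G k z = numer (w_vec q T k 0) z / (1 - of_nat q powr (- z) * lam k)"

lemma denom_nonzero:
  assumes "Re z > real CARD('d)"
  shows "1 - of_nat q powr (- z) * lam k \<noteq> 0"
proof -
  have "cmod (of_nat q powr (- z) * lam k) = real q powr (- Re z) * real q ^ CARD('d)"
    by (simp add: norm_mult cmod_of_nat_powr cmod_lam Q_def)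
  also have "\<dots> = real q powr (real CARD('d) - Re z)"
    using q by (simp add: powr_realpow[symmetric] powr_add[symmetric])
  also have "\<dots> < real q powr 0" using q assms by (intro powr_less_mono) auto
  finally show ?thesis using q by auto
qed

lemma G_eq_hser:
  assumes z: "Re z > real CARD('d)"
  shows "G k z = hser (al (w_vec q T k 0)) z"
proof -
  define w where "w = w_vec q T k 0"
  have "w v* M 0 = lam k *s w" using w_vec_at_0(1)[of k] by (simp add: lshift_def w_def)
  then have "al (w v* M 0) = (\<lambda>N. lam k * al w N)" by (simp add: al_def[abs_def] tdot_scale_left)
  then have "hser (al w) z = of_nat q powr (- z) * (lam k * hser (al w) z) + numer w z"
    using hser_al_functional_equation[OF z, of w] by (simp add: hser_cmult[OF log_growth_al z])
  then have "numer w z = (1 - of_nat q powr (- z) * lam k) * hser (al w) z"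
    by (simp add: algebra_simps)
  then show ?thesis unfolding G_def w_def[symmetric] using denom_nonzero[OF z, of k] by simp
qed

lemma denom_holomorphic: "(\<lambda>z. 1 - of_nat q powr (- z) * lam k) holomorphic_on S"
  by (intro holomorphic_intros holomorphic_of_nat_powr)

lemma open_halfplane: "open {z. Re z > real CARD('d) - 1}"
  by (rule open_halfspace_Re_gt)

lemma G_meromorphic: "G k meromorphic_on {z. Re z > real CARD('d) - 1}"
proof -
  have an: "f meromorphic_on {z. Re z > real CARD('d) - 1}" if "f holomorphic_on {z. Re z > real CARD('d) - 1}" for f
    using that open_halfplane by (intro analytic_on_imp_meromorphic_on) (simp add: analytic_on_open)
  show ?thesis
    unfolding G_def[abs_def] numer_def
    by (intro meromorphic_intros an jser_holomorphic[OF log_growth_al d_pos q] zeta_num_holomorphic[OF d_pos]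
        denom_holomorphic holomorphic_of_nat_powr)
       (intro holomorphic_intros)
qed

lemma G_pole:
  assumes "Re z > real CARD('d) - 1" "is_pole (G k) z"
  shows "\<exists>m. z = of_nat CARD('d) + chi_freq q per m"
proof (rule ccontr)
  assume no: "\<not> (\<exists>m. z = of_nat CARD('d) + chi_freq q per m)"
  have zd: "z \<noteq> of_nat CARD('d)"
  proof
    assume "z = of_nat CARD('d)"
    then have "z = of_nat CARD('d) + chi_freq q per 0" by (simp add: chi_freq_def)
    then show False using no by blast
  qed
  have "1 - of_nat q powr (- z) * lam k \<noteq> 0"
    using no powr_lam_eq_1E[of z k] by (metis eq_iff_diff_eq_0)
  moreover have "numer (w_vec q T k 0) analytic_on {z}"
    using assms(1) zd numer_holomorphic[of "w_vec q T k 0"] open_halfplane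
    by (intro analytic_at[THEN iffD2] exI[of _ "{z. Re z > real CARD('d) - 1} - {of_nat CARD('d)}"]) auto
  moreover have "(\<lambda>z. 1 - of_nat q powr (- z) * lam k) analytic_on {z}"
    by (intro analytic_at[THEN iffD2] exI[of _ UNIV]) (auto intro: denom_holomorphic)
  ultimately have "G k analytic_on {z}"
    unfolding G_def[abs_def] by (intro analytic_on_divide) auto
  then show False using assms(2) analytic_at_imp_no_pole by blast
qed

text \<open>The denominator has a simple zero at \<open>z0\<close> and \<open>numer\<close> a
  possible simple pole at \<open>d\<close>. They meet only for \<open>k = 0\<close>, where a double
  pole may arise; for \<open>k \<noteq> 0\<close> the point \<open>d\<close> is removed from the
  neighbourhood.\<close>

lemma G_local:
  fixes k :: int
  defines "z0 \<equiv> of_nat CARD('d) + chi_freq q per k"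
    and "n \<equiv> (if k = 0 then 2 else 1 :: nat)"
  shows "\<exists>A h. open A \<and> z0 \<in> A \<and> h holomorphic_on A \<and> (\<forall>z\<in>A - {z0}. G k z = h z / (z - z0) ^ n)"
proof -
  obtain E where E: "E holomorphic_on UNIV" "E 0 = of_real (ln (real q))"
    "\<And>w. 1 - exp (- of_real (ln (real q)) * w) = w * E w"
    using one_minus_exp_factor[of "ln (real q)"] by metis
  define w where "w = w_vec q T k 0"
  define H where "H = {z. Re z > real CARD('d) - 1}"
  have Eh: "(\<lambda>z. E (z - z0)) holomorphic_on S" for S
  proof -
    have "(\<lambda>z. z - z0) holomorphic_on S" by (intro holomorphic_intros)
    from holomorphic_on_compose[OF this holomorphic_on_subset[OF E(1)]] show ?thesis by (simp add: o_def)
  qed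
  have "open ((\<lambda>z. E (z - z0)) -` (- {0}))"
    by (intro open_vimage holomorphic_on_imp_continuous_on Eh) auto
  define B where "B = (\<lambda>z. E (z - z0)) -` (- {0})"
  have B: "open B" "z0 \<in> B" using \<open>open _\<close> E(2) q by (auto simp: B_def)
  have den: "1 - of_nat q powr (- z) * lam k = (z - z0) * E (z - z0)" for z
    unfolding powr_lam z0_def[symmetric] by (rule E(3))
  have z0H: "z0 \<in> H" by (simp add: H_def z0_def Re_chi_freq)
  have jh: "jser q (al w) holomorphic_on H" "zeta_num CARD('d) holomorphic_on H"
    unfolding H_def by (intro jser_holomorphic[OF log_growth_al d_pos q] zeta_num_holomorphic[OF d_pos])+
  show ?thesis
  proof (cases "k = 0")
    case True
    then have z0: "z0 = of_nat CARD('d)" by (simp add: z0_def chi_freq_def)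
    define h where "h z = (jser q (al w) z * (z - z0) + of_nat q powr (- z) * tdot w (out_vec q T) * zeta_num CARD('d) z) / E (z - z0)" for z
    show ?thesis
    proof (intro exI[of _ "H \<inter> B"] exI[of _ h] conjI ballI)
      show "h holomorphic_on H \<inter> B"
        unfolding h_def using jh
        by (intro holomorphic_intros holomorphic_of_nat_powr Eh) (auto simp: B_def intro: holomorphic_on_subset)
      fix z assume z: "z \<in> H \<inter> B - {z0}"
      then have "z - z0 \<noteq> 0" "E (z - z0) \<noteq> 0" by (auto simp: B_def)
      then show "G k z = h z / (z - z0) ^ n"
        unfolding G_def den numer_def w_def[symmetric] z0[symmetric] h_def
        by (simp add: n_def True power2_eq_square field_simps)
    qed (use B z0H open_halfplane in \<open>auto simp: H_def\<close>)
  next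
    case False
    define h where "h z = numer w z / E (z - z0)" for z
    have zd: "z0 \<noteq> of_nat CARD('d)" using chi_nonzero[OF False] by (simp add: z0_def)
    show ?thesis
    proof (intro exI[of _ "(H - {of_nat CARD('d)}) \<inter> B"] exI[of _ h] conjI ballI)
      show "h holomorphic_on (H - {of_nat CARD('d)}) \<inter> B"
        unfolding h_def
        by (intro holomorphic_intros Eh holomorphic_on_subset[OF numer_holomorphic]) (auto simp: B_def H_def)
      show "open ((H - {of_nat CARD('d)}) \<inter> B)" using B open_halfplane unfolding H_def by auto
      fix z assume z: "z \<in> (H - {of_nat CARD('d)}) \<inter> B - {z0}"
      then show "G k z = h z / (z - z0) ^ n"
        unfolding G_def den w_def[symmetric] h_def by (simp add: n_def False mult.commute)
    qed (use B z0H zd in auto)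
  qed
qed

lemma G_zorder:
  assumes "is_pole (G k) (of_nat CARD('d) + chi_freq q per k)"
  shows "zorder (G k) (of_nat CARD('d) + chi_freq q per k) \<ge> - int (if k = 0 then 2 else 1)"
proof -
  obtain A h where hA: "open A" "of_nat CARD('d) + chi_freq q per k \<in> A" "h holomorphic_on A"
    "\<And>z. z \<in> A - {of_nat CARD('d) + chi_freq q per k} \<Longrightarrow>
        G k z = h z / (z - (of_nat CARD('d) + chi_freq q per k)) ^ (if k = 0 then 2 else 1)"
    using G_local[of k] by (elim exE conjE) (erule that, assumption+, erule (1) bspec)
  show ?thesis by (rule zorder_ge_if_eq_divide_power[OF hA assms])
qed

section \<open>Limits along the rays into the critical line\<close>

lemma curve_filterlim: "filterlim (\<lambda>\<sigma>. z0 + complex_of_real \<sigma>) (at z0) (at_right 0)"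
proof -
  have "((\<lambda>\<sigma>. z0 + complex_of_real \<sigma>) \<longlongrightarrow> z0 + of_real 0) (at_right 0)" by (intro tendsto_intros)
  moreover have "\<forall>\<^sub>F \<sigma> in at_right (0::real). z0 + complex_of_real \<sigma> \<noteq> z0"
    using eventually_at_right_less[of 0] by eventually_elim simp
  ultimately show ?thesis by (simp add: filterlim_at)
qed

lemma isCont_along:
  assumes "isCont f z0"
  shows "((\<lambda>\<sigma>. f (z0 + complex_of_real \<sigma>)) \<longlongrightarrow> f z0) (at_right 0)"
  using assms curve_filterlim[of z0] unfolding isCont_def by (rule filterlim_compose)

lemma isCont_halfplane:
  assumes "f holomorphic_on {z. Re z > real CARD('d) - 1}" "Re z = real CARD('d)"
  shows "isCont f z"
proof -
  have "f analytic_on {z}"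
    using assms open_halfplane by (intro analytic_at[THEN iffD2] exI[of _ "{z. Re z > real CARD('d) - 1}"]) auto
  then show ?thesis by (rule analytic_at_imp_isCont)
qed

context
  fixes k :: int and z0 :: complex
  assumes z0: "z0 = of_nat CARD('d) + chi_freq q per k"
begin

lemma Re_z0: "Re z0 = real CARD('d)"
  by (simp add: z0 Re_chi_freq)

lemma powr_quotient_tendsto:
  "((\<lambda>\<sigma>. (of_nat q powr (z0 + of_real \<sigma>) - lam k) / of_real \<sigma>) \<longlongrightarrow> lam k * of_real (ln (real q))) (at_right 0)"
proof -
  have "((\<lambda>z. of_nat q powr z) has_field_derivative of_nat q powr z0 * Ln (of_nat q)) (at z0)"
    using q by (auto intro!: derivative_eq_intros)
  then have "((\<lambda>z. (of_nat q powr z - of_nat q powr z0) / (z - z0)) \<longlongrightarrow> of_nat q powr z0 * Ln (of_nat q)) (at z0)"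
    by (simp add: has_field_derivative_iff)
  from filterlim_compose[OF this curve_filterlim]
  have "((\<lambda>\<sigma>. (of_nat q powr (z0 + of_real \<sigma>) - of_nat q powr z0) / of_real \<sigma>) \<longlongrightarrow> of_nat q powr z0 * Ln (of_nat q)) (at_right 0)"
    by simp
  moreover have "Ln (of_nat q) = complex_of_real (ln (real q))"
    using q Ln_of_real[of "real q"] by simp
  ultimately show ?thesis by (simp add: lam_eq_powr z0[symmetric])
qed

lemma zeta_tendsto:
  "((\<lambda>\<sigma>. of_real \<sigma> * (zeta_num CARD('d) (z0 + of_real \<sigma>) / (z0 + of_real \<sigma> - of_nat CARD('d))))
     \<longlongrightarrow> (if k = 0 then of_nat CARD('d) else 0)) (at_right 0)"
proof -
  have zl: "((\<lambda>\<sigma>. zeta_num CARD('d) (z0 + of_real \<sigma>)) \<longlongrightarrow> zeta_num CARD('d) z0) (at_right 0)"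
    by (rule isCont_along[OF isCont_halfplane[OF zeta_num_holomorphic[OF d_pos] Re_z0]])
  show ?thesis
  proof (cases "k = 0")
    case True
    then have z0d: "z0 = of_nat CARD('d)" by (simp add: z0 chi_freq_def)
    have "((\<lambda>\<sigma>. zeta_num CARD('d) (z0 + of_real \<sigma>)) \<longlongrightarrow> of_nat CARD('d)) (at_right 0)"
      using zl by (simp add: z0d zeta_num_at)
    then have "((\<lambda>\<sigma>. of_real \<sigma> * (zeta_num CARD('d) (z0 + of_real \<sigma>) / (z0 + of_real \<sigma> - of_nat CARD('d))))
       \<longlongrightarrow> of_nat CARD('d)) (at_right 0)"
    proof (rule Lim_transform_eventually)
      show "\<forall>\<^sub>F \<sigma> in at_right 0. zeta_num CARD('d) (z0 + of_real \<sigma>)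
         = of_real \<sigma> * (zeta_num CARD('d) (z0 + of_real \<sigma>) / (z0 + of_real \<sigma> - of_nat CARD('d)))"
        using eventually_at_right_less[of 0] by eventually_elim (simp add: z0d)
    qed
    then show ?thesis using True by simp
  next
    case False
    have "z0 - of_nat CARD('d) \<noteq> 0" using chi_nonzero[OF False] by (simp add: z0)
    then have "((\<lambda>\<sigma>. of_real \<sigma> * (zeta_num CARD('d) (z0 + of_real \<sigma>) / (z0 + of_real \<sigma> - of_nat CARD('d))))
       \<longlongrightarrow> of_real 0 * (zeta_num CARD('d) z0 / (z0 + of_real 0 - of_nat CARD('d)))) (at_right 0)"
      by (intro tendsto_intros zl) simp
    then show ?thesis using False by simp
  qed
qed

lemma numer_tendsto:
  "((\<lambda>\<sigma>. of_real \<sigma> * (of_nat q powr (z0 + of_real \<sigma>) * numer u (z0 + of_real \<sigma>)))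
     \<longlongrightarrow> tdot u (out_vec q T) * (if k = 0 then of_nat CARD('d) else 0)) (at_right 0)"
proof -
  have jl: "((\<lambda>\<sigma>. jser q (al u) (z0 + of_real \<sigma>)) \<longlongrightarrow> jser q (al u) z0) (at_right 0)"
    by (rule isCont_along[OF isCont_halfplane[OF jser_holomorphic[OF log_growth_al d_pos q] Re_z0]])
  have pl: "((\<lambda>\<sigma>. of_nat q powr (z0 + of_real \<sigma>)) \<longlongrightarrow> (of_nat q powr z0 :: complex)) (at_right 0)"
    using q by (intro isCont_along) (auto intro!: continuous_intros)
  have "((\<lambda>\<sigma>. of_real \<sigma> * (of_nat q powr (z0 + of_real \<sigma>) * jser q (al u) (z0 + of_real \<sigma>))
       + tdot u (out_vec q T) * (of_real \<sigma> * (zeta_num CARD('d) (z0 + of_real \<sigma>) / (z0 + of_real \<sigma> - of_nat CARD('d)))))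
     \<longlongrightarrow> of_real 0 * (of_nat q powr z0 * jser q (al u) z0)
       + tdot u (out_vec q T) * (if k = 0 then of_nat CARD('d) else 0)) (at_right 0)"
    by (intro tendsto_add tendsto_mult tendsto_const tendsto_of_real tendsto_ident_at jl pl zeta_tendsto)
  moreover have "of_real \<sigma> * (of_nat q powr (z0 + of_real \<sigma>) * jser q (al u) (z0 + of_real \<sigma>))
       + tdot u (out_vec q T) * (of_real \<sigma> * (zeta_num CARD('d) (z0 + of_real \<sigma>) / (z0 + of_real \<sigma> - of_nat CARD('d))))
     = of_real \<sigma> * (of_nat q powr (z0 + of_real \<sigma>) * numer u (z0 + of_real \<sigma>))" for \<sigma>
  proof -
    define z where "z = z0 + complex_of_real \<sigma>"
    have "of_nat q powr z * of_nat q powr (- z) = (1 :: complex)" using q by (simp add: powr_minus)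
    then have "of_nat q powr z * numer u z = of_nat q powr z * jser q (al u) z + tdot u (out_vec q T) * (zeta_num CARD('d) z / (z - of_nat CARD('d)))"
      unfolding numer_def by (simp add: distrib_left mult.assoc[symmetric])
    then show ?thesis unfolding z_def[symmetric] by (simp add: distrib_left mult_ac)
  qed
  ultimately show ?thesis by simp
qed

text \<open>First use of the zero of \<open>q powr z - lam k\<close>: the bound of order
  \<open>1 / \<sigma>^2\<close> for \<open>u'\<close> improves to o(1 / \<sigma>^2) for its image
  \<open>u\<close>.\<close>

lemma hser_square_tendsto_0:
  assumes "u = lshift (M 0) (lam k) u'"
  shows "((\<lambda>\<sigma>. (of_real \<sigma>)\<^sup>2 * hser (al u) (z0 + of_real \<sigma>)) \<longlongrightarrow> 0) (at_right 0)"
proof -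
  obtain B where B: "\<And>z \<sigma>. 0 < \<sigma> \<Longrightarrow> \<sigma> \<le> 1 \<Longrightarrow> Re z = real CARD('d) + \<sigma> \<Longrightarrow> cmod (hser (al u') z) \<le> B / \<sigma>\<^sup>2"
    using hser_bound[OF log_growth_al] by blast
  have bounded: "((\<lambda>\<sigma>. of_real \<sigma> * ((of_real \<sigma>)\<^sup>2 * hser (al u') (z0 + of_real \<sigma>))) \<longlongrightarrow> 0) (at_right 0)"
  proof (rule Lim_null_comparison)
    show "((\<lambda>\<sigma>. \<sigma> * B) \<longlongrightarrow> 0) (at_right 0)" by (auto intro!: tendsto_eq_intros)
    have "\<forall>\<^sub>F \<sigma> in at_right (0::real). \<sigma> < 1" by (intro order_tendstoD(2)[OF tendsto_ident_at]) auto
    then show "\<forall>\<^sub>F \<sigma> in at_right 0. cmod (of_real \<sigma> * ((of_real \<sigma>)\<^sup>2 * hser (al u') (z0 + of_real \<sigma>))) \<le> \<sigma> * B"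
      using eventually_at_right_less[of 0]
    proof eventually_elim
      case (elim \<sigma>)
      have "cmod (hser (al u') (z0 + of_real \<sigma>)) \<le> B / \<sigma>\<^sup>2" using elim by (intro B) (auto simp: Re_z0)
      then have "\<sigma>\<^sup>2 * cmod (hser (al u') (z0 + of_real \<sigma>)) \<le> B" using elim by (simp add: field_simps)
      then have "\<sigma> * (\<sigma>\<^sup>2 * cmod (hser (al u') (z0 + of_real \<sigma>))) \<le> \<sigma> * B" using elim by (intro mult_left_mono) auto
      then show ?case using elim by (simp add: norm_mult norm_power)
    qed
  qed
  have "((\<lambda>\<sigma>. ((of_nat q powr (z0 + of_real \<sigma>) - lam k) / of_real \<sigma>) * (of_real \<sigma> * ((of_real \<sigma>)\<^sup>2 * hser (al u') (z0 + of_real \<sigma>)))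
      - of_real \<sigma> * (of_real \<sigma> * (of_nat q powr (z0 + of_real \<sigma>) * numer u' (z0 + of_real \<sigma>))))
     \<longlongrightarrow> (lam k * of_real (ln (real q))) * 0 - of_real 0 * (tdot u' (out_vec q T) * (if k = 0 then of_nat CARD('d) else 0))) (at_right 0)"
    by (intro tendsto_diff tendsto_mult powr_quotient_tendsto bounded numer_tendsto tendsto_of_real tendsto_ident_at)
  then have "((\<lambda>\<sigma>. ((of_nat q powr (z0 + of_real \<sigma>) - lam k) / of_real \<sigma>) * (of_real \<sigma> * ((of_real \<sigma>)\<^sup>2 * hser (al u') (z0 + of_real \<sigma>)))
      - of_real \<sigma> * (of_real \<sigma> * (of_nat q powr (z0 + of_real \<sigma>) * numer u' (z0 + of_real \<sigma>)))) \<longlongrightarrow> 0) (at_right 0)"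
    by simp
  then show ?thesis
  proof (rule Lim_transform_eventually)
    show "\<forall>\<^sub>F \<sigma> in at_right 0. ((of_nat q powr (z0 + of_real \<sigma>) - lam k) / of_real \<sigma>) * (of_real \<sigma> * ((of_real \<sigma>)\<^sup>2 * hser (al u') (z0 + of_real \<sigma>)))
      - of_real \<sigma> * (of_real \<sigma> * (of_nat q powr (z0 + of_real \<sigma>) * numer u' (z0 + of_real \<sigma>)))
      = (of_real \<sigma>)\<^sup>2 * hser (al u) (z0 + of_real \<sigma>)"
      using eventually_at_right_less[of 0]
    proof eventually_elim
      case (elim \<sigma>)
      define s where "s = complex_of_real \<sigma>"
      have s: "s \<noteq> 0" using elim by (simp add: s_def)
      have "Re (z0 + s) > real CARD('d)" using elim by (simp add: Re_z0 s_def)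
      note eq = hser_al_lshift[OF this, of "lam k" u']
      have "(a / s) * (s * (s\<^sup>2 * h)) - s * (s * b) = s\<^sup>2 * (a * h - b)" for a h b
        using s by (simp add: right_diff_distrib power2_eq_square)
      then show ?case
        unfolding assms s_def[symmetric] eq by (simp only:)
    qed
  qed
qed

text \<open>Second use: the series of \<open>u\<close> times \<open>q powr z - lam k\<close> is o(1
  / \<sigma>), so at order \<open>1 / \<sigma>\<close> only the pole of \<open>numer\<close> at
  \<open>d\<close> survives, and that only for \<open>k = 0\<close>.\<close>

lemma hser_lshift_tendsto:
  assumes "u = lshift (M 0) (lam k) u'"
  shows "((\<lambda>\<sigma>. of_real \<sigma> * hser (al (lshift (M 0) (lam k) u)) (z0 + of_real \<sigma>))
     \<longlongrightarrow> - (tdot u (out_vec q T) * (if k = 0 then of_nat CARD('d) else 0))) (at_right 0)"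
proof -
  have "((\<lambda>\<sigma>. ((of_nat q powr (z0 + of_real \<sigma>) - lam k) / of_real \<sigma>) * ((of_real \<sigma>)\<^sup>2 * hser (al u) (z0 + of_real \<sigma>))
      - of_real \<sigma> * (of_nat q powr (z0 + of_real \<sigma>) * numer u (z0 + of_real \<sigma>)))
     \<longlongrightarrow> (lam k * of_real (ln (real q))) * 0 - tdot u (out_vec q T) * (if k = 0 then of_nat CARD('d) else 0)) (at_right 0)"
    by (intro tendsto_diff tendsto_mult powr_quotient_tendsto hser_square_tendsto_0[OF assms] numer_tendsto)
  then have "((\<lambda>\<sigma>. ((of_nat q powr (z0 + of_real \<sigma>) - lam k) / of_real \<sigma>) * ((of_real \<sigma>)\<^sup>2 * hser (al u) (z0 + of_real \<sigma>))
      - of_real \<sigma> * (of_nat q powr (z0 + of_real \<sigma>) * numer u (z0 + of_real \<sigma>)))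
     \<longlongrightarrow> - (tdot u (out_vec q T) * (if k = 0 then of_nat CARD('d) else 0))) (at_right 0)"
    by (simp only: mult_zero_right diff_0)
  then show ?thesis
  proof (rule Lim_transform_eventually)
    show "\<forall>\<^sub>F \<sigma> in at_right 0. ((of_nat q powr (z0 + of_real \<sigma>) - lam k) / of_real \<sigma>) * ((of_real \<sigma>)\<^sup>2 * hser (al u) (z0 + of_real \<sigma>))
      - of_real \<sigma> * (of_nat q powr (z0 + of_real \<sigma>) * numer u (z0 + of_real \<sigma>))
      = of_real \<sigma> * hser (al (lshift (M 0) (lam k) u)) (z0 + of_real \<sigma>)"
      using eventually_at_right_less[of 0]
    proof eventually_elim
      case (elim \<sigma>)
      define s where "s = complex_of_real \<sigma>"
      have s: "s \<noteq> 0" using elim by (simp add: s_def)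
      have "Re (z0 + s) > real CARD('d)" using elim by (simp add: Re_z0 s_def)
      note eq = hser_al_lshift[OF this, of "lam k" u]
      have "(a / s) * (s\<^sup>2 * h) - s * b = s * (a * h - b)" for a h b
        using s by (simp add: right_diff_distrib power2_eq_square)
      then show ?case
        unfolding s_def[symmetric] eq by (simp only:)
    qed
  qed
qed

text \<open>\<open>M - lam k\<close> is onto on the span belonging to the other numbers, so
  \<open>e_1 - w_k\<close> has a preimage \<open>u\<close> there, which itself has a preimage. The
  membership of \<open>u\<close> in this span is recorded for
  \<open>w_vec_derivative\<close>.\<close>

lemma remainder_tendsto:
  obtains u where "u \<in> gen_span (M 0) (- {lam k})"
    "lshift (M 0) (lam k) u = axis (init T) 1 - w_vec q T k 0"
    "((\<lambda>\<sigma>. of_real \<sigma> * (hser (al (axis (init T) 1)) (z0 + of_real \<sigma>) - G k (z0 + of_real \<sigma>)))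
       \<longlongrightarrow> - (tdot u (out_vec q T) * (if k = 0 then of_nat CARD('d) else 0))) (at_right 0)"
proof -
  obtain u where u: "u \<in> gen_span (M 0) (- {lam k})" "axis (init T) 1 - w_vec q T k 0 = lshift (M 0) (lam k) u"
    using lshift_surj_gen_span[OF _ w_vec_at_0(2)[of k], of "lam k"] by auto
  obtain u' where u': "u = lshift (M 0) (lam k) u'"
    using lshift_surj_gen_span[OF _ u(1), of "lam k"] by auto
  have "((\<lambda>\<sigma>. of_real \<sigma> * (hser (al (axis (init T) 1)) (z0 + of_real \<sigma>) - G k (z0 + of_real \<sigma>)))
       \<longlongrightarrow> - (tdot u (out_vec q T) * (if k = 0 then of_nat CARD('d) else 0))) (at_right 0)"
    using hser_lshift_tendsto[OF u']
  proof (rule Lim_transform_eventually)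
    show "\<forall>\<^sub>F \<sigma> in at_right 0. of_real \<sigma> * hser (al (lshift (M 0) (lam k) u)) (z0 + of_real \<sigma>)
      = of_real \<sigma> * (hser (al (axis (init T) 1)) (z0 + of_real \<sigma>) - G k (z0 + of_real \<sigma>))"
      using eventually_at_right_less[of 0]
    proof eventually_elim
      case (elim \<sigma>)
      then have z: "Re (z0 + of_real \<sigma>) > real CARD('d)" by (simp add: Re_z0)
      have "al (axis (init T) 1 - w_vec q T k 0) = (\<lambda>N. al (axis (init T) 1) N - al (w_vec q T k 0) N)"
        by (simp add: al_def[abs_def] tdot_diff_left)
      then show ?case
        unfolding u(2)[symmetric] by (simp add: hser_diff[OF log_growth_al log_growth_al z] G_eq_hser[OF z])
    qed
  qed
  then show ?thesis by (rule that[OF u(1) u(2)[symmetric]])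
qed

end

text \<open>At an at most simple pole the residue is the limit of \<open>\<sigma>\<close> times
  \<open>G\<close> along the ray, and for \<open>k \<noteq> 0\<close> the remainder
  \<open>e_1 - w_k\<close> contributes nothing to this limit.\<close>

lemma residue_G_nonzero:
  assumes k: "k \<noteq> 0"
    and lim: "((\<lambda>\<sigma>. of_real \<sigma> * hser (al (axis (init T) 1)) (of_nat CARD('d) + chi_freq q per k + of_real \<sigma>)) \<longlongrightarrow> b) (at_right 0)"
  shows "residue (G k) (of_nat CARD('d) + chi_freq q per k) = b"
proof -
  define z0 where "z0 = of_nat CARD('d) + chi_freq q per k"
  obtain A h where hA: "open A" "z0 \<in> A" "h holomorphic_on A"
    "\<And>z. z \<in> A - {z0} \<Longrightarrow> G k z = h z / (z - z0) ^ (if k = 0 then 2 else 1)"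
    using G_local[of k, folded z0_def] by (elim exE conjE) (erule that, assumption+, erule (1) bspec)
  obtain u where u: "u \<in> gen_span (M 0) (- {lam k})" "lshift (M 0) (lam k) u = axis (init T) 1 - w_vec q T k 0"
    "((\<lambda>\<sigma>. of_real \<sigma> * (hser (al (axis (init T) 1)) (z0 + of_real \<sigma>) - G k (z0 + of_real \<sigma>)))
       \<longlongrightarrow> - (tdot u (out_vec q T) * (if k = 0 then of_nat CARD('d) else 0))) (at_right 0)"
    using remainder_tendsto[OF z0_def] by blast
  from u(3) have "((\<lambda>\<sigma>. of_real \<sigma> * (hser (al (axis (init T) 1)) (z0 + of_real \<sigma>) - G k (z0 + of_real \<sigma>))) \<longlongrightarrow> 0) (at_right 0)"
    using k by simp
  from tendsto_diff[OF lim[folded z0_def] this]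
  have G1: "((\<lambda>\<sigma>. of_real \<sigma> * G k (z0 + of_real \<sigma>)) \<longlongrightarrow> b) (at_right 0)"
    by (simp add: right_diff_distrib)
  have evA: "\<forall>\<^sub>F z in at z0. z \<in> A - {z0}"
    using hA(1,2) by (simp add: eventually_at_topological) blast
  have "isCont h z0" using hA(1-3) by (meson analytic_at analytic_at_imp_isCont)
  then have "((\<lambda>\<sigma>. h (z0 + of_real \<sigma>)) \<longlongrightarrow> h z0) (at_right 0)" by (rule isCont_along)
  moreover have "((\<lambda>\<sigma>. h (z0 + of_real \<sigma>)) \<longlongrightarrow> b) (at_right 0)"
    using G1
  proof (rule Lim_transform_eventually)
    have "\<forall>\<^sub>F \<sigma> in at_right 0. z0 + of_real \<sigma> \<in> A - {z0}"
      using filterlim_iff[THEN iffD1, OF curve_filterlim] evA by blast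
    then show "\<forall>\<^sub>F \<sigma> in at_right 0. of_real \<sigma> * G k (z0 + of_real \<sigma>) = h (z0 + of_real \<sigma>)"
      by eventually_elim (simp add: hA(4) k)
  qed
  ultimately have "h z0 = b" using tendsto_unique trivial_limit_at_right_real by blast
  moreover have "residue (G k) z0 = residue (\<lambda>z. h z / (z - z0) ^ Suc 0) z0"
    by (rule residue_cong) (use evA in \<open>auto elim!: eventually_mono simp: hA(4) k\<close>)
  moreover have "\<dots> = (deriv ^^ 0) h z0 / fact 0"
    by (rule residue_holomorphic_over_power[OF hA(1-3)])
  ultimately show ?thesis by (simp add: z0_def)
qed

text \<open>Passing from \<open>e_1\<close> to \<open>w_0\<close> changes the coefficient of
  \<open>1 / \<sigma>\<close> by \<open>d\<close> times \<open>u o\<close>, which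
  \<open>w_vec_derivative\<close> rewrites as \<open>\<i> * d\<close> times \<open>w_0' 1\<close>.
  The term \<open>a / \<sigma>^2\<close> is unaffected.\<close>

lemma residue_G_zero:
  assumes lim: "((\<lambda>\<sigma>. of_real \<sigma> * hser (al (axis (init T) 1)) (of_nat CARD('d) + of_real \<sigma>) - a / of_real \<sigma>) \<longlongrightarrow> b) (at_right 0)"
  shows "residue (G 0) (of_nat CARD('d))
     = b + of_nat CARD('d) * \<i> * tdot (vector_derivative (w_vec q T 0) (at 0)) (vec 1)"
proof -
  define z0 where "z0 = complex_of_nat CARD('d)"
  have z0': "z0 = of_nat CARD('d) + chi_freq q per 0" by (simp add: z0_def chi_freq_def)
  obtain A h where hA: "open A" "z0 \<in> A" "h holomorphic_on A"
    "\<And>z. z \<in> A - {z0} \<Longrightarrow> G 0 z = h z / (z - z0) ^ (if (0::int) = 0 then 2 else 1)"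
    using G_local[of 0, folded z0'] by (elim exE conjE) (erule that, assumption+, erule (1) bspec)
  obtain u where u: "u \<in> gen_span (M 0) (- {lam 0})" "lshift (M 0) (lam 0) u = axis (init T) 1 - w_vec q T 0 0"
    "((\<lambda>\<sigma>. of_real \<sigma> * (hser (al (axis (init T) 1)) (z0 + of_real \<sigma>) - G 0 (z0 + of_real \<sigma>)))
       \<longlongrightarrow> - (tdot u (out_vec q T) * (if (0::int) = 0 then of_nat CARD('d) else 0))) (at_right 0)"
    using remainder_tendsto[OF z0'] by blast
  have der: "tdot (vector_derivative (w_vec q T 0) (at 0)) (vec 1) = - \<i> * tdot u (out_vec q T)"
    using w_vec_derivative u(1,2) by (simp add: lam_0)
  define c where "c = b + of_nat CARD('d) * tdot u (out_vec q T)"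
  from tendsto_diff[OF lim[folded z0_def] u(3)]
  have G1: "((\<lambda>\<sigma>. of_real \<sigma> * G 0 (z0 + of_real \<sigma>) - a / of_real \<sigma>) \<longlongrightarrow> c) (at_right 0)"
    by (simp add: right_diff_distrib c_def mult.commute)
  have evA: "\<forall>\<^sub>F z in at z0. z \<in> A - {z0}"
    using hA(1,2) by (simp add: eventually_at_topological) blast
  have "((\<lambda>\<sigma>. h (z0 + of_real \<sigma>) / of_real \<sigma> - a / of_real \<sigma>) \<longlongrightarrow> c) (at_right 0)"
    using G1
  proof (rule Lim_transform_eventually)
    have "\<forall>\<^sub>F \<sigma> in at_right 0. z0 + of_real \<sigma> \<in> A - {z0}"
      using filterlim_iff[THEN iffD1, OF curve_filterlim] evA by blast
    then show "\<forall>\<^sub>F \<sigma> in at_right 0. of_real \<sigma> * G 0 (z0 + of_real \<sigma>) - a / of_real \<sigma> = h (z0 + of_real \<sigma>) / of_real \<sigma> - a / of_real \<sigma>"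
      by eventually_elim (simp add: hA(4) power2_eq_square)
  qed
  then have "deriv h z0 = c"
    by (rule tendsto_coefficient_of_double_pole[OF hA(1-3) _ curve_filterlim])
  moreover have "residue (G 0) z0 = residue (\<lambda>z. h z / (z - z0) ^ Suc 1) z0"
    by (rule residue_cong) (use evA in \<open>auto elim!: eventually_mono simp: hA(4) power2_eq_square\<close>)
  moreover have "\<dots> = (deriv ^^ 1) h z0 / fact 1"
    by (rule residue_holomorphic_over_power[OF hA(1-3)])
  moreover have "of_nat CARD('d) * \<i> * tdot (vector_derivative (w_vec q T 0) (at 0)) (vec 1) = of_nat CARD('d) * tdot u (out_vec q T)"
    unfolding der by (simp add: mult.assoc)
  ultimately show ?thesis unfolding z0_def[symmetric] c_def by auto
qed

end

section \<open>Fourier coefficients and Fourier series of the fluctuation\<close>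

theorem theorem2p5:
  fixes T :: "('s :: finite, 'd :: finite) transducer"
    and q p d :: nat and \<xi> :: real and \<Psi> :: "real \<Rightarrow> real"
    and c :: "int \<Rightarrow> complex" and \<chi>' :: "int \<Rightarrow> complex"
  defines "d \<equiv> CARD('d)"
    and "p \<equiv> final_period q T"
    and "c \<equiv> fourier_coeff p \<Psi>"
    and "\<chi>' \<equiv> chi_freq q p"
  assumes "q \<ge> 2"
    and "accessible q T"
    and "spectral_gap q T \<xi>"
    and "continuous_on UNIV \<Psi>"
    and "\<forall>x. \<Psi> (x + real p) = \<Psi> x"
    and "(\<lambda>N. of_real (expected_value q T N) - e_const q T * of_real (log (real q) (real N))
              - of_real (\<Psi> (log (real q) (real N))))
         \<in> O(\<lambda>N. complex_of_real (real N powr (- \<xi>) * ln (real N)))"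
  shows "\<exists>G :: int \<Rightarrow> complex \<Rightarrow> complex.
      (\<forall>z. Re z > real d \<longrightarrow> H_term q T z summable_on {n. n \<noteq> 0}) \<and>
      (\<forall>k. (\<forall>z. Re z > real d \<longrightarrow> G k z = tdot (w_vec q T k 0) (H_series q T z)) \<and>
           G k meromorphic_on {z. Re z > real d - 1} \<and>
           (\<forall>z. Re z > real d - 1 \<and> is_pole (G k) z \<longrightarrow> (\<exists>m. z = of_nat d + \<chi>' m)) \<and>
           (k = 0 \<longrightarrow> is_pole (G k) (of_nat d) \<longrightarrow> zorder (G k) (of_nat d) \<ge> -2) \<and>
           (k \<noteq> 0 \<longrightarrow> is_pole (G k) (of_nat d + \<chi>' k) \<longrightarrow> zorder (G k) (of_nat d + \<chi>' k) \<ge> -1)) \<and>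
      c 0 = - e_const q T / of_real (real d * ln (real q))
            - \<i> * tdot (vector_derivative (w_vec q T 0) (at 0)) (vec 1)
            + 1 / of_nat d * residue (G 0) (of_nat d) \<and>
      (\<forall>k. k \<noteq> 0 \<longrightarrow> c k = 1 / (of_nat d + \<chi>' k) * residue (G k) (of_nat d + \<chi>' k)) \<and>
      (\<lambda>k. norm (c k)) summable_on UNIV \<and>
      uniform_limit UNIV
        (\<lambda>K x. \<Sum>k\<in>K. c k * exp (2 * of_real pi * \<i> * of_int k / of_nat p * of_real x))
        (\<lambda>x. of_real (\<Psi> x)) (finite_subsets_at_top UNIV)"
proof -
  interpret S: transducer_setup T q by unfold_locales fact
  have p: "p = S.per" by (simp add: p_def S.per_def)
  have \<xi>: "\<xi> > 0" using assms(7) by (simp add: spectral_gap_def)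
  let ?e = "axis (init T) 1 :: complex ^ 's"
  define \<Phi> where "\<Phi> x = complex_of_real (\<Psi> x)" for x
  define \<epsilon> where "\<epsilon> N = (\<Sum>K<N. S.al ?e K) / of_nat (N ^ d) - e_const q T * of_real (log (real q) (real N)) - \<Phi> (log (real q) (real N))" for N
  obtain C0 N0 where C0: "\<And>N. N \<ge> N0 \<Longrightarrow> cmod (\<epsilon> N) \<le> C0 * (real N powr (- \<xi>) * ln (real N))"
  proof -
    obtain C0 where C0: "\<forall>\<^sub>F N in sequentially. cmod (of_real (expected_value q T N) - e_const q T * of_real (log (real q) (real N))
        - of_real (\<Psi> (log (real q) (real N)))) \<le> C0 * cmod (complex_of_real (real N powr (- \<xi>) * ln (real N)))"
      using landau_o.bigE[OF assms(10)] by blast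
    have "\<forall>\<^sub>F N in sequentially. cmod (\<epsilon> N) \<le> C0 * (real N powr (- \<xi>) * ln (real N))"
      using C0 eventually_ge_at_top[of 1]
    proof eventually_elim
      case (elim N)
      have "complex_of_real (expected_value q T N) = (\<Sum>K<N. S.al ?e K) / of_nat (N ^ d)"
        using expected_value_eq[OF elim(2), of q T] by (simp add: S.al_def tdot_axis d_def)
      moreover have "cmod (complex_of_real (real N powr (- \<xi>) * ln (real N))) = real N powr (- \<xi>) * ln (real N)"
        unfolding norm_of_real using elim(2) by (intro abs_of_nonneg) auto
      ultimately show ?case using elim(1) by (simp only: \<epsilon>_def \<Phi>_def)
    qed
    then show ?thesis using that unfolding eventually_sequentially by blast
  qed
  \<comment> \<open>The Abelian analysis asks for a null sequence; the rate in \<open>C0\<close> is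
    kept for Hoelder continuity.\<close>
  have \<epsilon>0: "\<epsilon> \<longlonglongrightarrow> 0"
  proof (rule Lim_null_comparison)
    show "\<forall>\<^sub>F N in sequentially. cmod (\<epsilon> N) \<le> C0 * (real N powr (- \<xi>) * ln (real N))"
      unfolding eventually_sequentially using C0 by blast
    have "(\<lambda>N. real N powr (- \<xi>) * ln (real N)) \<longlonglongrightarrow> 0" using \<xi> by real_asymp
    from tendsto_mult_right_zero[OF this] show "(\<lambda>N. C0 * (real N powr (- \<xi>) * ln (real N))) \<longlonglongrightarrow> 0" .
  qed
  interpret A: abel_asymptotics "S.al ?e" \<Phi> "e_const q T" q d p
  proof
    show "log_growth d (S.al ?e)" unfolding d_def by (rule S.log_growth_al)
    show "continuous_on UNIV \<Phi>" unfolding \<Phi>_def using assms(8) by (intro continuous_intros)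
    show "\<Phi> (x + real p) = \<Phi> x" for x using assms(9) by (simp add: \<Phi>_def)
    show "(\<lambda>N. (\<Sum>K<N. S.al ?e K) / of_nat (N ^ d) - e_const q T * of_real (log (real q) (real N))
       - \<Phi> (log (real q) (real N))) \<longlonglongrightarrow> 0"
      using \<epsilon>0 by (simp only: \<epsilon>_def[abs_def])
  qed (use assms(5) S.d_pos S.per_pos p in \<open>auto simp: d_def\<close>)
  have c_fcoef: "c k = fcoef p \<Phi> k" for k
    by (simp add: c_def fourier_coeff_eq_fcoef \<Phi>_def[abs_def])
  have d0: "complex_of_nat d \<noteq> 0" using S.d_pos by (simp add: d_def)
  have L0: "ln (real q) > 0" using assms(5) by simp
  have chi0: "chi_freq q p 0 = 0" by (simp add: chi_freq_def)
  \<comment> \<open>Read backwards, this is the formula for \<open>c 0\<close>: the coefficient of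
    \<open>1 / \<sigma>\<close> is known from the expansion, the residue from the
    continuation.\<close>
  have r0: "residue (S.G 0) (of_nat d) = (of_nat d * c 0 + e_const q T / of_real (ln (real q)))
      + of_nat d * \<i> * tdot (vector_derivative (w_vec q T 0) (at 0)) (vec 1)"
  proof -
    have "((\<lambda>\<sigma>. of_real \<sigma> * hser (S.al ?e) (of_nat CARD('d) + of_real \<sigma>) - (of_nat d * e_const q T / of_real (ln (real q))) / of_real \<sigma>)
       \<longlongrightarrow> of_nat d * c 0 + e_const q T / of_real (ln (real q))) (at_right 0)"
      using A.hser_tendsto_zero by (simp add: A.L_def d_def c_fcoef)
    from S.residue_G_zero[OF this] show ?thesis by (simp add: d_def)
  qed
  have rk: "residue (S.G k) (of_nat d + \<chi>' k) = (of_nat d + \<chi>' k) * c k" if "k \<noteq> 0" for k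
  proof -
    have "((\<lambda>\<sigma>. of_real \<sigma> * hser (S.al ?e) (of_nat CARD('d) + chi_freq q S.per k + of_real \<sigma>))
       \<longlongrightarrow> (of_nat d + \<chi>' k) * c k) (at_right 0)"
      using A.hser_tendsto_nonzero[OF that] by (simp add: \<chi>'_def d_def c_fcoef p)
    from S.residue_G_nonzero[OF that this] show ?thesis by (simp add: d_def \<chi>'_def p)
  qed
  obtain C where C: "\<And>x h. 0 < h \<Longrightarrow> cmod (\<Phi> (x + h) - \<Phi> x) \<le> C * h powr (3/4)"
    using A.Psi_holder[OF \<xi>, of N0 C0] C0 unfolding \<epsilon>_def A.A_def by blast
  have summ: "(\<lambda>k. cmod (fcoef p \<Phi> k)) summable_on UNIV"
    by (rule summable_fcoef_if_holder[OF A.p A.cont A.per C])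
  show ?thesis
  proof (intro exI[of _ S.G] conjI allI impI)
    fix z assume z: "Re z > real d"
    show "H_term q T z summable_on {n. n \<noteq> 0}" using z unfolding d_def by (rule S.H_term_summable)
    show "S.G k z = tdot (w_vec q T k 0) (H_series q T z)" for k
      using z unfolding d_def by (simp add: S.G_eq_hser S.tdot_H_series)
  next
    fix k
    show "S.G k meromorphic_on {z. Re z > real d - 1}" unfolding d_def by (rule S.G_meromorphic)
  next
    fix k z assume "Re z > real d - 1 \<and> is_pole (S.G k) z"
    then show "\<exists>m. z = of_nat d + \<chi>' m" unfolding d_def \<chi>'_def p using S.G_pole by blast
  next
    fix k :: int assume "k = 0" "is_pole (S.G k) (of_nat d)"
    then show "zorder (S.G k) (of_nat d) \<ge> -2"
      using S.G_zorder[of k] chi0 by (simp add: d_def p)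
  next
    fix k :: int assume "k \<noteq> 0" "is_pole (S.G k) (of_nat d + \<chi>' k)"
    then show "zorder (S.G k) (of_nat d + \<chi>' k) \<ge> -1"
      using S.G_zorder[of k] by (simp add: d_def p \<chi>'_def)
  next
    show "c 0 = - e_const q T / of_real (real d * ln (real q))
            - \<i> * tdot (vector_derivative (w_vec q T 0) (at 0)) (vec 1)
            + 1 / of_nat d * residue (S.G 0) (of_nat d)"
      unfolding r0 using d0 L0 by (simp add: field_simps)
  next
    fix k :: int assume k: "k \<noteq> 0"
    have "Re (of_nat d + \<chi>' k) = real d" by (simp add: \<chi>'_def p S.Re_chi_freq)
    then have "of_nat d + \<chi>' k \<noteq> 0" using S.d_pos by (auto simp: d_def complex_eq_iff)
    then show "c k = 1 / (of_nat d + \<chi>' k) * residue (S.G k) (of_nat d + \<chi>' k)"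
      unfolding rk[OF k] by simp
  next
    show "(\<lambda>k. norm (c k)) summable_on UNIV" using summ by (simp add: c_fcoef)
  next
    show "uniform_limit UNIV
        (\<lambda>K x. \<Sum>k\<in>K. c k * exp (2 * of_real pi * \<i> * of_int k / of_nat p * of_real x))
        (\<lambda>x. of_real (\<Psi> x)) (finite_subsets_at_top UNIV)"
      using fourier_series_uniform_limit[OF A.p A.cont A.per summ]
      by (simp only: c_fcoef fexp_def \<Phi>_def[abs_def])
  qed
qed

end
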